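(* Fix $g>0$, $\kappa>0$, $\mathtt h\in(0,+\infty]$, a lattice $\Gamma$, $\sigma>0$, $s\ge7/2$ with $s+\tfrac12\in\mathbb N$, and $c_*\in\mathbb R^2$ with $\mathcal V\neq\emptyset$. There exists $\delta>0$ such that if $u\in X$ is a Stokes wave with speed $c$, $|c-c_*|<\delta$ and $\|u\|_X<\delta$, then its momentum $a:=\mathcal I(u)$ belongs to the cone $\mathcal C$. Moreover: (B) if $a\in\partial\mathcal C$ then $u$ is a $2d$ wave, and if $a=0$ then $u=0$; (I) if $a\in\operatorname{int}(\mathcal C)$ is not collinear to any resonant wave vector $j\in\mathcal V$, then $u$ is truly $3$-dimensional.
   Context: Let $\Gamma=\{2\pi(m_1\mathbf v_1+m_2\mathbf v_2): m_1,m_2\in\mathbb Z\}$ with $\mathbf v_1,\mathbf v_2\in\mathbb R^2$ linearly independent, $\mathbb T^2_\Gamma=\mathbb R^2/\Gamma$, $|\Gamma|$ the area of a fundamental domain, and $\Gamma'=\mathtt M^{-\top}\mathbb Z^2$ the dual lattice, $\mathtt M=(\mathbf v_1|\mathbf v_2)$. Every $\Gamma$-periodic $f$ has Fourier series $f(x)=\sum_{j\in\Gamma'}f_je^{ij\cdot x}$. For $\sigma>0,s\in\mathbb R$, $H^{\sigma,s}$ is the space of real $f\in L^2(\mathbb T^2_\Gamma)$ with $\|f\|^2_{\sigma,s}=\sum_{j\in\Gamma'}|f_j|^2\langle j\rangle^{2s}e^{2\sigma|j|_1}<\infty$, $|j|_1=|j_1|+|j_2|$, $\langle j\rangle=\max(1,|j|_1)$;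 $H^{\sigma,s}_0$ its zero-average subspace; $X:=H^{\sigma,s}\times H^{\sigma,s}_0$. For $\eta$ and $\psi$ on $\mathbb T^2_\Gamma$, the Dirichlet–Neumann operator is $G(\eta)\psi=(\partial_y\Phi-\nabla\eta\cdot\nabla_x\Phi)|_{y=\eta(x)}$, where $\Phi$ is harmonic in $\{(x,y):x\in\mathbb T^2_\Gamma,-\mathtt h<y<\eta(x)\}$, $\Phi(x,\eta(x))=\psi(x)$, and $\partial_y\Phi=0$ at $y=-\mathtt h$ (resp. $\nabla\Phi\to0$ as $y\to-\infty$ if $\mathtt h=\infty$). A Stokes wave with speed $c\in\mathbb R^2$ is $u=(\eta,\psi)\in X$ such that $u(x-ct)$ solves the water waves (Zakharov–Craig–Sulem) system $\partial_t\eta=G(\eta)\psi$, $\partial_t\psi=-g\eta-\tfrac12|\nabla\psi|^2+\frac{(\nabla\eta\cdot\nabla\psi+G(\eta)\psi)^2}{2(1+|\nabla\eta|^2)}+\kappa\,\mathrm{div}\big(\nabla\eta/\sqrt{1+|\nabla\eta|^2}\big)$; equivalently $c\cdot\nabla u+X(u)=0$ where $X(u)$ is the right-hand side of this system. Its momentum is $\mathcal I(u)=\frac1{|\Gamma|}\int_{\mathbb T^2_\Gamma}\psi\,\nabla\eta\,dx\in\mathbb R^2$. The dispersion relation is $\omega(\xi)=\sqrt{(g+\kappa|\xi|^2)|\xi|\tanh(\mathtt h|\xi|)}$ (with $\tanh\equiv1$ if $\mathtt h=\infty$); the resonant wave vectors of $c_*$ are $\mathcal V=\{j\in\Gamma'\setminus\{0\}:\omega(j)=c_*\cdot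 j\}$, and $\mathcal C=\{\sum_{j\in\mathcal V}\tau_jj:\tau_j\le0\}$ is the closed convex cone they generate with nonpositive coefficients. A function $u$ on $\mathbb T^2_\Gamma$ is a $2d$ wave (along $j$) if $u(x)=u((x\cdot\hat\jmath)\hat\jmath)$ for all $x$ for some $j\in\Gamma'\setminus\{0\}$, $\hat\jmath=j/|j|$; otherwise it is truly $3$-dimensional. *)

theory Defs
  imports "HOL-Analysis.Analysis"
begin

definition lat :: "real^2 \<Rightarrow> real^2 \<Rightarrow> (real^2) set" where
  "lat v1 v2 = {(2*pi) *\<^sub>R (of_int m1 *\<^sub>R v1 + of_int m2 *\<^sub>R v2) | m1 m2 :: int. True}"

definition latM :: "real^2 \<Rightarrow> real^2 \<Rightarrow> real^2^2" where
  "latM v1 v2 = (\<chi> i k. if k = 1 then v1 $ i else v2 $ i)"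

definition dual_lat :: "real^2 \<Rightarrow> real^2 \<Rightarrow> (real^2) set" where
  "dual_lat v1 v2 = {matrix_inv (transpose (latM v1 v2)) *v vector [of_int m1, of_int m2]
                       | m1 m2 :: int. True}"

definition fund_dom :: "real^2 \<Rightarrow> real^2 \<Rightarrow> (real^2) set" where
  "fund_dom v1 v2 = {(2*pi) *\<^sub>R (t1 *\<^sub>R v1 + t2 *\<^sub>R v2) | t1 t2.
                        0 \<le> t1 \<and> t1 < 1 \<and> 0 \<le> t2 \<and> t2 < 1}"

definition lat_area :: "real^2 \<Rightarrow> real^2 \<Rightarrow> real" where
  "lat_area v1 v2 = measure lborel (fund_dom v1 v2)"

definition lat_periodic :: "real^2 \<Rightarrow> real^2 \<Rightarrow> (real^2 \<Rightarrow> 'a) \<Rightarrow> bool" where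
  "lat_periodic v1 v2 f \<longleftrightarrow> (\<forall>x. \<forall>\<gamma>\<in>lat v1 v2. f (x + \<gamma>) = f x)"

definition fcoeff :: "real^2 \<Rightarrow> real^2 \<Rightarrow> (real^2 \<Rightarrow> real) \<Rightarrow> real^2 \<Rightarrow> complex" where
  "fcoeff v1 v2 f j = complex_of_real (1 / lat_area v1 v2) *
      set_lebesgue_integral lborel (fund_dom v1 v2)
        (\<lambda>x. complex_of_real (f x) * cis (- (j \<bullet> x)))"

definition l1norm :: "real^2 \<Rightarrow> real" where
  "l1norm j = \<bar>j $ 1\<bar> + \<bar>j $ 2\<bar>"

definition jbr :: "real^2 \<Rightarrow> real" where
  "jbr j = max 1 (l1norm j)"

definition hweight :: "real \<Rightarrow> real \<Rightarrow> real^2 \<Rightarrow> real^2 \<Rightarrow> (real^2 \<Rightarrow> real) \<Rightarrow> real^2 \<Rightarrow> real" where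
  "hweight \<sigma> s v1 v2 f j =
     (cmod (fcoeff v1 v2 f j))^2 * jbr j powr (2 * s) * exp (2 * \<sigma> * l1norm j)"

definition hnorm_sq :: "real \<Rightarrow> real \<Rightarrow> real^2 \<Rightarrow> real^2 \<Rightarrow> (real^2 \<Rightarrow> real) \<Rightarrow> real" where
  "hnorm_sq \<sigma> s v1 v2 f = infsum (hweight \<sigma> s v1 v2 f) (dual_lat v1 v2)"

text \<open>H^{\<sigma>,s}: real, \<Gamma>-periodic, L^2 functions with finite norm; we work with the
  continuous representative (which exists since \<sigma> > 0).\<close>
definition Hsp :: "real \<Rightarrow> real \<Rightarrow> real^2 \<Rightarrow> real^2 \<Rightarrow> (real^2 \<Rightarrow> real) set" where
  "Hsp \<sigma> s v1 v2 = {f. lat_periodic v1 v2 f \<and> continuous_on UNIV f \<and>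
      set_integrable lborel (fund_dom v1 v2) (\<lambda>x. (f x)^2) \<and>
      (hweight \<sigma> s v1 v2 f) summable_on (dual_lat v1 v2)}"

definition Hsp0 :: "real \<Rightarrow> real \<Rightarrow> real^2 \<Rightarrow> real^2 \<Rightarrow> (real^2 \<Rightarrow> real) set" where
  "Hsp0 \<sigma> s v1 v2 = {f \<in> Hsp \<sigma> s v1 v2. fcoeff v1 v2 f 0 = 0}"

definition Xsp :: "real \<Rightarrow> real \<Rightarrow> real^2 \<Rightarrow> real^2 \<Rightarrow> ((real^2 \<Rightarrow> real) \<times> (real^2 \<Rightarrow> real)) set" where
  "Xsp \<sigma> s v1 v2 = Hsp \<sigma> s v1 v2 \<times> Hsp0 \<sigma> s v1 v2"

definition Xnorm :: "real \<Rightarrow> real \<Rightarrow> real^2 \<Rightarrow> real^2 \<Rightarrow> (real^2 \<Rightarrow> real) \<Rightarrow> (real^2 \<Rightarrow> real) \<Rightarrow> real" where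
  "Xnorm \<sigma> s v1 v2 \<eta> \<psi> = sqrt (hnorm_sq \<sigma> s v1 v2 \<eta> + hnorm_sq \<sigma> s v1 v2 \<psi>)"

definition pd :: "2 \<Rightarrow> (real^2 \<Rightarrow> real) \<Rightarrow> real^2 \<Rightarrow> real" where
  "pd i f x = deriv (\<lambda>t. f (x + t *\<^sub>R axis i 1)) 0"

definition grad2 :: "(real^2 \<Rightarrow> real) \<Rightarrow> real^2 \<Rightarrow> real^2" where
  "grad2 f x = (\<chi> i. pd i f x)"

definition div2 :: "(real^2 \<Rightarrow> real^2) \<Rightarrow> real^2 \<Rightarrow> real" where
  "div2 F x = (\<Sum>i\<in>UNIV. pd i (\<lambda>y. F y $ i) x)"

definition is_DN :: "ereal \<Rightarrow> real^2 \<Rightarrow> real^2 \<Rightarrow> (real^2 \<Rightarrow> real) \<Rightarrow> (real^2 \<Rightarrow> real)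
                      \<Rightarrow> (real^2 \<Rightarrow> real) \<Rightarrow> bool" where
  "is_DN h v1 v2 \<eta> \<psi> G \<longleftrightarrow>
    (\<forall>x. - h < ereal (\<eta> x)) \<and>
    (\<exists>(\<Phi> :: (real^2) \<times> real \<Rightarrow> real) (D\<Phi> :: (real^2) \<times> real \<Rightarrow> (real^2) \<times> real)
       (L :: (real^2) \<times> real \<Rightarrow> (real^2) \<times> real \<Rightarrow> (real^2) \<times> real).
      (\<forall>x y. \<forall>\<gamma>\<in>lat v1 v2. \<Phi> (x + \<gamma>, y) = \<Phi> (x, y)) \<and>
      (\<forall>p \<in> {(x, y). - h < ereal y \<and> y < \<eta> x}.
          (\<Phi> has_derivative (\<lambda>w. D\<Phi> p \<bullet> w)) (at p) \<and>
          (D\<Phi> has_derivative L p) (at p) \<and>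
          (\<Sum>b\<in>Basis. L p b \<bullet> b) = 0) \<and>
      continuous_on {(x, y). - h \<le> ereal y \<and> y \<le> \<eta> x} \<Phi> \<and>
      continuous_on {(x, y). - h \<le> ereal y \<and> y \<le> \<eta> x} D\<Phi> \<and>
      (\<forall>x. \<Phi> (x, \<eta> x) = \<psi> x) \<and>
      (h \<noteq> \<infinity> \<longrightarrow> (\<forall>x. snd (D\<Phi> (x, - real_of_ereal h)) = 0)) \<and>
      (h = \<infinity> \<longrightarrow> (\<forall>e>0. \<exists>M. \<forall>p \<in> {(x, y). y < \<eta> x}. snd p < - M \<longrightarrow> norm (D\<Phi> p) < e)) \<and>
      (\<forall>x. G x = snd (D\<Phi> (x, \<eta> x)) - grad2 \<eta> x \<bullet> fst (D\<Phi> (x, \<eta> x))))"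

text \<open>u(x - ct) solves the Zakharov--Craig--Sulem system, i.e. c\<cdot>\<nabla>u + X(u) = 0.\<close>
definition stokes_wave :: "real \<Rightarrow> real \<Rightarrow> ereal \<Rightarrow> real^2 \<Rightarrow> real^2 \<Rightarrow> real^2
                            \<Rightarrow> (real^2 \<Rightarrow> real) \<Rightarrow> (real^2 \<Rightarrow> real) \<Rightarrow> bool" where
  "stokes_wave g \<kappa> h v1 v2 c \<eta> \<psi> \<longleftrightarrow>
    (\<exists>G. is_DN h v1 v2 \<eta> \<psi> G \<and>
      (\<forall>x. c \<bullet> grad2 \<eta> x + G x = 0) \<and>
      (\<forall>x. c \<bullet> grad2 \<psi> x +
            (- g * \<eta> x - 1/2 * (norm (grad2 \<psi> x))^2
             + (grad2 \<eta> x \<bullet> grad2 \<psi> x + G x)^2 / (2 * (1 + (norm (grad2 \<eta> x))^2))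
             + \<kappa> * div2 (\<lambda>y. (1 / sqrt (1 + (norm (grad2 \<eta> y))^2)) *\<^sub>R grad2 \<eta> y) x) = 0))"

definition momentum :: "real^2 \<Rightarrow> real^2 \<Rightarrow> (real^2 \<Rightarrow> real) \<Rightarrow> (real^2 \<Rightarrow> real) \<Rightarrow> real^2" where
  "momentum v1 v2 \<eta> \<psi> = (1 / lat_area v1 v2) *\<^sub>R
      set_lebesgue_integral lborel (fund_dom v1 v2) (\<lambda>x. \<psi> x *\<^sub>R grad2 \<eta> x)"

definition omega :: "real \<Rightarrow> real \<Rightarrow> ereal \<Rightarrow> real^2 \<Rightarrow> real" where
  "omega g \<kappa> h \<xi> = sqrt ((g + \<kappa> * (norm \<xi>)^2) * norm \<xi> *
      (if h = \<infinity> then 1 else tanh (real_of_ereal h * norm \<xi>)))"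

definition resonant :: "real \<Rightarrow> real \<Rightarrow> ereal \<Rightarrow> real^2 \<Rightarrow> real^2 \<Rightarrow> real^2 \<Rightarrow> (real^2) set" where
  "resonant g \<kappa> h v1 v2 cs = {j \<in> dual_lat v1 v2 - {0}. omega g \<kappa> h j = cs \<bullet> j}"

definition neg_cone :: "(real^2) set \<Rightarrow> (real^2) set" where
  "neg_cone V = {(\<Sum>j\<in>V. \<tau> j *\<^sub>R j) | \<tau>. \<forall>j\<in>V. \<tau> j \<le> 0}"

definition two_d_wave :: "real^2 \<Rightarrow> real^2 \<Rightarrow> (real^2 \<Rightarrow> real) \<Rightarrow> (real^2 \<Rightarrow> real) \<Rightarrow> bool" where
  "two_d_wave v1 v2 \<eta> \<psi> \<longleftrightarrow>
    (\<exists>j \<in> dual_lat v1 v2 - {0}. \<forall>x.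
       \<eta> x = \<eta> ((x \<bullet> ((1 / norm j) *\<^sub>R j)) *\<^sub>R ((1 / norm j) *\<^sub>R j)) \<and>
       \<psi> x = \<psi> ((x \<bullet> ((1 / norm j) *\<^sub>R j)) *\<^sub>R ((1 / norm j) *\<^sub>R j)))"

end

theory Submission
 imports Defs "HOL-Analysis.Analysis"
begin

text \<open>
 Write $u=(\eta,\psi)$ and compare $u$ with its translate by a vector $d$. The difference of two
 small solutions with the same speed satisfies the linearised equations at rest up to an error that
 is quadratically small relative to the difference itself. This is proved by energy estimates only:
 the fluid domain is flattened by a vertical shear, the velocity is bounded by the maximum principle,
 and the kinematic and Bernoulli equations are tested against trigonometric polynomials (extended
 harmonically in the kinematic case). Hence the difference is controlled by its resonant modes, and
 division by $|d|^2$ with $d\to 0$ gives, for every vector $n$,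
 $$\sum_{k\notin\pm V}(n\cdot k)^2\bigl(|k|^2|\eta_k|^2+|k||\psi_k|^2\bigr)\le C\varepsilon^2\sum_{k\in\pm V}(n\cdot k)^2|k|^2|\eta_k|^2 .$$
 If $n\cdot k$ is an integer for all $k$ in the dual lattice, then $|n\cdot k|\le(n\cdot k)^2$, so the
 nonresonant part of $n\cdot I(u)=\sum_k (n\cdot k)\,\mathrm{Re}(i\eta_k\bar\psi_k)$ is dominated by the
 resonant part, which equals $-\sum_{k\in\pm V}(n\cdot k)(c_*\cdot k)|\eta_k|^2/(|k|\tanh)$ to leading order.
 For the integral normals $n$ of the sides of the cone this is nonpositive, and it vanishes only if all
 modes of $u$ are orthogonal to $n$.
\<close>

section \<open>Divergence theorem for pointwise differentiable fields\<close>

text \<open>Comparing u with 0 would also bound the nonresonant energy by the resonant one, but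
  without the weight (n.k)^2. That is too weak on a side of the cone: its normal n is orthogonal to
  the resonant vectors of that side, the main term of n.I(u) no longer sees their modes, and the
  error must degenerate in the same way. Translation by d multiplies mode k by cis(k.d), so the
  difference carries the missing factor, and a constant independent of d survives the limit. No
  implicit function theorem and no regularity of the Dirichlet-Neumann operator in \<eta> enter,
  only the potential that \<open>is_DN\<close> provides. Its gradient is merely continuous up to the
  boundary and its second derivative need not be continuous; this forces the Goursat argument,
  finite differences in the maximum principle, and traces taken as limits. In infinite depth all
  identities are written on a slab of finite depth H whose bottom terms tend to 0. The linear
  operator is frozen at \<open>cs\<close> and c - \<open>cs\<close> counts as an error, so all
  constants and the finite set of normals are fixed before \<epsilon>.\<close>

lemma integral_cut_fst:
 fixes f :: "real \<times> 'b::euclidean_space => real"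
 assumes "continuous_on (cbox (a1,a2) (b1,b2)) f" "a1 <= m" "m <= b1"
 shows "integral (cbox (a1,a2) (b1,b2)) f =
  integral (cbox (a1,a2) (m,b2)) f + integral (cbox (m,a2) (b1,b2)) f"
proof -
 have i: "f integrable_on cbox (a1,a2) (b1,b2)" using assms(1) by (rule integrable_continuous)
 have k: "(1::real, 0::'b) \<in> Basis" by (simp add: Basis_prod_def)
 have 1: "cbox (a1,a2) (b1,b2) \<inter> {x. x \<bullet> (1, 0) <= m} = cbox (a1,a2) (m,b2)" using assms by (auto simp: cbox_Pair_eq)
 have 2: "cbox (a1,a2) (b1,b2) \<inter> {x. x \<bullet> (1, 0) \<ge> m} = cbox (m,a2) (b1,b2)" using assms by (auto simp: cbox_Pair_eq)
 show ?thesis using integral_split[OF i k, of m] unfolding 1 2 .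
qed

lemma integral_cut_snd:
 fixes f :: "'b::euclidean_space \<times> real => real"
 assumes "continuous_on (cbox (a1,a2) (b1,b2)) f" "a2 <= m" "m <= b2"
 shows "integral (cbox (a1,a2) (b1,b2)) f =
  integral (cbox (a1,a2) (b1,m)) f + integral (cbox (a1,m) (b1,b2)) f"
proof -
 have i: "f integrable_on cbox (a1,a2) (b1,b2)" using assms(1) by (rule integrable_continuous)
 have k: "(0::'b, 1::real) \<in> Basis" by (simp add: Basis_prod_def)
 have 1: "cbox (a1,a2) (b1,b2) \<inter> {x. x \<bullet> (0, 1) <= m} = cbox (a1,a2) (b1,m)" using assms by (auto simp: cbox_Pair_eq)
 have 2: "cbox (a1,a2) (b1,b2) \<inter> {x. x \<bullet> (0, 1) \<ge> m} = cbox (a1,m) (b1,b2)" using assms by (auto simp: cbox_Pair_eq)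
 show ?thesis using integral_split[OF i k, of m] unfolding 1 2 .
qed

lemma integral_cut_mid:
 fixes f :: "'b::euclidean_space \<times> real \<times> 'c::euclidean_space => real"
 assumes "continuous_on (cbox (a1,a2,a3) (b1,b2,b3)) f" "a2 <= m" "m <= b2"
 shows "integral (cbox (a1,a2,a3) (b1,b2,b3)) f =
  integral (cbox (a1,a2,a3) (b1,m,b3)) f + integral (cbox (a1,m,a3) (b1,b2,b3)) f"
proof -
 have i: "f integrable_on cbox (a1,a2,a3) (b1,b2,b3)" using assms(1) by (rule integrable_continuous)
 have k: "(0::'b, 1::real, 0::'c) \<in> Basis" by (simp add: Basis_prod_def zero_prod_def)
 have 1: "cbox (a1,a2,a3) (b1,b2,b3) \<inter> {x. x \<bullet> (0, 1, 0) <= m} = cbox (a1,a2,a3) (b1,m,b3)" using assms by (auto simp: cbox_Pair_eq)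
 have 2: "cbox (a1,a2,a3) (b1,b2,b3) \<inter> {x. x \<bullet> (0, 1, 0) \<ge> m} = cbox (a1,m,a3) (b1,b2,b3)" using assms by (auto simp: cbox_Pair_eq)
 show ?thesis using integral_split[OF i k, of m] unfolding 1 2 .
qed

lemma integral_cut_last:
 fixes f :: "'b::euclidean_space \<times> 'c::euclidean_space \<times> real => real"
 assumes "continuous_on (cbox (a1,a2,a3) (b1,b2,b3)) f" "a3 <= m" "m <= b3"
 shows "integral (cbox (a1,a2,a3) (b1,b2,b3)) f =
  integral (cbox (a1,a2,a3) (b1,b2,m)) f + integral (cbox (a1,a2,m) (b1,b2,b3)) f"
proof -
 have i: "f integrable_on cbox (a1,a2,a3) (b1,b2,b3)" using assms(1) by (rule integrable_continuous)
 have k: "(0::'b, 0::'c, 1::real) \<in> Basis" by (simp add: Basis_prod_def zero_prod_def)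
 have 1: "cbox (a1,a2,a3) (b1,b2,b3) \<inter> {x. x \<bullet> (0, 0, 1) <= m} = cbox (a1,a2,a3) (b1,b2,m)" using assms by (auto simp: cbox_Pair_eq)
 have 2: "cbox (a1,a2,a3) (b1,b2,b3) \<inter> {x. x \<bullet> (0, 0, 1) \<ge> m} = cbox (a1,a2,m) (b1,b2,b3)" using assms by (auto simp: cbox_Pair_eq)
 show ?thesis using integral_split[OF i k, of m] unfolding 1 2 .
qed

lemma integral_near_const:
 fixes f :: "'a::euclidean_space => real"
 assumes "continuous_on (cbox a b) f" "!!x. x \<in> cbox a b ==> \<bar>f x - c\<bar> <= B" "0 <= B"
 shows "\<bar>integral (cbox a b) f - c*measure lborel (cbox a b)\<bar> <= B*measure lborel (cbox a b)"
proof -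
 have f: "f integrable_on cbox a b" using assms(1) by (rule integrable_continuous)
 have eq: "integral (cbox a b) f - c*measure lborel (cbox a b) = integral (cbox a b) (%x. f x - c)" by (subst integral_diff) (auto simp: f mult.commute)
 have "((%x. f x - c) has_integral integral (cbox a b) (%x. f x - c)) (cbox a b)" by (intro integrable_integral integrable_diff f) auto
 from has_integral_bound[OF assms(3) this] show ?thesis unfolding eq using assms(2) by simp
qed

text \<open>The divergence theorem says that this number is 0. Opposite faces are merged into one
  integral of a difference, so that a cut makes one of the three face terms telescope and splits the
  other two by additivity of the integral.\<close>

definition flux_defect ::
 "(real\<times>real\<times>real => real) => (real\<times>real\<times>real => real) => (real\<times>real\<times>real => real) =>
 (real\<times>real\<times>real => real) => real => real => real => real => real => real => real" where
 "flux_defect F1 F2 F3 g a1 b1 a2 b2 a3 b3 =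
  integral (cbox (a2,a3) (b2,b3)) (%(y,z). F1 (b1,y,z) - F1 (a1,y,z)) +
  integral (cbox (a1,a3) (b1,b3)) (%(x,z). F2 (x,b2,z) - F2 (x,a2,z)) +
  integral (cbox (a1,a2) (b1,b2)) (%(x,y). F3 (x,y,b3) - F3 (x,y,a3)) -
  integral (cbox (a1,a2,a3) (b1,b2,b3)) g"

lemma continuous_on_slices:
 fixes F :: "real\<times>real\<times>real => real"
 assumes "continuous_on (cbox (a1,a2,a3) (b1,b2,b3)) F"
 shows "x \<in> {a1..b1} ==> continuous_on (cbox (a2,a3) (b2,b3)) (%(y,z). F (x,y,z))"
  and "y \<in> {a2..b2} ==> continuous_on (cbox (a1,a3) (b1,b3)) (%(x,z). F (x,y,z))"
  and "z \<in> {a3..b3} ==> continuous_on (cbox (a1,a2) (b1,b2)) (%(x,y). F (x,y,z))"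
 by (auto simp: split_beta cbox_Pair_eq intro!: continuous_intros continuous_on_compose2[OF assms])

lemma continuous_on_slice_diffs:
 fixes F :: "real\<times>real\<times>real => real"
 assumes "continuous_on (cbox (a1,a2,a3) (b1,b2,b3)) F" "a1 <= b1" "a2 <= b2" "a3 <= b3"
 shows "continuous_on (cbox (a2,a3) (b2,b3)) (%(y,z). F (b1,y,z) - F (a1,y,z))"
  and "continuous_on (cbox (a1,a3) (b1,b3)) (%(x,z). F (x,b2,z) - F (x,a2,z))"
  and "continuous_on (cbox (a1,a2) (b1,b2)) (%(x,y). F (x,y,b3) - F (x,y,a3))" using continuous_on_slices[OF assms(1)] assms(2-)
 by (auto simp: split_beta intro!: continuous_intros)

text \<open>The two pieces share the cutting face with opposite signs, so the defect is additive;
  bisection rests on this.\<close>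

lemma flux_defect_cut1:
 assumes c: "continuous_on (cbox (a1,a2,a3) (b1,b2,b3)) F1" "continuous_on (cbox (a1,a2,a3) (b1,b2,b3)) F2"
  "continuous_on (cbox (a1,a2,a3) (b1,b2,b3)) F3" "continuous_on (cbox (a1,a2,a3) (b1,b2,b3)) g"
  and le: "a1 <= b1" "a2 <= b2" "a3 <= b3" and m: "a1 <= m" "m <= b1"
 shows "flux_defect F1 F2 F3 g a1 b1 a2 b2 a3 b3 =
  flux_defect F1 F2 F3 g a1 m a2 b2 a3 b3 + flux_defect F1 F2 F3 g m b1 a2 b2 a3 b3"
proof -
 have s: "(%(y,z). F1 (x,y,z) - F1 (x',y,z)) integrable_on cbox (a2,a3) (b2,b3)"
  if "x \<in> {a1..b1}" "x' \<in> {a1..b1}" for x x' using continuous_on_slices(1)[OF c(1)] that by (auto simp: split_beta intro!: integrable_continuous continuous_intros)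
 have "integral (cbox (a2,a3) (b2,b3)) (%(y,z). F1 (b1,y,z) - F1 (a1,y,z))
   = integral (cbox (a2,a3) (b2,b3)) (%(y,z). F1 (m,y,z) - F1 (a1,y,z))
   + integral (cbox (a2,a3) (b2,b3)) (%(y,z). F1 (b1,y,z) - F1 (m,y,z))" using integral_add[OF s[of m a1] s[of b1 m]] m le by (simp add: split_def)
 then show ?thesis unfolding flux_defect_def using integral_cut_fst[OF continuous_on_slice_diffs(2)[OF c(2) le] m]
   integral_cut_fst[OF continuous_on_slice_diffs(3)[OF c(3) le] m] integral_cut_fst[OF c(4) m] by simp
qed

lemma flux_defect_cut2:
 assumes c: "continuous_on (cbox (a1,a2,a3) (b1,b2,b3)) F1" "continuous_on (cbox (a1,a2,a3) (b1,b2,b3)) F2"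
  "continuous_on (cbox (a1,a2,a3) (b1,b2,b3)) F3" "continuous_on (cbox (a1,a2,a3) (b1,b2,b3)) g"
  and le: "a1 <= b1" "a2 <= b2" "a3 <= b3" and m: "a2 <= m" "m <= b2"
 shows "flux_defect F1 F2 F3 g a1 b1 a2 b2 a3 b3 =
  flux_defect F1 F2 F3 g a1 b1 a2 m a3 b3 + flux_defect F1 F2 F3 g a1 b1 m b2 a3 b3"
proof -
 have s: "(%(x,z). F2 (x,y,z) - F2 (x,y',z)) integrable_on cbox (a1,a3) (b1,b3)"
  if "y \<in> {a2..b2}" "y' \<in> {a2..b2}" for y y' using continuous_on_slices(2)[OF c(2)] that by (auto simp: split_beta intro!: integrable_continuous continuous_intros)
 have "integral (cbox (a1,a3) (b1,b3)) (%(x,z). F2 (x,b2,z) - F2 (x,a2,z))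
   = integral (cbox (a1,a3) (b1,b3)) (%(x,z). F2 (x,m,z) - F2 (x,a2,z))
   + integral (cbox (a1,a3) (b1,b3)) (%(x,z). F2 (x,b2,z) - F2 (x,m,z))" using integral_add[OF s[of m a2] s[of b2 m]] m le by (simp add: split_def)
 then show ?thesis unfolding flux_defect_def using integral_cut_fst[OF continuous_on_slice_diffs(1)[OF c(1) le] m]
   integral_cut_snd[OF continuous_on_slice_diffs(3)[OF c(3) le] m] integral_cut_mid[OF c(4) m] by simp
qed

lemma flux_defect_cut3:
 assumes c: "continuous_on (cbox (a1,a2,a3) (b1,b2,b3)) F1" "continuous_on (cbox (a1,a2,a3) (b1,b2,b3)) F2"
  "continuous_on (cbox (a1,a2,a3) (b1,b2,b3)) F3" "continuous_on (cbox (a1,a2,a3) (b1,b2,b3)) g"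
  and le: "a1 <= b1" "a2 <= b2" "a3 <= b3" and m: "a3 <= m" "m <= b3"
 shows "flux_defect F1 F2 F3 g a1 b1 a2 b2 a3 b3 =
  flux_defect F1 F2 F3 g a1 b1 a2 b2 a3 m + flux_defect F1 F2 F3 g a1 b1 a2 b2 m b3"
proof -
 have s: "(%(x,y). F3 (x,y,z) - F3 (x,y,z')) integrable_on cbox (a1,a2) (b1,b2)"
  if "z \<in> {a3..b3}" "z' \<in> {a3..b3}" for z z' using continuous_on_slices(3)[OF c(3)] that by (auto simp: split_beta intro!: integrable_continuous continuous_intros)
 have "integral (cbox (a1,a2) (b1,b2)) (%(x,y). F3 (x,y,b3) - F3 (x,y,a3))
   = integral (cbox (a1,a2) (b1,b2)) (%(x,y). F3 (x,y,m) - F3 (x,y,a3))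
   + integral (cbox (a1,a2) (b1,b2)) (%(x,y). F3 (x,y,b3) - F3 (x,y,m))" using integral_add[OF s[of m a3] s[of b3 m]] m le by (simp add: split_def)
 then show ?thesis unfolding flux_defect_def using integral_cut_snd[OF continuous_on_slice_diffs(1)[OF c(1) le] m]
   integral_cut_snd[OF continuous_on_slice_diffs(2)[OF c(2) le] m] integral_cut_last[OF c(4) m] by simp
qed

text \<open>One bisection per direction, each time keeping the piece with the larger defect. All
  edges shrink by the same factor 2, so the boxes stay similar, and the defect drops by at most the
  factor 8 of the volume.\<close>

lemma flux_defect_halve:
 assumes c: "continuous_on (cbox (a1,a2,a3) (b1,b2,b3)) F1" "continuous_on (cbox (a1,a2,a3) (b1,b2,b3)) F2"
  "continuous_on (cbox (a1,a2,a3) (b1,b2,b3)) F3" "continuous_on (cbox (a1,a2,a3) (b1,b2,b3)) g"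
  and le: "a1 <= b1" "a2 <= b2" "a3 <= b3"
  and big: "\<bar>flux_defect F1 F2 F3 g a1 b1 a2 b2 a3 b3\<bar> \<ge> e"
 obtains a1' b1' a2' b2' a3' b3' where "a1 <= a1'" "b1' <= b1" "b1' - a1' = (b1 - a1)/2"
  "a2 <= a2'" "b2' <= b2" "b2' - a2' = (b2 - a2)/2"
  "a3 <= a3'" "b3' <= b3" "b3' - a3' = (b3 - a3)/2"
  "\<bar>flux_defect F1 F2 F3 g a1' b1' a2' b2' a3' b3'\<bar> \<ge> e/8"
proof -
 let ?D = "flux_defect F1 F2 F3 g"
 have h: "\<bar>x\<bar> \<ge> e/2 \<or> \<bar>y\<bar> \<ge> e/2" if "\<bar>x + y\<bar> \<ge> e" for x y e :: real using that by linarith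
 have "\<exists>a b. a1 <= a \<and> b <= b1 \<and> b - a = (b1 - a1)/2 \<and> \<bar>?D a b a2 b2 a3 b3\<bar> \<ge> e/2"
 proof -
  have m: "a1 <= (a1+b1)/2" "(a1+b1)/2 <= b1" using le by auto
  from h[OF big[unfolded flux_defect_cut1[OF c le m]]] show ?thesis
  proof (elim disjE)
   assume h1: "\<bar>?D a1 ((a1+b1)/2) a2 b2 a3 b3\<bar> \<ge> e/2"
   show ?thesis by (rule exI[of _ a1], rule exI[of _ "(a1+b1)/2"], intro conjI) (use m h1 in \<open>auto simp: field_simps\<close>)
  next
   assume h1: "\<bar>?D ((a1+b1)/2) b1 a2 b2 a3 b3\<bar> \<ge> e/2"
   show ?thesis by (rule exI[of _ "(a1+b1)/2"], rule exI[of _ b1], intro conjI) (use m h1 in \<open>auto simp: field_simps\<close>)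
  qed
 qed
 then obtain a1' b1' where 1: "a1 <= a1'" "b1' <= b1" "b1' - a1' = (b1 - a1)/2" "\<bar>?D a1' b1' a2 b2 a3 b3\<bar> \<ge> e/2" by blast
 have le1: "a1' <= b1'" using 1(3) le(1) by simp
 have sub: "cbox (a1',a2,a3) (b1',b2,b3) \<subseteq> cbox (a1,a2,a3) (b1,b2,b3)" using 1 by (auto simp: cbox_Pair_eq)
 note c1 = c[THEN continuous_on_subset, OF sub]
 have "\<exists>a b. a2 <= a \<and> b <= b2 \<and> b - a = (b2 - a2)/2 \<and> \<bar>?D a1' b1' a b a3 b3\<bar> \<ge> e/2/2"
 proof -
  have m: "a2 <= (a2+b2)/2" "(a2+b2)/2 <= b2" using le by auto
  from h[OF 1(4)[unfolded flux_defect_cut2[OF c1 le1 le(2,3) m]]] show ?thesis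
  proof (elim disjE)
   assume h1: "\<bar>?D a1' b1' a2 ((a2+b2)/2) a3 b3\<bar> \<ge> e/2/2"
   show ?thesis by (rule exI[of _ a2], rule exI[of _ "(a2+b2)/2"], intro conjI) (use m h1 in \<open>auto simp: field_simps\<close>)
  next
   assume h1: "\<bar>?D a1' b1' ((a2+b2)/2) b2 a3 b3\<bar> \<ge> e/2/2"
   show ?thesis by (rule exI[of _ "(a2+b2)/2"], rule exI[of _ b2], intro conjI) (use m h1 in \<open>auto simp: field_simps\<close>)
  qed
 qed
 then obtain a2' b2' where 2: "a2 <= a2'" "b2' <= b2" "b2' - a2' = (b2 - a2)/2" "\<bar>?D a1' b1' a2' b2' a3 b3\<bar> \<ge> e/2/2" by blast
 have le2: "a2' <= b2'" using 2(3) le(2) by simp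
 have sub: "cbox (a1',a2',a3) (b1',b2',b3) \<subseteq> cbox (a1',a2,a3) (b1',b2,b3)" using 2 by (auto simp: cbox_Pair_eq)
 note c2 = c1[THEN continuous_on_subset, OF sub]
 have "\<exists>a b. a3 <= a \<and> b <= b3 \<and> b - a = (b3 - a3)/2 \<and> \<bar>?D a1' b1' a2' b2' a b\<bar> \<ge> e/2/2/2"
 proof -
  have m: "a3 <= (a3+b3)/2" "(a3+b3)/2 <= b3" using le by auto
  from h[OF 2(4)[unfolded flux_defect_cut3[OF c2 le1 le2 le(3) m]]] show ?thesis
  proof (elim disjE)
   assume h1: "\<bar>?D a1' b1' a2' b2' a3 ((a3+b3)/2)\<bar> \<ge> e/2/2/2"
   show ?thesis by (rule exI[of _ a3], rule exI[of _ "(a3+b3)/2"], intro conjI) (use m h1 in \<open>auto simp: field_simps\<close>)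
  next
   assume h1: "\<bar>?D a1' b1' a2' b2' ((a3+b3)/2) b3\<bar> \<ge> e/2/2/2"
   show ?thesis by (rule exI[of _ "(a3+b3)/2"], rule exI[of _ b3], intro conjI) (use m h1 in \<open>auto simp: field_simps\<close>)
  qed
 qed
 then obtain a3' b3' where 3: "a3 <= a3'" "b3' <= b3" "b3' - a3' = (b3 - a3)/2" "\<bar>?D a1' b1' a2' b2' a3' b3'\<bar> \<ge> e/2/2/2" by blast
 show ?thesis by (rule that[OF 1(1-3) 2(1-3) 3(1-3)]) (use 3 in simp)
qed

text \<open>The affine part of the field at p contributes trace times volume, that is
  \<open>g\<close> at p times volume. On each pair of faces the Taylor remainders are at most e
  times the sum of the edges, once per face, whence the factor 2; the last term is the oscillation
  of \<open>g\<close>.\<close>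

lemma flux_defect_local:
 assumes d: "(F1 has_derivative L1) (at (p1,p2,p3))" "(F2 has_derivative L2) (at (p1,p2,p3))"
  "(F3 has_derivative L3) (at (p1,p2,p3))"
  and tr: "L1 (1,0,0) + L2 (0,1,0) + L3 (0,0,1) = g (p1,p2,p3)"
  and gc: "continuous (at (p1,p2,p3) within S) g" and e: "e > 0"
 obtains d where "d > 0" and "!!a1 b1 a2 b2 a3 b3. [|a1 <= p1; p1 <= b1; a2 <= p2; p2 <= b2; a3 <= p3; p3 <= b3;
  b1 - a1 < d; b2 - a2 < d; b3 - a3 < d; cbox (a1,a2,a3) (b1,b2,b3) \<subseteq> S;
  continuous_on (cbox (a1,a2,a3) (b1,b2,b3)) F1; continuous_on (cbox (a1,a2,a3) (b1,b2,b3)) F2;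
  continuous_on (cbox (a1,a2,a3) (b1,b2,b3)) F3; continuous_on (cbox (a1,a2,a3) (b1,b2,b3)) g|] ==>
  \<bar>flux_defect F1 F2 F3 g a1 b1 a2 b2 a3 b3\<bar> <= e*(2*((b1-a1)+(b2-a2)+(b3-a3)) *
    ((b2-a2)*(b3-a3) + (b1-a1)*(b3-a3) + (b1-a1)*(b2-a2)) + (b1-a1)*(b2-a2)*(b3-a3))"
proof -
 let ?p = "(p1,p2,p3)"
 have ex: "\<exists>d>0. \<forall>q. norm (q - ?p) < d --> \<bar>F q - F ?p - L (q - ?p)\<bar> <= e*norm (q - ?p)"
  if "(F has_derivative L) (at ?p)" for F :: "real\<times>real\<times>real => real" and L using that[unfolded has_derivative_at_alt] e by (auto simp: real_norm_def)
 obtain d1 where d1: "d1>0" "!!q. norm (q - ?p) < d1 ==> \<bar>F1 q - F1 ?p - L1 (q - ?p)\<bar> <= e*norm (q - ?p)" using ex[OF d(1)] by blast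
 obtain d2 where d2: "d2>0" "!!q. norm (q - ?p) < d2 ==> \<bar>F2 q - F2 ?p - L2 (q - ?p)\<bar> <= e*norm (q - ?p)" using ex[OF d(2)] by blast
 obtain d3 where d3: "d3>0" "!!q. norm (q - ?p) < d3 ==> \<bar>F3 q - F3 ?p - L3 (q - ?p)\<bar> <= e*norm (q - ?p)" using ex[OF d(3)] by blast
 obtain d4 where d4: "d4>0" "!!q. q \<in> S ==> norm (q - ?p) < d4 ==> \<bar>g q - g ?p\<bar> < e"
  using gc[unfolded continuous_within_eps_delta] e by (auto simp: dist_norm real_norm_def)
 \<comment> \<open>The distance from p is estimated by the sum of the three edges, each shorter than
   d.\<close>
 define d where "d = Min {d1,d2,d3,d4}/3"
 have dpos: "d > 0" and dle: "3*d <= d1" "3*d <= d2" "3*d <= d3" "3*d <= d4" using d1 d2 d3 d4 unfolding d_def by auto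
 have nrm: "norm (x,y,z) <= \<bar>x\<bar> + \<bar>y\<bar> + \<bar>z\<bar>" for x y z :: real
 proof -
  have "norm (x,y,z) <= norm x + norm (y,z)" by (rule norm_Pair_le)
  also have "norm (y,z) <= norm y + norm z" by (rule norm_Pair_le)
  finally show ?thesis by simp
 qed
 show ?thesis
 proof (rule that[OF dpos])
  fix a1 b1 a2 b2 a3 b3
  assume le: "a1 <= p1" "p1 <= b1" "a2 <= p2" "p2 <= b2" "a3 <= p3" "p3 <= b3"
   and dd: "b1 - a1 < d" "b2 - a2 < d" "b3 - a3 < d" and S: "cbox (a1,a2,a3) (b1,b2,b3) \<subseteq> S"
   and c: "continuous_on (cbox (a1,a2,a3) (b1,b2,b3)) F1" "continuous_on (cbox (a1,a2,a3) (b1,b2,b3)) F2"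
  "continuous_on (cbox (a1,a2,a3) (b1,b2,b3)) F3" "continuous_on (cbox (a1,a2,a3) (b1,b2,b3)) g"
  define r1 r2 r3 R where r: "r1 = b1 - a1" "r2 = b2 - a2" "r3 = b3 - a3" "R = r1+r2+r3"
  have rp: "r1 \<ge> 0" "r2 \<ge> 0" "r3 \<ge> 0" using le r by auto
  have lle: "a1 <= b1" "a2 <= b2" "a3 <= b3" using le by auto
  have near: "norm ((x,y,z) - ?p) <= R" "norm ((x,y,z) - ?p) < 3*d"
   if "a1 <= x" "x <= b1" "a2 <= y" "y <= b2" "a3 <= z" "z <= b3" for x y z
  proof -
   have "norm ((x,y,z) - ?p) <= \<bar>x-p1\<bar> + \<bar>y-p2\<bar> + \<bar>z-p3\<bar>" using nrm by simp
   moreover have "\<bar>x-p1\<bar> <= r1" "\<bar>y-p2\<bar> <= r2" "\<bar>z-p3\<bar> <= r3" using that le r by auto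
   ultimately show "norm ((x,y,z) - ?p) <= R" "norm ((x,y,z) - ?p) < 3*d" using dd r by auto
  qed
  have lin: "L q - L q' = L (q - q')" if "(F has_derivative L) (at ?p)" for F and L :: "real\<times>real\<times>real => real" and q q'
   using linear_diff[OF has_derivative_linear[OF that]] by simp
  have sc: "L (t *\<^sub>R v) = t*L v" if "(F has_derivative L) (at ?p)" for F and L :: "real\<times>real\<times>real => real" and t v
   using linear_scale[OF has_derivative_linear[OF that]] by simp
  have e1: "\<bar>F1 (b1,y,z) - F1 (a1,y,z) - r1*L1 (1,0,0)\<bar> <= 2*e*R"
   if "a2 <= y" "y <= b2" "a3 <= z" "z <= b3" for y z
  proof -
   have n: "norm ((b1,y,z) - ?p) <= R" "norm ((b1,y,z) - ?p) < d1" "norm ((a1,y,z) - ?p) <= R" "norm ((a1,y,z) - ?p) < d1"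
    using near[of b1 y z] near[of a1 y z] that lle dle by auto
   have "\<bar>F1 (b1,y,z) - F1 ?p - L1 ((b1,y,z) - ?p)\<bar> <= e*R" "\<bar>F1 (a1,y,z) - F1 ?p - L1 ((a1,y,z) - ?p)\<bar> <= e*R"
    using d1(2)[OF n(2)] d1(2)[OF n(4)] n e by (meson less_imp_le mult_left_mono order_trans)+
   moreover have "L1 ((b1,y,z) - ?p) - L1 ((a1,y,z) - ?p) = r1*L1 (1,0,0)"
    using lin[OF d(1), of "(b1,y,z) - ?p" "(a1,y,z) - ?p"] sc[OF d(1), of r1 "(1,0,0)"] r by (simp add: zero_prod_def)
   ultimately show ?thesis by linarith
  qed
  have e2: "\<bar>F2 (x,b2,z) - F2 (x,a2,z) - r2*L2 (0,1,0)\<bar> <= 2*e*R"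
   if "a1 <= x" "x <= b1" "a3 <= z" "z <= b3" for x z
  proof -
   have n: "norm ((x,b2,z) - ?p) <= R" "norm ((x,b2,z) - ?p) < d2" "norm ((x,a2,z) - ?p) <= R" "norm ((x,a2,z) - ?p) < d2"
    using near[of x b2 z] near[of x a2 z] that lle dle by auto
   have "\<bar>F2 (x,b2,z) - F2 ?p - L2 ((x,b2,z) - ?p)\<bar> <= e*R" "\<bar>F2 (x,a2,z) - F2 ?p - L2 ((x,a2,z) - ?p)\<bar> <= e*R"
    using d2(2)[OF n(2)] d2(2)[OF n(4)] n e by (meson less_imp_le mult_left_mono order_trans)+
   moreover have "L2 ((x,b2,z) - ?p) - L2 ((x,a2,z) - ?p) = r2*L2 (0,1,0)" using lin[OF d(2), of "(x,b2,z) - ?p" "(x,a2,z) - ?p"] sc[OF d(2), of r2 "(0,1,0)"] r by simp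
   ultimately show ?thesis by linarith
  qed
  have e3: "\<bar>F3 (x,y,b3) - F3 (x,y,a3) - r3*L3 (0,0,1)\<bar> <= 2*e*R"
   if "a1 <= x" "x <= b1" "a2 <= y" "y <= b2" for x y
  proof -
   have n: "norm ((x,y,b3) - ?p) <= R" "norm ((x,y,b3) - ?p) < d3" "norm ((x,y,a3) - ?p) <= R" "norm ((x,y,a3) - ?p) < d3"
    using near[of x y b3] near[of x y a3] that lle dle by auto
   have "\<bar>F3 (x,y,b3) - F3 ?p - L3 ((x,y,b3) - ?p)\<bar> <= e*R" "\<bar>F3 (x,y,a3) - F3 ?p - L3 ((x,y,a3) - ?p)\<bar> <= e*R"
    using d3(2)[OF n(2)] d3(2)[OF n(4)] n e by (meson less_imp_le mult_left_mono order_trans)+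
   moreover have "L3 ((x,y,b3) - ?p) - L3 ((x,y,a3) - ?p) = r3*L3 (0,0,1)" using lin[OF d(3), of "(x,y,b3) - ?p" "(x,y,a3) - ?p"] sc[OF d(3), of r3 "(0,0,1)"] r by simp
   ultimately show ?thesis by linarith
  qed
  have e4: "\<bar>g q - g ?p\<bar> <= e" if "q \<in> cbox (a1,a2,a3) (b1,b2,b3)" for q
  proof -
   obtain x y z where q: "q = (x,y,z)" by (cases q)
   have "norm (q - ?p) < d4" using near(2)[of x y z] that dle unfolding q by (auto simp: cbox_Pair_eq)
   then show ?thesis using d4(2)[of q] that S by fastforce
  qed
  have R0: "0 <= 2*e*R" using rp e r by simp
  have cont2: "measure lborel (cbox (a,b) (a',b')) = (a'-a)*(b'-b)" if "a <= a'" "b <= b'" for a a' b b' :: real using that by (simp add: content_Pair)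
  have i1: "\<bar>integral (cbox (a2,a3) (b2,b3)) (%(y,z). F1 (b1,y,z) - F1 (a1,y,z)) - r1*L1 (1,0,0)*(r2*r3)\<bar> <= 2*e*R*(r2*r3)"
   by (rule integral_near_const[OF continuous_on_slice_diffs(1)[OF c(1) lle] _ R0, of "r1*L1 (1,0,0)", unfolded cont2[OF lle(2,3)], folded r])
    (use e1 in \<open>auto simp: cbox_Pair_eq\<close>)
  have i2: "\<bar>integral (cbox (a1,a3) (b1,b3)) (%(x,z). F2 (x,b2,z) - F2 (x,a2,z)) - r2*L2 (0,1,0)*(r1*r3)\<bar> <= 2*e*R*(r1*r3)"
   by (rule integral_near_const[OF continuous_on_slice_diffs(2)[OF c(2) lle] _ R0, of "r2*L2 (0,1,0)", unfolded cont2[OF lle(1,3)], folded r])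
    (use e2 in \<open>auto simp: cbox_Pair_eq\<close>)
  have i3: "\<bar>integral (cbox (a1,a2) (b1,b2)) (%(x,y). F3 (x,y,b3) - F3 (x,y,a3)) - r3*L3 (0,0,1)*(r1*r2)\<bar> <= 2*e*R*(r1*r2)"
   by (rule integral_near_const[OF continuous_on_slice_diffs(3)[OF c(3) lle] _ R0, of "r3*L3 (0,0,1)", unfolded cont2[OF lle(1,2)], folded r])
    (use e3 in \<open>auto simp: cbox_Pair_eq\<close>)
  have i4: "\<bar>integral (cbox (a1,a2,a3) (b1,b2,b3)) g - g ?p*(r1*(r2*r3))\<bar> <= e*(r1*(r2*r3))"
   using integral_near_const[OF c(4) e4] e lle by (simp add: content_Pair r)
  have "g ?p*(r1*(r2*r3)) = r1*L1 (1,0,0)*(r2*r3) + r2*L2 (0,1,0)*(r1*r3) + r3*L3 (0,0,1)*(r1*r2)" unfolding tr[symmetric] by (simp add: algebra_simps)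
  then have "\<bar>flux_defect F1 F2 F3 g a1 b1 a2 b2 a3 b3\<bar> <= 2*e*R*(r2*r3) + 2*e*R*(r1*r3) + 2*e*R*(r1*r2) + e*(r1*(r2*r3))"
   unfolding flux_defect_def using i1 i2 i3 i4 by linarith
  also have "\<dots> = e*(2*R*(r2*r3 + r1*r3 + r1*r2) + r1*r2*r3)" by (simp add: algebra_simps)
  finally show "\<bar>flux_defect F1 F2 F3 g a1 b1 a2 b2 a3 b3\<bar> <= e*(2*((b1-a1)+(b2-a2)+(b3-a3)) *
    ((b2-a2)*(b3-a3) + (b1-a1)*(b3-a3) + (b1-a1)*(b2-a2)) + (b1-a1)*(b2-a2)*(b3-a3))" unfolding r .
 qed
qed

text \<open>Goursat's argument: a nonzero defect survives in nested boxes at the rate 8^-n, whereas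
  differentiability at their common point forces a rate with an arbitrarily small constant. No
  continuity of the derivatives enters, only that of \<open>g\<close>.\<close>

lemma flux_defect_eq_0:
 assumes c: "continuous_on (cbox (a1,a2,a3) (b1,b2,b3)) F1" "continuous_on (cbox (a1,a2,a3) (b1,b2,b3)) F2"
  "continuous_on (cbox (a1,a2,a3) (b1,b2,b3)) F3" "continuous_on (cbox (a1,a2,a3) (b1,b2,b3)) g"
  and lt: "a1 < b1" "a2 < b2" "a3 < b3"
  and d: "!!p. p \<in> cbox (a1,a2,a3) (b1,b2,b3) ==> \<exists>L1 L2 L3. (F1 has_derivative L1) (at p) \<and>
   (F2 has_derivative L2) (at p) \<and> (F3 has_derivative L3) (at p) \<and>
   L1 (1,0,0) + L2 (0,1,0) + L3 (0,0,1) = g p"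
 shows "flux_defect F1 F2 F3 g a1 b1 a2 b2 a3 b3 = 0"
proof (rule ccontr)
 let ?D = "flux_defect F1 F2 F3 g"
 let ?Q = "cbox (a1,a2,a3) (b1,b2,b3)"
 assume nz: "?D a1 b1 a2 b2 a3 b3 ~= 0"
 define e0 where "e0 = \<bar>?D a1 b1 a2 b2 a3 b3\<bar>"
 have e0: "e0 > 0" using nz unfolding e0_def by simp
 define good where "good n s = (case s of (x1,y1,x2,y2,x3,y3) =>
  a1 <= x1 \<and> y1 <= b1 \<and> y1 - x1 = (b1-a1)/2^n \<and>
  a2 <= x2 \<and> y2 <= b2 \<and> y2 - x2 = (b2-a2)/2^n \<and>
  a3 <= x3 \<and> y3 <= b3 \<and> y3 - x3 = (b3-a3)/2^n \<and> \<bar>?D x1 y1 x2 y2 x3 y3\<bar> \<ge> e0/8^n)" for n :: nat and s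
 define nest where "nest s t = (case s of (x1,y1,x2,y2,x3,y3) => case t of (u1,w1,u2,w2,u3,w3) =>
  x1 <= u1 \<and> w1 <= y1 \<and> x2 <= u2 \<and> w2 <= y2 \<and> x3 <= u3 \<and> w3 <= y3)" for s t :: "real\<times>real\<times>real\<times>real\<times>real\<times>real"
 have "\<exists>f. \<forall>n. good n (f n) \<and> nest (f n) (f (Suc n))"
 proof (rule dependent_nat_choice)
  show "\<exists>s. good 0 s" by (rule exI[of _ "(a1,b1,a2,b2,a3,b3)"]) (simp add: good_def e0_def)
 next
  fix s n assume g: "good n s"
  obtain x1 y1 x2 y2 x3 y3 where s: "s = (x1,y1,x2,y2,x3,y3)" by (cases s)
  have G: "a1 <= x1" "y1 <= b1" "y1 - x1 = (b1-a1)/2^n" "a2 <= x2" "y2 <= b2" "y2 - x2 = (b2-a2)/2^n"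
   "a3 <= x3" "y3 <= b3" "y3 - x3 = (b3-a3)/2^n" "\<bar>?D x1 y1 x2 y2 x3 y3\<bar> \<ge> e0/8^n" using g unfolding good_def s by auto
  have le: "x1 <= y1" "x2 <= y2" "x3 <= y3"
  proof -
   have "y1 - x1 \<ge> 0" "y2 - x2 \<ge> 0" "y3 - x3 \<ge> 0" unfolding G using lt by auto
   then show "x1 <= y1" "x2 <= y2" "x3 <= y3" by auto
  qed
  have sub: "cbox (x1,x2,x3) (y1,y2,y3) \<subseteq> ?Q" using G by (auto simp: cbox_Pair_eq)
  obtain u1 w1 u2 w2 u3 w3 where U: "x1 <= u1" "w1 <= y1" "w1 - u1 = (y1 - x1)/2"
   "x2 <= u2" "w2 <= y2" "w2 - u2 = (y2 - x2)/2" "x3 <= u3" "w3 <= y3" "w3 - u3 = (y3 - x3)/2"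
   "\<bar>?D u1 w1 u2 w2 u3 w3\<bar> \<ge> (e0/8^n)/8" by (rule flux_defect_halve[OF c[THEN continuous_on_subset, OF sub] le G(10)])
  show "\<exists>t. good (Suc n) t \<and> nest s t" by (rule exI[of _ "(u1,w1,u2,w2,u3,w3)"])
    (use U G in \<open>auto simp: good_def nest_def s field_simps\<close>)
 qed
 then obtain f where f: "!!n. good n (f n)" "!!n. nest (f n) (f (Suc n))" by blast
 define x1 where "x1 n = fst (f n)" for n
 define y1 where "y1 n = fst (snd (f n))" for n
 define x2 where "x2 n = fst (snd (snd (f n)))" for n
 define y2 where "y2 n = fst (snd (snd (snd (f n))))" for n
 define x3 where "x3 n = fst (snd (snd (snd (snd (f n)))))" for n
 define y3 where "y3 n = snd (snd (snd (snd (snd (f n)))))" for n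
 have G: "a1 <= x1 n" "y1 n <= b1" "y1 n - x1 n = (b1-a1)/2^n" "a2 <= x2 n" "y2 n <= b2" "y2 n - x2 n = (b2-a2)/2^n"
   "a3 <= x3 n" "y3 n <= b3" "y3 n - x3 n = (b3-a3)/2^n" "\<bar>?D (x1 n) (y1 n) (x2 n) (y2 n) (x3 n) (y3 n)\<bar> \<ge> e0/8^n" for n
  using f(1)[of n] unfolding good_def x1_def y1_def x2_def y2_def x3_def y3_def by (auto simp: split_beta)
 have N: "x1 n <= x1 (Suc n)" "y1 (Suc n) <= y1 n" "x2 n <= x2 (Suc n)" "y2 (Suc n) <= y2 n" "x3 n <= x3 (Suc n)" "y3 (Suc n) <= y3 n" for n
  using f(2)[of n] unfolding nest_def x1_def y1_def x2_def y2_def x3_def y3_def by (auto simp: split_beta)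
 have pt: "\<exists>l. \<forall>n. u n <= l \<and> l <= w n" if "!!n. u n <= u (Suc n)" "!!n. w (Suc n) <= w n" "!!n. w n - u n = r/2^n" "r > 0" for u w :: "nat => real" and r
 proof -
  have "(%n. u n - w n) \<longlonglongrightarrow> 0"
  proof -
   have eq: "(%n. u n - w n) = (%n. - r*(1/2)^n)"
   proof
    fix n have "u n - w n = - (r/2^n)" using that(3)[of n] by simp
    then show "u n - w n = - r*(1/2)^n" by (simp add: power_one_over field_simps)
   qed
   have "(%n. - r*(1/2)^n) \<longlonglongrightarrow> - r*0" by (intro tendsto_intros LIMSEQ_power_zero) simp
   then show ?thesis unfolding eq by simp
  qed
  moreover have "\<forall>n. u n <= w n" using that(3,4) by (metis diff_ge_0_iff_ge divide_nonneg_pos less_imp_le zero_less_numeral zero_less_power)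
  ultimately show ?thesis using nested_sequence_unique[of u w] that(1,2) by blast
 qed
 obtain p1 where p1: "!!n. x1 n <= p1" "!!n. p1 <= y1 n" using pt[OF N(1,2) G(3)] lt by auto
 obtain p2 where p2: "!!n. x2 n <= p2" "!!n. p2 <= y2 n" using pt[OF N(3,4) G(6)] lt by auto
 obtain p3 where p3: "!!n. x3 n <= p3" "!!n. p3 <= y3 n" using pt[OF N(5,6) G(9)] lt by auto
 have pQ: "(p1,p2,p3) \<in> ?Q" using p1[of 0] p2[of 0] p3[of 0] G(1,2,4,5,7,8)[of 0] by (auto simp: cbox_Pair_eq)
 obtain L1 L2 L3 where L: "(F1 has_derivative L1) (at (p1,p2,p3))" "(F2 has_derivative L2) (at (p1,p2,p3))"
  "(F3 has_derivative L3) (at (p1,p2,p3))" "L1 (1,0,0) + L2 (0,1,0) + L3 (0,0,1) = g (p1,p2,p3)" using d[OF pQ] by blast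
 have gc: "continuous (at (p1,p2,p3) within ?Q) g" using c(4) pQ by (simp add: continuous_on_eq_continuous_within)
 define R where "R = (b1-a1)+(b2-a2)+(b3-a3)"
 define S where "S = (b2-a2)*(b3-a3) + (b1-a1)*(b3-a3) + (b1-a1)*(b2-a2)"
 define V where "V = (b1-a1)*(b2-a2)*(b3-a3)"
 have pos: "R > 0" "S > 0" "V > 0" using lt unfolding R_def S_def V_def by (auto intro!: add_pos_pos mult_pos_pos)
 define K where "K = 2*R*S + V"
 have K: "K > 0" using pos unfolding K_def by (intro add_pos_pos mult_pos_pos) auto
 \<comment> \<open>\<open>K\<close> is the local bound for the initial box without its factor e. It
   is homogeneous of degree 3 in the edges, so n bisections turn it into \<open>K/8^n\<close>, and
   this e allows only half of the required defect.\<close>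
 define e where "e = e0/(2*K)"
 have e: "e > 0" using e0 K unfolding e_def by simp
 obtain dl where dl: "dl > 0" and loc: "!!a1 b1 a2 b2 a3 b3. [|a1 <= p1; p1 <= b1; a2 <= p2; p2 <= b2; a3 <= p3; p3 <= b3;
  b1 - a1 < dl; b2 - a2 < dl; b3 - a3 < dl; cbox (a1,a2,a3) (b1,b2,b3) \<subseteq> ?Q;
  continuous_on (cbox (a1,a2,a3) (b1,b2,b3)) F1; continuous_on (cbox (a1,a2,a3) (b1,b2,b3)) F2;
  continuous_on (cbox (a1,a2,a3) (b1,b2,b3)) F3; continuous_on (cbox (a1,a2,a3) (b1,b2,b3)) g|] ==>
  \<bar>?D a1 b1 a2 b2 a3 b3\<bar> <= e*(2*((b1-a1)+(b2-a2)+(b3-a3)) *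
    ((b2-a2)*(b3-a3) + (b1-a1)*(b3-a3) + (b1-a1)*(b2-a2)) + (b1-a1)*(b2-a2)*(b3-a3))" using flux_defect_local[OF L gc e] by metis
 obtain n where n: "R/2^n < dl"
 proof -
  have "(%n. R*(1/2)^n) \<longlonglongrightarrow> R*0" by (intro tendsto_intros LIMSEQ_power_zero) simp
  then have "eventually (%n. R*(1/2)^n < dl) sequentially" using dl by (simp add: order_tendstoD)
  then obtain n where "R*(1/2)^n < dl" by (auto simp: eventually_sequentially)
  then show ?thesis using that by (simp add: power_one_over field_simps)
 qed
 have sml: "(b1-a1)/2^n <= R/2^n" "(b2-a2)/2^n <= R/2^n" "(b3-a3)/2^n <= R/2^n" using lt unfolding R_def by (auto intro!: divide_right_mono)
 have sub: "cbox (x1 n,x2 n,x3 n) (y1 n,y2 n,y3 n) \<subseteq> ?Q" using G[of n] by (auto simp: cbox_Pair_eq)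
 have "\<bar>?D (x1 n) (y1 n) (x2 n) (y2 n) (x3 n) (y3 n)\<bar> <= e*(2*((b1-a1)/2^n+(b2-a2)/2^n+(b3-a3)/2^n) *
  ((b2-a2)/2^n*((b3-a3)/2^n) + (b1-a1)/2^n*((b3-a3)/2^n) + (b1-a1)/2^n*((b2-a2)/2^n)) + (b1-a1)/2^n*((b2-a2)/2^n)*((b3-a3)/2^n))" unfolding G(3,6,9)[of n, symmetric]
  by (rule loc[OF p1 p2 p3 _ _ _ sub c[THEN continuous_on_subset, OF sub]])
   (use sml n G(3,6,9)[of n] in linarith)+
 also have "\<dots> = e*K/8^n"
 proof -
  have 8: "(8::real)^n = 2^n*2^n*2^n" by (simp flip: power_mult_distrib)
  show ?thesis unfolding K_def R_def S_def V_def 8 by (simp add: field_simps)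
 qed
 also have "\<dots> = (e0/8^n)/2" using K unfolding e_def by (simp add: field_simps)
 finally have "e0/8^n <= (e0/8^n)/2" by (rule order_trans[OF G(10)])
 moreover have "q <= q/2 ==> q <= 0" for q :: real by simp
 ultimately have "e0/8^n <= 0" by blast
 then show False using e0 by (metis divide_pos_pos not_le zero_less_numeral zero_less_power)
qed

section \<open>Lattice and dual lattice\<close>

lemma inner_2: "(x::real^2) \<bullet> y = x$1*y$1 + x$2*y$2"
 by (simp add: inner_vec_def sum_2)

lemma vec2_eq_iff: "(x::real^2) = y \<longleftrightarrow> x$1 = y$1 \<and> x$2 = y$2"
 by (simp add: vec_eq_iff forall_2)

definition lat_pt :: "real^2 => real^2 => real \<times> real => real^2" where
 "lat_pt v1 v2 t = (2*pi) *\<^sub>R (fst t *\<^sub>R v1 + snd t *\<^sub>R v2)"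

locale lattice2 =
 fixes v1 v2 :: "real^2"
 assumes indep: "\<forall>a b :: real. a *\<^sub>R v1 + b *\<^sub>R v2 = 0 --> a = 0 \<and> b = 0"
begin

abbreviation pt :: "real \<times> real => real^2" where "pt \<equiv> lat_pt v1 v2"
abbreviation Lam :: "(real^2) set" where "Lam \<equiv> dual_lat v1 v2"

text \<open>\<open>w1\<close> and \<open>w2\<close> are the basis dual to \<open>v1\<close>,
  \<open>v2\<close>, by Cramer's rule with determinant \<open>dt\<close>. They generate the dual
  lattice and give the coordinates on the torus.\<close>

definition dt :: real where "dt = v1$1 * v2$2 - v1$2 * v2$1"
definition w1 :: "real^2" where "w1 = vector [v2$2/dt, - v2$1/dt]"
definition w2 :: "real^2" where "w2 = vector [- v1$2/dt, v1$1/dt]"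

lemma dt_nz: "dt ~= 0"
proof
 assume d: "dt = 0"
 have "v2$1 *\<^sub>R v1 + (- v1$1) *\<^sub>R v2 = 0" "v2$2 *\<^sub>R v1 + (- v1$2) *\<^sub>R v2 = 0" using d by (auto simp: vec2_eq_iff dt_def algebra_simps)
 then have "v1$1 = 0" "v1$2 = 0" using indep by (metis neg_equal_0_iff_equal)+
 then have "1 *\<^sub>R v1 + 0 *\<^sub>R v2 = 0" by (auto simp: vec2_eq_iff)
 then show False using indep by (metis zero_neq_one)
qed

lemma w_nth: "w1$1 = v2$2/dt" "w1$2 = - v2$1/dt" "w2$1 = - v1$2/dt" "w2$2 = v1$1/dt"
 by (simp_all add: w1_def w2_def)

lemma w_v: "w1 \<bullet> v1 = 1" "w1 \<bullet> v2 = 0" "w2 \<bullet> v1 = 0" "w2 \<bullet> v2 = 1"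
proof -
 have e: "v1$1 * v2$2 - v1$2 * v2$1 = dt" by (simp add: dt_def)
 show "w1 \<bullet> v1 = 1" "w1 \<bullet> v2 = 0" "w2 \<bullet> v1 = 0" "w2 \<bullet> v2 = 1" using dt_nz e by (auto simp: inner_2 w_nth field_simps)
qed

lemma w_v': "v1 \<bullet> w1 = 1" "v2 \<bullet> w1 = 0" "v1 \<bullet> w2 = 0" "v2 \<bullet> w2 = 1"
 using w_v by (simp_all add: inner_commute)

lemma dt_w: "dt*(x \<bullet> w1) = x$1 * v2$2 - x$2 * v2$1" "dt*(x \<bullet> w2) = x$2 * v1$1 - x$1 * v1$2"
 using dt_nz by (simp_all add: inner_2 w_nth field_simps)

lemma v_expand: "x = (x \<bullet> w1) *\<^sub>R v1 + (x \<bullet> w2) *\<^sub>R v2"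
proof -
 have "dt*x$i = dt*((x \<bullet> w1) * v1$i + (x \<bullet> w2) * v2$i)" if "i = 1 \<or> i = 2" for i
 proof -
  have "dt*((x \<bullet> w1) * v1$i + (x \<bullet> w2) * v2$i) = (dt*(x \<bullet> w1)) * v1$i + (dt*(x \<bullet> w2)) * v2$i" by (simp add: algebra_simps)
  also have "\<dots> = dt*x$i" unfolding dt_w using that by (auto simp: dt_def algebra_simps)
  finally show ?thesis by (rule sym)
 qed
 then show ?thesis using dt_nz by (auto simp: vec2_eq_iff)
qed

lemma w_expand: "k = (k \<bullet> v1) *\<^sub>R w1 + (k \<bullet> v2) *\<^sub>R w2"
proof -
 have "dt*k$i = dt*((k \<bullet> v1)*w1$i + (k \<bullet> v2)*w2$i)" if "i = 1 \<or> i = 2" for i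
  using that dt_nz by (auto simp: w_nth distrib_left) (auto simp: inner_2 dt_def algebra_simps)
 then show ?thesis using dt_nz by (auto simp: vec2_eq_iff)
qed

lemma dual_lat_eq: "Lam = {of_int m *\<^sub>R w1 + of_int n *\<^sub>R w2 | m n :: int. True}"
proof -
 let ?A = "transpose (latM v1 v2)"
 have det: "det ?A ~= 0" using dt_nz by (simp add: det_2 transpose_def latM_def dt_def algebra_simps)
 have "invertible ?A" using det invertible_det_nz by blast
 then have inv: "matrix_inv ?A ** ?A = mat 1" unfolding invertible_def matrix_inv_def by (rule someI2_ex) simp
 have "?A *v (of_int m *\<^sub>R w1 + of_int n *\<^sub>R w2) = vector [of_int m, of_int n]" for m n :: int
 proof -
  have "?A *v k = vector [k \<bullet> v1, k \<bullet> v2]" for k by (simp add: vec2_eq_iff matrix_vector_mult_def sum_2 transpose_def latM_def inner_2 algebra_simps)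
  then show ?thesis by (simp add: inner_add_left w_v)
 qed
 then have "matrix_inv ?A *v vector [of_int m, of_int n] = of_int m *\<^sub>R w1 + of_int n *\<^sub>R w2" for m n :: int
  by (metis inv matrix_vector_mul_assoc matrix_vector_mul_lid)
 then show ?thesis unfolding dual_lat_def by auto
qed

lemma dual_lat_iff: "k \<in> Lam \<longleftrightarrow> k \<bullet> v1 \<in> \<int> \<and> k \<bullet> v2 \<in> \<int>"
proof
 assume "k \<in> Lam"
 then obtain m n :: int where "k = of_int m *\<^sub>R w1 + of_int n *\<^sub>R w2" unfolding dual_lat_eq by auto
 then show "k \<bullet> v1 \<in> \<int> \<and> k \<bullet> v2 \<in> \<int>" by (simp add: inner_add_left w_v)
next
 assume "k \<bullet> v1 \<in> \<int> \<and> k \<bullet> v2 \<in> \<int>"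
 then obtain m n :: int where "k \<bullet> v1 = of_int m" "k \<bullet> v2 = of_int n" by (auto elim!: Ints_cases)
 then show "k \<in> Lam" using w_expand[of k] unfolding dual_lat_eq by auto
qed

lemma Lam_0 [simp]: "0 \<in> Lam" by (simp add: dual_lat_iff)
lemma Lam_uminus [simp]: "- k \<in> Lam \<longleftrightarrow> k \<in> Lam" by (simp add: dual_lat_iff)
lemma Lam_add: "k \<in> Lam ==> l \<in> Lam ==> k + l \<in> Lam" by (simp add: dual_lat_iff inner_add_left)
lemma Lam_diff: "k \<in> Lam ==> l \<in> Lam ==> k - l \<in> Lam" by (simp add: dual_lat_iff inner_diff_left)
lemma w_Lam: "w1 \<in> Lam" "w2 \<in> Lam" by (simp_all add: dual_lat_iff w_v)

lemma lat_iff: "x \<in> lat v1 v2 \<longleftrightarrow> x \<bullet> w1/(2*pi) \<in> \<int> \<and> x \<bullet> w2/(2*pi) \<in> \<int>"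
proof
 assume "x \<in> lat v1 v2"
 then show "x \<bullet> w1/(2*pi) \<in> \<int> \<and> x \<bullet> w2/(2*pi) \<in> \<int>" using w_v by (auto simp: lat_def inner_add_left w_v')
next
 assume "x \<bullet> w1/(2*pi) \<in> \<int> \<and> x \<bullet> w2/(2*pi) \<in> \<int>"
 then obtain m n :: int where "x \<bullet> w1/(2*pi) = of_int m" "x \<bullet> w2/(2*pi) = of_int n" by (auto elim!: Ints_cases)
 then have e: "x \<bullet> w1 = 2*pi* of_int m" "x \<bullet> w2 = 2*pi * of_int n" by (auto simp: field_simps)
 have "x = (2*pi) *\<^sub>R (of_int m *\<^sub>R v1 + of_int n *\<^sub>R v2)" using v_expand[of x] unfolding e by (simp add: scaleR_add_right)
 then show "x \<in> lat v1 v2" unfolding lat_def by blast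
qed

lemma pt_w: "pt t \<bullet> w1 = 2*pi*fst t" "pt t \<bullet> w2 = 2*pi * snd t"
 by (simp_all add: lat_pt_def inner_add_left w_v')

lemma pt_surj: "x = pt (x \<bullet> w1/(2*pi), x \<bullet> w2/(2*pi))"
 using v_expand[of x] by (simp add: lat_pt_def scaleR_add_right)

lemma periodic_lat: "lat_periodic v1 v2 f ==> \<gamma> \<in> lat v1 v2 ==> f (x + \<gamma>) = f x"
 by (simp add: lat_periodic_def)

lemma pt_shift: "pt (1 + a, b) - pt (a, b) \<in> lat v1 v2" "pt (a, 1 + b) - pt (a, b) \<in> lat v1 v2"
 by (simp_all add: lat_iff inner_diff_left pt_w field_simps)

lemma reduce_cell: obtains t where "t \<in> cbox (0,0) (1,1)" "x - pt t \<in> lat v1 v2"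
proof
 let ?t = "(frac (x \<bullet> w1/(2*pi)), frac (x \<bullet> w2/(2*pi)))"
 show "?t \<in> cbox (0,0) (1,1)" by (auto simp: cbox_Pair_eq frac_lt_1 less_imp_le)
 show "x - pt ?t \<in> lat v1 v2" by (simp add: lat_iff inner_diff_left pt_w frac_def diff_divide_distrib)
qed

lemma periodic_reduce:
 assumes "lat_periodic v1 v2 f"
 obtains t where "t \<in> cbox (0,0) (1,1)" "f x = f (pt t)"
proof -
 obtain t where t: "t \<in> cbox (0,0) (1,1)" "x - pt t \<in> lat v1 v2" by (rule reduce_cell)
 have "f (pt t + (x - pt t)) = f (pt t)" by (rule periodic_lat[OF assms t(2)])
 then show ?thesis using that[OF t(1)] by simp
qed

lemma cont_pt [continuous_intros]: "continuous_on S f ==> continuous_on S (%x. pt (f x))"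
 unfolding lat_pt_def by (intro continuous_intros)

text \<open>The cell is parametrised by the unit square, so this is the mean value over the torus,
  with neither a Jacobian nor a division by the area.\<close>

definition av :: "(real^2 => 'b::banach) => 'b" where
 "av f = integral (cbox (0,0) (1,1)) (%t. f (pt t))"

lemma av_integrable: "continuous_on UNIV (f :: real^2 => 'b::banach) ==> (%t. f (pt t)) integrable_on cbox (0,0) (1,1)"
 by (rule integrable_continuous, rule continuous_on_compose2[of UNIV f]) (auto intro!: continuous_intros)

lemma av_add: "continuous_on UNIV f ==> continuous_on UNIV g ==> av (%x. f x + g x) = av f + av g"
 unfolding av_def by (intro integral_add av_integrable)
lemma av_diff: "continuous_on UNIV f ==> continuous_on UNIV g ==> av (%x. f x - g x) = av f - av g"
 unfolding av_def by (intro integral_diff av_integrable)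
lemma av_minus: "av (%x. - f x) = - av f"
 unfolding av_def by (rule integral_neg)
lemma av_cmul: "av (%x. c*f x) = (c::real)*av f"
 unfolding av_def by (rule integral_mult_right)
lemma av_cmul_complex: "av (%x. c*f x) = (c::complex)*av f"
 unfolding av_def by (rule integral_mult_right)
lemma av_linear: "continuous_on UNIV f ==> bounded_linear T ==> av (%x. T (f x)) = T (av f)"
 unfolding av_def using integral_linear[OF av_integrable, of f T] by (simp add: o_def)
lemma av_const: "av (%x. c) = (c::'a::euclidean_space)"
 unfolding av_def by (simp add: content_Pair)
lemma av_sum: "finite K ==> (!!k. k \<in> K ==> continuous_on UNIV (f k)) ==> av (%x. \<Sum>k\<in>K. f k x) = (\<Sum>k\<in>K. av (f k))"
 unfolding av_def by (intro integral_sum av_integrable)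
lemma av_mono:
 fixes f g :: "real^2 => real"
 shows "continuous_on UNIV f ==> continuous_on UNIV g ==> (!!x. f x <= g x) ==> av f <= av g"
 unfolding av_def by (intro integral_le av_integrable)
lemma av_norm_le:
 fixes f :: "real^2 => 'a::euclidean_space"
 assumes "continuous_on UNIV f" "!!x. norm (f x) <= B"
 shows "norm (av f) <= B"
proof -
 have "norm (av f) <= integral (cbox (0,0) (1,1::real)) (%t::real\<times>real. B)"
  unfolding av_def by (rule integral_norm_bound_integral) (use assms av_integrable in auto)
 then show ?thesis by (simp add: content_Pair)
qed
lemma av_nonneg: "continuous_on UNIV f ==> (!!x. 0 <= f x) ==> 0 <= av (f :: real^2 => real)"
 using av_mono[of "%_. 0" f] by (simp add: av_const)

lemma av_sq_eq_0:
 fixes f :: "real^2 => real"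
 assumes c: "continuous_on UNIV f" and p: "lat_periodic v1 v2 f" and z: "av (%x. (f x)^2) = 0"
 shows "f x = 0"
proof -
 have cc: "continuous_on (cbox (0,0) (1,1)) (%t. (f (pt t))^2)" by (intro continuous_intros, rule continuous_on_compose2[OF c]) (auto intro!: continuous_intros)
 have "(f (pt t))^2 = 0" if "t \<in> cbox (0,0) (1,1)" for t
 proof (rule has_integral_0_cbox_imp_0[OF cc _ _ _ that])
  show "((%t. (f (pt t))^2) has_integral 0) (cbox (0,0) (1,1))" using z integrable_integral[OF integrable_continuous[OF cc]] unfolding av_def by simp
  show "box (0::real,0::real) (1,1) ~= {}" by (simp add: box_ne_empty Basis_prod_def)
 qed auto
 moreover obtain t where "t \<in> cbox (0,0) (1,1)" "f x = f (pt t)" by (rule periodic_reduce[OF p])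
 ultimately show ?thesis by simp
qed

end

section \<open>Divergence theorem on the periodic slab\<close>

context lattice2 begin

text \<open>Mean over the torus and integral over the depth. The height is the first coordinate of
  the box, so the first pair of faces in \<open>flux_defect\<close> is top and bottom.\<close>

definition av3 :: "real => ((real^2) \<times> real => real) => real" where
 "av3 H g = integral (cbox (-H,0,0) (0,1,1)) (%q. g (pt (snd q), fst q))"

lemma w_v_dual: "w1$1 * v1$1 + w2$1 * v2$1 = 1" "w1$2 * v1$2 + w2$2 * v2$2 = 1"
 "w1$1 * v1$2 + w2$1 * v2$2 = 0" "w1$2 * v1$1 + w2$2 * v2$1 = 0" using dt_nz by (auto simp: w_nth field_simps) (auto simp: dt_def algebra_simps)

text \<open>The box coordinates run along \<open>v1\<close> and \<open>v2\<close>; duality with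
  \<open>w1\<close>, \<open>w2\<close> makes the divergence in these oblique coordinates equal to
  the Cartesian one.\<close>

lemma oblique_trace:
 "w1 \<bullet> (v1$1 *\<^sub>R A + v1$2 *\<^sub>R B) + w2 \<bullet> (v2$1 *\<^sub>R A + v2$2 *\<^sub>R B) = A$1 + B$2"
proof -
 have "w1 \<bullet> (v1$1 *\<^sub>R A + v1$2 *\<^sub>R B) + w2 \<bullet> (v2$1 *\<^sub>R A + v2$2 *\<^sub>R B) =
  (w1$1 * v1$1 + w2$1 * v2$1)*A$1 + (w1$2 * v1$2 + w2$2 * v2$2)*B$2
  + (w1$1 * v1$2 + w2$1 * v2$2)*B$1 + (w1$2 * v1$1 + w2$2 * v2$1)*A$2" by (simp add: inner_2 algebra_simps)
 then show ?thesis unfolding w_v_dual by simp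
qed

lemma cont_cell:
 fixes F :: "(real^2) \<times> real => 'b::topological_space"
 assumes "continuous_on (UNIV \<times> {-H..0}) F" "-H <= p" "q <= 0"
 shows "continuous_on (cbox (p,0,0) (q,1,1)) (%q. F (pt (snd q), fst q))"
 by (rule continuous_on_compose2[OF assms(1)]) (use assms in \<open>auto simp: cbox_Pair_eq intro!: continuous_intros\<close>)

lemma cont_height_av:
 fixes F :: "(real^2) \<times> real => real"
 assumes "continuous_on (UNIV \<times> {-H..0}) F"
 shows "continuous_on {-H..0} (%z. av (%x. F (x,z)))" unfolding av_def
proof (rule integral_continuous_on_param)
 show "continuous_on ({- H..0} \<times> cbox (0, 0) (1, 1)) (%(x, y). F (pt y, x))" unfolding split_beta
  by (rule continuous_on_compose2[OF assms]) (auto intro!: continuous_intros)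
qed

lemma av3_slices:
 assumes "continuous_on (UNIV \<times> {-H..0}) g" "0 <= H"
 shows "av3 H g = integral {-H..0} (%z. av (%x. g (x,z)))" using integral_prod_continuous[OF cont_cell[OF assms(1), of "-H" 0]] by (simp add: av3_def av_def)

text \<open>The field is only assumed to be pointwise differentiable: harmonic functions are given here
 with a possibly discontinuous second derivative, which is why the divergence theorem is obtained
 from a Goursat-type subdivision argument.\<close>

lemma torus_divergence:
 fixes Fx :: "(real^2) \<times> real => real^2" and Fz g :: "(real^2) \<times> real => real"
 assumes H: "H > 0"
  and c: "continuous_on (UNIV \<times> {-H..0}) Fx" "continuous_on (UNIV \<times> {-H..0}) Fz" "continuous_on (UNIV \<times> {-H..0}) g"
  and per: "!!x \<gamma> z. \<gamma> \<in> lat v1 v2 ==> -H < z ==> z < 0 ==> Fx (x + \<gamma>, z) = Fx (x, z)"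
  and d: "!!x z. -H < z ==> z < 0 ==> \<exists>L M. (Fx has_derivative L) (at (x,z)) \<and> (Fz has_derivative M) (at (x,z)) \<and>
   L (axis 1 1, 0)$1 + L (axis 2 1, 0)$2 + M (0, 1) = g (x,z)"
 shows "av (%x. Fz (x,0)) - av (%x. Fz (x,-H)) = av3 H g"
proof -
 let ?P = "%q::real\<times>real\<times>real. (pt (snd q), fst q)"
 define h where "h z = av (%x. Fz (x,z))" for z
 define h2 where "h2 z = av (%x. g (x,z))" for z
 have hc: "continuous_on {-H..0} h" "continuous_on {-H..0} h2" unfolding h_def h2_def using cont_height_av c by blast+
 have dP: "(?P has_derivative ?P) (at q)" for q unfolding lat_pt_def by (auto intro!: derivative_eq_intros)
 \<comment> \<open>Differentiability is assumed only in the open slab, so the box argument runs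
   between two interior levels. The lateral faces cancel because corresponding points differ by a
   lattice vector.\<close>
 have step: "h q - h p = integral {p..q} h2" if pq: "-H < p" "p < q" "q < 0" for p q
 proof -
  let ?F1 = "%q. Fz (?P q)" and ?F2 = "%q. w1 \<bullet> Fx (?P q)/(2*pi)" and ?F3 = "%q. w2 \<bullet> Fx (?P q)/(2*pi)"
  let ?g = "%q. g (?P q)"
  have cc: "continuous_on (cbox (p,0,0) (q,1,1)) ?F1" "continuous_on (cbox (p,0,0) (q,1,1)) ?F2"
   "continuous_on (cbox (p,0,0) (q,1,1)) ?F3" "continuous_on (cbox (p,0,0) (q,1,1)) ?g" using cont_cell[OF c(1), of p q] cont_cell[OF c(2), of p q] cont_cell[OF c(3), of p q] pq
   by (auto intro!: continuous_intros)
  have "flux_defect ?F1 ?F2 ?F3 ?g p q 0 1 0 1 = 0"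
  proof (rule flux_defect_eq_0[OF cc])
   fix r assume r: "r \<in> cbox (p,0,0) (q,1::real,1::real)"
   then have z: "-H < fst r" "fst r < 0" using pq by (auto simp: cbox_Pair_eq)
   obtain L M where LM: "(Fx has_derivative L) (at (?P r))" "(Fz has_derivative M) (at (?P r))"
    "L (axis 1 1, 0)$1 + L (axis 2 1, 0)$2 + M (0, 1) = g (?P r)" using d[OF z] by blast
   let ?L1 = "%v. M (?P v)" and ?L2 = "%v. w1 \<bullet> L (?P v)/(2*pi)" and ?L3 = "%v. w2 \<bullet> L (?P v)/(2*pi)"
   have D1: "(?F1 has_derivative ?L1) (at r)" by (rule has_derivative_compose[OF dP LM(2)])
   have DF: "((%q. Fx (?P q)) has_derivative (%v. L (?P v))) (at r)" by (rule has_derivative_compose[OF dP LM(1)])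
   have D2: "(?F2 has_derivative ?L2) (at r)" "(?F3 has_derivative ?L3) (at r)" by (auto intro!: derivative_eq_intros DF)
   have lin: "linear L" using LM(1) has_derivative_linear by blast
   have Lv: "L ((2*pi) *\<^sub>R v, 0) = (2*pi) *\<^sub>R (v$1 *\<^sub>R L (axis 1 1, 0) + v$2 *\<^sub>R L (axis 2 1, 0))" for v
   proof -
    have "((2*pi) *\<^sub>R v, 0::real) = (2*pi) *\<^sub>R (v$1 *\<^sub>R (axis 1 1, 0) + v$2 *\<^sub>R (axis 2 1, 0))" by (simp add: vec2_eq_iff axis_def)
    then show ?thesis by (simp only: linear_add[OF lin] linear_scale[OF lin])
   qed
   have "?L1 (1,0,0) + ?L2 (0,1,0) + ?L3 (0,0,1) = ?g r"
   proof -
    have "?L1 (1,0,0) = M (0,1)" by (simp add: lat_pt_def zero_prod_def[symmetric])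
    moreover have "?L2 (0,1,0) = w1 \<bullet> (v1$1 *\<^sub>R L (axis 1 1, 0) + v1$2 *\<^sub>R L (axis 2 1, 0))" by (simp add: lat_pt_def Lv)
    moreover have "?L3 (0,0,1) = w2 \<bullet> (v2$1 *\<^sub>R L (axis 1 1, 0) + v2$2 *\<^sub>R L (axis 2 1, 0))" by (simp add: lat_pt_def Lv)
    ultimately show ?thesis using oblique_trace LM(3) by (simp add: algebra_simps)
   qed
   then show "\<exists>L1 L2 L3. (?F1 has_derivative L1) (at r) \<and> (?F2 has_derivative L2) (at r) \<and>
    (?F3 has_derivative L3) (at r) \<and> L1 (1,0,0) + L2 (0,1,0) + L3 (0,0,1) = ?g r" using D1 D2 by blast
  qed (use pq in auto)
  moreover have "integral (cbox (p,0) (q,1::real)) (%(x,z). ?F2 (x,1,z) - ?F2 (x,0,z)) = integral (cbox (p,0) (q,1::real)) (%_. 0)"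
  proof (rule integral_cong)
   fix y assume "y \<in> cbox (p,0) (q,1::real)"
   then have z: "-H < fst y" "fst y < 0" using pq by (auto simp: cbox_Pair_eq)
   have "Fx (pt (0, snd y) + (pt (1 + 0, snd y) - pt (0, snd y)), fst y) = Fx (pt (0, snd y), fst y)" by (rule per[OF pt_shift(1) z])
   then show "(case y of (x,z) => ?F2 (x,1,z) - ?F2 (x,0,z)) = 0" by (simp add: split_beta)
  qed
  moreover have "integral (cbox (p,0) (q,1::real)) (%(x,z). ?F3 (x,z,1) - ?F3 (x,z,0)) = integral (cbox (p,0) (q,1::real)) (%_. 0)"
  proof (rule integral_cong)
   fix y assume "y \<in> cbox (p,0) (q,1::real)"
   then have z: "-H < fst y" "fst y < 0" using pq by (auto simp: cbox_Pair_eq)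
   have "Fx (pt (snd y, 0) + (pt (snd y, 1 + 0) - pt (snd y, 0)), fst y) = Fx (pt (snd y, 0), fst y)" by (rule per[OF pt_shift(2) z])
   then show "(case y of (x,z) => ?F3 (x,z,1) - ?F3 (x,z,0)) = 0" by (simp add: split_beta)
  qed
  ultimately have "integral (cbox (0,0) (1,1)) (%(y,z). ?F1 (q,y,z) - ?F1 (p,y,z)) = integral (cbox (p,0,0) (q,1,1)) ?g" unfolding flux_defect_def by simp
  moreover have "integral (cbox (0,0) (1,1)) (%(y,z). ?F1 (q,y,z) - ?F1 (p,y,z)) = h q - h p" unfolding h_def av_def split_beta
  proof (subst integral_diff[symmetric])
   show "(%t. Fz (pt t, q)) integrable_on cbox (0,0) (1,1)" "(%t. Fz (pt t, p)) integrable_on cbox (0,0) (1,1)"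
    using pq by (auto intro!: integrable_continuous continuous_on_compose2[OF c(2)] continuous_intros)
  qed simp
  moreover have "integral (cbox (p,0,0) (q,1,1)) ?g = integral {p..q} h2" using integral_prod_continuous[OF cc(4)] unfolding h2_def av_def by simp
  ultimately show ?thesis by simp
 qed
 \<comment> \<open>By \<open>step\<close> this is constant between interior levels; continuity
   carries the identity to the two boundary levels.\<close>
 define K where "K z = h z - integral {-H..z} h2" for z
 have hi: "h2 integrable_on {-H..0}" using hc(2) by (rule integrable_continuous_real)
 have Kc: "continuous_on {-H..0} K" unfolding K_def using hc(1) indefinite_integral_continuous_1[OF hi] by (intro continuous_intros)
 have Kconst: "K q = K p" if pq: "-H < p" "p < q" "q < 0" for p q
 proof -
  have "h2 integrable_on {-H..q}" by (rule integrable_subinterval_real[OF hi]) (use pq in auto)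
  then have "integral {-H..p} h2 + integral {p..q} h2 = integral {-H..q} h2" using pq by (intro Henstock_Kurzweil_Integration.integral_combine) auto
  then show ?thesis using step[OF pq] unfolding K_def by simp
 qed
 have all: "K z = K (-H/2)" if "z \<in> {-H..0}" for z
 proof (rule continuous_constant_on_closure[of "{-H<..<0}" K])
  show "continuous_on (closure {-H<..<0}) K" using Kc H by simp
  show "z \<in> closure {-H<..<0}" using H that by simp
  fix x assume "x \<in> {-H<..<0}"
  then show "K x = K (-H/2)" using Kconst[of x "-H/2"] Kconst[of "-H/2" x] H by (cases x "-H/2" rule: linorder_cases) auto
 qed
 have "K 0 = K (-H)" using all[of 0] all[of "-H"] H by simp
 then have "h 0 - h (-H) = integral {-H..0} h2" unfolding K_def using H by simp
 then show ?thesis unfolding h_def h2_def using av3_slices[OF c(3)] H by simp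
qed

section \<open>Orthogonality of characters, and Lebesgue integrals over the fundamental domain as
  mean values\<close>

lemma integral_cis: "m ~= 0 ==> integral {0..1} (%a. cis (2*pi * of_int m*a)) = 0"
proof -
 assume m: "m ~= 0"
 define F where "F a = cis (2*pi * of_int m*a)/(\<i> * of_real (2*pi * of_int m))" for a
 have "((%a. cis (2*pi * of_int m*a)) has_integral (F 1 - F 0)) {0..1}"
 proof (rule fundamental_theorem_of_calculus)
  fix x :: real
  show "(F has_vector_derivative cis (2*pi * of_int m*x)) (at x within {0..1})"
  proof -
   have "((%a. exp (\<i> * of_real (2*pi * of_int m) * of_real a)/(\<i> * of_real (2*pi * of_int m))) has_vector_derivative
    exp (\<i> * of_real (2*pi * of_int m) * of_real x)) (at x within {0..1})" by (rule has_vector_derivative_real_field) (use m in \<open>auto intro!: derivative_eq_intros\<close>)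
   then show ?thesis unfolding F_def cis_conv_exp by (simp add: mult.assoc)
  qed
 qed simp
 moreover have "F 1 = F 0" unfolding F_def by (simp add: cis_multiple_2pi[of "of_int m"])
 ultimately show ?thesis by (simp add: integral_unique)
qed

lemma av_cis:
 assumes "k \<in> Lam"
 shows "av (%x. cis (k \<bullet> x)) = (if k = 0 then 1 else 0)"
proof -
 obtain m n :: int where k: "k = of_int m *\<^sub>R w1 + of_int n *\<^sub>R w2" using assms unfolding dual_lat_eq by auto
 have e: "cis (k \<bullet> pt t) = cis (2*pi * of_int m*fst t) * cis (2*pi * of_int n * snd t)" for t
  unfolding cis_mult k by (simp add: inner_add_left pt_w[unfolded inner_commute[of "pt _"]] algebra_simps)
 have c: "continuous_on (cbox (0,0) (1,1)) (%t::real\<times>real. cis (2*pi * of_int m*fst t) * cis (2*pi * of_int n * snd t))" by (intro continuous_intros)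
 have "av (%x. cis (k \<bullet> x)) = integral {0..1} (%a. integral {0..1} (%b. cis (2*pi * of_int m*a) * cis (2*pi * of_int n*b)))"
  unfolding av_def e using integral_prod_continuous[OF c] by simp
 also have "\<dots> = integral {0..1} (%a. cis (2*pi * of_int m*a))*integral {0..1} (%b. cis (2*pi * of_int n*b))" by simp
 also have "\<dots> = (if k = 0 then 1 else 0)"
 proof (cases "m = 0 \<and> n = 0")
  case True then show ?thesis by (simp add: k)
 next
  case False
  have "k ~= 0"
  proof
   assume "k = 0"
   then have "k \<bullet> v1 = 0" "k \<bullet> v2 = 0" by auto
   then show False using False unfolding k by (simp add: inner_add_left w_v)
  qed
  then show ?thesis using False integral_cis by auto
 qed
 finally show ?thesis .
qed

end

text \<open>The linear change of variables used for the fundamental domain lives on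
  \<open>real^2\<close>, while \<open>av\<close> integrates over pairs; the coordinate map between
  the two preserves boxes and their measure.\<close>

lemma integral_cbox_vec2:
 fixes f :: "real^2 => 'b::real_normed_vector"
 assumes "f integrable_on cbox 0 1"
 shows "integral (cbox 0 1) f = integral (cbox (0,0) (1,1)) (%t. f (vector [fst t, snd t]))"
proof -
 let ?g = "%t::real\<times>real. vector [fst t, snd t] :: real^2" and ?h = "%x::real^2. (x$1, x$2)"
 have gh: "?g (?h x) = x" for x by (simp add: vec2_eq_iff)
 have hg: "?h (?g x) = x" for x by simp
 have hb: "?h ` cbox u v = cbox (?h u) (?h v)" for u v
 proof (intro set_eqI iffI)
  fix y assume "y \<in> cbox (?h u) (?h v)"
  then have "?g y \<in> cbox u v" by (auto simp: cbox_Pair_eq mem_box_cart forall_2)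
  then show "y \<in> ?h ` cbox u v" by (intro image_eqI[of _ _ "?g y"]) simp_all
 qed (auto simp: cbox_Pair_eq mem_box_cart)
 have gb: "?g ` cbox u v = cbox (?g u) (?g v)" for u v
 proof -
  have "?h ` cbox (?g u) (?g v) = cbox u v" unfolding hb hg ..
  then have "?g ` cbox u v = ?g ` ?h ` cbox (?g u) (?g v)" by simp
  then show ?thesis unfolding image_image gh by simp
 qed
 have cg: "continuous_on UNIV ?g" by (rule continuous_on_componentwise[THEN iffD2])
   (auto simp: Basis_vec_def inner_axis UNIV_2 intro!: continuous_intros)
 have "((%t. f (?g t)) has_integral (1/1) *\<^sub>R integral (cbox 0 1) f) (?h ` cbox 0 1)"
 proof (rule has_integral_twiddle)
  show "continuous (at x) ?g" for x using cg by (metis continuous_on_eq_continuous_at open_UNIV UNIV_I)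
  show "\<exists>w z. ?g ` cbox u v = cbox w z" "\<exists>w z. ?h ` cbox u' v' = cbox w z" for u v u' v' using hb gb by blast+
  show "measure lborel (?g ` cbox u v) = 1*measure lborel (cbox u v)" for u v
  proof -
   have "cbox (?g u) (?g v) = {} \<longleftrightarrow> fst v < fst u \<or> snd v < snd u"
    using interval_ne_empty_cart(1)[of "?g u" "?g v"] unfolding forall_2 by (simp add: not_le[symmetric]) blast
   moreover have "measure lborel (cbox u v) = measure lborel (cbox (fst u) (fst v))*measure lborel (cbox (snd u) (snd v))"
    using content_Pair[of "fst u" "snd u" "fst v" "snd v"] by simp
   ultimately show ?thesis unfolding gb content_cbox_if_cart by (simp add: UNIV_2)
  qed
  show "(f has_integral integral (cbox 0 1) f) (cbox 0 1)" using assms by (rule integrable_integral)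
 qed (use gh hg in auto)
 then show ?thesis by (simp add: hb integral_unique)
qed

context lattice2 begin

lemma fund_dom_integral:
 fixes f :: "real^2 => real"
 assumes c: "continuous_on UNIV f"
 shows "set_integrable lborel (fund_dom v1 v2) f"
  and "set_lebesgue_integral lborel (fund_dom v1 v2) f = (2*pi)^2*\<bar>dt\<bar>*av f"
proof -
 let ?g = "%t::real^2. (2*pi) *\<^sub>R (t$1 *\<^sub>R v1 + t$2 *\<^sub>R v2)"
 let ?S = "{t::real^2. 0 <= t$1 \<and> t$1 < 1 \<and> 0 <= t$2 \<and> t$2 < 1}"
 let ?B = "cbox 0 1 :: (real^2) set"
 \<comment> \<open>The change of variables is applied to functions with values in
   \<open>real^1\<close>; the scalar statement is read off from the only component. The half-open
   square and the closed box differ by a null set.\<close>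
 define F where "F x = (vec (f x) :: real^1)" for x
 have lin: "linear ?g" by (intro linearI) (auto simp: algebra_simps)
 have det: "\<bar>det (matrix ?g)\<bar> = (2*pi)^2*\<bar>dt\<bar>"
 proof -
  have "det (matrix ?g) = (2*pi)^2*dt" by (simp add: det_2 matrix_def axis_def dt_def power2_eq_square algebra_simps)
  then show ?thesis by (simp add: abs_mult)
 qed
 have im: "fund_dom v1 v2 = ?g ` ?S"
 proof (intro set_eqI iffI)
  fix x assume "x \<in> fund_dom v1 v2"
  then obtain a b where "x = (2*pi) *\<^sub>R (a *\<^sub>R v1 + b *\<^sub>R v2)" "0 <= a" "a < 1" "0 <= b" "b < 1" unfolding fund_dom_def by auto
  then show "x \<in> ?g ` ?S" by (intro image_eqI[of _ _ "vector [a,b]"]) auto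
 qed (auto simp: fund_dom_def)
 have cF: "continuous_on UNIV (%t. F (?g t))" unfolding F_def vec_def by (intro continuous_on_vec_lambda continuous_on_compose2[OF c] continuous_intros) auto
 have "(%t. F (?g t)) absolutely_integrable_on ?B" by (rule absolutely_integrable_continuous) (rule continuous_on_subset[OF cF], simp)
 then have BI: "(%t. \<bar>det (matrix ?g)\<bar> *\<^sub>R F (?g t)) absolutely_integrable_on ?B" by (rule set_integrable_scaleR_right)
 have neg: "negligible (sym_diff ?S ?B)"
 proof (rule negligible_subset)
  show "negligible ({x::real^2. x$1 = 1} \<union> {x. x$2 = 1})" unfolding cart_eq_inner_axis by (intro negligible_Un negligible_standard_hyperplane) (auto simp: axis_in_Basis_iff)
  show "sym_diff ?S ?B \<subseteq> {x::real^2. x$1 = 1} \<union> {x. x$2 = 1}" by (auto simp: mem_box_cart forall_2)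
 qed
 have SI: "(%t. \<bar>det (matrix ?g)\<bar> *\<^sub>R F (?g t)) absolutely_integrable_on ?S"
  by (rule absolutely_integrable_spike_set[OF BI]; rule negligible_subset[OF neg]) auto
 have iS: "integral ?S h = integral ?B h" for h :: "real^2 => real^1" by (rule integral_spike_set; rule negligible_subset[OF neg]) auto
 have FI: "F absolutely_integrable_on (fund_dom v1 v2)"
  and Fint: "integral (fund_dom v1 v2) F = integral ?B (%t. \<bar>det (matrix ?g)\<bar> *\<^sub>R F (?g t))"
  using has_absolute_integral_change_of_variables_linear[OF lin, where f=F and S="?S" and b="integral ?S (%t. \<bar>det (matrix ?g)\<bar> *\<^sub>R F (?g t))"] SI iS
  unfolding im by auto
 have fF: "f = (%x. F x$1)" by (simp add: F_def)
 have blin: "bounded_linear (%x::real^1. x$1)" by (rule bounded_linear_vec_nth)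
 have fI: "f absolutely_integrable_on (fund_dom v1 v2)" unfolding fF using absolutely_integrable_linear[OF FI blin] by (simp add: o_def)
 have meas: "fund_dom v1 v2 \<in> sets borel"
 proof -
  have "fund_dom v1 v2 = {x. 0 <= x \<bullet> w1} \<inter> {x. x \<bullet> w1 < 2*pi} \<inter> {x. 0 <= x \<bullet> w2} \<inter> {x. x \<bullet> w2 < 2*pi}"
  proof (intro set_eqI iffI)
   fix x assume "x \<in> fund_dom v1 v2"
   then show "x \<in> {x. 0 <= x \<bullet> w1} \<inter> {x. x \<bullet> w1 < 2*pi} \<inter> {x. 0 <= x \<bullet> w2} \<inter> {x. x \<bullet> w2 < 2*pi}"
    by (auto simp: fund_dom_def inner_add_left w_v')
  next
   fix x assume "x \<in> {x. 0 <= x \<bullet> w1} \<inter> {x. x \<bullet> w1 < 2*pi} \<inter> {x. 0 <= x \<bullet> w2} \<inter> {x. x \<bullet> w2 < 2*pi}"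
   moreover have "x = (2*pi) *\<^sub>R ((x \<bullet> w1/(2*pi)) *\<^sub>R v1 + (x \<bullet> w2/(2*pi)) *\<^sub>R v2)" using pt_surj[of x] by (simp add: lat_pt_def)
   ultimately show "x \<in> fund_dom v1 v2" unfolding fund_dom_def by (intro CollectI exI[of _ "x \<bullet> w1/(2*pi)"] exI[of _ "x \<bullet> w2/(2*pi)"]) auto
  qed
  also have "\<dots> \<in> sets borel" by measurable
  finally show ?thesis .
 qed
 have fb: "f \<in> borel_measurable borel" using c by (rule borel_measurable_continuous_onI)
 show si: "set_integrable lborel (fund_dom v1 v2) f" using fI meas fb unfolding set_integrable_def by (subst (asm) integrable_completion) auto
 have "set_lebesgue_integral lborel (fund_dom v1 v2) f = integral (fund_dom v1 v2) f" by (rule set_borel_integral_eq_integral(2)[OF si])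
 also have "\<dots> = integral (fund_dom v1 v2) F $ 1" unfolding fF using integral_linear[OF set_lebesgue_integral_eq_integral(1)[OF FI] blin] by (simp add: o_def)
 also have "\<dots> = integral ?B (%t. \<bar>det (matrix ?g)\<bar>*f (?g t))" unfolding Fint
  using integral_linear[OF set_lebesgue_integral_eq_integral(1)[OF BI] blin] by (simp add: o_def F_def) metis
 also have "\<dots> = (2*pi)^2*\<bar>dt\<bar>*integral ?B (%t. f (?g t))" unfolding det by simp
 also have "integral ?B (%t. f (?g t)) = av f"
 proof -
  have "(%t. f (?g t)) integrable_on ?B" by (rule integrable_continuous, rule continuous_on_compose2[OF c]) (auto intro!: continuous_intros)
  from integral_cbox_vec2[OF this] show ?thesis by (simp add: av_def lat_pt_def)
 qed
 finally show "set_lebesgue_integral lborel (fund_dom v1 v2) f = (2*pi)^2*\<bar>dt\<bar>*av f" .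
qed

lemma lat_area_eq: "lat_area v1 v2 = (2*pi)^2*\<bar>dt\<bar>"
proof -
 have "set_lebesgue_integral lborel (fund_dom v1 v2) (%x. 1::real) = (2*pi)^2*\<bar>dt\<bar>" using fund_dom_integral(2)[of "%_. 1"] by (simp add: av_const)
 then show ?thesis unfolding lat_area_def set_lebesgue_integral_def by simp
qed

lemma lat_area_pos: "lat_area v1 v2 > 0"
 unfolding lat_area_eq using dt_nz by simp

lemma fcoeff_eq_av:
 assumes "continuous_on UNIV f"
 shows "fcoeff v1 v2 f j = av (%x. complex_of_real (f x) * cis (- (j \<bullet> x)))"
proof -
 let ?F = "%x. complex_of_real (f x) * cis (- (j \<bullet> x))" and ?D = "fund_dom v1 v2"
 have cR: "continuous_on UNIV (%x. Re (?F x))" "continuous_on UNIV (%x. Im (?F x))" and cF: "continuous_on UNIV ?F" by (intro continuous_intros assms)+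
 note R = fund_dom_integral[OF cR(1)] and I = fund_dom_integral[OF cR(2)]
 have "set_integrable lborel ?D (%x. complex_of_real (Re (?F x)))" "set_integrable lborel ?D (%x. complex_of_real (Im (?F x)))"
  using R(1) I(1) by (auto simp: set_integrable_def scaleR_conv_of_real simp flip: of_real_mult intro: integrable_of_real)
 then have "set_integrable lborel ?D (%x. of_real (Re (?F x)) + \<i> * of_real (Im (?F x)))" by (intro set_integral_add set_integrable_mult_right)
 moreover have "(%x. of_real (Re (?F x)) + \<i> * of_real (Im (?F x))) = ?F" by (rule ext) (simp add: complex_eq_iff)
 ultimately have int: "set_integrable lborel ?D ?F" by simp
 have "Re (set_lebesgue_integral lborel ?D ?F) = set_lebesgue_integral lborel ?D (%x. Re (?F x))"
  "Im (set_lebesgue_integral lborel ?D ?F) = set_lebesgue_integral lborel ?D (%x. Im (?F x))" using int unfolding set_integrable_def set_lebesgue_integral_def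
  by (simp_all flip: integral_Re integral_Im)
 moreover have "Re (av ?F) = av (%x. Re (?F x))" "Im (av ?F) = av (%x. Im (?F x))"
  using av_linear[OF cF bounded_linear_Re] av_linear[OF cF bounded_linear_Im] by simp_all
 ultimately have "set_lebesgue_integral lborel ?D ?F = of_real (lat_area v1 v2)*av ?F" using R(2) I(2) by (auto simp: complex_eq_iff lat_area_eq)
 then show ?thesis unfolding fcoeff_def using lat_area_pos by simp
qed

end

section \<open>Uniqueness of Fourier coefficients\<close>

context lattice2 begin

definition zero_fourier :: "(real^2 => complex) => bool" where
 "zero_fourier f \<longleftrightarrow> continuous_on UNIV f \<and> (\<forall>k\<in>Lam. av (%x. f x * cis (k \<bullet> x)) = 0)"

lemma zero_fourier_add: "zero_fourier f ==> zero_fourier g ==> zero_fourier (%x. f x + g x)"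
 unfolding zero_fourier_def by (auto simp: distrib_right av_add continuous_intros)

lemma zero_fourier_cmul: "zero_fourier f ==> zero_fourier (%x. c*f x)"
 unfolding zero_fourier_def by (auto simp: mult.assoc av_cmul_complex continuous_intros)

lemma zero_fourier_cis: "l \<in> Lam ==> zero_fourier f ==> zero_fourier (%x. cis (l \<bullet> x)*f x)"
proof -
 assume l: "l \<in> Lam" and f: "zero_fourier f"
 have "cis (l \<bullet> x)*f x * cis (k \<bullet> x) = f x * cis ((k + l) \<bullet> x)" for k x by (simp add: inner_add_left flip: cis_mult)
 then have "av (%x. cis (l \<bullet> x)*f x * cis (k \<bullet> x)) = av (%x. f x * cis ((k + l) \<bullet> x))" for k by (simp only:)
 then show ?thesis using f Lam_add[OF _ l] unfolding zero_fourier_def by (auto intro!: continuous_intros)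
qed

text \<open>Real and imaginary parts of the two basic characters are combinations of characters, and
  multiplication by a character only shifts frequencies. A product of polynomials acts one factor
  after the other, which is why the induction keeps f arbitrary.\<close>

lemma zero_fourier_polynomial:
 assumes "real_polynomial_function p"
 shows "zero_fourier f ==> zero_fourier (%x. of_real (p (cis (w1 \<bullet> x), cis (w2 \<bullet> x)))*f x)" using assms
proof (induction p arbitrary: f rule: real_polynomial_function.induct)
 case (linear p)
 then interpret bounded_linear p by simp
 have e: "p (u,v) = Re u*p (1,0) + Im u*p (\<i>,0) + Re v * p (0,1) + Im v * p (0,\<i>)" for u v
 proof -
  have "(u,v) = Re u *\<^sub>R (1,0) + Im u *\<^sub>R (\<i>,0) + Re v *\<^sub>R (0,1) + Im v *\<^sub>R (0,\<i>)" by (simp add: complex_eq_iff)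
  then show ?thesis by (simp only: add scaleR real_scaleR_def)
 qed
 define c1 c2 c3 c4 :: complex where "c1 = of_real (p (1,0))/2" "c2 = of_real (p (\<i>,0))/(2*\<i>)"
  "c3 = of_real (p (0,1))/2" "c4 = of_real (p (0,\<i>))/(2*\<i>)"
 have co: "complex_of_real (cos t) = (cis t + cis (-t))/2" "complex_of_real (sin t) = (cis t - cis (-t))/(2*\<i>)" for t by (simp_all add: complex_eq_iff Re_divide Im_divide)
 have "of_real (p (cis (w1 \<bullet> x), cis (w2 \<bullet> x)))*f x =
  ((c1 + c2)*(cis (w1 \<bullet> x)*f x) + (c1 - c2)*(cis ((-w1) \<bullet> x)*f x))
 + ((c3 + c4)*(cis (w2 \<bullet> x)*f x) + (c3 - c4)*(cis ((-w2) \<bullet> x)*f x))" for x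
  unfolding e[of "cis (w1 \<bullet> x)"] c1_c2_c3_c4_def by (simp add: co field_simps)
 then show ?case using linear.prems by (simp add: zero_fourier_add zero_fourier_cmul zero_fourier_cis w_Lam del: inner_minus_left)
next
 case (const c)
 then show ?case by (simp add: zero_fourier_cmul)
next
 case (add p q)
 from zero_fourier_add[OF add.IH(1)[OF add.prems] add.IH(2)[OF add.prems]]
 show ?case by (simp add: distrib_right)
next
 case (mult p q)
 from mult.IH(1)[OF mult.IH(2)[OF mult.prems]] show ?case by (simp add: mult.assoc)
qed

lemma periodic_bounded:
 fixes f :: "real^2 => 'a::real_normed_vector"
 assumes c: "continuous_on UNIV f" and p: "lat_periodic v1 v2 f"
 obtains B where "B > 0" "!!x. norm (f x) <= B"
proof -
 have "compact ((%t. f (pt t)) ` cbox (0,0) (1,1))" by (intro compact_continuous_image compact_cbox continuous_on_compose2[OF c]) (auto intro!: continuous_intros)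
 then obtain B where B: "B > 0" "!!y. y \<in> (%t. f (pt t)) ` cbox (0,0) (1,1) ==> norm y <= B" using compact_imp_bounded bounded_pos by metis
 show ?thesis
 proof (rule that[OF B(1)])
  fix x obtain t where t: "t \<in> cbox (0,0) (1,1)" "f x = f (pt t)" by (rule periodic_reduce[OF p])
  then show "norm (f x) <= B" using B(2) by auto
 qed
qed

text \<open>The torus is embedded in $\mathbf C^2$ by two characters, so that polynomials on $\mathbf C^2$
 restrict to trigonometric polynomials and Stone--Weierstrass applies.\<close>

lemma torus_descends:
 fixes f :: "real^2 => real"
 assumes c: "continuous_on UNIV f" and p: "lat_periodic v1 v2 f"
 obtains g where "continuous_on (range (%x. (cis (w1 \<bullet> x), cis (w2 \<bullet> x)))) g"
  "!!x. g (cis (w1 \<bullet> x), cis (w2 \<bullet> x)) = f x" "compact (range (%x. (cis (w1 \<bullet> x), cis (w2 \<bullet> x))))"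
proof -
 let ?q = "%x. (cis (w1 \<bullet> x), cis (w2 \<bullet> x))"
 let ?C = "pt ` cbox (0,0) (1,1)"
 have qc: "continuous_on S ?q" for S by (intro continuous_intros)
 have cC: "compact ?C" by (intro compact_continuous_image compact_cbox) (auto intro!: continuous_intros)
 have cis_eq: "\<exists>n::int. a = b + 2*pi*n" if "cis a = cis b" for a b using that sin_cos_eq_iff[of a b] by (auto simp: complex_eq_iff)
 have feq: "f x = f y" if qq: "?q x = ?q y" for x y
 proof -
  obtain m where m: "w1 \<bullet> x = w1 \<bullet> y + 2*pi* of_int m" using cis_eq[of "w1 \<bullet> x" "w1 \<bullet> y"] qq by auto
  obtain n where n: "w2 \<bullet> x = w2 \<bullet> y + 2*pi* of_int n" using cis_eq[of "w2 \<bullet> x" "w2 \<bullet> y"] qq by auto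
  have "x - y \<in> lat v1 v2" unfolding lat_iff using m n by (simp add: inner_diff_left inner_commute)
  from periodic_lat[OF p this, of y] show ?thesis by simp
 qed
 define g where "g z = f (SOME x. ?q x = z)" for z
 have g: "g (?q x) = f x" for x unfolding g_def by (rule feq, rule someI[of "%y. ?q y = ?q x"]) simp
 have rC: "range ?q = ?q ` ?C"
 proof
  show "range ?q \<subseteq> ?q ` ?C"
  proof
   fix z assume "z \<in> range ?q"
   then obtain x where z: "z = ?q x" by auto
   obtain t where t: "t \<in> cbox (0,0) (1,1)" "x - pt t \<in> lat v1 v2" by (rule reduce_cell)
   then obtain m n :: int where mn: "(x - pt t) \<bullet> w1/(2*pi) = of_int m" "(x - pt t) \<bullet> w2/(2*pi) = of_int n" unfolding lat_iff by (auto elim!: Ints_cases)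
   then have "x \<bullet> w1 - pt t \<bullet> w1 = 2*pi* of_int m" "x \<bullet> w2 - pt t \<bullet> w2 = 2*pi* of_int n"
    unfolding inner_diff_left by (simp_all add: divide_eq_eq mult.commute)
   then have "w1 \<bullet> x = w1 \<bullet> pt t + 2*pi* of_int m" "w2 \<bullet> x = w2 \<bullet> pt t + 2*pi* of_int n"
    unfolding inner_commute[of w1 x] inner_commute[of w1 "pt t"] inner_commute[of w2 x] inner_commute[of w2 "pt t"] by linarith+
   then have "?q x = ?q (pt t)" by (simp add: cis_multiple_2pi flip: cis_mult)
   then show "z \<in> ?q ` ?C" using z t by auto
  qed
 qed auto
 have comp: "compact (range ?q)" unfolding rC by (intro compact_continuous_image qc cC)
 \<comment> \<open>A closed set pulls back under g to the image of a compact subset of one cell,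
   hence to a closed set.\<close>
 have "continuous_on (range ?q) g"
 proof (subst continuous_on_closed_vimage)
  show "closed (range ?q)" using comp by (rule compact_imp_closed)
  show "\<forall>B. closed B --> closed (g -` B \<inter> range ?q)"
  proof (intro allI impI)
   fix B :: "real set" assume B: "closed B"
   have eq: "g -` B \<inter> range ?q = ?q ` (?C \<inter> f -` B)"
   proof
    show "g -` B \<inter> range ?q \<subseteq> ?q ` (?C \<inter> f -` B)" unfolding rC using g by auto
    show "?q ` (?C \<inter> f -` B) \<subseteq> g -` B \<inter> range ?q" using g by auto
   qed
   have cp: "compact (?C \<inter> f -` B)" using cC B c by (intro compact_Int_closed) (auto intro: continuous_closed_vimage simp: continuous_on_eq_continuous_at)
   show "closed (g -` B \<inter> range ?q)" unfolding eq by (rule compact_imp_closed, rule compact_continuous_image[OF qc cp])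
  qed
 qed
 then show ?thesis using that g comp by blast
qed

text \<open>f is orthogonal to every trigonometric polynomial Q, so the mean of f^2 equals the mean
  of (f - Q) f, which uniform approximation makes arbitrarily small.\<close>

lemma fourier_unique:
 fixes f :: "real^2 => real"
 assumes c: "continuous_on UNIV f" and p: "lat_periodic v1 v2 f"
  and z: "!!k. k \<in> Lam ==> av (%x. of_real (f x) * cis (k \<bullet> x)) = (0::complex)"
 shows "f x = 0"
proof (rule av_sq_eq_0[OF c p])
 have zf: "zero_fourier (%x. of_real (f x))" unfolding zero_fourier_def using c z by (auto intro!: continuous_intros)
 obtain B where B: "B > 0" "!!x. norm (f x) <= B" using periodic_bounded[OF c p] by metis
 obtain g where g: "continuous_on (range (%x. (cis (w1 \<bullet> x), cis (w2 \<bullet> x)))) g"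
  "!!x. g (cis (w1 \<bullet> x), cis (w2 \<bullet> x)) = f x" "compact (range (%x. (cis (w1 \<bullet> x), cis (w2 \<bullet> x))))"
  by (rule torus_descends[OF c p]) blast
 have sq: "av (%x. (f x)^2) <= e*B" if e: "e > 0" for e
 proof -
  obtain P where P: "real_polynomial_function P"
   "!!x. x \<in> range (%x. (cis (w1 \<bullet> x), cis (w2 \<bullet> x))) ==> \<bar>g x - P x\<bar> < e"
   by (rule Stone_Weierstrass_real_polynomial_function[OF g(3,1) e]) blast
  define Q where "Q x = P (cis (w1 \<bullet> x), cis (w2 \<bullet> x))" for x
  have Q: "\<bar>f x - Q x\<bar> < e" for x using P(2) g(2) unfolding Q_def by (metis rangeI)
  have Qc: "continuous_on UNIV Q" unfolding Q_def by (rule continuous_on_compose2[of UNIV P])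
    (use P(1) continuous_on_polymonial_function real_polynomial_function_eq in \<open>auto intro!: continuous_intros\<close>)
  have "zero_fourier (%x. of_real (Q x) * of_real (f x))" using zero_fourier_polynomial[OF P(1) zf] unfolding Q_def .
  then have "av (%x. of_real (Q x) * of_real (f x) * cis (0 \<bullet> x)) = (0::complex)" unfolding zero_fourier_def using Lam_0 by blast
  then have "av (%x. complex_of_real (Q x*f x)) = 0" by simp
  moreover have "av (%x. complex_of_real (Q x*f x)) = of_real (av (%x. Q x*f x))"
   by (rule av_linear[OF _ bounded_linear_of_real]) (intro continuous_intros Qc c)
  ultimately have 0: "av (%x. Q x*f x) = 0" by simp
  have "av (%x. (f x)^2) = av (%x. (f x - Q x)*f x) + av (%x. Q x*f x)"
   by (subst av_add[symmetric]) (auto intro!: continuous_intros c Qc simp: algebra_simps power2_eq_square)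
  also have "\<dots> = av (%x. (f x - Q x)*f x)" using 0 by simp
  also have "\<dots> <= norm (av (%x. (f x - Q x)*f x))" by simp
  also have "\<dots> <= e*B"
  proof (rule av_norm_le)
   show "continuous_on UNIV (%x. (f x - Q x)*f x)" by (intro continuous_intros c Qc)
   fix x show "norm ((f x - Q x)*f x) <= e*B" using mult_mono[of "\<bar>f x - Q x\<bar>" e "\<bar>f x\<bar>" B] Q[of x] B(2)[of x] e by (simp add: abs_mult)
  qed
  finally show ?thesis .
 qed
 have "av (%x. (f x)^2) <= 0"
 proof (rule field_le_epsilon)
  fix e :: real assume "e > 0"
  then show "av (%x. (f x)^2) <= 0 + e" using sq[of "e/B"] B(1) by simp
 qed
 moreover have "av (%x. (f x)^2) \<ge> 0" by (intro av_nonneg continuous_intros c) auto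
 ultimately show "av (%x. (f x)^2) = 0" by simp
qed

end

section \<open>Absolutely convergent Fourier series\<close>

lemma cis_minus_linear_bound: "cmod (cis t - 1 - \<i> * of_real t) <= t^2"
proof -
 have "norm (exp (\<i> * of_real t) - (\<Sum>k\<le>1. (\<i> * of_real t) ^ k/(fact k))) <= exp\<bar>Re (\<i> * of_real t)\<bar>*(norm (\<i> * complex_of_real t)) ^ (Suc 1)/(fact 1)"
  by (rule Taylor_exp)
 moreover have "norm (\<i> * complex_of_real t) = \<bar>t\<bar>" by (simp add: norm_mult)
 ultimately show ?thesis unfolding cis_conv_exp by (simp add: power2_eq_square algebra_simps)
qed

lemma has_sum_sub:
 fixes f g :: "'a => 'b::topological_ab_group_add"
 assumes "(f has_sum a) A" "(g has_sum b) A"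
 shows "((%x. f x - g x) has_sum (a - b)) A"
proof -
 have "((%x. - g x) has_sum - b) A" unfolding has_sum_uminus using assms(2) by simp
 from has_sum_add[OF assms(1) this] show ?thesis by simp
qed

lemma has_sum_metric_iff:
 fixes f :: "'a => 'b::{metric_space,comm_monoid_add}"
 shows "(f has_sum s) A \<longleftrightarrow> (\<forall>e>0. \<exists>X. finite X \<and> X \<subseteq> A \<and>
  (\<forall>Y. finite Y \<and> X \<subseteq> Y \<and> Y \<subseteq> A --> dist (sum f Y) s < e))"
 unfolding has_sum_def tendsto_iff eventually_finite_subsets_at_top by blast

context lattice2 begin

text \<open>All polynomial weights are demanded at once, so the class is closed under
  \<open>pd\<close> and derivatives never have to be counted.\<close>

definition wser :: "(real^2 => real) => (real^2 => complex) => bool" where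
 "wser f a \<longleftrightarrow> (\<forall>m::nat. (%k. norm k ^ m * cmod (a k)) summable_on Lam) \<and>
  (\<forall>x. ((%k. a k * cis (k \<bullet> x)) has_sum complex_of_real (f x)) Lam)"

text \<open>A Wiener-type norm that dominates the sup norms of the derivatives of order m. As 0^0 =
  1, the mean is counted only for m = 0.\<close>

definition wnorm :: "nat => (real^2 => complex) => real" where
 "wnorm m a = infsum (%k. norm k ^ m * cmod (a k)) Lam"

lemma wser_summable: "wser f a ==> (%k. norm k ^ m * cmod (a k)) summable_on Lam"
 by (simp add: wser_def)

lemma wser_abs: "wser f a ==> (%k. cmod (a k)) summable_on Lam"
 using wser_summable[of f a 0] by simp

lemma wser_sum: "wser f a ==> ((%k. a k * cis (k \<bullet> x)) has_sum complex_of_real (f x)) Lam"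
 by (simp add: wser_def)

lemma wnorm_nonneg: "0 <= wnorm m a"
 unfolding wnorm_def by (intro infsum_nonneg) auto

lemma has_sum_norm_le:
 fixes u :: "'i => complex"
 assumes "(u has_sum S) A" "!!k. k \<in> A ==> cmod (u k) <= b k" "b summable_on A"
 shows "cmod S <= infsum b A"
proof -
 have abs: "(%k. cmod (u k)) summable_on A" by (rule summable_on_comparison_test[OF assms(3)]) (use assms in auto)
 have "cmod S <= infsum (%k. cmod (u k)) A" using norm_infsum_bound[OF abs] infsumI[OF assms(1)] by simp
 also have "\<dots> <= infsum b A" by (rule infsum_mono[OF abs assms(3)]) (use assms in auto)
 finally show ?thesis .
qed

lemma wser_bound: "wser f a ==> \<bar>f x\<bar> <= wnorm 0 a"
 using has_sum_norm_le[OF wser_sum[of f a x], of "%k. norm k ^ 0 * cmod (a k)"] wser_summable[of f a 0] by (simp add: wnorm_def norm_mult)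

lemma wser_periodic: assumes "wser f a" shows "lat_periodic v1 v2 f"
 unfolding lat_periodic_def
proof (intro allI ballI)
 fix x \<gamma> assume g: "\<gamma> \<in> lat v1 v2"
 have "cis (k \<bullet> (x + \<gamma>)) = cis (k \<bullet> x)" if k: "k \<in> Lam" for k
 proof -
  obtain m n :: int where km: "k = of_int m *\<^sub>R w1 + of_int n *\<^sub>R w2" using k unfolding dual_lat_eq by auto
  obtain p q :: int where "\<gamma> \<bullet> w1/(2*pi) = of_int p" "\<gamma> \<bullet> w2/(2*pi) = of_int q" using g unfolding lat_iff by (auto elim!: Ints_cases)
  then have pq: "w1 \<bullet> \<gamma> = 2*pi* of_int p" "w2 \<bullet> \<gamma> = 2*pi* of_int q" by (auto simp: field_simps inner_commute)
  have "k \<bullet> \<gamma> = 2*pi* of_int (m*p + n*q)" unfolding km by (simp add: inner_add_left pq algebra_simps)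
  then show ?thesis by (simp add: inner_add_right cis_multiple_2pi flip: cis_mult)
 qed
 then have "((%k. a k * cis (k \<bullet> (x + \<gamma>))) has_sum of_real (f x)) Lam" using wser_sum[OF assms, of x] by (subst has_sum_cong) auto
 from has_sum_unique[OF this wser_sum[OF assms]] show "f (x + \<gamma>) = f x" by simp
qed

lemma wser_diff: assumes "wser f a" "wser g b" shows "wser (%x. f x - g x) (%k. a k - b k)"
 unfolding wser_def
proof (intro conjI allI)
 fix m
 show "(%k. norm k ^ m * cmod (a k - b k)) summable_on Lam"
  by (rule summable_on_comparison_test[OF summable_on_add[OF wser_summable[OF assms(1), of m] wser_summable[OF assms(2), of m]]])
   (use norm_triangle_ineq4 in \<open>auto simp flip: distrib_left intro!: mult_left_mono\<close>)
next
 fix x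
 show "((%k. (a k - b k) * cis (k \<bullet> x)) has_sum complex_of_real (f x - g x)) Lam"
  using has_sum_sub[OF wser_sum[OF assms(1)] wser_sum[OF assms(2)], of x x] by (simp only: left_diff_distrib of_real_diff)
qed

lemma wser_shift: assumes "wser f a" shows "wser (%x. f (x + b)) (%k. a k * cis (k \<bullet> b))"
 unfolding wser_def
proof (intro conjI allI)
 fix m show "(%k. norm k ^ m * cmod (a k * cis (k \<bullet> b))) summable_on Lam" using wser_summable[OF assms] by (simp add: norm_mult)
next
 fix x show "((%k. a k * cis (k \<bullet> b) * cis (k \<bullet> x)) has_sum complex_of_real (f (x + b))) Lam"
  using wser_sum[OF assms, of "x + b"] by (simp add: inner_add_right mult_ac flip: cis_mult)
qed

text \<open>The Taylor remainder of mode k is at most (|k| |h|)^2 times its coefficient, so the sum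
  has remainder \<open>wnorm 2 a\<close> times |h|^2. The differentiated series is a priori complex;
  it is real because the imaginary part of f is identically 0 and may be differentiated.\<close>

lemma wser_derivative_aux:
 assumes w: "wser f a"
 shows "\<exists>D. (\<forall>i x. ((%k. \<i> * of_real (k$i)*a k * cis (k \<bullet> x)) has_sum D i x) Lam) \<and>
  (\<forall>x. ((%x. complex_of_real (f x)) has_derivative (%h. of_real (h$1)*D 1 x + of_real (h$2)*D 2 x)) (at x)) \<and>
  (\<forall>i x. D i x = of_real (Re (D i x)))"
proof -
 define D where "D i x = infsum (%k. \<i> * of_real (k$i)*a k * cis (k \<bullet> x)) Lam" for i x
 have comp: "\<bar>k$i\<bar> <= norm k" for k :: "real^2" and i by (rule component_le_norm_cart)
 have s: "((%k. \<i> * of_real (k$i)*a k * cis (k \<bullet> x)) has_sum D i x) Lam" for i x unfolding D_def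
 proof (rule has_sum_infsum, rule abs_summable_summable, rule summable_on_comparison_test)
  show "(%k. norm k ^ 1 * cmod (a k)) summable_on Lam" by (rule wser_summable[OF w])
  show "cmod (\<i> * of_real (k$i)*a k * cis (k \<bullet> x)) <= norm k ^ 1 * cmod (a k)" for k using comp[of k i] by (simp add: norm_mult mult_right_mono)
 qed auto
 define E where "E x h = of_real (h$1)*D 1 x + of_real (h$2)*D 2 x" for x and h :: "real^2"
 have hE: "((%k. \<i> * of_real (k \<bullet> h)*a k * cis (k \<bullet> x)) has_sum E x h) Lam" for x h
 proof -
  have "((%k. of_real (h$1)*(\<i> * of_real (k$1)*a k * cis (k \<bullet> x)) + of_real (h$2)*(\<i> * of_real (k$2)*a k * cis (k \<bullet> x))) has_sum E x h) Lam"
   unfolding E_def by (intro has_sum_add has_sum_cmult_right s)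
  then show ?thesis by (simp add: inner_2 algebra_simps)
 qed
 have bl: "bounded_linear (E x)" for x unfolding E_def by (intro bounded_linear_intros bounded_linear_compose[OF bounded_linear_of_real] bounded_linear_vec_nth
   bounded_linear_add bounded_linear_mult_const)
 have err: "cmod (of_real (f (x + h)) - of_real (f x) - E x h) <= wnorm 2 a*(norm h)^2" for x h
 proof -
  have "((%k. (a k * cis (k \<bullet> (x+h)) - (a k * cis (k \<bullet> x))) - (\<i> * of_real (k \<bullet> h)*a k * cis (k \<bullet> x))) has_sum
   ((of_real (f (x + h)) - of_real (f x)) - E x h)) Lam" by (rule has_sum_sub[OF has_sum_sub[OF wser_sum[OF w] wser_sum[OF w]] hE])
  then have "((%k. a k * cis (k \<bullet> x)*(cis (k \<bullet> h) - 1 - \<i> * of_real (k \<bullet> h))) has_sum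
   (of_real (f (x + h)) - of_real (f x) - E x h)) Lam" by (simp add: inner_add_right algebra_simps flip: cis_mult)
  then have "cmod (of_real (f (x + h)) - of_real (f x) - E x h) <= infsum (%k. (norm h)^2*(norm k ^ 2 * cmod (a k))) Lam"
  proof (rule has_sum_norm_le)
   show "(%k. (norm h)^2*(norm k ^ 2 * cmod (a k))) summable_on Lam" by (intro summable_on_cmult_right wser_summable[OF w])
   fix k
   have "cmod (cis (k \<bullet> h) - 1 - \<i> * of_real (k \<bullet> h)) <= (k \<bullet> h)^2" by (rule cis_minus_linear_bound)
   also have "\<dots> <= (norm k*norm h)^2" using Cauchy_Schwarz_ineq2[of k h] by (metis abs_ge_zero power2_abs power_mono)
   finally show "cmod (a k * cis (k \<bullet> x)*(cis (k \<bullet> h) - 1 - \<i> * of_real (k \<bullet> h))) <= (norm h)^2*(norm k ^ 2 * cmod (a k))"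
    by (simp add: norm_mult power_mult_distrib mult_left_mono mult_ac)
  qed
  then show ?thesis by (simp add: infsum_cmult_right' wnorm_def mult.commute)
 qed
 have d: "((%x. complex_of_real (f x)) has_derivative (%h. of_real (h$1)*D 1 x + of_real (h$2)*D 2 x)) (at x)" for x
  unfolding has_derivative_at2 E_def[symmetric]
 proof (intro conjI bl)
  have lim: "((%y. wnorm 2 a*norm (y - x)) \<longlongrightarrow> 0) (at x)" by (rule tendsto_eq_intros refl | simp)+
  show "((%y. (1/norm (y - x)) *\<^sub>R (complex_of_real (f y) - (of_real (f x) + E x (y - x)))) \<longlongrightarrow> 0) (at x)"
  proof (rule Lim_null_comparison[OF _ lim], rule always_eventually, rule allI)
   fix y
   have "cmod (of_real (f y) - (of_real (f x) + E x (y - x))) <= wnorm 2 a*(norm (y - x))^2" using err[of x "y - x"] by (simp add: algebra_simps)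
   then show "norm ((1/norm (y - x)) *\<^sub>R (complex_of_real (f y) - (of_real (f x) + E x (y - x)))) <= wnorm 2 a*norm (y - x)"
    by (cases "y = x") (auto simp: divide_simps power2_eq_square mult_ac)
  qed
 qed
 have "((%x. Im (complex_of_real (f x))) has_derivative (%h. Im (of_real (h$1)*D 1 x + of_real (h$2)*D 2 x))) (at x)" for x
  by (rule bounded_linear.has_derivative[OF bounded_linear_Im d])
 then have "((%x::real^2. 0::real) has_derivative (%h. Im (of_real (h$1)*D 1 x + of_real (h$2)*D 2 x))) (at x)" for x by simp
 then have "(%h::real^2. Im (of_real (h$1)*D 1 x + of_real (h$2)*D 2 x)) = (%h. 0)" for x using has_derivative_unique has_derivative_const by blast
 then have im: "Im (of_real (h$1)*D 1 x + of_real (h$2)*D 2 x) = 0" for x and h :: "real^2" by meson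
 have "Im (D i x) = 0" for i x using im[of "axis 1 1" x] im[of "axis 2 1" x] exhaust_2[of i] by (auto simp: axis_def)
 then have "D i x = of_real (Re (D i x))" for i x by (simp add: complex_eq_iff)
 then show ?thesis using s d by blast
qed

lemma wser_has_derivative:
 assumes w: "wser f a"
 shows "(f has_derivative (%h. grad2 f x \<bullet> h)) (at x)"
  and "wser (pd i f) (%k. \<i> * of_real (k$i)*a k)"
proof -
 obtain D where D: "!!i x. ((%k. \<i> * of_real (k$i)*a k * cis (k \<bullet> x)) has_sum D i x) Lam"
  "!!x. ((%x. complex_of_real (f x)) has_derivative (%h. of_real (h$1)*D 1 x + of_real (h$2)*D 2 x)) (at x)"
  "!!i x. D i x = of_real (Re (D i x))" using wser_derivative_aux[OF w] by blast
 have d: "(f has_derivative (%h. h$1*Re (D 1 x) + h$2*Re (D 2 x))) (at x)" for x using bounded_linear.has_derivative[OF bounded_linear_Re D(2)[of x]] by simp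
 have p: "pd i f x = Re (D i x)" for i x
 proof -
  have "((%t. f (x + t *\<^sub>R axis i 1)) has_derivative (%t. (t *\<^sub>R axis i 1 :: real^2)$1*Re (D 1 x) + (t *\<^sub>R axis i 1 :: real^2)$2*Re (D 2 x))) (at 0)"
  proof (rule has_derivative_compose[of "%t. x + t *\<^sub>R axis i 1" "%t. t *\<^sub>R axis i 1" 0 UNIV f])
   show "((%t. x + t *\<^sub>R axis i 1) has_derivative (%t. t *\<^sub>R axis i 1)) (at 0)" by (auto intro!: derivative_eq_intros)
  qed (use d in simp)
  moreover have "(%t. (t *\<^sub>R axis i 1 :: real^2)$1*Re (D 1 x) + (t *\<^sub>R axis i 1 :: real^2)$2*Re (D 2 x)) = (%t. t*Re (D i x))"
   using exhaust_2[of i] by (auto simp: axis_def)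
  ultimately have "((%t. f (x + t *\<^sub>R axis i 1)) has_field_derivative Re (D i x)) (at 0)"
   by (simp add: has_field_derivative_def mult.commute[of _ "Re _"] mult_commute_abs)
  then show ?thesis unfolding pd_def by (rule DERIV_imp_deriv)
 qed
 have "(%h. grad2 f x \<bullet> h) = (%h. h$1*Re (D 1 x) + h$2*Re (D 2 x))" by (auto simp: grad2_def p inner_2 algebra_simps)
 then show "(f has_derivative (%h. grad2 f x \<bullet> h)) (at x)" using d by simp
 show "wser (pd i f) (%k. \<i> * of_real (k$i)*a k)" unfolding wser_def
 proof (intro conjI allI)
  fix m
  show "(%k. norm k ^ m * cmod (\<i> * of_real (k$i)*a k)) summable_on Lam"
  proof (rule summable_on_comparison_test[OF wser_summable[OF w, of "Suc m"]])
   fix k :: "real^2"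
   have "\<bar>k$i\<bar>*(norm k ^ m * cmod (a k)) <= norm k*(norm k ^ m * cmod (a k))" by (intro mult_right_mono component_le_norm_cart) auto
   then show "norm k ^ m * cmod (\<i> * of_real (k$i)*a k) <= norm k ^ Suc m * cmod (a k)" by (simp add: norm_mult mult_ac)
  qed auto
 next
  fix x
  show "((%k. \<i> * of_real (k$i)*a k * cis (k \<bullet> x)) has_sum complex_of_real (pd i f x)) Lam" using D(1)[of i x] D(3)[of i x] unfolding p by metis
 qed
qed

lemma wser_cont: "wser f a ==> continuous_on UNIV f"
 by (rule continuous_at_imp_continuous_on, rule ballI, rule has_derivative_continuous, rule wser_has_derivative(1))

lemma wnorm_pd: "wser f a ==> wnorm m (%k. \<i> * of_real (k$i)*a k) <= wnorm (Suc m) a"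
 unfolding wnorm_def
proof (rule infsum_mono)
 assume w: "wser f a"
 show "(%k. norm k ^ m * cmod (\<i> * of_real (k$i)*a k)) summable_on Lam" by (rule wser_summable[OF wser_has_derivative(2)[OF w]])
 show "(%k. norm k ^ Suc m * cmod (a k)) summable_on Lam" by (rule wser_summable[OF w])
 fix k :: "real^2"
 have "\<bar>k$i\<bar>*(norm k ^ m * cmod (a k)) <= norm k*(norm k ^ m * cmod (a k))" by (intro mult_right_mono component_le_norm_cart) auto
 then show "norm k ^ m * cmod (\<i> * of_real (k$i)*a k) <= norm k ^ Suc m * cmod (a k)" by (simp add: norm_mult mult_ac)
qed

text \<open>The tails of the series are bounded uniformly in x by the tails of the sum of |a k|, so
  summation and averaging may be exchanged.\<close>

lemma av_wser_mult:
 assumes w: "wser f a" and g: "continuous_on UNIV g" and B: "!!x. cmod (g x) <= B"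
 shows "((%k. a k*av (%x. cis (k \<bullet> x)*g x)) has_sum av (%x. of_real (f x)*g x)) Lam" unfolding has_sum_metric_iff
proof (intro allI impI)
 fix e :: real assume e: "e > 0"
 have B0: "B \<ge> 0" using B[of 0] norm_ge_zero order_trans by blast
 have abs: "((%k. cmod (a k)) has_sum infsum (%k. cmod (a k)) Lam) Lam" using wser_abs[OF w] by simp
 let ?S = "infsum (%k. cmod (a k)) Lam"
 have "e/(B + 1) > 0" using e B0 by simp
 then obtain X where X: "finite X" "X \<subseteq> Lam" "!!Y. finite Y ==> X \<subseteq> Y ==> Y \<subseteq> Lam ==> dist (\<Sum>k\<in>Y. cmod (a k)) ?S < e/(B+1)"
  using abs[unfolded has_sum_metric_iff] by metis
 show "\<exists>X. finite X \<and> X \<subseteq> Lam \<and> (\<forall>Y. finite Y \<and> X \<subseteq> Y \<and> Y \<subseteq> Lam -->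
  dist (\<Sum>k\<in>Y. a k*av (%x. cis (k \<bullet> x)*g x)) (av (%x. complex_of_real (f x)*g x)) < e)"
 proof (intro exI[of _ X] conjI X(1,2) allI impI)
  fix Y assume "finite Y \<and> X \<subseteq> Y \<and> Y \<subseteq> Lam"
  then have Y: "finite Y" "X \<subseteq> Y" "Y \<subseteq> Lam" by auto
  let ?T = "%x. \<Sum>k\<in>Y. a k * cis (k \<bullet> x)"
  have fin: "(h has_sum sum h Y) Y" for h :: "real^2 => 'c::{comm_monoid_add,topological_space}" using Y(1) by simp
  have tail: "cmod (of_real (f x) - ?T x) <= ?S - (\<Sum>k\<in>Y. cmod (a k))" for x
  proof -
   have 1: "((%k. a k * cis (k \<bullet> x)) has_sum (of_real (f x) - ?T x)) (Lam - Y)" by (rule has_sum_Diff[OF wser_sum[OF w] fin Y(3)])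
   have 2: "((%k. cmod (a k)) has_sum (?S - (\<Sum>k\<in>Y. cmod (a k)))) (Lam - Y)" by (rule has_sum_Diff[OF abs fin Y(3)])
   show ?thesis using has_sum_norm_le[OF 1, of "%k. cmod (a k)"] 2 by (simp add: norm_mult has_sum_imp_summable infsumI)
  qed
  have tail0: "0 <= ?S - (\<Sum>k\<in>Y. cmod (a k))" by (rule order_trans[OF norm_ge_zero tail])
  have small: "?S - (\<Sum>k\<in>Y. cmod (a k)) < e/(B+1)" using X(3)[OF Y] by (simp add: dist_real_def)
  have cf: "continuous_on UNIV (%x. complex_of_real (f x))" by (intro continuous_intros wser_cont[OF w])
  have "(\<Sum>k\<in>Y. a k*av (%x. cis (k \<bullet> x)*g x)) = av (%x. ?T x*g x)"
   by (simp add: sum_distrib_right av_sum[OF Y(1)] mult.assoc av_cmul_complex continuous_intros g)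
  moreover have "continuous_on UNIV (%x. of_real (f x)*g x)" "continuous_on UNIV (%x. ?T x*g x)" by (intro continuous_intros cf g)+
  ultimately have "av (%x. of_real (f x)*g x) - (\<Sum>k\<in>Y. a k*av (%x. cis (k \<bullet> x)*g x)) = av (%x. (of_real (f x) - ?T x)*g x)"
   using av_diff[of "%x. of_real (f x)*g x" "%x. ?T x*g x"] by (simp only: left_diff_distrib)
  also have "cmod \<dots> <= (?S - (\<Sum>k\<in>Y. cmod (a k)))*B"
  proof (rule av_norm_le)
   show "continuous_on UNIV (%x. (of_real (f x) - ?T x)*g x)" by (intro continuous_intros cf g)
   fix x show "cmod ((of_real (f x) - ?T x)*g x) <= (?S - (\<Sum>k\<in>Y. cmod (a k)))*B" unfolding norm_mult by (intro mult_mono tail B) (use tail0 in simp_all)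
  qed
  also have "\<dots> <= e/(B+1)*B" using small B0 by (intro mult_right_mono) auto
  also have "\<dots> < e" using e B0 by (simp add: field_simps)
  finally show "dist (\<Sum>k\<in>Y. a k*av (%x. cis (k \<bullet> x)*g x)) (av (%x. complex_of_real (f x)*g x)) < e"
   by (simp add: dist_norm norm_minus_commute)
 qed
qed

lemma wser_coeff:
 assumes w: "wser f a" and l: "l \<in> Lam"
 shows "av (%x. of_real (f x) * cis (- (l \<bullet> x))) = a l"
proof -
 have "((%k. a k*av (%x. cis (k \<bullet> x) * cis (- (l \<bullet> x)))) has_sum av (%x. of_real (f x) * cis (- (l \<bullet> x)))) Lam"
  by (rule av_wser_mult[OF w, where B=1]) (auto intro!: continuous_intros)
 moreover have "av (%x. cis (k \<bullet> x) * cis (- (l \<bullet> x))) = (if k = l then 1 else 0)" if "k \<in> Lam" for k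
  using av_cis[OF Lam_diff[OF that l]] by (simp add: cis_mult inner_diff_left)
 ultimately have "((%k. a k*(if k = l then 1 else 0)) has_sum av (%x. of_real (f x) * cis (- (l \<bullet> x)))) Lam" by (subst (asm) has_sum_cong[of Lam]) auto
 moreover have "((%k. a k*(if k = l then 1 else 0)) has_sum a l) Lam"
 proof -
  have "((%k. a k*(if k = l then 1 else 0)) has_sum a l) {l}" using has_sum_finite[of "{l}" "%k. a k*(if k = l then 1 else 0)"] by simp
  then show ?thesis by (subst has_sum_cong_neutral[of "{l}" Lam]) (use l in auto)
 qed
 ultimately show ?thesis by (rule has_sum_unique)
qed

lemma wser_coeff_cnj:
 assumes w: "wser f a" and l: "l \<in> Lam"
 shows "av (%x. cis (l \<bullet> x) * of_real (f x)) = cnj (a l)"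
proof -
 have "cnj (av (%x. of_real (f x) * cis (- (l \<bullet> x)))) = av (%x. cnj (of_real (f x) * cis (- (l \<bullet> x))))"
  by (rule av_linear[symmetric]) (auto intro!: continuous_intros wser_cont[OF w] bounded_linear_cnj)
 then show ?thesis unfolding wser_coeff[OF w l] by (simp add: cis_cnj mult.commute)
qed

lemma wser_parseval:
 assumes f: "wser f a" and g: "wser g b"
 shows "((%k. Re (a k * cnj (b k))) has_sum av (%x. f x*g x)) Lam"
proof -
 have "((%k. a k*av (%x. cis (k \<bullet> x) * of_real (g x))) has_sum av (%x. of_real (f x) * of_real (g x))) Lam"
  by (rule av_wser_mult[OF f, where B="wnorm 0 b"]) (auto intro!: continuous_intros wser_cont[OF g] wser_bound[OF g])
 then have "((%k. a k * cnj (b k)) has_sum av (%x. complex_of_real (f x*g x))) Lam" by (subst (asm) has_sum_cong[of Lam]) (auto simp: wser_coeff_cnj[OF g])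
 moreover have "av (%x. complex_of_real (f x*g x)) = of_real (av (%x. f x*g x))"
  by (rule av_linear) (auto intro!: continuous_intros wser_cont[OF f] wser_cont[OF g] bounded_linear_of_real)
 ultimately show ?thesis using has_sum_Re by fastforce
qed

end

section \<open>Summability over the dual lattice, and the Fourier series of a function in
  \<open>Hsp\<close>\<close>

lemma summable_on_int_geometric:
 fixes r :: real
 assumes "0 <= r" "r < 1"
 shows "(%n::int. r ^ nat \<bar>n\<bar>) summable_on UNIV"
proof -
 have g: "(%n::nat. r ^ n) summable_on UNIV" by (rule norm_summable_imp_summable_on) (use assms in \<open>simp add: norm_power summable_geometric\<close>)
 have "(%n::int. r ^ nat \<bar>n\<bar>) summable_on range int" "(%n::int. r ^ nat \<bar>n\<bar>) summable_on range (%n. - int n)"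
  using g by (auto simp: summable_on_reindex inj_def o_def)
 then have "(%n::int. r ^ nat \<bar>n\<bar>) summable_on (range int \<union> range (%n. - int n))" by (rule summable_on_union)
 moreover have "range int \<union> range (%n. - int n) = UNIV" by (auto simp: image_def) (metis int_cases2)
 ultimately show ?thesis by simp
qed

lemma power_le_exp:
 fixes t c :: real
 assumes "c > 0" "t \<ge> 0"
 shows "t ^ m <= (real m/c) ^ m*exp (c*t)"
proof (cases "m = 0")
 case False
 have "c*t/m <= exp (c*t/m)" using exp_ge_add_one_self[of "c*t/m"] by linarith
 then have "(c*t/m) ^ m <= exp (c*t/m) ^ m" using assms by (intro power_mono) auto
 also have "\<dots> = exp (c*t)" using False by (simp flip: exp_of_nat_mult)
 finally have "(real m/c) ^ m*(c*t/m) ^ m <= (real m/c) ^ m*exp (c*t)" using assms by (intro mult_left_mono) auto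
 moreover have "(real m/c) ^ m*(c*t/m) ^ m = t ^ m" using assms False by (simp flip: power_mult_distrib)
 ultimately show ?thesis by simp
qed (use assms in simp)

lemma norm_le_l1norm: "norm (k::real^2) <= l1norm k"
 using norm_le_l1_cart[of k] by (simp add: l1norm_def sum_2)

lemma l1norm_nonneg: "0 <= l1norm k" by (simp add: l1norm_def)

lemma inner_le_l1norm: "\<bar>k \<bullet> v\<bar> <= l1norm k*l1norm v"
proof -
 have "\<bar>k \<bullet> v\<bar> <= \<bar>k$1\<bar>*\<bar>v$1\<bar> + \<bar>k$2\<bar>*\<bar>v$2\<bar>" unfolding inner_2 abs_mult[symmetric] by (rule abs_triangle_ineq)
 also have "\<dots> <= l1norm k*l1norm v" unfolding l1norm_def by (simp add: algebra_simps)
 finally show ?thesis .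
qed

context lattice2 begin

lemma Lam_bij: "bij_betw (%(m,n). of_int m *\<^sub>R w1 + of_int n *\<^sub>R w2) (UNIV \<times> UNIV) Lam"
proof (rule bij_betwI')
 fix x y :: "int \<times> int"
 show "((case x of (m, n) => of_int m *\<^sub>R w1 + of_int n *\<^sub>R w2) = (case y of (m, n) => of_int m *\<^sub>R w1 + of_int n *\<^sub>R w2)) = (x = y)"
 proof
  assume e: "(case x of (m, n) => of_int m *\<^sub>R w1 + of_int n *\<^sub>R w2) = (case y of (m, n) => of_int m *\<^sub>R w1 + of_int n *\<^sub>R w2)"
  have "(case x of (m, n) => of_int m *\<^sub>R w1 + of_int n *\<^sub>R w2) \<bullet> v1 = of_int (fst x)"
   "(case x of (m, n) => of_int m *\<^sub>R w1 + of_int n *\<^sub>R w2) \<bullet> v2 = of_int (snd x)" for x :: "int \<times> int"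
   by (auto simp: split_beta inner_add_left w_v)
  then show "x = y" using e by (metis of_int_eq_iff prod_eqI)
 qed auto
qed (auto simp: dual_lat_eq)

text \<open>Half of the exponential absorbs the polynomial weight. The other half is dominated by a
  product of two geometric series, since the integer coordinates k.v1 and k.v2 are bounded by a
  multiple of \<open>l1norm k\<close>.\<close>

lemma Lam_exp_summable:
 assumes s: "\<sigma> > 0"
 shows "(%k. norm k ^ m*exp (- \<sigma>*l1norm k)) summable_on Lam"
proof -
 define e where "e = (%(m,n). of_int m *\<^sub>R w1 + of_int n *\<^sub>R w2 :: real^2)"
 define M where "M = l1norm v1 + l1norm v2 + 1"
 have M: "M > 0" unfolding M_def using l1norm_nonneg[of v1] l1norm_nonneg[of v2] by simp
 define c where "c = \<sigma>/(2*M)"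
 have c: "c > 0" unfolding c_def using s M by simp
 define r where "r = exp (- c)"
 have r: "0 <= r" "r < 1" unfolding r_def using c by auto
 have low: "\<bar>real_of_int (fst p)\<bar> + \<bar>real_of_int (snd p)\<bar> <= M*l1norm (e p)" for p
 proof -
  have "e p \<bullet> v1 = of_int (fst p)" "e p \<bullet> v2 = of_int (snd p)" unfolding e_def by (auto simp: split_beta inner_add_left w_v)
  then have "\<bar>real_of_int (fst p)\<bar> + \<bar>real_of_int (snd p)\<bar> <= l1norm (e p)*l1norm v1 + l1norm (e p)*l1norm v2"
   using inner_le_l1norm[of "e p" v1] inner_le_l1norm[of "e p" v2] by simp
  also have "\<dots> <= M*l1norm (e p)" unfolding M_def using l1norm_nonneg[of "e p"] by (simp add: algebra_simps)
  finally show ?thesis .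
 qed
 have sum2: "(%p. r ^ nat \<bar>fst p\<bar>*r ^ nat \<bar>snd p\<bar>) summable_on (UNIV \<times> UNIV :: (int \<times> int) set)"
 proof -
  let ?u = "%n::int. r ^ nat \<bar>n\<bar>"
  have "((%(x,y). ?u x*?u y)) summable_on (SIGMA x:UNIV. UNIV)"
  proof (rule summable_on_SigmaI)
   show "((%y. case (x, y) of (x, y) => ?u x*?u y) has_sum ?u x*infsum ?u UNIV) UNIV" for x
    using has_sum_cmult_right[OF has_sum_infsum[OF summable_on_int_geometric[OF r]], of "?u x"] by simp
   show "(%x. ?u x*infsum ?u UNIV) summable_on UNIV" by (intro summable_on_cmult_left summable_on_int_geometric r)
  qed (use r in auto)
  then show ?thesis by (simp add: case_prod_unfold)
 qed
 define C where "C = (real m/(\<sigma>/2)) ^ m"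
 have "(%p. norm (e p) ^ m*exp (- \<sigma>*l1norm (e p))) summable_on (UNIV \<times> UNIV)"
 proof (rule summable_on_comparison_test[OF summable_on_cmult_right[OF sum2, of C]])
  fix p :: "int \<times> int"
  let ?l = "l1norm (e p)"
  have "norm (e p) ^ m <= ?l ^ m" by (intro power_mono norm_le_l1norm) auto
  also have "\<dots> <= C*exp (\<sigma>/2*?l)" unfolding C_def by (rule power_le_exp) (use s l1norm_nonneg in auto)
  finally have "norm (e p) ^ m*exp (- \<sigma>*?l) <= C*exp (\<sigma>/2*?l)*exp (- \<sigma>*?l)" by (intro mult_right_mono) auto
  also have "\<dots> = C*exp (- (\<sigma>/2)*?l)" by (simp flip: exp_add)
  also have "\<dots> <= C*exp (- c*(\<bar>real_of_int (fst p)\<bar> + \<bar>real_of_int (snd p)\<bar>))"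
  proof -
   have "c*(\<bar>real_of_int (fst p)\<bar> + \<bar>real_of_int (snd p)\<bar>) <= c*(M*?l)" using low[of p] c by (intro mult_left_mono) auto
   also have "\<dots> = \<sigma>/2*?l" unfolding c_def using M by simp
   finally show ?thesis unfolding C_def using s by (intro mult_left_mono) auto
  qed
  also have "exp (- c*(\<bar>real_of_int (fst p)\<bar> + \<bar>real_of_int (snd p)\<bar>)) = r ^ nat \<bar>fst p\<bar>*r ^ nat \<bar>snd p\<bar>"
   unfolding r_def exp_of_nat_mult[symmetric] exp_add[symmetric] by (simp add: algebra_simps)
  finally show "norm (e p) ^ m*exp (- \<sigma>*?l) <= C*(r ^ nat \<bar>fst p\<bar>*r ^ nat \<bar>snd p\<bar>)" .
 qed auto
 then show ?thesis using summable_on_reindex_bij_betw[OF Lam_bij[folded e_def], of "%k. norm k ^ m*exp (- \<sigma>*l1norm k)"] by simp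
qed

definition Kc :: "real => nat => real" where
 "Kc \<sigma> m = infsum (%k. norm k ^ m*exp (- \<sigma>*l1norm k)) Lam"

lemma Kc_nonneg: "0 <= Kc \<sigma> m"
 unfolding Kc_def by (intro infsum_nonneg) auto

lemma fcoeff_bound:
 assumes f: "f \<in> Hsp \<sigma> s v1 v2" and s: "s \<ge> 0" and k: "k \<in> Lam"
 shows "cmod (fcoeff v1 v2 f k) <= sqrt (hnorm_sq \<sigma> s v1 v2 f)*exp (- \<sigma>*l1norm k)"
proof -
 let ?a = "cmod (fcoeff v1 v2 f k)"
 have sm: "hweight \<sigma> s v1 v2 f summable_on Lam" using f by (simp add: Hsp_def)
 have nn: "0 <= hweight \<sigma> s v1 v2 f k" for k unfolding hweight_def by auto
 have "hweight \<sigma> s v1 v2 f k <= hnorm_sq \<sigma> s v1 v2 f" unfolding hnorm_sq_def using finite_sum_le_infsum[OF sm, of "{k}"] k nn by simp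
 moreover have "?a^2*1*exp (2*\<sigma>*l1norm k) <= hweight \<sigma> s v1 v2 f k" unfolding hweight_def
  by (intro mult_right_mono mult_left_mono) (use s in \<open>auto simp: jbr_def intro!: ge_one_powr_ge_zero\<close>)
 ultimately have "?a^2*exp (2*\<sigma>*l1norm k) <= hnorm_sq \<sigma> s v1 v2 f" by simp
 moreover have "?a^2*exp (2*\<sigma>*l1norm k) = (?a*exp (\<sigma>*l1norm k))^2" by (simp add: power_mult_distrib flip: exp_of_nat_mult)
 ultimately have "?a*exp (\<sigma>*l1norm k) <= sqrt (hnorm_sq \<sigma> s v1 v2 f)" by (intro real_le_rsqrt) simp
 then have "?a*exp (\<sigma>*l1norm k)*exp (- \<sigma>*l1norm k) <= sqrt (hnorm_sq \<sigma> s v1 v2 f)*exp (- \<sigma>*l1norm k)" by (intro mult_right_mono) auto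
 then show ?thesis by (simp add: mult.assoc flip: exp_add)
qed

text \<open>Conjugate symmetry of the coefficients makes the series real; it has the same
  coefficients as the continuous f and thus equals it everywhere. The second claim is linear in the
  norm of f and turns smallness in X into smallness of every derivative.\<close>

lemma Hsp_wser:
 assumes f: "f \<in> Hsp \<sigma> s v1 v2" and s: "s \<ge> 0" and sg: "\<sigma> > 0"
 shows "wser f (fcoeff v1 v2 f)"
  and "wnorm m (fcoeff v1 v2 f) <= sqrt (hnorm_sq \<sigma> s v1 v2 f)*Kc \<sigma> m"
proof -
 let ?a = "fcoeff v1 v2 f" and ?N = "sqrt (hnorm_sq \<sigma> s v1 v2 f)"
 have c: "continuous_on UNIV f" and p: "lat_periodic v1 v2 f" using f by (auto simp: Hsp_def)
 have bd: "norm k ^ m * cmod (?a k) <= ?N*(norm k ^ m*exp (- \<sigma>*l1norm k))" if "k \<in> Lam" for m k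
  using mult_left_mono[OF fcoeff_bound[OF f s that], of "norm k ^ m"] by (simp add: mult_ac)
 have sm: "(%k. norm k ^ m * cmod (?a k)) summable_on Lam" for m by (rule summable_on_comparison_test[OF summable_on_cmult_right[OF Lam_exp_summable[OF sg]] bd]) auto
 have "wnorm m ?a <= infsum (%k. ?N*(norm k ^ m*exp (- \<sigma>*l1norm k))) Lam"
  unfolding wnorm_def by (rule infsum_mono[OF sm summable_on_cmult_right[OF Lam_exp_summable[OF sg]] bd])
 then show "wnorm m ?a <= ?N*Kc \<sigma> m" by (simp add: infsum_cmult_right' Kc_def)
 define S where "S x = infsum (%k. ?a k * cis (k \<bullet> x)) Lam" for x
 have hS: "((%k. ?a k * cis (k \<bullet> x)) has_sum S x) Lam" for x unfolding S_def
  by (rule has_sum_infsum, rule abs_summable_summable) (use sm[of 0] in \<open>simp add: norm_mult\<close>)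
 have acnj: "cnj (?a k) = ?a (- k)" for k
 proof -
  have "cnj (av (%x. of_real (f x) * cis (- (k \<bullet> x)))) = av (%x. cnj (of_real (f x) * cis (- (k \<bullet> x))))"
   by (rule av_linear[symmetric]) (auto intro!: continuous_intros c bounded_linear_cnj)
  then show ?thesis unfolding fcoeff_eq_av[OF c] by (simp add: cis_cnj)
 qed
 have Sreal: "cnj (S x) = S x" for x
 proof -
  have 1: "((%k. ?a (- k) * cis ((- k) \<bullet> x)) has_sum cnj (S x)) Lam"
  proof -
   have "((%k. cnj (?a k * cis (k \<bullet> x))) has_sum cnj (S x)) Lam" using hS[of x] by (simp only: has_sum_cnj_iff)
   then show ?thesis by (simp add: acnj cis_cnj)
  qed
  have bij: "bij_betw uminus Lam Lam" by (rule bij_betwI[of _ _ _ uminus]) auto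
  have "((%k. ?a k * cis (k \<bullet> x)) has_sum cnj (S x)) Lam" using has_sum_reindex_bij_betw[OF bij, of "%k. ?a k * cis (k \<bullet> x)" "cnj (S x)"] 1 by simp
  from has_sum_unique[OF this hS] show ?thesis .
 qed
 define g where "g x = Re (S x)" for x
 have Sg: "S x = of_real (g x)" for x unfolding g_def using Sreal[of x] by (simp add: complex_eq_iff)
 have wg: "wser g ?a" unfolding wser_def using sm hS Sg by simp
 have "f x - g x = 0" for x
 proof (rule fourier_unique[of "%x. f x - g x"])
  show "continuous_on UNIV (%x. f x - g x)" by (intro continuous_intros c wser_cont[OF wg])
  show "lat_periodic v1 v2 (%x. f x - g x)" using p wser_periodic[OF wg] by (simp add: lat_periodic_def)
  fix k assume k: "k \<in> Lam"
  have "av (%x. of_real (f x) * cis (- ((- k) \<bullet> x))) = ?a (- k)" by (rule fcoeff_eq_av[OF c, symmetric])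
  moreover have "av (%x. of_real (g x) * cis (- ((- k) \<bullet> x))) = ?a (- k)" by (rule wser_coeff[OF wg]) (simp add: k)
  moreover have "av (%x. of_real (f x) * cis (k \<bullet> x) - of_real (g x) * cis (k \<bullet> x)) = av (%x. of_real (f x) * cis (k \<bullet> x)) - av (%x. of_real (g x) * cis (k \<bullet> x))"
   by (rule av_diff) (intro continuous_intros c wser_cont[OF wg])+
  ultimately show "av (%x. complex_of_real (f x - g x) * cis (k \<bullet> x)) = 0" by (simp add: left_diff_distrib)
 qed
 then have "g = f" by (auto simp: fun_eq_iff)
 then show "wser f ?a" using wg by simp
qed

end

section \<open>Maximum principle and velocity bounds\<close>

text \<open>The second derivative is asked for at one point only, which matches the pointwise second
  derivative that \<open>is_DN\<close> grants.\<close>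

lemma second_derivative_nonpos_at_max:
 fixes f f' :: "real => real"
 assumes d: "d > 0" "!!s. \<bar>s\<bar> < d ==> (f has_real_derivative f' s) (at s)"
  and dd: "(f' has_real_derivative c) (at 0)" and mx: "!!s. \<bar>s\<bar> < d ==> f s <= f 0"
 shows "c <= 0"
proof (rule ccontr)
 assume "\<not> c <= 0"
 then have c: "c > 0" by simp
 have z: "f' 0 = 0" using DERIV_local_max[of f "f' 0" 0 d] d mx by auto
 obtain d' where d': "d' > 0" "!!h. 0 < h ==> h < d' ==> f' 0 < f' (0 + h)" using DERIV_pos_inc_right[OF dd c] by auto
 define s where "s = min d d'/2"
 have s: "s > 0" "s < d" "s < d'" unfolding s_def using d d' by auto
 have "\<exists>z. 0 < z \<and> z < s \<and> f s - f 0 = (s - 0)*f' z" by (rule MVT2) (use s d in auto)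
 then obtain w where w: "0 < w" "w < s" "f s - f 0 = s*f' w" by auto
 have "f' w > 0" using d'(2)[of w] w s z by auto
 then have "f s - f 0 > 0" using w s by simp
 then show False using mx[of s] s by simp
qed

lemma sum_Basis_slab:
 fixes f :: "(real^2) \<times> real => 'b::comm_monoid_add"
 shows "(\<Sum>b\<in>Basis. f b) = f (axis 1 1, 0) + f (axis 2 1, 0) + f (0, 1)"
proof -
 have e: "(Basis :: ((real^2) \<times> real) set) = {(axis 1 1, 0), (axis 2 1, 0), (0, 1)}" unfolding Basis_prod_def Basis_vec_def UNIV_2 by auto
 have ne: "(axis 1 1 :: real^2) ~= axis 2 1" by (simp add: axis_eq_axis)
 show ?thesis unfolding e using ne by (simp add: add.assoc)
qed

lemma directional_le:
 fixes \<Phi> :: "'a::real_normed_vector => real"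
 assumes d: "(\<Phi> has_derivative D) (at p)" and t0: "t0 > 0"
  and le: "!!t. 0 < t ==> t < t0 ==> \<Phi> (p + t *\<^sub>R v) - \<Phi> p <= t*C"
 shows "D v <= C"
proof -
 have "((%t. \<Phi> (p + t *\<^sub>R v)) has_derivative (%t. D (t *\<^sub>R v))) (at 0)"
  by (rule has_derivative_compose[of "%t. p + t *\<^sub>R v" "%t. t *\<^sub>R v"]) (use d in \<open>auto intro!: derivative_eq_intros\<close>)
 moreover have "D (t *\<^sub>R v) = t*D v" for t using linear_scale[OF has_derivative_linear[OF d]] by simp
 ultimately have "((%t. \<Phi> (p + t *\<^sub>R v)) has_real_derivative D v) (at 0)" by (simp add: has_field_derivative_def mult_commute_abs)
 then have "((%t. (\<Phi> (p + t *\<^sub>R v) - \<Phi> p)/t) \<longlongrightarrow> D v) (at 0)" by (simp add: DERIV_def)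
 then have "((%t. (\<Phi> (p + t *\<^sub>R v) - \<Phi> p)/t) \<longlongrightarrow> D v) (at_right 0)" by (rule tendsto_within_subset) auto
 moreover have "\<forall>\<^sub>F t in at_right 0. (\<Phi> (p + t *\<^sub>R v) - \<Phi> p)/t <= C" using eventually_at_right_real[OF t0]
 proof eventually_elim
  case (elim t)
  then show ?case using le[of t] by (auto simp: divide_le_eq mult.commute)
 qed
 ultimately show ?thesis using tendsto_upperbound trivial_limit_at_right_real by blast
qed

context lattice2 begin

text \<open>w is perturbed by a small multiple of (y+H) + (y+H)^2. The quadratic term makes the
  Laplacian positive and excludes an interior maximum; the linear term excludes a maximum on the
  bottom where w has no downward slope there. Periodicity supplies compactness. The upper graph m
  may dip below -H, so the boundary conditions are only imposed where the slab is nonempty.\<close>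

lemma max_principle:
 fixes w :: "(real^2) \<times> real => real" and Dw :: "(real^2) \<times> real => (real^2) \<times> real" and m :: "real^2 => real"
 assumes m: "continuous_on UNIV m" "lat_periodic v1 v2 m"
  and per: "!!x \<gamma> y. \<gamma> \<in> lat v1 v2 ==> w (x + \<gamma>, y) = w (x, y)"
  and cont: "continuous_on {(x,y). -H <= y \<and> y <= m x} w"
  and d: "!!x y. -H < y ==> y < m x ==> (w has_derivative (%v. Dw (x,y) \<bullet> v)) (at (x,y)) \<and>
   (Dw has_derivative L (x,y)) (at (x,y)) \<and> (\<Sum>b\<in>Basis. L (x,y) b \<bullet> b) = 0"
  and top: "!!x. -H <= m x ==> w (x, m x) <= A"
  and bot: "!!x. -H < m x ==> w (x,-H) <= A \<or> (\<forall>e>0. \<exists>d>0. \<forall>y. -H < y \<and> y < -H+d --> w (x,y) \<ge> w (x,-H) - e*(y+H))"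
  and xy: "-H <= y0" "y0 <= m x0"
 shows "w (x0,y0) <= A"
proof (rule ccontr)
 assume "\<not> w (x0,y0) <= A"
 then have big: "w (x0,y0) > A" by simp
 obtain M where M: "M > 0" "!!x. norm (m x) <= M" using periodic_bounded[OF m] by blast
 define R where "R = M + \<bar>H\<bar>"
 have R: "R > 0" using M unfolding R_def by auto
 \<comment> \<open>R bounds y + H on the domain, so the perturbation eats at most half of the excess
   of w over A.\<close>
 define \<epsilon> where "\<epsilon> = (w (x0,y0) - A)/(2*(R + R^2))"
 have RR: "R + R^2 > 0" using R by (intro add_pos_pos) auto
 have eps: "\<epsilon> > 0" unfolding \<epsilon>_def using big RR by (intro divide_pos_pos mult_pos_pos) auto
 define q where "q y = (y + H) + (y + H)^2" for y :: real
 define W where "W p = w p + \<epsilon>*q (snd p)" for p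
 define Dom where "Dom = {(x,y). -H <= y \<and> y <= m x}"
 define K where "K = {p \<in> Dom. fst p \<in> pt ` cbox (0,0) (1,1)}"
 have cm: "continuous_on UNIV (%p::(real^2)\<times>real. m (fst p))" by (rule continuous_on_compose2[OF m(1)]) (auto intro!: continuous_intros)
 have clD: "closed Dom"
 proof -
  have "Dom = {p. -H <= snd p} \<inter> {p. snd p <= m (fst p)}" unfolding Dom_def by auto
  then show ?thesis by (auto intro!: closed_Int closed_Collect_le continuous_intros cm)
 qed
 have cC: "compact (pt ` cbox (0,0) (1,1))" by (intro compact_continuous_image compact_cbox) (auto intro!: continuous_intros)
 have "snd p \<in> {-M-\<bar>H\<bar>..M}" if "p \<in> Dom" for p using M(2)[of "fst p"] M(1) that unfolding Dom_def by (auto simp: abs_le_iff)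
 then have "K = Dom \<inter> (pt ` cbox (0,0) (1,1) \<times> {-M-\<bar>H\<bar>..M})" by (intro set_eqI) (simp add: K_def mem_Times_iff del: atLeastAtMost_iff, blast)
 then have cK: "compact K" using clD compact_Int_closed[OF compact_Times[OF cC compact_Icc]] by (metis Int_commute)
 have red: "\<exists>x'. (x', y) \<in> K \<and> W (x', y) = W (x, y)" if "(x,y) \<in> Dom" for x y
 proof -
  obtain t where t: "t \<in> cbox (0,0) (1,1)" "x - pt t \<in> lat v1 v2" by (rule reduce_cell)
  have "w (pt t + (x - pt t), y) = w (pt t, y)" "m (pt t + (x - pt t)) = m (pt t)" by (rule per[OF t(2)], rule periodic_lat[OF m(2) t(2)])
  then show ?thesis using that t unfolding K_def W_def Dom_def by (intro exI[of _ "pt t"]) auto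
 qed
 have x0D: "(x0,y0) \<in> Dom" using xy unfolding Dom_def by simp
 have ne: "K ~= {}" using red[OF x0D] by blast
 have cW: "continuous_on K W" unfolding W_def q_def using continuous_on_subset[OF cont, of K] unfolding K_def Dom_def by (auto intro!: continuous_intros)
 obtain p where p: "p \<in> K" "!!r. r \<in> K ==> W r <= W p" using continuous_attains_sup[OF cK ne cW] by blast
 have maxD: "W r <= W p" if "r \<in> Dom" for r using red[of "fst r" "snd r"] that p(2) by (metis prod.collapse)
 obtain x y where pxy: "p = (x,y)" by (cases p)
 have pD: "-H <= y" "y <= m x" using p(1) unfolding K_def Dom_def pxy by auto
 have qle: "q y <= R + R^2"
 proof -
  have "0 <= y + H" "y + H <= R" using pD M(2)[of x] unfolding R_def by auto
  then show ?thesis unfolding q_def by (intro add_mono power_mono) auto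
 qed
 have q0: "0 <= q y0" using xy unfolding q_def by simp
 have wp: "w p > A"
 proof -
  have "w (x0,y0) <= W (x0,y0)" unfolding W_def using q0 eps by simp
  also have "\<dots> <= W p" by (rule maxD[OF x0D])
  also have "\<dots> <= w p + \<epsilon>*(R + R^2)" unfolding W_def pxy using qle eps by simp
  also have "\<epsilon>*(R + R^2) = (w (x0,y0) - A)/2" unfolding \<epsilon>_def using RR by (simp add: field_simps)
  finally show ?thesis using big by (simp add: field_simps)
 qed
 have ym: "y < m x" using top[of x] pD wp unfolding pxy by (cases "y = m x") auto
 show False
 proof (cases "y = -H")
  case True
  \<comment> \<open>Here w exceeds A, so the second alternative of \<open>bot\<close> holds; it is
    used with half the slope of the linear perturbation.\<close>
  then obtain d where d: "d > 0" "!!y. -H < y ==> y < -H+d ==> w (x,y) \<ge> w (x,-H) - (\<epsilon>/2)*(y+H)"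
   using bot[of x] wp ym eps unfolding pxy by (metis half_gt_zero not_le)
  define r where "r = min d (m x + H)/2"
  have r: "r > 0" "r < d" "r < m x + H" unfolding r_def using d ym True by auto
  have "w (x,-H+r) \<ge> w (x,-H) - (\<epsilon>/2)*r" using d(2)[of "-H+r"] r by simp
  then have "W (x,-H+r) \<ge> w (x,-H) + (\<epsilon>/2)*r + \<epsilon>*r^2" unfolding W_def q_def by (simp add: algebra_simps)
  moreover have "(\<epsilon>/2)*r > 0" "\<epsilon>*r^2 > 0" using eps r by auto
  ultimately have "W (x,-H+r) > w (x,-H)" by linarith
  moreover have "W p = w (x,-H)" unfolding W_def pxy q_def True by simp
  moreover have "W (x,-H+r) <= W p" by (rule maxD) (use r in \<open>auto simp: Dom_def\<close>)
  ultimately show False by simp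
 next
  case False
  then have yH: "-H < y" using pD by simp
  let ?U = "{p::(real^2)\<times>real. -H < snd p} \<inter> {p. snd p < m (fst p)}"
  have "open ?U" by (intro open_Int open_Collect_less continuous_intros cm)
  moreover have "p \<in> ?U" using yH ym pxy by simp
  ultimately obtain e where e: "e > 0" "ball p e \<subseteq> ?U" using open_contains_ball by blast
  have le0: "L p b \<bullet> b + 2*\<epsilon>*(snd b)^2 <= 0" if b: "b \<in> Basis" for b
  proof -
   have inU: "p + s *\<^sub>R b \<in> ?U" if "\<bar>s\<bar> < e" for s
   proof -
    have "p + s *\<^sub>R b \<in> ball p e" using that b by (simp add: dist_norm)
    then show ?thesis using e(2) by blast
   qed
   define f where "f s = W (p + s *\<^sub>R b)" for s
   define f' where "f' s = Dw (p + s *\<^sub>R b) \<bullet> b + \<epsilon>*(snd b + 2*(y + H + s * snd b) * snd b)" for s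
   have sn: "snd (p + s *\<^sub>R b) = y + s * snd b" for s by (simp add: pxy)
   have lin: "((%s. p + s *\<^sub>R b) has_derivative (%s. s *\<^sub>R b)) (at s)" for s by (auto intro!: derivative_eq_intros)
   show ?thesis
   proof (rule second_derivative_nonpos_at_max[OF e(1), of f f'])
    fix s :: real assume s: "\<bar>s\<bar> < e"
    have "(w has_derivative (%v. Dw (p + s *\<^sub>R b) \<bullet> v)) (at (p + s *\<^sub>R b))"
    proof -
     obtain x' y' where q: "p + s *\<^sub>R b = (x',y')" by (cases "p + s *\<^sub>R b")
     show ?thesis using d[of y' x'] inU[OF s] unfolding q by simp
    qed
    from has_derivative_compose[OF lin this]
    have "((%s. w (p + s *\<^sub>R b)) has_real_derivative Dw (p + s *\<^sub>R b) \<bullet> b) (at s)" by (simp add: has_field_derivative_def mult_commute_abs)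
    then show "(f has_real_derivative f' s) (at s)" unfolding f_def f'_def W_def q_def sn by (auto intro!: derivative_eq_intros simp: algebra_simps)
    show "f s <= f 0" unfolding f_def using maxD[of "p + s *\<^sub>R b"] inU[OF s] by (auto simp: Dom_def split_beta)
   next
    have "(Dw has_derivative L p) (at (p + 0 *\<^sub>R b))" using d[OF yH ym] pxy by simp
    from has_derivative_compose[OF lin this]
    have "((%s. Dw (p + s *\<^sub>R b) \<bullet> b) has_derivative (%s. L p (s *\<^sub>R b) \<bullet> b)) (at 0)" by (intro has_derivative_inner_left)
    moreover have "L p (s *\<^sub>R b) \<bullet> b = s*(L p b \<bullet> b)" for s
    proof -
     have "linear (L p)" using d[OF yH ym] has_derivative_linear unfolding pxy by blast
     from linear_scale[OF this] show ?thesis by simp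
    qed
    ultimately have "((%s. Dw (p + s *\<^sub>R b) \<bullet> b) has_real_derivative L p b \<bullet> b) (at 0)" by (simp add: has_field_derivative_def mult_commute_abs)
    then show "(f' has_real_derivative L p b \<bullet> b + 2*\<epsilon>*(snd b)^2) (at 0)"
     unfolding f'_def by (auto intro!: derivative_eq_intros simp: power2_eq_square algebra_simps)
   qed
  qed
  have "(\<Sum>b\<in>Basis. L p b \<bullet> b + 2*\<epsilon>*(snd b)^2) <= 0" by (rule sum_nonpos) (rule le0)
  moreover have "(\<Sum>b\<in>Basis. L p b \<bullet> b) = 0" using d[OF yH ym] pxy by simp
  moreover have "(\<Sum>b\<in>(Basis::((real^2)\<times>real) set). 2*\<epsilon>*(snd b)^2) = 2*\<epsilon>" by (simp add: sum_Basis_slab)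
  ultimately show False using eps by (simp add: sum.distrib)
 qed
qed

end

section \<open>Potentials of the Dirichlet-Neumann problem and the bound on their gradient\<close>

context lattice2 begin

text \<open>The part of \<open>is_DN\<close> that mentions neither the trace nor G. It is invariant
  under a change of sign of the potential, so one-sided bounds become two-sided.\<close>

definition dn_pot :: "ereal => (real^2 => real) => ((real^2) \<times> real => real) => ((real^2) \<times> real => (real^2) \<times> real)
  => ((real^2) \<times> real => (real^2) \<times> real => (real^2) \<times> real) => bool" where
 "dn_pot h \<eta> \<Phi> D\<Phi> L \<longleftrightarrow>
   (\<forall>x. - h < ereal (\<eta> x)) \<and>
   (\<forall>x y. \<forall>\<gamma>\<in>lat v1 v2. \<Phi> (x + \<gamma>, y) = \<Phi> (x, y)) \<and>
   (\<forall>p \<in> {(x, y). - h < ereal y \<and> y < \<eta> x}.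
     (\<Phi> has_derivative (%w. D\<Phi> p \<bullet> w)) (at p) \<and>
     (D\<Phi> has_derivative L p) (at p) \<and>
     (\<Sum>b\<in>Basis. L p b \<bullet> b) = 0) \<and>
   continuous_on {(x, y). - h <= ereal y \<and> y <= \<eta> x} \<Phi> \<and>
   continuous_on {(x, y). - h <= ereal y \<and> y <= \<eta> x} D\<Phi> \<and>
   (h ~= \<infinity> --> (\<forall>x. snd (D\<Phi> (x, - real_of_ereal h)) = 0)) \<and>
   (h = \<infinity> --> (\<forall>e>0. \<exists>M. \<forall>p \<in> {(x, y). y < \<eta> x}. snd p < - M --> norm (D\<Phi> p) < e))"

lemma is_DN_iff: "is_DN h v1 v2 \<eta> \<psi> G \<longleftrightarrow> (\<exists>\<Phi> D\<Phi> L. dn_pot h \<eta> \<Phi> D\<Phi> L \<and> (\<forall>x. \<Phi> (x, \<eta> x) = \<psi> x) \<and>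
  (\<forall>x. G x = snd (D\<Phi> (x, \<eta> x)) - grad2 \<eta> x \<bullet> fst (D\<Phi> (x, \<eta> x))))"
 unfolding is_DN_def dn_pot_def by (intro iffI; elim exE conjE; intro exI conjI; assumption)

lemma dn_pot_minus:
 assumes "dn_pot h \<eta> \<Phi> D\<Phi> L"
 shows "dn_pot h \<eta> (%p. - \<Phi> p) (%p. - D\<Phi> p) (%p v. - L p v)"
proof -
 have "((%p. - \<Phi> p) has_derivative (%w. - D\<Phi> p \<bullet> w)) (at p) \<and> ((%p. - D\<Phi> p) has_derivative (%v. - L p v)) (at p) \<and>
   (\<Sum>b\<in>Basis. - L p b \<bullet> b) = 0" if "p \<in> {(x, y). - h < ereal y \<and> y < \<eta> x}" for p
 proof -
  have a: "(\<Phi> has_derivative (%w. D\<Phi> p \<bullet> w)) (at p)" "(D\<Phi> has_derivative L p) (at p)" "(\<Sum>b\<in>Basis. L p b \<bullet> b) = 0"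
   using assms that unfolding dn_pot_def by blast+
  show ?thesis using has_derivative_minus[OF a(1)] has_derivative_minus[OF a(2)] a(3) by (simp add: sum_negf)
 qed
 then have 1: "\<forall>p \<in> {(x, y). - h < ereal y \<and> y < \<eta> x}.
   ((%p. - \<Phi> p) has_derivative (%w. - D\<Phi> p \<bullet> w)) (at p) \<and> ((%p. - D\<Phi> p) has_derivative (%v. - L p v)) (at p) \<and>
   (\<Sum>b\<in>Basis. - L p b \<bullet> b) = 0" by blast
 have 2: "continuous_on {(x, y). - h <= ereal y \<and> y <= \<eta> x} (%p. - \<Phi> p)"
  "continuous_on {(x, y). - h <= ereal y \<and> y <= \<eta> x} (%p. - D\<Phi> p)" by (rule continuous_on_minus, use assms in \<open>simp only: dn_pot_def\<close>)+
 show ?thesis using assms 1 2 unfolding dn_pot_def snd_uminus norm_minus_cancel neg_equal_iff_equal neg_equal_0_iff_equal by (elim conjE, intro conjI) assumption+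
qed

lemma dn_pot_interior:
 assumes "dn_pot h \<eta> \<Phi> D\<Phi> L" "- h < ereal y" "y < \<eta> x"
 shows "(\<Phi> has_derivative (%w. D\<Phi> (x,y) \<bullet> w)) (at (x,y))" "(D\<Phi> has_derivative L (x,y)) (at (x,y))"
  "(\<Sum>b\<in>Basis. L (x,y) b \<bullet> b) = 0" using assms unfolding dn_pot_def by auto

lemma dn_pot_grad_periodic:
 assumes p: "dn_pot h \<eta> \<Phi> D\<Phi> L" and per: "lat_periodic v1 v2 \<eta>" and y: "- h < ereal y" "y < \<eta> x" and g: "\<gamma> \<in> lat v1 v2"
 shows "D\<Phi> (x + \<gamma>, y) = D\<Phi> (x, y)"
proof -
 have e: "\<eta> (x + \<gamma>) = \<eta> x" by (rule periodic_lat[OF per g])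
 have "((%q. q + (\<gamma>,0)) has_derivative (%w. w)) (at (x,y))" by (auto intro!: derivative_eq_intros)
 from has_derivative_compose[OF this, of \<Phi> "%w. D\<Phi> (x+\<gamma>,y) \<bullet> w"]
 have "((%q. \<Phi> (q + (\<gamma>,0))) has_derivative (%w. D\<Phi> (x+\<gamma>,y) \<bullet> w)) (at (x,y))"
  using dn_pot_interior(1)[OF p y(1), of "x + \<gamma>"] y e by simp
 moreover have "(%q. \<Phi> (q + (\<gamma>,0))) = \<Phi>" using p g unfolding dn_pot_def by (auto simp: fun_eq_iff)
 ultimately have "(%w. D\<Phi> (x+\<gamma>,y) \<bullet> w) = (%w. D\<Phi> (x,y) \<bullet> w)" using has_derivative_unique[OF _ dn_pot_interior(1)[OF p y]] by simp
 then have "\<forall>w. D\<Phi> (x+\<gamma>,y) \<bullet> w = D\<Phi> (x,y) \<bullet> w" by meson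
 then show ?thesis using vector_eq_rdot by blast
qed

lemma compact_cell: "compact (pt ` cbox (0,0) (1,1))"
 by (intro compact_continuous_image compact_cbox) (auto intro!: continuous_intros)

lemma uniform_near_face:
 fixes G :: "(real^2) \<times> real => 'b::real_normed_vector"
 assumes c: "continuous_on (pt ` cbox (0,0) (1,1) \<times> {0..r}) G" and r: "r > 0" and e: "e > 0"
 obtains \<tau> where "\<tau> > 0" "\<tau> <= r" "!!x s. x \<in> pt ` cbox (0,0) (1,1) ==> 0 <= s ==> s < \<tau> ==> norm (G (x,s) - G (x,0)) < e"
proof -
 have "uniformly_continuous_on (pt ` cbox (0,0) (1,1) \<times> {0..r}) G" by (rule compact_uniformly_continuous[OF c]) (intro compact_Times compact_cell compact_Icc)
 then obtain d where d: "d > 0" "!!p q. p \<in> pt ` cbox (0,0) (1,1) \<times> {0..r} ==> q \<in> pt ` cbox (0,0) (1,1) \<times> {0..r} ==> dist q p < d ==> dist (G q) (G p) < e"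
  unfolding uniformly_continuous_on_def using e by metis
 show ?thesis
 proof (rule that[of "min d r"])
  fix x s assume x: "x \<in> pt ` cbox (0,0) (1,1)" and s: "0 <= s" "s < min d r"
  have "dist (x,s) (x,0) < d" using s by (simp add: dist_Pair_Pair)
  then show "norm (G (x,s) - G (x,0)) < e" using d(2)[of "(x,0)" "(x,s)"] x s r by (simp add: dist_norm)
 qed (use d r in auto)
qed

lemma dn_pot_cont:
 assumes "dn_pot h \<eta> \<Phi> D\<Phi> L"
 shows "continuous_on {(x, y). - h <= ereal y \<and> y <= \<eta> x} \<Phi>" "continuous_on {(x, y). - h <= ereal y \<and> y <= \<eta> x} D\<Phi>"
 using assms unfolding dn_pot_def by auto

text \<open>In the coordinates (x, depth below the surface) a strip over one cell is a compact
  product. Uniform continuity of the gradient there gives a strip of uniform thickness, and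
  periodicity spreads it over all x.\<close>

lemma dn_pot_near_surface:
 assumes p: "dn_pot h \<eta> \<Phi> D\<Phi> L" and \<eta>: "continuous_on UNIV \<eta>" "lat_periodic v1 v2 \<eta>"
  and S: "!!x. norm (D\<Phi> (x, \<eta> x)) <= S" and e: "e > 0"
 obtains \<tau> where "\<tau> > 0" "!!x y. - h < ereal y ==> \<eta> x - \<tau> < y ==> y < \<eta> x ==> norm (D\<Phi> (x,y)) <= S + e"
proof -
 let ?C = "pt ` cbox (0,0) (1,1)"
 obtain r where r: "r > 0" "!!x. x \<in> ?C ==> - h <= ereal (\<eta> x - r)"
 proof (cases h)
  case (real hr)
  have "?C ~= {}" by (auto simp: cbox_Pair_eq)
  then obtain x0 where x0: "x0 \<in> ?C" "!!x. x \<in> ?C ==> \<eta> x0 <= \<eta> x"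
   using continuous_attains_inf[OF compact_cell _ continuous_on_subset[OF \<eta>(1)]] by blast
  have "-h < ereal (\<eta> x0)" using p unfolding dn_pot_def by blast
  then have "0 < \<eta> x0 + hr" using real by simp
  then show ?thesis using that[of "\<eta> x0 + hr"] x0(2) real by force
 next
  case PInf then show ?thesis using that[of 1] by simp
 next
  case MInf then show ?thesis using p unfolding dn_pot_def by auto
 qed
 have "continuous_on (?C \<times> {0..r}) (%(x,s). D\<Phi> (x, \<eta> x - s))" unfolding split_beta
 proof (rule continuous_on_compose2[OF dn_pot_cont(2)[OF p]])
  show "continuous_on (?C \<times> {0..r}) (%p. (fst p, \<eta> (fst p) - snd p))" by (intro continuous_intros continuous_on_compose2[OF \<eta>(1)]) auto
  show "(%p. (fst p, \<eta> (fst p) - snd p)) ` (?C \<times> {0..r}) \<subseteq> {(x, y). - h <= ereal y \<and> y <= \<eta> x}"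
  proof
   fix z assume "z \<in> (%p. (fst p, \<eta> (fst p) - snd p)) ` (?C \<times> {0..r})"
   then obtain x s where z: "z = (x, \<eta> x - s)" "x \<in> ?C" "0 <= s" "s <= r" by auto
   then have "- h <= ereal (\<eta> x - r)" "ereal (\<eta> x - r) <= ereal (\<eta> x - s)" using r(2) by auto
   then have "- h <= ereal (\<eta> x - s)" by (rule order_trans)
   then show "z \<in> {(x, y). - h <= ereal y \<and> y <= \<eta> x}" using z by simp
  qed
 qed
 from uniform_near_face[OF this r(1) e] obtain \<tau> where \<tau>: "\<tau> > 0" "\<tau> <= r"
  "!!x s. x \<in> ?C ==> 0 <= s ==> s < \<tau> ==> norm (D\<Phi> (x, \<eta> x - s) - D\<Phi> (x, \<eta> x)) < e" by auto
 show ?thesis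
 proof (rule that[OF \<tau>(1)])
  fix x y assume y: "- h < ereal y" "\<eta> x - \<tau> < y" "y < \<eta> x"
  obtain t where t: "t \<in> cbox (0,0) (1,1)" "x - pt t \<in> lat v1 v2" by (rule reduce_cell)
  have "\<eta> (pt t + (x - pt t)) = \<eta> (pt t)" by (rule periodic_lat[OF \<eta>(2) t(2)])
  then have e1: "\<eta> x = \<eta> (pt t)" by simp
  have "D\<Phi> (pt t + (x - pt t), y) = D\<Phi> (pt t, y)" by (rule dn_pot_grad_periodic[OF p \<eta>(2) y(1) _ t(2)]) (use y e1 in simp)
  then have e2: "D\<Phi> (x,y) = D\<Phi> (pt t, y)" by simp
  have "norm (D\<Phi> (pt t, \<eta> (pt t) - (\<eta> x - y)) - D\<Phi> (pt t, \<eta> (pt t))) < e" by (rule \<tau>(3)) (use t y in auto)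
  then have "norm (D\<Phi> (x,y) - D\<Phi> (pt t, \<eta> (pt t))) < e" unfolding e1 e2 by simp
  then show "norm (D\<Phi> (x,y)) <= S + e" using S[of "pt t"] norm_triangle_sub[of "D\<Phi> (x,y)" "D\<Phi> (pt t, \<eta> (pt t))"] by linarith
 qed
qed

text \<open>The same uniform continuity at the flat bottom, where the vertical velocity vanishes.
  That the strip stays below the surface is recorded as well, because it later keeps a lowered
  surface above the bottom.\<close>

lemma dn_pot_near_bottom:
 assumes p: "dn_pot (ereal hr) \<eta> \<Phi> D\<Phi> L" and \<eta>: "continuous_on UNIV \<eta>" "lat_periodic v1 v2 \<eta>" and e: "e > 0"
 obtains \<tau> where "\<tau> > 0" "!!x y. - hr < y ==> y < - hr + \<tau> ==> y < \<eta> x \<and> \<bar>snd (D\<Phi> (x,y))\<bar> <= e"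
proof -
 let ?C = "pt ` cbox (0,0) (1,1)"
 have "?C ~= {}" by (auto simp: cbox_Pair_eq)
 then obtain x0 where x0: "x0 \<in> ?C" "!!x. x \<in> ?C ==> \<eta> x0 <= \<eta> x"
  using continuous_attains_inf[OF compact_cell _ continuous_on_subset[OF \<eta>(1)]] by blast
 have "- ereal hr < ereal (\<eta> x0)" using p unfolding dn_pot_def by blast
 then have r: "0 < \<eta> x0 + hr" by simp
 let ?r = "\<eta> x0 + hr"
 have "continuous_on (?C \<times> {0..?r}) (%(x,s). snd (D\<Phi> (x, - hr + s)))" unfolding split_beta
 proof (intro continuous_intros, rule continuous_on_compose2[OF dn_pot_cont(2)[OF p]])
  show "continuous_on (?C \<times> {0..?r}) (%p. (fst p, - hr + snd p))" by (intro continuous_intros)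
  show "(%p. (fst p, - hr + snd p)) ` (?C \<times> {0..?r}) \<subseteq> {(x, y). - ereal hr <= ereal y \<and> y <= \<eta> x}" using x0(2) by force
 qed
 from uniform_near_face[OF this r e] obtain \<tau> where \<tau>: "\<tau> > 0" "\<tau> <= ?r"
  "!!x s. x \<in> ?C ==> 0 <= s ==> s < \<tau> ==> norm (snd (D\<Phi> (x, - hr + s)) - snd (D\<Phi> (x, - hr + 0))) < e" by auto
 have b0: "snd (D\<Phi> (x, - hr)) = 0" for x using p unfolding dn_pot_def by auto
 show ?thesis
 proof (rule that[OF \<tau>(1)])
  fix x y assume y: "- hr < y" "y < - hr + \<tau>"
  obtain t where t: "t \<in> cbox (0,0) (1,1)" "x - pt t \<in> lat v1 v2" by (rule reduce_cell)
  have "\<eta> (pt t + (x - pt t)) = \<eta> (pt t)" by (rule periodic_lat[OF \<eta>(2) t(2)])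
  then have e1: "\<eta> x = \<eta> (pt t)" by simp
  have ylt: "y < \<eta> x" using y \<tau>(2) x0(2)[of "pt t"] t(1) unfolding e1 by auto
  have "D\<Phi> (pt t + (x - pt t), y) = D\<Phi> (pt t, y)" by (rule dn_pot_grad_periodic[OF p \<eta>(2) _ _ t(2)]) (use y ylt e1 in auto)
  then have e2: "D\<Phi> (x,y) = D\<Phi> (pt t, y)" by simp
  have "norm (snd (D\<Phi> (pt t, - hr + (y + hr))) - snd (D\<Phi> (pt t, - hr + 0))) < e" by (rule \<tau>(3)) (use t y in auto)
  then show "y < \<eta> x \<and> \<bar>snd (D\<Phi> (x,y))\<bar> <= e" unfolding e2 using b0 ylt by simp
 qed
qed

lemma dn_pot_directional_bound:
 fixes b :: "real^2" and \<beta> :: real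
 assumes p: "dn_pot h \<eta> \<Phi> D\<Phi> L" and h: "h > 0" and \<eta>: "continuous_on UNIV \<eta>" "lat_periodic v1 v2 \<eta>"
  and lip: "!!x x'. \<bar>\<eta> x - \<eta> x'\<bar> <= lam*norm (x - x')" and lam: "lam \<ge> 0"
  and S: "!!x. norm (D\<Phi> (x, \<eta> x)) <= S" and v: "\<beta> = 0 \<or> (\<beta> = 1 \<and> b = 0)"
  and y0: "- h < ereal y0" "y0 < \<eta> x0"
 shows "D\<Phi> (x0,y0) \<bullet> (b,\<beta>) <= S*norm (b,\<beta>)"
proof -
 let ?v = "(b,\<beta>)"
 \<comment> \<open>Lowering the surface by \<open>K*t\<close> compensates its slope along b and the
   vertical shift, with 1 to spare so that the segments stay strictly inside.\<close>
 define K where "K = lam*norm b + \<bar>\<beta>\<bar> + 1"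
 have K: "K \<ge> 1" unfolding K_def using lam by simp
 have S0: "S \<ge> 0" using S[of 0] norm_ge_zero order_trans by blast
 have b0: "\<beta> \<ge> 0" using v by auto
 have seg: "y + s*\<beta> < \<eta> (x + s *\<^sub>R b) \<and> \<eta> (x + s *\<^sub>R b) <= y + s*\<beta> + (\<eta> x - K*t - y) + 2*K*t"
  if "0 <= s" "s <= t" "t > 0" "y <= \<eta> x - K*t" for x y s t
 proof -
  have "\<bar>\<eta> (x + s *\<^sub>R b) - \<eta> x\<bar> <= lam*(s*norm b)" using lip[of "x + s *\<^sub>R b" x] that by simp
  also have "\<dots> <= lam*(t*norm b)" using that lam by (intro mult_left_mono mult_right_mono) auto
  finally have 1: "\<bar>\<eta> (x + s *\<^sub>R b) - \<eta> x\<bar> <= t*(lam*norm b)" by (simp add: mult_ac)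
  have 2: "s*\<beta> <= t*\<bar>\<beta>\<bar>" "0 <= s*\<beta>" using that b0 by (auto intro!: mult_mono)
  have 3: "K*t = t*(lam*norm b) + t*\<bar>\<beta>\<bar> + t" unfolding K_def by (simp add: algebra_simps)
  show ?thesis using 1 2 3 that by (auto simp: abs_le_iff)
 qed
 have main: "D\<Phi> (x0,y0) \<bullet> ?v <= (S + e)*norm ?v" if e: "e > 0" for e
 proof -
  obtain \<tau>1 where \<tau>1: "\<tau>1 > 0" "!!x y. - h < ereal y ==> \<eta> x - \<tau>1 < y ==> y < \<eta> x ==> norm (D\<Phi> (x,y)) <= S + e"
   using dn_pot_near_surface[OF p \<eta> S e] by metis
  obtain \<tau>2 where \<tau>2: "\<tau>2 > 0" "!!x y. h ~= \<infinity> ==> - real_of_ereal h < y ==> y < - real_of_ereal h + \<tau>2 ==> y < \<eta> x \<and> \<bar>snd (D\<Phi> (x,y))\<bar> <= e"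
  proof (cases h)
   case (real hr) then show ?thesis using dn_pot_near_bottom[OF p[unfolded real] \<eta> e] that by auto
  qed (use h that[of 1] in auto)
  obtain M where M: "!!x y. h = \<infinity> ==> y < \<eta> x ==> y < - M ==> norm (D\<Phi> (x,y)) < e"
   using p e unfolding dn_pot_def by (metis (mono_tags, lifting) case_prodI mem_Collect_eq snd_conv)
  define t0 where "t0 = Min {\<tau>1/(2*K), \<tau>2/K, (\<eta> x0 - y0)/K}"
  have t0: "t0 > 0" "t0 <= \<tau>1/(2*K)" "t0 <= \<tau>2/K" "t0 <= (\<eta> x0 - y0)/K" unfolding t0_def using \<tau>1 \<tau>2 y0 K by auto
  show ?thesis
  proof (rule directional_le[OF dn_pot_interior(1)[OF p y0] t0(1)])
   fix t :: real assume t: "0 < t" "t < t0"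
   have "t < \<tau>1/(2*K)" "t < \<tau>2/K" "t < (\<eta> x0 - y0)/K" using t t0 by linarith+
   then have t': "2*K*t < \<tau>1" "K*t < \<tau>2" "K*t < \<eta> x0 - y0" using K by (auto simp: field_simps)
   have t2: "t < \<tau>2" using t'(2) mult_right_mono[OF K, of t] t by linarith
   define m where "m x = \<eta> x - K*t" for x
   \<comment> \<open>In infinite depth the artificial bottom lies so deep that segments of length t
     starting there remain below -M, where the gradient is smaller than e; it also lies below
     y0.\<close>
   define H where "H = (if h = \<infinity> then max (M + t + 1) (1 - y0) else real_of_ereal h)"
   define w where "w q = \<Phi> (q + t *\<^sub>R ?v) - \<Phi> q" for q
   define A where "A = t*((S + e)*norm ?v)"
   have A0: "A \<ge> 0" unfolding A_def using t S0 e by simp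
   have Hh: "- h <= ereal (-H)" unfolding H_def using h by (cases h) auto
   have inn: "- h < ereal y" if "-H < y" for y
   proof -
    have "ereal (-H) < ereal y" using that by simp
    then show ?thesis using Hh by (rule le_less_trans[rotated])
   qed
   have inn': "- h <= ereal y" if "-H <= y" for y using Hh that by (meson ereal_less_eq(3) order_trans)
   have y0H: "-H <= y0" using y0 h unfolding H_def by (cases h) auto
   have mvt_seg: "\<exists>s. 0 < s \<and> s < t \<and> w (x,y) = t*(D\<Phi> (x + s *\<^sub>R b, y + s*\<beta>) \<bullet> ?v)"
    if y: "-H <= y" "y <= m x" and int: "!!s. 0 < s ==> s < t ==> - h < ereal (y + s*\<beta>)" for x y
   proof -
    have sg: "y + s*\<beta> < \<eta> (x + s *\<^sub>R b)" if "0 <= s" "s <= t" for s using seg[OF that t(1), of y x] y unfolding m_def by simp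
    have lo: "- h <= ereal (y + s*\<beta>)" if "0 <= s" for s by (rule inn') (use y mult_nonneg_nonneg[OF that b0] in linarith)
    obtain s where s: "0 < s" "s < t"
     "\<Phi> ((x,y) + t *\<^sub>R ?v) - \<Phi> ((x,y) + 0 *\<^sub>R ?v) = D\<Phi> (x + s *\<^sub>R b, y + s*\<beta>) \<bullet> ((t - 0) *\<^sub>R ?v)"
    proof (rule mvt[of 0 t "%s. \<Phi> ((x,y) + s *\<^sub>R ?v)" "%s u. D\<Phi> (x + s *\<^sub>R b, y + s*\<beta>) \<bullet> (u *\<^sub>R ?v)"])
     show "continuous_on {0..t} (%s. \<Phi> ((x,y) + s *\<^sub>R ?v))" by (rule continuous_on_compose2[OF dn_pot_cont(1)[OF p]])
       (use sg lo in \<open>auto intro!: continuous_intros simp: less_imp_le\<close>)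
     fix s assume s: "0 < s" "s < t"
     have "((%s. (x,y) + s *\<^sub>R ?v) has_derivative (%u. u *\<^sub>R ?v)) (at s)" by (auto intro!: derivative_eq_intros)
     from has_derivative_compose[OF this, of \<Phi> "%w. D\<Phi> (x + s *\<^sub>R b, y + s*\<beta>) \<bullet> w"]
     show "((%s. \<Phi> ((x,y) + s *\<^sub>R ?v)) has_derivative (%u. D\<Phi> (x + s *\<^sub>R b, y + s*\<beta>) \<bullet> (u *\<^sub>R ?v))) (at s)"
      using dn_pot_interior(1)[OF p int[OF s], of "x + s *\<^sub>R b"] sg[of s] s by simp
    qed (use t in auto)
    then show ?thesis unfolding w_def by (intro exI[of _ s]) (simp add: zero_prod_def[symmetric] del: scaleR_Pair)
   qed
   have bdseg: "w (x,y) <= A"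
    if y: "-H <= y" "y <= m x" and int: "!!s. 0 < s ==> s < t ==> - h < ereal (y + s*\<beta>)"
     and nb: "!!s. 0 < s ==> s < t ==> D\<Phi> (x + s *\<^sub>R b, y + s*\<beta>) \<bullet> ?v <= (S + e)*norm ?v" for x y
   proof -
    obtain s where s: "0 < s" "s < t" "w (x,y) = t*(D\<Phi> (x + s *\<^sub>R b, y + s*\<beta>) \<bullet> ?v)" using mvt_seg[OF y int] by blast
    show ?thesis unfolding A_def s(3) using nb[OF s(1,2)] t by (intro mult_left_mono) auto
   qed
   have "w (x0,y0) <= A"
   proof (rule max_principle[of m w H "%q. D\<Phi> (q + t *\<^sub>R ?v) - D\<Phi> q" "%q u. L (q + t *\<^sub>R ?v) u - L q u"])
    show "continuous_on UNIV m" unfolding m_def by (intro continuous_intros \<eta>)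
    show "lat_periodic v1 v2 m" using \<eta>(2) unfolding m_def lat_periodic_def by simp
    show "w (x + \<gamma>, y) = w (x,y)" if "\<gamma> \<in> lat v1 v2" for x \<gamma> y
    proof -
     have "\<Phi> (z + \<gamma>, y) = \<Phi> (z, y)" for z y using p that unfolding dn_pot_def by blast
     from this[of "x + t *\<^sub>R b"] this[of x] show ?thesis unfolding w_def by (simp add: add_ac)
    qed
    show "continuous_on {(x, y). - H <= y \<and> y <= m x} w" unfolding w_def
    proof (intro continuous_on_diff)
     show "continuous_on {(x, y). - H <= y \<and> y <= m x} \<Phi>" by (rule continuous_on_subset[OF dn_pot_cont(1)[OF p]])
       (use inn' K t in \<open>auto simp: m_def intro: order_trans\<close>)
     show "continuous_on {(x, y). - H <= y \<and> y <= m x} (%q. \<Phi> (q + t *\<^sub>R ?v))"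
     proof (rule continuous_on_compose2[OF dn_pot_cont(1)[OF p]])
      show "(%q. q + t *\<^sub>R ?v) ` {(x, y). - H <= y \<and> y <= m x} \<subseteq> {(x, y). - h <= ereal y \<and> y <= \<eta> x}"
      proof (clarsimp)
       fix x y assume y: "- H <= y" "y <= m x"
       show "- h <= ereal (y + t*\<beta>) \<and> y + t*\<beta> <= \<eta> (x + t *\<^sub>R b)"
       proof -
        have "0 <= t*\<beta>" using t b0 by simp
        then have "- h <= ereal (y + t*\<beta>)" by (intro inn') (use y in linarith)
        then show ?thesis using seg[of t t y x] y t unfolding m_def by auto
       qed
      qed
     qed (intro continuous_intros)
    qed
    show "(w has_derivative (%v. (D\<Phi> ((x,y) + t *\<^sub>R ?v) - D\<Phi> (x,y)) \<bullet> v)) (at (x,y)) \<and>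
     ((%q. D\<Phi> (q + t *\<^sub>R ?v) - D\<Phi> q) has_derivative (%u. L ((x,y) + t *\<^sub>R ?v) u - L (x,y) u)) (at (x,y)) \<and>
     (\<Sum>c\<in>Basis. (L ((x,y) + t *\<^sub>R ?v) c - L (x,y) c) \<bullet> c) = 0" if y: "-H < y" "y < m x" for x y
    proof -
     have y1: "- h < ereal y" "y < \<eta> x" using inn y K t unfolding m_def by (auto intro: less_le_trans)
     have "-H < y + t*\<beta>" using y t b0 by (simp add: add_strict_increasing2 add.commute less_le_trans)
     then have y2: "- h < ereal (y + t*\<beta>)" "y + t*\<beta> < \<eta> (x + t *\<^sub>R b)" using inn seg[of t t y x] y t unfolding m_def by auto
     note a1 = dn_pot_interior[OF p y1] and a2 = dn_pot_interior[OF p y2]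
     have sh: "((%q. q + t *\<^sub>R ?v) has_derivative (%u. u)) (at (x,y))" by (auto intro!: derivative_eq_intros)
     have eqp: "(x,y) + t *\<^sub>R ?v = (x + t *\<^sub>R b, y + t*\<beta>)" by simp
     have "((%q. \<Phi> (q + t *\<^sub>R ?v)) has_derivative (%u. D\<Phi> (x + t *\<^sub>R b, y + t*\<beta>) \<bullet> u)) (at (x,y))"
      by (rule has_derivative_compose[OF sh]) (unfold eqp, rule a2)
     from has_derivative_diff[OF this a1(1)]
     have 1: "(w has_derivative (%v. (D\<Phi> ((x,y) + t *\<^sub>R ?v) - D\<Phi> (x,y)) \<bullet> v)) (at (x,y))" unfolding w_def eqp inner_diff_left .
     have "((%q. D\<Phi> (q + t *\<^sub>R ?v)) has_derivative (%u. L (x + t *\<^sub>R b, y + t*\<beta>) u)) (at (x,y))"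
      by (rule has_derivative_compose[OF sh]) (unfold eqp, rule a2)
     from has_derivative_diff[OF this a1(2)]
     have 2: "((%q. D\<Phi> (q + t *\<^sub>R ?v) - D\<Phi> q) has_derivative (%u. L ((x,y) + t *\<^sub>R ?v) u - L (x,y) u)) (at (x,y))" unfolding eqp .
     show ?thesis using 1 2 a1(3) a2(3) unfolding eqp inner_diff_left sum_subtractf by simp
    qed
    show "w (x, m x) <= A" if mx: "-H <= m x" for x
    proof -
     show ?thesis
     proof (rule bdseg[OF mx order_refl])
      fix s assume s: "0 < s" "s < t"
      show i: "- h < ereal (m x + s*\<beta>)"
      proof (cases h)
       case (real hr)
       \<comment> \<open>The bottom strip of thickness \<tau>2 lies below the surface, and
         \<open>K*t\<close> is less than \<tau>2, so the lowered surface is above the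
         bottom.\<close>
       have "\<not> \<eta> x < - hr + \<tau>2"
       proof
        assume a: "\<eta> x < - hr + \<tau>2"
        have "- h < ereal (\<eta> x)" using p unfolding dn_pot_def by blast
        then show False using \<tau>2(2)[of "\<eta> x" x] a real by simp
       qed
       then show ?thesis using t'(2) real s b0 unfolding m_def by (simp add: add_pos_nonneg)
        (smt (verit) mult_nonneg_nonneg)
      qed (use h in auto)
      have sg: "m x + s*\<beta> < \<eta> (x + s *\<^sub>R b)" "\<eta> (x + s *\<^sub>R b) <= m x + s*\<beta> + 2*K*t" using seg[of s t "m x" x] s t unfolding m_def by auto
      have "norm (D\<Phi> (x + s *\<^sub>R b, m x + s*\<beta>)) <= S + e" by (rule \<tau>1(2)[OF i]) (use sg t' in auto)
      then have "norm (D\<Phi> (x + s *\<^sub>R b, m x + s*\<beta>))*norm ?v <= (S + e)*norm ?v" by (intro mult_right_mono) auto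
      then show "D\<Phi> (x + s *\<^sub>R b, m x + s*\<beta>) \<bullet> ?v <= (S + e)*norm ?v"
       using norm_cauchy_schwarz[of "D\<Phi> (x + s *\<^sub>R b, m x + s*\<beta>)" ?v] by linarith
     qed
    qed
    show "w (x,-H) <= A \<or> (\<forall>e>0. \<exists>d>0. \<forall>y. -H < y \<and> y < -H+d --> w (x,y) \<ge> w (x,-H) - e*(y+H))" if mx: "-H < m x" for x
    proof (cases "h = \<infinity> \<or> \<beta> = 1")
     \<comment> \<open>The derivative along v is at most of size e on the segment: far down in
       infinite depth, or as a vertical velocity near a flat bottom. In the remaining case v is
       horizontal, and the vertical derivative of w is a difference of two vertical velocities that
       vanish at the bottom.\<close>
     case True
     have "w (x,-H) <= A"
     proof (rule bdseg[OF order_refl])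
      show "-H <= m x" using mx by simp
      fix s assume s: "0 < s" "s < t"
      have sg: "-H + s*\<beta> < \<eta> (x + s *\<^sub>R b)" using seg[of s t "-H" x] s t mx unfolding m_def by auto
      show "- h < ereal (-H + s*\<beta>)"
      proof (cases "h = \<infinity>")
       case False
       then show ?thesis using True inn[of "-H + s*\<beta>"] s by simp
      qed simp
      show "D\<Phi> (x + s *\<^sub>R b, -H + s*\<beta>) \<bullet> ?v <= (S + e)*norm ?v"
      proof (cases "h = \<infinity>")
       case True
       have "s*\<beta> <= t" using v s by auto
       then have "-H + s*\<beta> < -M" using True unfolding H_def by auto
       then have "norm (D\<Phi> (x + s *\<^sub>R b, -H + s*\<beta>)) <= S + e" using M[OF True sg] S0 by simp
       then have "norm (D\<Phi> (x + s *\<^sub>R b, -H + s*\<beta>))*norm ?v <= (S + e)*norm ?v" by (intro mult_right_mono) auto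
       then show ?thesis using norm_cauchy_schwarz[of "D\<Phi> (x + s *\<^sub>R b, -H + s*\<beta>)" ?v] by linarith
      next
       case False
       then have bb: "\<beta> = 1" "b = 0" "H = real_of_ereal h" using True v unfolding H_def by auto
       have "\<bar>snd (D\<Phi> (x, -H + s))\<bar> <= e" using \<tau>2(2)[OF False, of "-H + s" x] s t2 bb by simp
       then show ?thesis using S0 by (simp add: bb inner_prod_def norm_Pair)
      qed
     qed
     then show ?thesis ..
    next
     case False
     then obtain hr where hr: "h = ereal hr" "H = hr" using h unfolding H_def by (cases h) auto
     have \<beta>: "\<beta> = 0" using False v by auto
     show ?thesis
     proof (intro disjI2 allI impI)
      fix e' :: real assume e': "e' > 0"
      obtain \<tau>3 where \<tau>3: "\<tau>3 > 0" "!!x y. - hr < y ==> y < - hr + \<tau>3 ==> y < \<eta> x \<and> \<bar>snd (D\<Phi> (x,y))\<bar> <= e'/2"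
       using dn_pot_near_bottom[OF p[unfolded hr] \<eta>, of "e'/2"] e' by auto
      show "\<exists>d>0. \<forall>y. - H < y \<and> y < - H + d --> w (x, - H) - e'*(y + H) <= w (x, y)"
      proof (intro exI[of _ \<tau>3] conjI \<tau>3(1) allI impI)
       fix y assume y: "- H < y \<and> y < - H + \<tau>3"
       have dom: "- h < ereal u" "u < \<eta> z" if "-H < u" "u <= y" for u z using \<tau>3(2)[of u z] that y hr by auto
       have bot0: "-H < \<eta> z" for z using p hr unfolding dn_pot_def by (metis ereal_less_eq(3) linorder_not_less uminus_ereal.simps(1))
       have cl: "- h <= ereal u" "u <= \<eta> z" if "-H <= u" "u <= y" for u z using dom(1)[of u] dom(2)[of u z] bot0[of z] that hr by (cases "u = -H"; fastforce)+
       obtain u where u: "-H < u" "u < y"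
        "w (x,y) - w (x,-H) = (snd (D\<Phi> (x + t *\<^sub>R b, u)) - snd (D\<Phi> (x,u)))*(y - (-H))"
       proof (rule mvt[of "-H" y "%u. w (x,u)" "%u r. (snd (D\<Phi> (x + t *\<^sub>R b, u)) - snd (D\<Phi> (x,u)))*r"])
        show "continuous_on {-H..y} (%u. w (x,u))" unfolding w_def using \<beta> by (auto intro!: continuous_intros continuous_on_compose2[OF dn_pot_cont(1)[OF p]] cl)
        fix u assume u: "-H < u" "u < y"
        have d1: "((%u. (z,u)) has_derivative (%r. (0,r))) (at u)" for z :: "real^2" by (auto intro!: derivative_eq_intros)
        have d2: "((%u. \<Phi> (z,u)) has_derivative (%r. D\<Phi> (z,u) \<bullet> (0,r))) (at u)" for z
         by (rule has_derivative_compose[OF d1]) (rule dn_pot_interior(1)[OF p dom]; use u in simp)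
        from has_derivative_diff[OF d2[of "x + t *\<^sub>R b"] d2[of x]]
        show "((%u. w (x,u)) has_derivative (%r. (snd (D\<Phi> (x + t *\<^sub>R b, u)) - snd (D\<Phi> (x,u)))*r)) (at u)"
         unfolding w_def using \<beta> by (simp add: inner_prod_def algebra_simps)
       qed (use y in auto)
       have "\<bar>snd (D\<Phi> (x + t *\<^sub>R b, u))\<bar> <= e'/2" "\<bar>snd (D\<Phi> (x,u))\<bar> <= e'/2" using \<tau>3(2)[of u] u y hr by auto
       then have "- e' <= snd (D\<Phi> (x + t *\<^sub>R b, u)) - snd (D\<Phi> (x,u))" by linarith
       then have "- e'*(y - (-H)) <= (snd (D\<Phi> (x + t *\<^sub>R b, u)) - snd (D\<Phi> (x,u)))*(y - (-H))" using y by (intro mult_right_mono) auto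
       then show "w (x, - H) - e'*(y + H) <= w (x, y)" unfolding u(3)[symmetric] by simp
      qed
     qed
    qed
    show "- H <= y0" by (rule y0H)
    show "y0 <= m x0" using t' unfolding m_def by simp
   qed
   then show "\<Phi> ((x0,y0) + t *\<^sub>R ?v) - \<Phi> (x0,y0) <= t*((S + e)*norm ?v)" unfolding w_def A_def .
  qed
 qed
 have "D\<Phi> (x0,y0) \<bullet> ?v <= S*norm ?v"
 proof (rule field_le_epsilon)
  fix d :: real assume d: "d > 0"
  have "(S + d/(norm ?v + 1))*norm ?v = S*norm ?v + d*(norm ?v/(norm ?v + 1))" by (simp add: algebra_simps)
  also have "\<dots> <= S*norm ?v + d*1"
  proof -
   have "n/(n + 1) <= 1" if "n \<ge> 0" for n :: real using that by simp
   from this[OF norm_ge_zero[of ?v]] show ?thesis using d by (intro add_left_mono mult_left_mono) linarith+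
  qed
  finally show "D\<Phi> (x0,y0) \<bullet> ?v <= S*norm ?v + d"
   using main[of "d/(norm ?v + 1)"] d divide_pos_pos[OF d add_nonneg_pos[OF norm_ge_zero[of ?v] zero_less_one]] by linarith
 qed
 then show ?thesis .
qed

end

section \<open>Flattening the fluid domain\<close>

lemma has_real_derivative_max_power:
 "((%u::real. max 0 u ^ Suc (Suc n)) has_real_derivative real (Suc (Suc n))*max 0 u ^ Suc n) (at u)"
proof (cases u "0::real" rule: linorder_cases)
 case less
 have "((%u::real. 0) has_real_derivative 0) (at u)" by simp
 then have "((%u::real. max 0 u ^ Suc (Suc n)) has_real_derivative 0) (at u)" by (rule has_field_derivative_transform_within_open[where S="{..<0}"]) (use less in auto)
 then show ?thesis using less by simp
next
 case greater
 have "((%u::real. u ^ Suc (Suc n)) has_real_derivative real (Suc (Suc n))*u ^ Suc n) (at u)"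
  by (rule DERIV_pow[of "Suc (Suc n)" u, simplified diff_Suc_Suc minus_nat.diff_0, THEN DERIV_cong]) simp
 then have "((%u::real. max 0 u ^ Suc (Suc n)) has_real_derivative real (Suc (Suc n))*u ^ Suc n) (at u)"
  by (rule has_field_derivative_transform_within_open[where S="{0<..}"]) (use greater in auto)
 then show ?thesis using greater by simp
next
 case equal
 have e: "((max 0 (0 + t) ^ Suc (Suc n) - max 0 0 ^ Suc (Suc n))/t) = max 0 t ^ Suc n" for t :: real by (cases "t > 0") (auto simp: max_def)
 have "((%t::real. max 0 t ^ Suc n) \<longlongrightarrow> max 0 0 ^ Suc n) (at 0)" by (intro tendsto_intros)
 then show ?thesis unfolding equal DERIV_def e by simp
qed

text \<open>\<phi> is differentiable only below the surface. The increment along b is estimated at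
  height z < 0 by the mean value theorem and z is sent to 0; the inequality for b and for -b gives
  equality.\<close>

lemma trace_gradient:
 fixes \<phi> :: "(real^2) \<times> real => real" and P :: "(real^2) \<times> real => real^2"
 assumes r: "r > 0" and c: "continuous_on (UNIV \<times> {-r..0}) \<phi>" "continuous_on (UNIV \<times> {-r..0}) P"
  and d: "!!x z. -r < z ==> z < 0 ==> (\<phi> has_derivative (%v. P (x,z) \<bullet> fst v + Q (x,z) * snd v)) (at (x,z))"
  and t: "!!x. \<phi> (x,0) = \<psi> x" and g: "(\<psi> has_derivative (%w. G \<bullet> w)) (at x)"
 shows "G = P (x,0)"
proof -
 have le: "G \<bullet> b <= P (x,0) \<bullet> b" for b
 proof (rule field_le_epsilon)
  fix e0 :: real assume e0: "e0 > 0"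
  define e where "e = e0/(norm b + 1)"
  have np: "norm b + 1 > 0" by (intro add_nonneg_pos) auto
  have "norm b/(norm b + 1) <= 1" using np by (simp only: divide_le_eq) simp
  then have "e0*(norm b/(norm b + 1)) <= e0*1" using e0 by (intro mult_left_mono) auto
  then have e: "e > 0" "e*norm b <= e0" unfolding e_def using e0 np by auto
  have "continuous (at (x,0) within UNIV \<times> {-r..0}) P" using c(2) r by (simp add: continuous_on_eq_continuous_within)
  then obtain \<delta> where \<delta>: "\<delta> > 0" "!!q. q \<in> UNIV \<times> {-r..0} ==> dist q (x,0) < \<delta> ==> dist (P q) (P (x,0)) < e"
   unfolding continuous_within_eps_delta using e by blast
  define t0 where "t0 = \<delta>/(2*(norm b + 1))"
  have t0: "t0 > 0" unfolding t0_def using \<delta> by (intro divide_pos_pos mult_pos_pos add_nonneg_pos) auto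
  have "G \<bullet> b <= P (x,0) \<bullet> b + e*norm b"
  proof (rule directional_le[OF g t0])
   fix s :: real assume s: "0 < s" "s < t0"
   have sb: "s*norm b < \<delta>/2"
   proof -
    have "s*norm b <= s*(norm b + 1)" using s by (intro mult_left_mono) auto
    also have "\<dots> < t0*(norm b + 1)" using s by (intro mult_strict_right_mono) (auto intro: add_nonneg_pos)
    also have "\<dots> = \<delta>/2"
    proof -
     have "\<delta>/(2*n)*n = \<delta>/2" if "n > 0" for n :: real using that by simp
     from this[OF np] show ?thesis unfolding t0_def .
    qed
    finally show ?thesis .
   qed
   define z0 where "z0 = min r (\<delta>/2)"
   have z0: "z0 > 0" "z0 <= r" "z0 <= \<delta>/2" unfolding z0_def using r \<delta> by auto
   have inc: "\<phi> (x + s *\<^sub>R b, z) - \<phi> (x,z) <= s*(P (x,0) \<bullet> b + e*norm b)" if z: "z \<in> {-z0<..<0}" for z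
   proof -
    have dz: "(\<phi> has_derivative (%v. P (y,z) \<bullet> fst v + Q (y,z) * snd v)) (at (y,z))" for y by (rule d) (use z z0 in auto)
    have d1: "((%u. (x + u *\<^sub>R b, z)) has_derivative (%u. (u *\<^sub>R b, 0))) (at u)" for u by (auto intro!: derivative_eq_intros)
    have d2: "((%u. \<phi> (x + u *\<^sub>R b, z)) has_derivative (%h. h*(P (x + u *\<^sub>R b,z) \<bullet> b))) (at u)" for u
     using has_derivative_compose[OF d1 dz] by simp
    have "\<exists>u. 0 < u \<and> u < s \<and> \<phi> (x + s *\<^sub>R b, z) - \<phi> (x + 0 *\<^sub>R b, z) = (s - 0)*(P (x + u *\<^sub>R b,z) \<bullet> b)"
    proof (rule MVT2)
     fix u show "((%u. \<phi> (x + u *\<^sub>R b, z)) has_real_derivative P (x + u *\<^sub>R b,z) \<bullet> b) (at u)"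
      using d2[of u] by (simp add: has_field_derivative_def mult_commute_abs)
    qed (use s in simp)
    then obtain u where u: "0 < u" "u < s" "\<phi> (x + s *\<^sub>R b, z) - \<phi> (x, z) = s*(P (x + u *\<^sub>R b,z) \<bullet> b)" by auto
    have "dist (x + u *\<^sub>R b,z) (x,0) <= u*norm b + \<bar>z\<bar>" using norm_Pair_le[of "u *\<^sub>R b" z] u by (simp add: dist_norm)
    also have "\<dots> < \<delta>" using sb mult_right_mono[of u s "norm b"] u z z0 by auto
    finally have "dist (P (x + u *\<^sub>R b,z)) (P (x,0)) < e" using \<delta>(2) z z0 by auto
    then have n: "norm (P (x + u *\<^sub>R b,z) - P (x,0)) <= e" by (simp add: dist_norm)
    have "P (x + u *\<^sub>R b,z) \<bullet> b - P (x,0) \<bullet> b <= norm (P (x + u *\<^sub>R b,z) - P (x,0))*norm b"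
     unfolding inner_diff_left[symmetric] by (rule norm_cauchy_schwarz)
    also have "\<dots> <= e*norm b" using n by (intro mult_right_mono) auto
    finally show ?thesis unfolding u(3) using s by (intro mult_left_mono) auto
   qed
   have "continuous_on {-z0..0} (%z. \<phi> (x + s *\<^sub>R b, z) - \<phi> (x,z))" using z0 by (auto intro!: continuous_intros continuous_on_compose2[OF c(1)])
   then have cc: "continuous_on (closure {-z0<..<0}) (%z. \<phi> (x + s *\<^sub>R b, z) - \<phi> (x,z))" using z0 by simp
   have "\<phi> (x + s *\<^sub>R b, 0) - \<phi> (x,0) <= s*(P (x,0) \<bullet> b + e*norm b)" by (rule continuous_le_on_closure[OF cc _ inc]) (use z0 in auto)
   then show "\<psi> (x + s *\<^sub>R b) - \<psi> x <= s*(P (x,0) \<bullet> b + e*norm b)" using t by simp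
  qed
  then show "G \<bullet> b <= P (x,0) \<bullet> b + e0" using e by linarith
 qed
 have "G \<bullet> b = P (x,0) \<bullet> b" for b using le[of b] le[of "-b"] by simp
 then show ?thesis using vector_eq_rdot by blast
qed

text \<open>Cut-off with value 1 at the surface and 0 below depth l. The cube keeps
  \<open>rho1\<close> differentiable, as the derivative of \<open>flux_x\<close> requires.\<close>

definition rho :: "real => real => real" where "rho l z = max 0 (1 + z/l) ^ 3"
definition rho1 :: "real => real => real" where "rho1 l z = 3/l*max 0 (1 + z/l) ^ 2"
definition rho2 :: "real => real => real" where "rho2 l z = 6/l^2*max 0 (1 + z/l)"

lemma rho_deriv:
 assumes l: "l > 0"
 shows "(rho l has_real_derivative rho1 l z) (at z)" "(rho1 l has_real_derivative rho2 l z) (at z)"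
proof -
 have i: "((%z. 1 + z/l) has_real_derivative 1/l) (at z)" using l by (auto intro!: derivative_eq_intros)
 from DERIV_chain2[OF has_real_derivative_max_power[of 1] i]
 have "((%z. max 0 (1 + z/l) ^ 3) has_real_derivative (real (Suc (Suc 1))*max 0 (1 + z/l) ^ Suc 1)*(1/l)) (at z)" by (simp add: numeral_3_eq_3)
 then show "(rho l has_real_derivative rho1 l z) (at z)" unfolding rho_def[abs_def] rho1_def by (rule DERIV_cong) (simp add: numeral_2_eq_2)
 from DERIV_chain2[OF has_real_derivative_max_power[of 0] i]
 have "((%z. max 0 (1 + z/l) ^ 2) has_real_derivative (real (Suc (Suc 0))*max 0 (1 + z/l) ^ Suc 0)*(1/l)) (at z)" by (simp add: numeral_2_eq_2)
 from DERIV_cmult[OF this, of "3/l"]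
 show "(rho1 l has_real_derivative rho2 l z) (at z)" unfolding rho1_def[abs_def] rho2_def by (rule DERIV_cong) (simp add: power2_eq_square)
qed

lemma rho_bounds:
 assumes l: "l > 0" and z: "z <= 0"
 shows "0 <= rho l z" "rho l z <= max 0 (1 + z/l)" "0 <= rho1 l z" "rho1 l z <= 3/l*max 0 (1 + z/l)" "max 0 (1 + z/l) <= 1"
proof -
 let ?u = "max 0 (1 + z/l)"
 show u: "?u <= 1" using l z by (simp add: divide_le_0_iff)
 have u0: "0 <= ?u" by simp
 show "0 <= rho l z" "0 <= rho1 l z" unfolding rho_def rho1_def using l by auto
 have "?u ^ 3 <= ?u ^ 1" "?u ^ 2 <= ?u ^ 1" by (rule power_decreasing; use u u0 in simp)+
 then show "rho l z <= ?u" unfolding rho_def by simp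
 have "3/l*?u ^ 2 <= 3/l*?u ^ 1" using l \<open>?u ^ 2 <= ?u ^ 1\<close> by (intro mult_left_mono) auto
 then show "rho1 l z <= 3/l*?u" unfolding rho1_def by simp
qed

lemma rho_0: "rho l 0 = 1" by (simp add: rho_def)
lemma rho_deep: "l > 0 ==> z <= -l ==> rho l z = 0 \<and> rho1 l z = 0"
 by (simp add: rho_def rho1_def max_def field_simps)

lemma rho_cont: "l > 0 ==> continuous_on S (rho l)" "l > 0 ==> continuous_on S (rho1 l)"
 unfolding rho_def rho1_def by (intro continuous_intros; simp)+

text \<open>Vertical shear that flattens the fluid domain; it is the identity below depth $l$.\<close>

definition shear :: "real => (real^2 => real) => (real^2) \<times> real => (real^2) \<times> real" where
 "shear l \<eta> p = (fst p, snd p + \<eta> (fst p)*rho l (snd p))"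

lemma shear_has_derivative:
 assumes l: "l > 0" and d: "(\<eta> has_derivative (%w. D \<bullet> w)) (at x)"
 shows "(shear l \<eta> has_derivative (%v. (fst v, (1 + \<eta> x*rho1 l z) * snd v + rho l z*(D \<bullet> fst v)))) (at (x,z))"
proof -
 have f: "((%p. \<eta> (fst p)) has_derivative (%v. D \<bullet> fst v)) (at (x,z))"
  by (rule has_derivative_compose[OF has_derivative_fst[OF has_derivative_ident]]) (use d in simp)
 have "((%p. rho l (snd p)) has_derivative (%v. snd v * rho1 l z)) (at (x,z))"
  using has_derivative_compose[OF has_derivative_snd[OF has_derivative_ident], of "rho l" "%v. v * rho1 l z" "(x,z)" UNIV]
   rho_deriv(1)[OF l, of z] by (simp add: has_field_derivative_def mult_commute_abs)
 note r = this
 show ?thesis unfolding shear_def by (rule has_derivative_eq_rhs, rule has_derivative_Pair, rule has_derivative_fst[OF has_derivative_ident],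
   rule has_derivative_add, rule has_derivative_snd[OF has_derivative_ident], rule has_derivative_mult[OF f r])
   (auto simp: fun_eq_iff algebra_simps)
qed

text \<open>As \<open>rho1\<close> is at most 3/l, the hypothesis keeps the vertical derivative 1 +
  \<eta> \<open>rho1\<close> positive, so the sheared height is increasing in z.\<close>

lemma shear_range:
 assumes l: "l > 0" and sm: "3*\<bar>\<eta> x\<bar> < l"
 shows "z < 0 ==> snd (shear l \<eta> (x,z)) < \<eta> x"
  and "H \<ge> l ==> -H < z ==> z <= 0 ==> -H < snd (shear l \<eta> (x,z))"
proof -
 let ?Y = "%z. z + \<eta> x*rho l z"
 have d: "(?Y has_real_derivative 1 + \<eta> x*rho1 l z) (at z)" for z using rho_deriv(1)[OF l, of z] by (auto intro!: derivative_eq_intros)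
 have pos: "0 < 1 + \<eta> x*rho1 l z" if "z <= 0" for z
 proof -
  have "rho1 l z <= 3/l*1" using rho_bounds(4,5)[OF l that] l by (meson divide_nonneg_pos less_imp_le mult_left_mono order_trans zero_le_numeral)
  then have "\<bar>\<eta> x\<bar>*rho1 l z <= \<bar>\<eta> x\<bar>*(3/l)" by (intro mult_left_mono) auto
  then have "\<bar>\<eta> x*rho1 l z\<bar> <= \<bar>\<eta> x\<bar>*(3/l)" using rho_bounds(3)[OF l that] by (simp only: abs_mult abs_of_nonneg)
  also have "\<dots> < 1" using sm l by (simp add: field_simps)
  finally show ?thesis by linarith
 qed
 have mono: "?Y a < ?Y b" if "a < b" "b <= 0" for a b by (rule DERIV_pos_imp_increasing[OF that(1)]) (use d pos that in fastforce)
 show "snd (shear l \<eta> (x,z)) < \<eta> x" if "z < 0" using mono[OF that] by (simp add: shear_def rho_0)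
 show "-H < snd (shear l \<eta> (x,z))" if H: "H \<ge> l" and z: "-H < z" "z <= 0" using mono[OF z] rho_deep[OF l, of "-H"] H by (simp add: shear_def)
qed

text \<open>\<open>flux_x\<close> and \<open>flux_z\<close> are the Piola transform of the velocity
  (V,B) under the shear, hence divergence free in the flat coordinates. At z = 0 the vertical
  component is B - grad \<eta> . V, that is the Dirichlet-Neumann value.\<close>

definition flux_x :: "real => (real^2 => real) => ((real^2) \<times> real => real^2) => (real^2) \<times> real => real^2" where
 "flux_x l \<eta> V p = (1 + \<eta> (fst p)*rho1 l (snd p)) *\<^sub>R V p"

definition flux_z :: "real => (real^2 => real) => ((real^2) \<times> real => real^2) => ((real^2) \<times> real => real) => (real^2) \<times> real => real" where
 "flux_z l \<eta> V B p = B p - rho l (snd p)*(grad2 \<eta> (fst p) \<bullet> V p)"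

context lattice2 begin

text \<open>$V$ and $B$ are the horizontal and vertical components of the velocity in the flattened domain,
 so that the gradient of the flattened potential and the (divergence free) flux are both
 perturbations of $(V,B)$ by products of the elevation with $(V,B)$.\<close>

definition flat_sol :: "real => ereal => real^2 => (real^2 => real) => (real^2 => real) => ((real^2) \<times> real => real) =>
  ((real^2) \<times> real => real^2) => ((real^2) \<times> real => real) => real => bool" where
 "flat_sol l h c \<eta> \<psi> \<phi> V B M \<longleftrightarrow>
  continuous_on {(x,z). - h <= ereal z \<and> z <= 0} \<phi> \<and>
  continuous_on {(x,z). - h <= ereal z \<and> z <= 0} V \<and>
  continuous_on {(x,z). - h <= ereal z \<and> z <= 0} B \<and>
  (\<forall>x z. \<forall>\<gamma>\<in>lat v1 v2. - h < ereal z \<and> z < 0 --> \<phi> (x+\<gamma>,z) = \<phi> (x,z) \<and> V (x+\<gamma>,z) = V (x,z)) \<and>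
  (\<forall>x z. - h < ereal z \<and> z < 0 -->
   (\<phi> has_derivative (%v. (V (x,z) + (rho l z*B (x,z)) *\<^sub>R grad2 \<eta> x) \<bullet> fst v + (1 + \<eta> x*rho1 l z)*B (x,z) * snd v)) (at (x,z)) \<and>
   (\<exists>L N. (flux_x l \<eta> V has_derivative L) (at (x,z)) \<and> (flux_z l \<eta> V B has_derivative N) (at (x,z)) \<and>
    L (axis 1 1, 0)$1 + L (axis 2 1, 0)$2 + N (0, 1) = 0)) \<and>
  (\<forall>x. \<phi> (x,0) = \<psi> x \<and> flux_z l \<eta> V B (x,0) = - (c \<bullet> grad2 \<eta> x)) \<and>
  (\<forall>x z. - h <= ereal z \<and> z <= 0 --> norm (V (x,z)) <= M \<and> \<bar>B (x,z)\<bar> <= M) \<and>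
  (\<forall>e>0. \<forall>H0. \<exists>H>0. ereal H <= h \<and> l <= H \<and> (h ~= \<infinity> --> ereal H = h) \<and> (h = \<infinity> --> H0 <= H) \<and>
   (\<forall>x. \<bar>B (x,-H)\<bar> <= e))"

lemma wser_grad2_has_derivative:
 assumes "wser \<eta> a"
 shows "(grad2 \<eta> has_derivative (%w. (grad2 (pd 1 \<eta>) x \<bullet> w) *\<^sub>R axis 1 1 + (grad2 (pd 2 \<eta>) x \<bullet> w) *\<^sub>R axis 2 1)) (at x)"
proof -
 have "grad2 \<eta> = (%x. pd 1 \<eta> x *\<^sub>R axis 1 1 + pd 2 \<eta> x *\<^sub>R axis 2 1)" by (auto simp: fun_eq_iff grad2_def vec2_eq_iff axis_def)
 then show ?thesis using wser_has_derivative(1)[OF wser_has_derivative(2)[OF assms, of 1]]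
   wser_has_derivative(1)[OF wser_has_derivative(2)[OF assms, of 2]] by (auto intro!: has_derivative_add has_derivative_scaleR_left)
qed

lemma wser_grad2_cont: "wser \<eta> a ==> continuous_on UNIV (grad2 \<eta>)"
 by (rule continuous_at_imp_continuous_on, rule ballI, rule has_derivative_continuous, rule wser_grad2_has_derivative)

text \<open>Chain rule through the shear. In the divergence of the flux the terms containing
  \<open>rho1\<close> times grad \<eta> . V, and those containing the vertical derivative of V,
  cancel in pairs; what is left is the Jacobian times the Laplacian of \<Phi>.\<close>

lemma flat_equations:
 assumes w: "wser \<eta> a" and p: "dn_pot h \<eta> \<Phi> D\<Phi> L" and l: "l > 0"
  and i: "- h < ereal (snd (shear l \<eta> (x,z)))" "snd (shear l \<eta> (x,z)) < \<eta> x"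
 defines "\<phi> \<equiv> %p. \<Phi> (shear l \<eta> p)" and "V \<equiv> %p. fst (D\<Phi> (shear l \<eta> p))" and "B \<equiv> %p. snd (D\<Phi> (shear l \<eta> p))"
 shows "(\<phi> has_derivative (%v. (V (x,z) + (rho l z*B (x,z)) *\<^sub>R grad2 \<eta> x) \<bullet> fst v + (1 + \<eta> x*rho1 l z)*B (x,z) * snd v)) (at (x,z))"
  and "\<exists>L N. (flux_x l \<eta> V has_derivative L) (at (x,z)) \<and> (flux_z l \<eta> V B has_derivative N) (at (x,z)) \<and>
    L (axis 1 1, 0)$1 + L (axis 2 1, 0)$2 + N (0, 1) = 0"
proof -
 let ?s = "shear l \<eta> (x,z)" and ?J = "1 + \<eta> x*rho1 l z" and ?r = "rho l z" and ?g = "grad2 \<eta> x"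
 define S' where "S' v = (fst v, ?J * snd v + ?r*(?g \<bullet> fst v))" for v :: "(real^2) \<times> real"
 have s: "(shear l \<eta> has_derivative S') (at (x,z))" unfolding S'_def by (rule shear_has_derivative[OF l wser_has_derivative(1)[OF w]])
 have sp: "?s = (x, snd ?s)" by (simp add: shear_def)
 note I = dn_pot_interior[OF p i, folded sp]
 have D: "((%p. D\<Phi> (shear l \<eta> p)) has_derivative (%v. L ?s (S' v))) (at (x,z))" by (rule has_derivative_compose[OF s I(2)])
 have "(\<phi> has_derivative (%v. D\<Phi> ?s \<bullet> S' v)) (at (x,z))" unfolding \<phi>_def by (rule has_derivative_compose[OF s I(1)])
 moreover have "(%v. D\<Phi> ?s \<bullet> S' v) = (%v. (V (x,z) + (?r*B (x,z)) *\<^sub>R ?g) \<bullet> fst v + ?J*B (x,z) * snd v)"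
  by (auto simp: fun_eq_iff V_def B_def S'_def inner_prod_def inner_add_left algebra_simps)
 ultimately show "(\<phi> has_derivative (%v. (V (x,z) + (?r*B (x,z)) *\<^sub>R ?g) \<bullet> fst v + ?J*B (x,z) * snd v)) (at (x,z))" by simp
 have dV: "(V has_derivative (%v. fst (L ?s (S' v)))) (at (x,z))" and dB: "(B has_derivative (%v. snd (L ?s (S' v)))) (at (x,z))"
  unfolding V_def B_def by (rule has_derivative_fst[OF D], rule has_derivative_snd[OF D])
 have f: "((%p. \<eta> (fst p)) has_derivative (%v. ?g \<bullet> fst v)) (at (x,z))"
  by (rule has_derivative_compose[OF has_derivative_fst[OF has_derivative_ident]]) (use wser_has_derivative(1)[OF w] in simp)
 have r: "((%p. rho l (snd p)) has_derivative (%v. snd v * rho1 l z)) (at (x,z))"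
  "((%p. rho1 l (snd p)) has_derivative (%v. snd v * rho2 l z)) (at (x,z))"
  using has_derivative_compose[OF has_derivative_snd[OF has_derivative_ident], of "rho l" "%v. v * rho1 l z" "(x,z)" UNIV]
   has_derivative_compose[OF has_derivative_snd[OF has_derivative_ident], of "rho1 l" "%v. v * rho2 l z" "(x,z)" UNIV]
   rho_deriv[OF l, of z] by (simp_all add: has_field_derivative_def mult_commute_abs)
 define N where "N w = (grad2 (pd 1 \<eta>) x \<bullet> w) *\<^sub>R axis 1 1 + (grad2 (pd 2 \<eta>) x \<bullet> w) *\<^sub>R (axis 2 1 :: real^2)" for w
 have g: "((%p. grad2 \<eta> (fst p)) has_derivative (%v. N (fst v))) (at (x,z))" by (rule has_derivative_compose[OF has_derivative_fst[OF has_derivative_ident]])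
   (use wser_grad2_has_derivative[OF w] in \<open>simp add: N_def[abs_def]\<close>)
 define LX where "LX v = ?J *\<^sub>R fst (L ?s (S' v)) + ((?g \<bullet> fst v)*rho1 l z + \<eta> x*(snd v * rho2 l z)) *\<^sub>R V (x,z)" for v
 define LZ where "LZ v = snd (L ?s (S' v)) - (?r*(?g \<bullet> fst (L ?s (S' v)) + N (fst v) \<bullet> V (x,z)) + (snd v * rho1 l z)*(?g \<bullet> V (x,z)))" for v
 have X: "(flux_x l \<eta> V has_derivative LX) (at (x,z))"
 proof -
  have "((%p. 1 + \<eta> (fst p)*rho1 l (snd p)) has_derivative (%v. 0 + (\<eta> x*(snd v * rho2 l z) + (?g \<bullet> fst v)*rho1 l z))) (at (x,z))"
   using has_derivative_add[OF has_derivative_const has_derivative_mult[OF f r(2)], of 1] by simp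
  from has_derivative_scaleR[OF this dV]
  show ?thesis unfolding flux_x_def[abs_def] LX_def[abs_def] by (simp add: add.commute)
 qed
 have Z: "(flux_z l \<eta> V B has_derivative LZ) (at (x,z))" using has_derivative_diff[OF dB has_derivative_mult[OF r(1) has_derivative_inner[OF g dV]]]
  unfolding flux_z_def[abs_def] LZ_def[abs_def] by simp
 have lin: "linear (L ?s)" using I(2) has_derivative_linear by blast
 let ?e1 = "axis 1 1 :: real^2" and ?e2 = "axis 2 1 :: real^2"
 have Le: "L ?s (S' (w, 0)) = L ?s (w,0) + (?r*(?g \<bullet> w)) *\<^sub>R L ?s (0,1)" for w
 proof -
  have "S' (w,0) = (w,0) + (?r*(?g \<bullet> w)) *\<^sub>R (0,1)" unfolding S'_def by simp
  then show ?thesis by (simp only: linear_add[OF lin] linear_scale[OF lin])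
 qed
 have L1: "L ?s (S' (0, 1)) = ?J *\<^sub>R L ?s (0,1)"
 proof -
  have "S' (0,1) = ?J *\<^sub>R (0,1)" unfolding S'_def by simp
  then show ?thesis by (simp only: linear_scale[OF lin])
 qed
 have tr: "fst (L ?s (?e1,0))$1 + fst (L ?s (?e2,0))$2 + snd (L ?s (0,1)) = 0" using I(3) unfolding sum_Basis_slab by (simp add: inner_prod_def inner_axis)
 have N0: "N 0 = 0" unfolding N_def by simp
 have "LX (?e1, 0)$1 + LX (?e2, 0)$2 + LZ (0, 1) =
  ?J*(fst (L ?s (?e1,0))$1 + fst (L ?s (?e2,0))$2 + snd (L ?s (0,1)))" unfolding LX_def LZ_def Le L1 fst_conv snd_conv N0 by (simp add: axis_def inner_2 algebra_simps)
 then have "LX (?e1, 0)$1 + LX (?e2, 0)$2 + LZ (0, 1) = 0" unfolding tr by simp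
 then show "\<exists>L N. (flux_x l \<eta> V has_derivative L) (at (x,z)) \<and> (flux_z l \<eta> V B has_derivative N) (at (x,z)) \<and>
    L (axis 1 1, 0)$1 + L (axis 2 1, 0)$2 + N (0, 1) = 0" using X Z by blast
qed

end

context lattice2 begin

lemma flat_solD:
 assumes "flat_sol l h c \<eta> \<psi> \<phi> V B M"
 shows "continuous_on {(x,z). - h <= ereal z \<and> z <= 0} \<phi>" "continuous_on {(x,z). - h <= ereal z \<and> z <= 0} V"
  "continuous_on {(x,z). - h <= ereal z \<and> z <= 0} B"
  "!!x z \<gamma>. \<gamma> \<in> lat v1 v2 ==> - h < ereal z ==> z < 0 ==> \<phi> (x+\<gamma>,z) = \<phi> (x,z) \<and> V (x+\<gamma>,z) = V (x,z)"
  "!!x z. - h < ereal z ==> z < 0 ==>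
   (\<phi> has_derivative (%v. (V (x,z) + (rho l z*B (x,z)) *\<^sub>R grad2 \<eta> x) \<bullet> fst v + (1 + \<eta> x*rho1 l z)*B (x,z) * snd v)) (at (x,z))"
  "!!x z. - h < ereal z ==> z < 0 ==> \<exists>L N. (flux_x l \<eta> V has_derivative L) (at (x,z)) \<and> (flux_z l \<eta> V B has_derivative N) (at (x,z)) \<and>
    L (axis 1 1, 0)$1 + L (axis 2 1, 0)$2 + N (0, 1) = 0"
  "!!x. \<phi> (x,0) = \<psi> x" "!!x. flux_z l \<eta> V B (x,0) = - (c \<bullet> grad2 \<eta> x)"
  "!!x z. - h <= ereal z ==> z <= 0 ==> norm (V (x,z)) <= M" "!!x z. - h <= ereal z ==> z <= 0 ==> \<bar>B (x,z)\<bar> <= M"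
  "!!e H0. e > 0 ==> \<exists>H>0. ereal H <= h \<and> l <= H \<and> (h ~= \<infinity> --> ereal H = h) \<and> (h = \<infinity> --> H0 <= H) \<and> (\<forall>x. \<bar>B (x,-H)\<bar> <= e)"
proof -
 note A = assms[unfolded flat_sol_def]
 note A4 = A[THEN conjunct2, THEN conjunct2, THEN conjunct2]
 note A5 = A4[THEN conjunct2] note A6 = A5[THEN conjunct2] note A7 = A6[THEN conjunct2] note A8 = A7[THEN conjunct2]
 show "continuous_on {(x,z). - h <= ereal z \<and> z <= 0} \<phi>" by (rule A[THEN conjunct1])
 show "continuous_on {(x,z). - h <= ereal z \<and> z <= 0} V" by (rule A[THEN conjunct2, THEN conjunct1])
 show "continuous_on {(x,z). - h <= ereal z \<and> z <= 0} B" by (rule A[THEN conjunct2, THEN conjunct2, THEN conjunct1])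
 show "\<phi> (x+\<gamma>,z) = \<phi> (x,z) \<and> V (x+\<gamma>,z) = V (x,z)" if "\<gamma> \<in> lat v1 v2" "- h < ereal z" "z < 0" for x z \<gamma>
  using A4[THEN conjunct1] that by blast
 show "(\<phi> has_derivative (%v. (V (x,z) + (rho l z*B (x,z)) *\<^sub>R grad2 \<eta> x) \<bullet> fst v + (1 + \<eta> x*rho1 l z)*B (x,z) * snd v)) (at (x,z))"
  "\<exists>L N. (flux_x l \<eta> V has_derivative L) (at (x,z)) \<and> (flux_z l \<eta> V B has_derivative N) (at (x,z)) \<and>
    L (axis 1 1, 0)$1 + L (axis 2 1, 0)$2 + N (0, 1) = 0" if "- h < ereal z" "z < 0" for x z
  using A5[THEN conjunct1, rule_format, OF conjI[OF that], of x] by (rule conjunct1, rule conjunct2)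
 show "\<phi> (x,0) = \<psi> x" "flux_z l \<eta> V B (x,0) = - (c \<bullet> grad2 \<eta> x)" for x using A6[THEN conjunct1, rule_format, of x] by (rule conjunct1, rule conjunct2)
 show "norm (V (x,z)) <= M" "\<bar>B (x,z)\<bar> <= M" if "- h <= ereal z" "z <= 0" for x z
  using A7[THEN conjunct1, rule_format, OF conjI[OF that], of x] by (rule conjunct1, rule conjunct2)
 show "\<exists>H>0. ereal H <= h \<and> l <= H \<and> (h ~= \<infinity> --> ereal H = h) \<and> (h = \<infinity> --> H0 <= H) \<and> (\<forall>x. \<bar>B (x,-H)\<bar> <= e)" if "e > 0" for e H0
  by (rule A8[rule_format, OF that])
qed

lemma shear_domain:
 assumes h: "h > 0" and l: "l > 0" "ereal l <= h" and sm: "3*\<bar>\<eta> x\<bar> < l"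
 shows "- h <= ereal z ==> z <= 0 ==> - h <= ereal (snd (shear l \<eta> (x,z))) \<and> snd (shear l \<eta> (x,z)) <= \<eta> x"
  and "- h < ereal z ==> z < 0 ==> - h < ereal (snd (shear l \<eta> (x,z))) \<and> snd (shear l \<eta> (x,z)) < \<eta> x"
proof -
 have lo: "- h < ereal (snd (shear l \<eta> (x,z)))" if "- h < ereal z" "z <= 0" for z
 proof (cases h)
  case (real hr)
  then show ?thesis using shear_range(2)[where \<eta>=\<eta> and x=x, OF l(1) sm, of hr z] l that by simp
 qed (use h in auto)
 show 2: "- h < ereal (snd (shear l \<eta> (x,z))) \<and> snd (shear l \<eta> (x,z)) < \<eta> x" if "- h < ereal z" "z < 0" for z
  using lo[of z] shear_range(1)[where \<eta>=\<eta> and x=x, OF l(1) sm] that by simp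
 show "- h <= ereal (snd (shear l \<eta> (x,z))) \<and> snd (shear l \<eta> (x,z)) <= \<eta> x" if z: "- h <= ereal z" "z <= 0" for z
 proof
  show "snd (shear l \<eta> (x,z)) <= \<eta> x" using shear_range(1)[where \<eta>=\<eta> and x=x, OF l(1) sm, of z] z by (cases "z = 0") (auto simp: shear_def rho_0 less_imp_le)
  show "- h <= ereal (snd (shear l \<eta> (x,z)))"
  proof (cases "- h = ereal z")
   case True
   then have hz: "h = ereal (-z)" by (metis ereal_uminus_uminus uminus_ereal.simps(1))
   then have "rho l z = 0" using rho_deep[OF l(1), of z] l(2) by simp
   then show ?thesis using hz by (simp add: shear_def)
  next
   case False
   then show ?thesis using lo[of z] z by (simp add: less_le)
  qed
 qed
qed

text \<open>The velocity at the surface is an explicit function of the slopes and of c. The maximum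
  principle carries its bound into the fluid, and the shear transports everything to the flat
  slab.\<close>

lemma flat_sol_exists:
 assumes h: "h > 0" and l: "l > 0" "ereal l <= h" and w: "wser \<eta> a" and w\<psi>: "wser \<psi> b"
  and dn: "is_DN h v1 v2 \<eta> \<psi> G" and kin: "!!x. c \<bullet> grad2 \<eta> x + G x = 0"
  and e: "0 <= \<epsilon>" "\<epsilon> <= 1" "3*\<epsilon> < l"
  and bd: "!!x. \<bar>\<eta> x\<bar> <= \<epsilon>" "!!x. norm (grad2 \<eta> x) <= \<epsilon>" "!!x. norm (grad2 \<psi> x) <= \<epsilon>" and C: "norm c <= C"
 shows "\<exists>\<phi> V B. flat_sol l h c \<eta> \<psi> \<phi> V B ((2*C + 3)*\<epsilon>)"
proof -
 obtain \<Phi> D\<Phi> L where p: "dn_pot h \<eta> \<Phi> D\<Phi> L" and tr: "!!x. \<Phi> (x, \<eta> x) = \<psi> x"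
  and G: "!!x. G x = snd (D\<Phi> (x, \<eta> x)) - grad2 \<eta> x \<bullet> fst (D\<Phi> (x, \<eta> x))" using dn unfolding is_DN_iff by blast
 define \<phi> where "\<phi> = (%p. \<Phi> (shear l \<eta> p))"
 define V where "V = (%p. fst (D\<Phi> (shear l \<eta> p)))"
 define B where "B = (%p. snd (D\<Phi> (shear l \<eta> p)))"
 let ?S = "(2*C + 3)*\<epsilon>"
 let ?D = "{(x,z). - h <= ereal z \<and> z <= 0} :: ((real^2) \<times> real) set"
 have C0: "0 <= C" using C norm_ge_zero order_trans by blast
 have sm: "3*\<bar>\<eta> x\<bar> < l" for x using bd(1)[of x] e by linarith
 have dom: "- h <= ereal z ==> z <= 0 ==> - h <= ereal (snd (shear l \<eta> (x,z))) \<and> snd (shear l \<eta> (x,z)) <= \<eta> x"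
  "- h < ereal z ==> z < 0 ==> - h < ereal (snd (shear l \<eta> (x,z))) \<and> snd (shear l \<eta> (x,z)) < \<eta> x" for x z
  using shear_domain[where \<eta>=\<eta> and x=x and z=z, OF h l sm] by blast+
 have sf: "fst (shear l \<eta> p) = fst p" for p by (simp add: shear_def)
 have sp: "shear l \<eta> (x,z) = (x, snd (shear l \<eta> (x,z)))" for x z by (simp add: shear_def)
 have s0: "shear l \<eta> (x,0) = (x, \<eta> x)" for x by (simp add: shear_def rho_0)
 have \<eta>c: "continuous_on UNIV \<eta>" and \<eta>p: "lat_periodic v1 v2 \<eta>" by (rule wser_cont[OF w], rule wser_periodic[OF w])
 have sc: "continuous_on ?D (shear l \<eta>)" unfolding shear_def
  by (intro continuous_intros continuous_on_compose2[OF \<eta>c] continuous_on_compose2[OF rho_cont(1)[OF l(1), of UNIV]]) auto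
 have simg: "shear l \<eta> ` ?D \<subseteq> {(x, y). - h <= ereal y \<and> y <= \<eta> x}"
 proof
  fix q assume "q \<in> shear l \<eta> ` ?D"
  then obtain x z where "q = shear l \<eta> (x,z)" "- h <= ereal z" "z <= 0" by auto
  then show "q \<in> {(x, y). - h <= ereal y \<and> y <= \<eta> x}" using dom(1)[of z x] sp[of x z] by (auto simp: split_beta sf)
 qed
 have cD: "continuous_on ?D (%p. D\<Phi> (shear l \<eta> p))" by (rule continuous_on_compose2[OF dn_pot_cont(2)[OF p] sc simg])
 have cont: "continuous_on ?D \<phi>" "continuous_on ?D V" "continuous_on ?D B" unfolding \<phi>_def V_def B_def
  by (rule continuous_on_compose2[OF dn_pot_cont(1)[OF p] sc simg], rule continuous_on_fst[OF cD], rule continuous_on_snd[OF cD])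
 have per: "\<phi> (x+\<gamma>,z) = \<phi> (x,z) \<and> V (x+\<gamma>,z) = V (x,z)" if g: "\<gamma> \<in> lat v1 v2" and z: "- h < ereal z" "z < 0" for x \<gamma> z
 proof -
  have e1: "shear l \<eta> (x+\<gamma>,z) = (x + \<gamma>, snd (shear l \<eta> (x,z)))" using periodic_lat[OF \<eta>p g, of x] by (simp add: shear_def)
  have "\<Phi> (x + \<gamma>, y) = \<Phi> (x, y)" for y using p g unfolding dn_pot_def by blast
  moreover have "D\<Phi> (x + \<gamma>, snd (shear l \<eta> (x,z))) = D\<Phi> (x, snd (shear l \<eta> (x,z)))"
   by (rule dn_pot_grad_periodic[OF p \<eta>p _ _ g]) (use dom(2)[OF z] in auto)
  ultimately show ?thesis unfolding \<phi>_def V_def e1 using sp[of x z] by metis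
 qed
 have eqs: "(\<phi> has_derivative (%v. (V (x,z) + (rho l z*B (x,z)) *\<^sub>R grad2 \<eta> x) \<bullet> fst v + (1 + \<eta> x*rho1 l z)*B (x,z) * snd v)) (at (x,z))"
  "\<exists>L N. (flux_x l \<eta> V has_derivative L) (at (x,z)) \<and> (flux_z l \<eta> V B has_derivative N) (at (x,z)) \<and>
    L (axis 1 1, 0)$1 + L (axis 2 1, 0)$2 + N (0, 1) = 0" if z: "- h < ereal z" "z < 0" for x z
  unfolding \<phi>_def V_def B_def using flat_equations[where x=x and z=z, OF w p l(1)] dom(2)[of z x, OF z] by blast+
 have t0: "\<phi> (x,0) = \<psi> x" for x unfolding \<phi>_def s0 by (rule tr)
 have fz: "flux_z l \<eta> V B (x,0) = - (c \<bullet> grad2 \<eta> x)" for x using G[of x] kin[of x] unfolding flux_z_def V_def B_def by (simp add: s0 rho_0)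
 have lsub: "UNIV \<times> {-l..0} \<subseteq> ?D"
 proof
  fix q :: "(real^2)\<times>real" assume "q \<in> UNIV \<times> {-l..0}"
  then obtain x z where q: "q = (x,z)" "-l <= z" "z <= 0" by auto
  have "- h <= ereal (-l)" using l(2) by (metis ereal_minus_le_minus uminus_ereal.simps(1))
  then have "- h <= ereal z" using q(2) by (meson ereal_less_eq(3) order_trans)
  then show "q \<in> ?D" using q by simp
 qed
 have lint: "- h < ereal z" if "-l < z" for z
 proof -
  have "- h <= ereal (-l)" using l(2) by (metis ereal_minus_le_minus uminus_ereal.simps(1))
  also have "ereal (-l) < ereal z" using that by simp
  finally show ?thesis .
 qed
 have gp: "grad2 \<psi> x = V (x,0) + B (x,0) *\<^sub>R grad2 \<eta> x" for x
 proof -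
  have "grad2 \<psi> x = (%q. V q + (rho l (snd q)*B q) *\<^sub>R grad2 \<eta> (fst q)) (x,0)"
  proof (rule trace_gradient[where \<phi>=\<phi> and P="%q. V q + (rho l (snd q)*B q) *\<^sub>R grad2 \<eta> (fst q)" and Q="%q. (1 + \<eta> (fst q)*rho1 l (snd q))*B q" and \<psi>=\<psi> and x=x, OF l(1)])
   show "continuous_on (UNIV \<times> {- l..0}) \<phi>" by (rule continuous_on_subset[OF cont(1) lsub])
   show "continuous_on (UNIV \<times> {- l..0}) (%q. V q + (rho l (snd q)*B q) *\<^sub>R grad2 \<eta> (fst q))"
    by (intro continuous_intros continuous_on_subset[OF cont(2) lsub] continuous_on_subset[OF cont(3) lsub]
      continuous_on_compose2[OF rho_cont(1)[OF l(1), of UNIV]] continuous_on_compose2[OF wser_grad2_cont[OF w]]) auto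
   show "(\<phi> has_derivative (%v. (V (x, z) + (rho l (snd (x, z))*B (x, z)) *\<^sub>R grad2 \<eta> (fst (x, z))) \<bullet> fst v +
     (1 + \<eta> (fst (x, z))*rho1 l (snd (x, z)))*B (x, z) * snd v)) (at (x, z))" if "-l < z" "z < 0" for x z using eqs(1)[OF lint[OF that(1)] that(2)] by simp
   show "(\<psi> has_derivative (%w. grad2 \<psi> x \<bullet> w)) (at x)" by (rule wser_has_derivative(1)[OF w\<psi>])
  qed (rule t0)
  then show ?thesis by (simp add: rho_0)
 qed
 \<comment> \<open>Eliminating V from \<open>gp\<close> and from the definition of G gives B (1 +
   |grad \<eta>|^2) = G + grad \<eta> . grad \<psi>, where G = -c . grad \<eta>. The bounds (C+1)
   \<epsilon> for B and (C+2) \<epsilon> for V add up to the constant 2C+3.\<close>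
 have Bs: "\<bar>B (x,0)\<bar> <= (C + 1)*\<epsilon>" for x
 proof -
  let ?g = "grad2 \<eta> x"
  have Gx: "B (x,0) = G x + ?g \<bullet> V (x,0)" using G[of x] unfolding V_def B_def s0 by simp
  have "B (x,0)*(1 + ?g \<bullet> ?g) = G x + ?g \<bullet> grad2 \<psi> x" unfolding gp inner_add_right inner_scaleR_right using Gx by (simp add: algebra_simps)
  moreover have "\<bar>B (x,0)\<bar>*1 <= \<bar>B (x,0)\<bar>*\<bar>1 + ?g \<bullet> ?g\<bar>" by (intro mult_left_mono) auto
  ultimately have "\<bar>B (x,0)\<bar> <= \<bar>G x + ?g \<bullet> grad2 \<psi> x\<bar>" by (simp add: abs_mult)
  also have "\<dots> <= \<bar>c \<bullet> ?g\<bar> + \<bar>?g \<bullet> grad2 \<psi> x\<bar>" using kin[of x] by linarith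
  also have "\<dots> <= norm c*norm ?g + norm ?g*norm (grad2 \<psi> x)" by (intro add_mono Cauchy_Schwarz_ineq2)
  also have "\<dots> <= C*\<epsilon> + 1*\<epsilon>" using bd(2)[of x] bd(3)[of x] C e C0 by (intro add_mono mult_mono) auto
  finally show ?thesis by (simp add: algebra_simps)
 qed
 have Vs: "norm (V (x,0)) <= (C + 2)*\<epsilon>" for x
 proof -
  have "V (x,0) = grad2 \<psi> x - B (x,0) *\<^sub>R grad2 \<eta> x" using gp[of x] by simp
  then have "norm (V (x,0)) <= norm (grad2 \<psi> x) + \<bar>B (x,0)\<bar>*norm (grad2 \<eta> x)"
   using norm_triangle_ineq4[of "grad2 \<psi> x" "B (x,0) *\<^sub>R grad2 \<eta> x"] by simp
  also have "\<dots> <= \<epsilon> + (C + 1)*\<epsilon>*1" using bd(2)[of x] bd(3)[of x] Bs[of x] e C0 by (intro add_mono mult_mono) auto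
  finally show ?thesis by (simp add: algebra_simps)
 qed
 have S: "norm (D\<Phi> (x, \<eta> x)) <= ?S" for x
 proof -
  have "norm (D\<Phi> (x, \<eta> x)) <= norm (V (x,0)) + norm (B (x,0))"
   unfolding V_def B_def s0 using norm_Pair_le[of "fst (D\<Phi> (x, \<eta> x))" "snd (D\<Phi> (x, \<eta> x))"] by simp
  then show ?thesis using Vs[of x] Bs[of x] by (simp add: algebra_simps)
 qed
 have lip: "\<bar>\<eta> x - \<eta> x'\<bar> <= \<epsilon>*norm (x - x')" for x x'
 proof -
  have "norm (\<eta> x - \<eta> x') <= \<epsilon>*norm (x - x')"
  proof (rule differentiable_bound[of UNIV \<eta> "%x w. grad2 \<eta> x \<bullet> w"])
   show "onorm (%w. grad2 \<eta> y \<bullet> w) <= \<epsilon>" for y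
    by (rule onorm_le) (use bd(2)[of y] Cauchy_Schwarz_ineq2 in \<open>force intro: order_trans[OF Cauchy_Schwarz_ineq2] mult_right_mono\<close>)
  qed (use wser_has_derivative(1)[OF w] in auto)
  then show ?thesis by simp
 qed
 have S0: "0 <= ?S" using C0 e by simp
 have inb: "norm (fst (D\<Phi> (x,y))) <= ?S \<and> \<bar>snd (D\<Phi> (x,y))\<bar> <= ?S" if y: "- h < ereal y" "y < \<eta> x" for x y
 proof -
  let ?b = "fst (D\<Phi> (x,y))"
  have "D\<Phi> (x,y) \<bullet> (?b,0) <= ?S*norm (?b,0::real)" by (rule dn_pot_directional_bound[OF p h \<eta>c \<eta>p lip e(1) S _ y]) simp
  then have "norm ?b*norm ?b <= ?S*norm ?b" by (simp add: inner_prod_def norm_Pair dot_square_norm power2_eq_square)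
  then have 1: "norm ?b <= ?S" using S0 by (cases "norm ?b = 0") auto
  have "D\<Phi> (x,y) \<bullet> (0,1) <= ?S*norm (0::real^2,1::real)" by (rule dn_pot_directional_bound[OF p h \<eta>c \<eta>p lip e(1) S _ y]) simp
  moreover have "- D\<Phi> (x,y) \<bullet> (0,1) <= ?S*norm (0::real^2,1::real)"
   by (rule dn_pot_directional_bound[OF dn_pot_minus[OF p] h \<eta>c \<eta>p lip e(1) _ _ y]) (use S in simp_all)
  ultimately have "\<bar>snd (D\<Phi> (x,y))\<bar> <= ?S" by (simp add: inner_prod_def norm_Pair)
  then show ?thesis using 1 by simp
 qed
 have fb: "norm (V (x,z)) <= ?S \<and> \<bar>B (x,z)\<bar> <= ?S" if z: "- h < ereal z" "z < 0" for x z
  using inb[of "snd (shear l \<eta> (x,z))" x] dom(2)[of z x, OF z] unfolding V_def B_def using sp[of x z] by metis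
 have fb': "norm (V (x,z)) <= ?S \<and> \<bar>B (x,z)\<bar> <= ?S" if z: "- h <= ereal z" "z <= 0" for x z
 proof -
  consider "z = 0" | "- h < ereal z" "z < 0" | "- h = ereal z" "z < 0" using z by (cases "z = 0"; force simp: less_le)
  then show ?thesis
  proof cases
   case 1
   have "(C + 2)*\<epsilon> <= ?S" "(C + 1)*\<epsilon> <= ?S" using C0 e by (auto intro!: mult_right_mono)
   then show ?thesis using Vs[of x] Bs[of x] 1 by (metis order_trans)
  next
   case 2 then show ?thesis by (rule fb)
  next
   case 3
   have sub: "Pair x ` {z..0} \<subseteq> ?D"
   proof
    fix q assume "q \<in> Pair x ` {z..0}"
    then obtain u where q: "q = (x,u)" "z <= u" "u <= 0" by auto
    have "- h <= ereal u" using 3 q(2) by simp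
    then show "q \<in> ?D" using q by simp
   qed
   have cl: "closure {z<..<0} = {z..0}" using 3 by simp
   have c1: "continuous_on (closure {z<..<0}) (%u. V (x,u))" "continuous_on (closure {z<..<0}) (%u. B (x,u))" unfolding cl using sub
    by (auto intro!: continuous_on_compose2[OF cont(2)] continuous_on_compose2[OF cont(3)] continuous_intros)
   have i: "- h < ereal u" "u < 0" if "u \<in> {z<..<0}" for u using that 3 by auto
   have "norm (V (x,z)) <= ?S" "norm (B (x,z)) <= ?S" by (rule continuous_on_closure_norm_le[OF c1(1)], use fb i 3 cl in force, use 3 cl in force,
     rule continuous_on_closure_norm_le[OF c1(2)], use fb i 3 cl in force, use 3 cl in force)
   then show ?thesis by simp
  qed
 qed
 have bot: "\<exists>H>0. ereal H <= h \<and> l <= H \<and> (h ~= \<infinity> --> ereal H = h) \<and> (h = \<infinity> --> H0 <= H) \<and> (\<forall>x. \<bar>B (x,-H)\<bar> <= e)" if e: "e > 0" for e H0 :: real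
 proof (cases h)
  case (real hr)
  have "B (x,-hr) = 0" for x
  proof -
   have "shear l \<eta> (x,-hr) = (x,-hr)" using rho_deep[OF l(1), of "-hr"] l(2) real by (simp add: shear_def)
   then show ?thesis unfolding B_def using p real unfolding dn_pot_def by simp
  qed
  then show ?thesis using real h l e by (intro exI[of _ hr]) auto
 next
  case PInf
  then obtain M where M: "!!x y. y < \<eta> x ==> y < - M ==> norm (D\<Phi> (x,y)) < e"
   using p e unfolding dn_pot_def by (metis (mono_tags, lifting) case_prodI mem_Collect_eq snd_conv)
  define H where "H = max (max H0 l) (M + 1)"
  have H: "H0 <= H" "l <= H" "M < H" "0 < H" unfolding H_def using l by auto
  have "\<bar>B (x,-H)\<bar> <= e" for x
  proof -
   have s: "shear l \<eta> (x,-H) = (x,-H)" using rho_deep[OF l(1), of "-H"] H by (simp add: shear_def)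
   have "-H < \<eta> x" using sm[of x] H by linarith
   then have "norm (D\<Phi> (x,-H)) < e" using M H by auto
   moreover have "norm (snd (D\<Phi> (x,-H))) <= norm (D\<Phi> (x,-H))" by (metis norm_snd_le prod.collapse)
   ultimately show ?thesis unfolding B_def s by simp
  qed
  then show ?thesis using H PInf by (intro exI[of _ H]) auto
 qed (use h in auto)
 have "flat_sol l h c \<eta> \<psi> \<phi> V B ?S" unfolding flat_sol_def
  apply (intro conjI cont)
  subgoal using per by blast
  subgoal using eqs by blast
  subgoal using t0 fz by blast
  subgoal using fb' by blast
  subgoal using bot by blast
  done
 then show ?thesis by blast
qed

end

section \<open>Green's identity, Parseval and trigonometric test functions\<close>

context lattice2 begin

lemma mult_cnj_cmod: "z * cnj z = of_real ((cmod z)^2)"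
 by (rule complex_norm_square[symmetric])

lemma av3_integrable: "continuous_on (UNIV \<times> {-H..0}) (f :: (real^2) \<times> real => real) ==> (%q. f (pt (snd q), fst q)) integrable_on cbox (-H,0,0) (0,1,1)"
 by (rule integrable_continuous, rule cont_cell) auto

lemma av3_add: "continuous_on (UNIV \<times> {-H..0}) f ==> continuous_on (UNIV \<times> {-H..0}) g ==> av3 H (%p. f p + g p) = av3 H f + av3 H g"
 unfolding av3_def by (intro integral_add av3_integrable)

lemma av3_diff: "continuous_on (UNIV \<times> {-H..0}) f ==> continuous_on (UNIV \<times> {-H..0}) g ==> av3 H (%p. f p - g p) = av3 H f - av3 H g"
 unfolding av3_def by (intro integral_diff av3_integrable)

lemma av3_cmul: "av3 H (%p. c*f p) = c*av3 H f"
 unfolding av3_def by (rule integral_mult_right)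

lemma av3_mono:
 assumes "continuous_on (UNIV \<times> {-H..0}) f" "continuous_on (UNIV \<times> {-H..0}) g"
  "!!x z. -H <= z ==> z <= 0 ==> f (x,z) <= g (x,z)"
 shows "av3 H f <= av3 H g" unfolding av3_def by (intro integral_le av3_integrable assms) (auto simp: cbox_Pair_eq intro!: assms(3))

lemma av3_abs_le:
 assumes "continuous_on (UNIV \<times> {-H..0}) f" "continuous_on (UNIV \<times> {-H..0}) g"
  "!!x z. -H <= z ==> z <= 0 ==> \<bar>f (x,z)\<bar> <= g (x,z)"
 shows "\<bar>av3 H f\<bar> <= av3 H g"
proof -
 have "av3 H f <= av3 H g" using assms by (intro av3_mono) (auto simp: abs_le_iff)
 moreover have "av3 H (%p. - 1*f p) <= av3 H g" using assms by (intro av3_mono continuous_intros) (auto simp: abs_le_iff)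
 ultimately show ?thesis unfolding av3_cmul by simp
qed

text \<open>Green's identity for a scalar times a divergence free field. It is used for the
  potential difference against the flux difference, for a harmonic test function against the flux
  difference, and for the potential difference against the gradient of that test function.\<close>

lemma product_divergence:
 fixes s Fz sz :: "(real^2) \<times> real => real" and sx Fx :: "(real^2) \<times> real => real^2"
 assumes H: "H > 0"
  and c: "continuous_on (UNIV \<times> {-H..0}) s" "continuous_on (UNIV \<times> {-H..0}) sx" "continuous_on (UNIV \<times> {-H..0}) sz"
   "continuous_on (UNIV \<times> {-H..0}) Fx" "continuous_on (UNIV \<times> {-H..0}) Fz"
  and per: "!!x \<gamma> z. \<gamma> \<in> lat v1 v2 ==> -H < z ==> z < 0 ==> s (x + \<gamma>, z) = s (x, z) \<and> Fx (x + \<gamma>, z) = Fx (x, z)"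
  and ds: "!!x z. -H < z ==> z < 0 ==> (s has_derivative (%v. sx (x,z) \<bullet> fst v + sz (x,z) * snd v)) (at (x,z))"
  and dF: "!!x z. -H < z ==> z < 0 ==> \<exists>L N. (Fx has_derivative L) (at (x,z)) \<and> (Fz has_derivative N) (at (x,z)) \<and>
   L (axis 1 1, 0)$1 + L (axis 2 1, 0)$2 + N (0, 1) = 0"
 shows "av (%x. s (x,0)*Fz (x,0)) - av (%x. s (x,-H)*Fz (x,-H)) = av3 H (%p. sx p \<bullet> Fx p + sz p*Fz p)"
proof (rule torus_divergence[OF H, of "%p. s p *\<^sub>R Fx p" "%p. s p*Fz p"])
 fix x z assume z: "-H < z" "z < 0"
 obtain L N where LN: "(Fx has_derivative L) (at (x,z))" "(Fz has_derivative N) (at (x,z))"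
  "L (axis 1 1, 0)$1 + L (axis 2 1, 0)$2 + N (0, 1) = 0" using dF[OF z] by blast
 let ?d = "%v. sx (x,z) \<bullet> fst v + sz (x,z) * snd v"
 have 1: "((%p. s p *\<^sub>R Fx p) has_derivative (%v. s (x,z) *\<^sub>R L v + ?d v *\<^sub>R Fx (x,z))) (at (x,z))"
  by (rule has_derivative_scaleR[OF ds[OF z] LN(1)])
 have 2: "((%p. s p*Fz p) has_derivative (%v. s (x,z)*N v + ?d v * Fz (x,z))) (at (x,z))" by (rule has_derivative_mult[OF ds[OF z] LN(2)])
 have "(s (x,z) *\<^sub>R L (axis 1 1,0) + ?d (axis 1 1,0) *\<^sub>R Fx (x,z))$1 + (s (x,z) *\<^sub>R L (axis 2 1,0) + ?d (axis 2 1,0) *\<^sub>R Fx (x,z))$2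
  + (s (x,z)*N (0,1) + ?d (0,1)*Fz (x,z)) = s (x,z)*(L (axis 1 1, 0)$1 + L (axis 2 1, 0)$2 + N (0, 1)) + (sx (x,z) \<bullet> Fx (x,z) + sz (x,z)*Fz (x,z))"
  by (simp add: axis_def inner_2 algebra_simps)
 note tr = this
 show "\<exists>L M. ((%p. s p *\<^sub>R Fx p) has_derivative L) (at (x, z)) \<and> ((%p. s p*Fz p) has_derivative M) (at (x, z)) \<and>
   L (axis 1 1, 0)$1 + L (axis 2 1, 0)$2 + M (0, 1) = sx (x,z) \<bullet> Fx (x,z) + sz (x,z)*Fz (x,z)" by (intro exI, rule conjI[OF 1 conjI[OF 2]]) (use LN(3) tr in simp)
qed (use c per in \<open>auto intro!: continuous_intros\<close>)

lemma wser_unique: "wser f a ==> wser g a ==> f = g"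
proof
 fix x assume "wser f a" "wser g a"
 from has_sum_unique[OF wser_sum[OF this(1)] wser_sum[OF this(2)]] show "f x = g x" by (simp only: of_real_eq_iff)
qed

lemma wser_pd_diff:
 assumes "wser f a" "wser g b"
 shows "pd i (%x. f x - g x) = (%x. pd i f x - pd i g x)"
proof (rule wser_unique)
 show "wser (pd i (%x. f x - g x)) (%k. \<i> * of_real (k$i)*(a k - b k))" by (rule wser_has_derivative(2)[OF wser_diff[OF assms]])
 show "wser (%x. pd i f x - pd i g x) (%k. \<i> * of_real (k$i)*(a k - b k))"
  using wser_diff[OF wser_has_derivative(2)[OF assms(1)] wser_has_derivative(2)[OF assms(2)], of i i] by (simp only: right_diff_distrib)
qed

lemma wser_grad_diff:
 assumes "wser f a" "wser g b"
 shows "grad2 (%x. f x - g x) x = grad2 f x - grad2 g x" unfolding grad2_def by (simp add: vec2_eq_iff wser_pd_diff[OF assms])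

lemma wser_square: "wser f a ==> ((%k. (cmod (a k))^2) has_sum av (%x. (f x)^2)) Lam"
 using wser_parseval[of f a f a] by (simp only: mult_cnj_cmod Re_complex_of_real power2_eq_square[of "f _"])

lemma wser_grad_square:
 assumes "wser f a"
 shows "((%k. (norm k)^2*(cmod (a k))^2) has_sum av (%x. (norm (grad2 f x))^2)) Lam"
proof -
 have n: "(norm (v::real^2))^2 = (v$1)^2 + (v$2)^2" for v by (simp add: norm_eq_sqrt_inner inner_2 power2_eq_square)
 note p = wser_has_derivative(2)[OF assms]
 have "((%k. (cmod (\<i> * of_real (k$1)*a k))^2 + (cmod (\<i> * of_real (k$2)*a k))^2) has_sum (av (%x. (pd 1 f x)^2) + av (%x. (pd 2 f x)^2))) Lam"
  by (rule has_sum_add[OF wser_square[OF p] wser_square[OF p]])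
 moreover have "(cmod (\<i> * of_real (k$1)*a k))^2 + (cmod (\<i> * of_real (k$2)*a k))^2 = (norm k)^2*(cmod (a k))^2" for k :: "real^2"
  by (simp add: n norm_mult power_mult_distrib algebra_simps)
 moreover have "av (%x. (pd 1 f x)^2) + av (%x. (pd 2 f x)^2) = av (%x. (norm (grad2 f x))^2)"
  by (subst av_add[symmetric]) (auto intro!: continuous_intros wser_cont[OF p] simp: n grad2_def)
 ultimately show ?thesis by simp
qed

definition kap :: real where "kap = 1/(norm v1 + norm v2)"

lemma v_nz: "norm v1 + norm v2 > 0"
 using w_v(1) by (intro add_pos_nonneg) auto

lemma kap_pos: "kap > 0" unfolding kap_def using v_nz by simp

text \<open>The numbers k.v1 and k.v2 are integers and not both 0, so one of them has modulus at
  least 1.\<close>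

lemma Lam_norm_ge: assumes "k \<in> Lam" "k ~= 0" shows "norm k \<ge> kap"
proof -
 have i: "k \<bullet> v1 \<in> \<int>" "k \<bullet> v2 \<in> \<int>" using assms(1) by (auto simp: dual_lat_iff)
 have "k \<bullet> v1 ~= 0 \<or> k \<bullet> v2 ~= 0" using assms(2) w_expand[of k] by auto
 then have "1 <= \<bar>k \<bullet> v1\<bar> \<or> 1 <= \<bar>k \<bullet> v2\<bar>" using i Ints_nonzero_abs_ge1 by blast
 moreover have "\<bar>k \<bullet> v1\<bar> <= norm k*(norm v1 + norm v2)" "\<bar>k \<bullet> v2\<bar> <= norm k*(norm v1 + norm v2)"
  using Cauchy_Schwarz_ineq2[of k v1] Cauchy_Schwarz_ineq2[of k v2] by (auto simp: algebra_simps intro: order_trans)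
 ultimately have "1 <= norm k*(norm v1 + norm v2)" by linarith
 then show ?thesis unfolding kap_def using v_nz by (simp add: divide_le_eq)
qed

definition trig :: "(real^2) set => (real^2 => complex) => real^2 => complex" where
 "trig S \<beta> x = (\<Sum>k\<in>S. \<beta> k * cis (k \<bullet> x))"

lemma trig_cont: "continuous_on A (trig S \<beta>)"
 unfolding trig_def by (intro continuous_intros)

lemma av_trig:
 assumes w: "wser f a" and S: "finite S" "S \<subseteq> Lam"
 shows "av (%x. f x*Re (trig S \<beta> x)) = Re (\<Sum>k\<in>S. \<beta> k * cnj (a k))"
proof -
 have cf: "continuous_on UNIV f" by (rule wser_cont[OF w])
 have "av (%x. f x*Re (trig S \<beta> x)) = av (%x. Re (\<Sum>k\<in>S. \<beta> k*(cis (k \<bullet> x) * of_real (f x))))"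
  by (rule arg_cong[of _ _ av]) (auto simp: fun_eq_iff trig_def sum_distrib_left algebra_simps)
 also have "\<dots> = Re (av (%x. \<Sum>k\<in>S. \<beta> k*(cis (k \<bullet> x) * of_real (f x))))"
  by (rule av_linear) (auto intro!: continuous_intros cf bounded_linear_Re)
 also have "av (%x. \<Sum>k\<in>S. \<beta> k*(cis (k \<bullet> x) * of_real (f x))) = (\<Sum>k\<in>S. \<beta> k * cnj (a k))"
  by (subst av_sum[OF S(1)]) (auto intro!: continuous_intros cf sum.cong simp: av_cmul_complex wser_coeff_cnj[OF w] subsetD[OF S(2)])
 finally show ?thesis .
qed

lemma av_trig_square:
 assumes S: "finite S" "S \<subseteq> Lam"
 shows "av (%x. (Re (trig S \<beta> x))^2) <= (\<Sum>k\<in>S. (cmod (\<beta> k))^2)"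
proof -
 have "av (%x. (Re (trig S \<beta> x))^2) <= av (%x. Re (trig S \<beta> x * cnj (trig S \<beta> x)))"
 proof (rule av_mono)
  fix x
  have "\<bar>Re (trig S \<beta> x)\<bar>^2 <= (cmod (trig S \<beta> x))^2" by (intro power_mono abs_Re_le_cmod) auto
  then show "(Re (trig S \<beta> x))^2 <= Re (trig S \<beta> x * cnj (trig S \<beta> x))" unfolding mult_cnj_cmod Re_complex_of_real by simp
 qed (intro continuous_intros trig_cont)+
 also have "\<dots> = Re (av (%x. trig S \<beta> x * cnj (trig S \<beta> x)))" by (rule av_linear) (auto intro!: continuous_intros trig_cont bounded_linear_Re)
 also have "av (%x. trig S \<beta> x * cnj (trig S \<beta> x)) = (\<Sum>k\<in>S. \<Sum>j\<in>S. (\<beta> k * cnj (\<beta> j))*(if k = j then 1 else 0))"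
 proof -
  have e: "trig S \<beta> x * cnj (trig S \<beta> x) = (\<Sum>k\<in>S. \<Sum>j\<in>S. (\<beta> k * cnj (\<beta> j)) * cis ((k - j) \<bullet> x))" for x
  proof -
   have "\<beta> k * cis (k \<bullet> x) * cnj (\<beta> j * cis (j \<bullet> x)) = (\<beta> k * cnj (\<beta> j)) * cis ((k - j) \<bullet> x)" for k j
   proof -
    have "cis ((k - j) \<bullet> x) = cis (k \<bullet> x) * cnj (cis (j \<bullet> x))" by (simp add: inner_diff_left cis_cnj cis_mult)
    then show ?thesis by simp
   qed
   then show ?thesis unfolding trig_def cnj_sum sum_product by (simp only:)
  qed
  show ?thesis unfolding e by (subst av_sum[OF S(1)], intro continuous_intros, rule sum.cong[OF refl],
     subst av_sum[OF S(1)], intro continuous_intros, rule sum.cong[OF refl])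
    (use S(2) in \<open>auto simp: av_cmul_complex av_cis Lam_diff subset_iff\<close>)
 qed
 also have "\<dots> = (\<Sum>k\<in>S. of_real ((cmod (\<beta> k))^2))" by (rule sum.cong) (auto simp: S(1) if_distrib mult_cnj_cmod cong: if_cong)
 finally show ?thesis by simp
qed

end

section \<open>Difference of two waves: kinematic equation\<close>

lemma amgm2: "t > 0 ==> x*(2*y) <= t/2*x^2 + 2/t*y^2" for t x y :: real
proof -
 assume t: "t > 0"
 have "0 <= (t*x - 2*y)^2/(2*t)" using t by simp
 also have "\<dots> = t/2*x^2 + 2/t*y^2 - x*(2*y)" using t by (simp add: power2_eq_square field_simps)
 finally show ?thesis by simp
qed

lemma sum_sq_le: "(x + y)^2 <= 2*(x^2 + y^2)" for x y :: real
 using sum_squares_bound[of x y] by (simp add: power2_sum)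

text \<open>Both waves live on the same flat slab and have the same speed. Equal means remove the
  zero mode of the difference, so Poincare-type bounds with \<open>kap\<close> apply.
  \<open>Pm\<close> only ever appears multiplied by a bottom error that tends to 0, so its size is
  irrelevant. \<open>bot\<close> provides one level H that serves both waves.\<close>

locale two_waves = lattice2 +
 fixes l \<epsilon> M Pm :: real and h :: ereal and c :: "real^2" and \<eta>1 \<psi>1 \<eta>2 \<psi>2 :: "real^2 => real"
  and a1 b1 a2 b2 :: "real^2 => complex" and \<phi>1 \<phi>2 B1 B2 :: "(real^2) \<times> real => real" and V1 V2 :: "(real^2) \<times> real => real^2"
 assumes h: "h > 0" and l: "0 < l" "l <= 1" "ereal l <= h"
  and w: "wser \<eta>1 a1" "wser \<psi>1 b1" "wser \<eta>2 a2" "wser \<psi>2 b2"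
  and f1: "flat_sol l h c \<eta>1 \<psi>1 \<phi>1 V1 B1 M" and f2: "flat_sol l h c \<eta>2 \<psi>2 \<phi>2 V2 B2 M"
  and eps: "0 <= \<epsilon>" "(1 + 3/l)*\<epsilon> <= 1/16"
  and small: "!!x. \<bar>\<eta>2 x\<bar> <= \<epsilon>" "!!x. norm (grad2 \<eta>2 x) <= \<epsilon>"
  and Pm: "!!x z. - h <= ereal z ==> z <= 0 ==> \<bar>\<phi>2 (x,z) - \<phi>1 (x,z)\<bar> <= Pm"
  and mean: "a2 0 = a1 0" "b2 0 = b1 0"
  and bot: "!!e H0. e > 0 ==> \<exists>H>0. ereal H <= h \<and> l <= H \<and> (h ~= \<infinity> --> ereal H = h) \<and> (h = \<infinity> --> H0 <= H) \<and>
   (\<forall>x. \<bar>B1 (x,-H)\<bar> <= e \<and> \<bar>B2 (x,-H)\<bar> <= e)"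
begin

definition "\<eta>d x = \<eta>2 x - \<eta>1 x"
definition "\<psi>d x = \<psi>2 x - \<psi>1 x"
definition "ad k = a2 k - a1 k"
definition "bd k = b2 k - b1 k"
definition "gd x = grad2 \<eta>2 x - grad2 \<eta>1 x"
definition "Vd p = V2 p - V1 p"
definition "Bd p = B2 p - B1 p"
text \<open>Dominates both cut-offs: \<open>rho\<close> is at most 1 and \<open>rho1\<close> at most
  3/l.\<close>

definition "Kl = 1 + 3/l"
text \<open>Majorant of \<open>rho\<close> and, up to \<open>Kl\<close>, of \<open>rho1\<close>. It
  is kept in the estimates because surface data multiplied by it remain integrable over the depth
  uniformly in H.\<close>

definition "mu z = max 0 (1 + z/l)"
definition "dd x = (\<eta>d x)^2 + (norm (gd x))^2"
definition "DD = av dd"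
definition "ud p = (norm (Vd p))^2 + (Bd p)^2"
text \<open>Common pointwise bound for the four error fields below: (\<open>Px\<close>,
  \<open>Pz\<close>) is the gradient of the potential difference minus (\<open>Vd\<close>,
  \<open>Bd\<close>), and (\<open>Qx\<close>, \<open>Qz\<close>) is the flux difference minus
  (\<open>Vd\<close>, \<open>Bd\<close>).\<close>

definition "rr p = Kl*(\<epsilon>*(norm (Vd p) + \<bar>Bd p\<bar>) + M*mu (snd p)*(\<bar>\<eta>d (fst p)\<bar> + norm (gd (fst p))))"
definition "Px p = (rho l (snd p)*B2 p) *\<^sub>R grad2 \<eta>2 (fst p) - (rho l (snd p)*B1 p) *\<^sub>R grad2 \<eta>1 (fst p)"
definition "Pz p = \<eta>2 (fst p)*rho1 l (snd p)*B2 p - \<eta>1 (fst p)*rho1 l (snd p)*B1 p"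
definition "Qx p = (\<eta>2 (fst p)*rho1 l (snd p)) *\<^sub>R V2 p - (\<eta>1 (fst p)*rho1 l (snd p)) *\<^sub>R V1 p"
definition "Qz p = rho l (snd p)*(grad2 \<eta>1 (fst p) \<bullet> V1 p) - rho l (snd p)*(grad2 \<eta>2 (fst p) \<bullet> V2 p)"
definition "fxd p = flux_x l \<eta>2 V2 p - flux_x l \<eta>1 V1 p"
definition "fzd p = flux_z l \<eta>2 V2 B2 p - flux_z l \<eta>1 V1 B1 p"
definition "pd3 p = \<phi>2 p - \<phi>1 p"

lemma flux_split: "fxd p = Vd p + Qx p" "fzd p = Bd p + Qz p"
 unfolding fxd_def fzd_def Vd_def Bd_def Qx_def Qz_def flux_x_def flux_z_def by (simp_all add: algebra_simps)

lemma Kl: "Kl \<ge> 1" "3/l <= Kl" "Kl*\<epsilon> <= 1/16"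
 unfolding Kl_def using l eps by auto

lemma M0: "0 <= M"
proof -
 have "- h <= ereal 0" using h by (metis ereal_uminus_le_0_iff less_imp_le zero_ereal_def)
 then have "\<bar>B1 (0,0)\<bar> <= M" using flat_solD(10)[OF f1, of 0 0] by simp
 then show ?thesis by linarith
qed

text \<open>Every error is a difference of products, written as (surface data of wave 2) times
  (velocity difference) plus (surface difference) times (velocity of wave 1). The first factor is at
  most \<epsilon>, the last at most M.\<close>

lemma pert_bounds:
 assumes z: "- h <= ereal z" "z <= 0"
 shows "norm (Px (x,z)) <= rr (x,z)" "\<bar>Pz (x,z)\<bar> <= rr (x,z)" "norm (Qx (x,z)) <= rr (x,z)" "\<bar>Qz (x,z)\<bar> <= rr (x,z)"
proof -
 let ?r = "rho l z" and ?s = "rho1 l z" and ?m = "mu z"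
 note rb = rho_bounds[OF l(1) z(2)]
 have r: "0 <= ?r" "?r <= 1" "?r <= ?m" "0 <= ?s" "?s <= Kl" "?s <= Kl*?m" "0 <= ?m"
 proof -
  have m: "0 <= ?m" "?m <= 1" using rb unfolding mu_def by auto
  show "0 <= ?r" "?r <= 1" "?r <= ?m" "0 <= ?s" "0 <= ?m" using rb m unfolding mu_def by auto
  have "?s <= 3/l*?m" using rb unfolding mu_def by simp
  also have "\<dots> <= Kl*?m" using Kl(2) m by (intro mult_right_mono) auto
  finally show "?s <= Kl*?m" .
  also have "\<dots> <= Kl*1" using Kl(1) m by (intro mult_left_mono) auto
  finally show "?s <= Kl" by simp
 qed
 have bB: "\<bar>B1 (x,z)\<bar> <= M" and bV: "norm (V1 (x,z)) <= M" using flat_solD(9,10)[OF f1 z] by auto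
 let ?v = "norm (Vd (x,z))" and ?b = "\<bar>Bd (x,z)\<bar>" and ?e = "\<bar>\<eta>d x\<bar>" and ?g = "norm (gd x)"
 have K0: "0 <= Kl" using Kl by simp
 have key: "X <= rr (x,z)" if "X <= Kl*(\<epsilon>*p) + Kl*(M*?m*q)" "p <= ?v + ?b" "q <= ?e + ?g" "0 <= p" "0 <= q" for X p q
 proof -
  have "\<epsilon>*p <= \<epsilon>*(?v + ?b)" using eps that by (intro mult_left_mono) auto
  moreover have "M*?m*q <= M*?m*(?e + ?g)" using M0 r that by (intro mult_left_mono mult_nonneg_nonneg) auto
  ultimately have "Kl*(\<epsilon>*p + M*?m*q) <= Kl*(\<epsilon>*(?v + ?b) + M*?m*(?e + ?g))" by (intro mult_left_mono[OF add_mono] K0)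
  then show ?thesis using that(1) unfolding rr_def by (simp add: algebra_simps)
 qed
 have up: "y*(p*q) <= Kl*(e*q)" if "0 <= y" "y <= Kl" "0 <= p" "p <= e" "0 <= q" for y p q e :: real
 proof -
  have "y*(p*q) <= Kl*(p*q)" using that by (intro mult_right_mono) auto
  also have "\<dots> <= Kl*(e*q)" using that K0 by (intro mult_left_mono mult_right_mono) auto
  finally show ?thesis .
 qed
 have um: "y*(p*q) <= Kl*(M*?m*q)" if "0 <= y" "y <= Kl*?m" "0 <= p" "p <= M" "0 <= q" for y p q
 proof -
  have "y*(p*q) <= (Kl*?m)*(M*q)" using that K0 r by (intro mult_mono) auto
  then show ?thesis by (simp add: mult_ac)
 qed
 have rK: "?r <= Kl" "?r <= Kl*?m" using r Kl(1) mult_right_mono[OF Kl(1) r(7)] by auto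
 show "norm (Px (x,z)) <= rr (x,z)"
 proof (rule key)
  have "Px (x,z) = ?r *\<^sub>R (Bd (x,z) *\<^sub>R grad2 \<eta>2 x) + ?r *\<^sub>R (B1 (x,z) *\<^sub>R gd x)" unfolding Px_def Bd_def gd_def by (simp add: algebra_simps)
  then have "norm (Px (x,z)) <= ?r*(norm (grad2 \<eta>2 x)*?b) + ?r*(\<bar>B1 (x,z)\<bar>*?g)"
   using norm_triangle_ineq[of "?r *\<^sub>R (Bd (x,z) *\<^sub>R grad2 \<eta>2 x)" "?r *\<^sub>R (B1 (x,z) *\<^sub>R gd x)"] r by (simp add: abs_mult mult_ac)
  also have "\<dots> <= Kl*(\<epsilon>*?b) + Kl*(M*?m*?g)" by (intro add_mono up um) (use r rK small bB in auto)
  finally show "norm (Px (x,z)) <= Kl*(\<epsilon>*?b) + Kl*(M*?m*?g)" .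
 qed auto
 show "\<bar>Pz (x,z)\<bar> <= rr (x,z)"
 proof (rule key)
  have "Pz (x,z) = ?s*(\<eta>2 x*Bd (x,z)) + ?s*(B1 (x,z)*\<eta>d x)" unfolding Pz_def Bd_def \<eta>d_def by (simp add: algebra_simps)
  then have "\<bar>Pz (x,z)\<bar> <= ?s*(\<bar>\<eta>2 x\<bar>*?b) + ?s*(\<bar>B1 (x,z)\<bar>*?e)"
   using abs_triangle_ineq[of "?s*(\<eta>2 x*Bd (x,z))" "?s*(B1 (x,z)*\<eta>d x)"] r by (simp add: abs_mult)
  also have "\<dots> <= Kl*(\<epsilon>*?b) + Kl*(M*?m*?e)" by (intro add_mono up um) (use r rK small bB in auto)
  finally show "\<bar>Pz (x,z)\<bar> <= Kl*(\<epsilon>*?b) + Kl*(M*?m*?e)" .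
 qed auto
 show "norm (Qx (x,z)) <= rr (x,z)"
 proof (rule key)
  have "Qx (x,z) = ?s *\<^sub>R (\<eta>2 x *\<^sub>R Vd (x,z)) + ?s *\<^sub>R (\<eta>d x *\<^sub>R V1 (x,z))" unfolding Qx_def Vd_def \<eta>d_def by (simp add: algebra_simps)
  then have "norm (Qx (x,z)) <= ?s*(\<bar>\<eta>2 x\<bar>*?v) + ?s*(norm (V1 (x,z))*?e)"
   using norm_triangle_ineq[of "?s *\<^sub>R (\<eta>2 x *\<^sub>R Vd (x,z))" "?s *\<^sub>R (\<eta>d x *\<^sub>R V1 (x,z))"] r by (simp add: abs_mult mult_ac)
  also have "\<dots> <= Kl*(\<epsilon>*?v) + Kl*(M*?m*?e)" by (intro add_mono up um) (use r rK small bV in auto)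
  finally show "norm (Qx (x,z)) <= Kl*(\<epsilon>*?v) + Kl*(M*?m*?e)" .
 qed auto
 show "\<bar>Qz (x,z)\<bar> <= rr (x,z)"
 proof (rule key)
  have "Qz (x,z) = - (?r*(grad2 \<eta>2 x \<bullet> Vd (x,z)) + ?r*(gd x \<bullet> V1 (x,z)))" unfolding Qz_def Vd_def gd_def by (simp add: algebra_simps)
  then have "\<bar>Qz (x,z)\<bar> <= ?r*\<bar>grad2 \<eta>2 x \<bullet> Vd (x,z)\<bar> + ?r*\<bar>gd x \<bullet> V1 (x,z)\<bar>"
   using abs_triangle_ineq[of "?r*(grad2 \<eta>2 x \<bullet> Vd (x,z))" "?r*(gd x \<bullet> V1 (x,z))"] r by (simp add: abs_mult)
  also have "\<dots> <= ?r*(norm (grad2 \<eta>2 x)*?v) + ?r*(norm (V1 (x,z))*?g)"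
   using r Cauchy_Schwarz_ineq2[of "grad2 \<eta>2 x" "Vd (x,z)"] Cauchy_Schwarz_ineq2[of "gd x" "V1 (x,z)"] by (intro add_mono mult_left_mono) (auto simp: mult.commute)
  also have "\<dots> <= Kl*(\<epsilon>*?v) + Kl*(M*?m*?g)" by (intro add_mono up um) (use r rK small bV in auto)
  finally show "\<bar>Qz (x,z)\<bar> <= Kl*(\<epsilon>*?v) + Kl*(M*?m*?g)" .
 qed auto
qed

lemma rr_square: "(rr p)^2 <= 4*Kl^2*\<epsilon>^2*ud p + 4*Kl^2*M^2*((mu (snd p))^2*dd (fst p))"
proof -
 let ?s = "norm (Vd p) + \<bar>Bd p\<bar>" and ?q = "\<bar>\<eta>d (fst p)\<bar> + norm (gd (fst p))"
 have "(rr p)^2 <= Kl^2*(2*((\<epsilon>*?s)^2 + (M*mu (snd p)*?q)^2))"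
  unfolding rr_def power_mult_distrib[of Kl] by (intro mult_left_mono sum_sq_le) auto
 also have "\<dots> = 2*Kl^2*\<epsilon>^2*?s^2 + 2*Kl^2*M^2*(mu (snd p))^2*?q^2"
 proof -
  have "K^2*(2*((e * s)^2 + (m*u*q)^2)) = 2*K^2*e^2 * s^2 + 2*K^2*m^2*u^2*q^2" for K e s m u q :: real
   by (simp add: power_mult_distrib algebra_simps)
  then show ?thesis .
 qed
 also have "\<dots> <= 2*Kl^2*\<epsilon>^2*(2*((norm (Vd p))^2 + \<bar>Bd p\<bar>^2)) + 2*Kl^2*M^2*(mu (snd p))^2*(2*(\<bar>\<eta>d (fst p)\<bar>^2 + (norm (gd (fst p)))^2))"
  by (intro add_mono mult_left_mono sum_sq_le) auto
 finally show ?thesis by (simp add: ud_def dd_def algebra_simps)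
qed

text \<open>The quadratic form is |(\<open>Vd\<close>,\<open>Bd\<close>)|^2 plus cross terms linear
  and quadratic in \<open>rr\<close>. Young's inequality spends ud/4 on the linear ones and leaves
  10 \<open>rr\<close>^2. As \<open>Kl\<close> \<epsilon> is at most 1/16, the velocity part of that
  is at most (40/256) ud, below the second quarter.\<close>

lemma energy_pointwise:
 assumes z: "- h <= ereal z" "z <= 0"
 shows "ud (x,z)/2 - 40*Kl^2*M^2*((mu z)^2*dd x) <= (Vd (x,z) + Px (x,z)) \<bullet> fxd (x,z) + (Bd (x,z) + Pz (x,z))*fzd (x,z)"
proof -
 let ?p = "(x,z)"
 let ?v = "norm (Vd ?p)" and ?b = "\<bar>Bd ?p\<bar>" and ?r = "rr ?p"
 note pb = pert_bounds[OF z, of x]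
 have r0: "0 <= ?r" using pb(2) by linarith
 have ip: "- (s*t) <= u \<bullet> y" if "norm u <= s" "norm y <= t" for u y :: "real^2" and s t
 proof -
  have "\<bar>u \<bullet> y\<bar> <= norm u*norm y" by (rule Cauchy_Schwarz_ineq2)
  also have "\<dots> <= s*t" using that by (intro mult_mono) (auto intro: order_trans[OF norm_ge_zero])
  finally show ?thesis by linarith
 qed
 have ip1: "- (s*t) <= u*y" if "\<bar>u\<bar> <= s" "\<bar>y\<bar> <= t" for u y s t :: real
 proof -
  have "\<bar>u*y\<bar> <= s*t" unfolding abs_mult using that by (intro mult_mono) auto
  then show ?thesis by linarith
 qed
 have "(Vd ?p + Px ?p) \<bullet> fxd ?p = ?v^2 + (Vd ?p \<bullet> Qx ?p + Px ?p \<bullet> Vd ?p + Px ?p \<bullet> Qx ?p)"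
  unfolding flux_split by (simp add: inner_add_left inner_add_right dot_square_norm)
 also have "\<dots> \<ge> ?v^2 + (- (?v * ?r) + - (?r*?v) + - (?r*?r))" by (intro add_mono ip) (use pb in auto)
 finally have 1: "?v^2 - 2*?v * ?r - ?r^2 <= (Vd ?p + Px ?p) \<bullet> fxd ?p" by (simp add: power2_eq_square)
 have "(Bd ?p + Pz ?p)*fzd ?p = (Bd ?p)^2 + (Bd ?p*Qz ?p + Pz ?p*Bd ?p + Pz ?p*Qz ?p)" unfolding flux_split by (simp add: algebra_simps power2_eq_square)
 also have "\<dots> \<ge> (Bd ?p)^2 + (- (?b*?r) + - (?r*?b) + - (?r*?r))" by (intro add_mono ip1) (use pb in auto)
 finally have 2: "(Bd ?p)^2 - 2*?b*?r - ?r^2 <= (Bd ?p + Pz ?p)*fzd ?p" by (simp add: power2_eq_square)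
 have "(?v + ?b)*(2*?r) <= (1/4)/2*(?v + ?b)^2 + 2/(1/4)*?r^2" by (rule amgm2) simp
 moreover have "(?v + ?b)^2 <= 2*ud ?p" using sum_sq_le[of ?v ?b] by (simp add: ud_def)
 ultimately have 3: "(?v + ?b)*(2*?r) <= ud ?p/4 + 8*?r^2" by simp
 have "(Kl*\<epsilon>)^2 <= (1/16)^2" using Kl eps by (intro power_mono mult_nonneg_nonneg) auto
 then have "(Kl*\<epsilon>)^2*ud ?p <= (1/256)*ud ?p" unfolding ud_def by (intro mult_right_mono) (auto simp: power2_eq_square)
 moreover have "ud ?p \<ge> 0" unfolding ud_def by simp
 ultimately have "40*Kl^2*\<epsilon>^2*ud ?p <= ud ?p/4" unfolding power_mult_distrib by simp
 moreover have "10*(rr ?p)^2 <= 10*(4*Kl^2*\<epsilon>^2*ud ?p + 4*Kl^2*M^2*((mu z)^2*dd x))" using rr_square[of ?p] by simp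
 ultimately have "10*?r^2 <= ud ?p/4 + 40*Kl^2*M^2*((mu z)^2*dd x)" by (simp add: algebra_simps)
 moreover have "(?v + ?b)*(2*?r) = 2*?v * ?r + 2*?b*?r" by (simp add: algebra_simps)
 moreover have "ud ?p = ?v^2 + (Bd ?p)^2" by (simp add: ud_def)
 ultimately show ?thesis using 1 2 3 by linarith
qed

lemma cont_slab:
 assumes "ereal H <= h"
 shows "continuous_on (UNIV \<times> {-H..0}) V1" "continuous_on (UNIV \<times> {-H..0}) V2" "continuous_on (UNIV \<times> {-H..0}) B1"
  "continuous_on (UNIV \<times> {-H..0}) B2" "continuous_on (UNIV \<times> {-H..0}) \<phi>1" "continuous_on (UNIV \<times> {-H..0}) \<phi>2"
proof -
 have sub: "UNIV \<times> {-H..0} \<subseteq> {(x::real^2,z). - h <= ereal z \<and> z <= 0}"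
 proof
  fix q :: "(real^2)\<times>real" assume "q \<in> UNIV \<times> {-H..0}"
  then obtain x z where q: "q = (x,z)" "-H <= z" "z <= 0" by auto
  have "- h <= ereal (-H)" using assms by (metis ereal_minus_le_minus uminus_ereal.simps(1))
  then have "- h <= ereal z" using q(2) by (meson ereal_less_eq(3) order_trans)
  then show "q \<in> {(x::real^2,z). - h <= ereal z \<and> z <= 0}" using q by simp
 qed
 show "continuous_on (UNIV \<times> {-H..0}) V1" "continuous_on (UNIV \<times> {-H..0}) V2" "continuous_on (UNIV \<times> {-H..0}) B1"
  "continuous_on (UNIV \<times> {-H..0}) B2" "continuous_on (UNIV \<times> {-H..0}) \<phi>1" "continuous_on (UNIV \<times> {-H..0}) \<phi>2"
  using flat_solD(1-3)[OF f1] flat_solD(1-3)[OF f2] continuous_on_subset[OF _ sub] by blast+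
qed

lemma slab_le: "ereal H <= h ==> -H <= z ==> - h <= ereal z"
 by (metis ereal_less_eq(3) ereal_minus_le_minus order_trans uminus_ereal.simps(1))

lemma slab_less: "ereal H <= h ==> -H < z ==> - h < ereal z"
 by (metis ereal_minus_le_minus le_less_trans less_ereal.simps(1) uminus_ereal.simps(1))

lemma cont_surface:
 "continuous_on UNIV \<eta>1" "continuous_on UNIV \<eta>2" "continuous_on UNIV \<psi>1" "continuous_on UNIV \<psi>2"
 "continuous_on UNIV (grad2 \<eta>1)" "continuous_on UNIV (grad2 \<eta>2)" "continuous_on UNIV \<eta>d" "continuous_on UNIV \<psi>d" "continuous_on UNIV gd" "continuous_on UNIV dd"
proof -
 show 1: "continuous_on UNIV \<eta>1" "continuous_on UNIV \<eta>2" "continuous_on UNIV \<psi>1" "continuous_on UNIV \<psi>2"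
  "continuous_on UNIV (grad2 \<eta>1)" "continuous_on UNIV (grad2 \<eta>2)" using w wser_cont wser_grad2_cont by blast+
 show 2: "continuous_on UNIV \<eta>d" "continuous_on UNIV \<psi>d" "continuous_on UNIV gd"
  unfolding \<eta>d_def[abs_def] \<psi>d_def[abs_def] gd_def[abs_def] by (intro continuous_intros 1)+
 show "continuous_on UNIV dd" unfolding dd_def[abs_def] by (intro continuous_intros 2)
qed

lemma cont_fst: "continuous_on UNIV f ==> continuous_on S (%p. f (fst p))"
 by (rule continuous_on_compose2[of UNIV f]) (auto intro!: continuous_intros)

lemma cont_snd: "continuous_on UNIV f ==> continuous_on S (%p. f (snd p))"
 by (rule continuous_on_compose2[of UNIV f]) (auto intro!: continuous_intros)

lemma mu_cont: "continuous_on S mu" unfolding mu_def[abs_def] using l by (intro continuous_intros) auto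

lemma cont_diffs:
 assumes H: "ereal H <= h"
 defines "S \<equiv> (UNIV \<times> {-H..0}) :: ((real^2) \<times> real) set"
 shows "continuous_on S Vd" "continuous_on S Bd" "continuous_on S ud" "continuous_on S pd3"
  "continuous_on S Px" "continuous_on S Pz" "continuous_on S Qx" "continuous_on S Qz" "continuous_on S fxd" "continuous_on S fzd"
  "continuous_on S rr" "continuous_on S (%p. (mu (snd p))^2*dd (fst p))"
proof -
 note cs = cont_slab[OF H, folded S_def]
 note cf = cont_surface[THEN cont_fst, of S]
 note cr = cont_snd[OF rho_cont(1)[OF l(1)], of S] cont_snd[OF rho_cont(2)[OF l(1)], of S] cont_snd[OF mu_cont, of S]
 show 1: "continuous_on S Vd" "continuous_on S Bd" "continuous_on S pd3" unfolding Vd_def[abs_def] Bd_def[abs_def] pd3_def[abs_def] by (intro continuous_intros cs)+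
 show 2: "continuous_on S Px" "continuous_on S Pz" "continuous_on S Qx" "continuous_on S Qz"
  unfolding Px_def[abs_def] Pz_def[abs_def] Qx_def[abs_def] Qz_def[abs_def] by (intro continuous_intros cs cf cr)+
 show "continuous_on S fxd" "continuous_on S fzd" unfolding flux_split[abs_def] by (intro continuous_intros 1 2)+
 show "continuous_on S ud" "continuous_on S rr" "continuous_on S (%p. (mu (snd p))^2*dd (fst p))"
  unfolding ud_def[abs_def] rr_def[abs_def] by (intro continuous_intros 1 cf cr)+
qed

text \<open>\<open>mu\<close>^2 is the derivative of (l/3) \<open>rho\<close>, so its integral over
  the depth is l/3, whatever H is.\<close>

lemma av3_mu:
 assumes H: "l <= H" "ereal H <= h"
 shows "av3 H (%p. (mu (snd p))^2*dd (fst p)) <= DD"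
proof -
 have "av3 H (%p. (mu (snd p))^2*dd (fst p)) = integral {-H..0} (%z. (mu z)^2*DD)"
  using av3_slices[OF cont_diffs(12)[OF H(2)]] l H by (simp add: av_cmul DD_def)
 also have "\<dots> = integral {-H..0} (%z. (mu z)^2)*DD" by simp
 also have "integral {-H..0} (%z. (mu z)^2) = l/3*rho l 0 - l/3*rho l (-H)"
 proof (rule integral_unique, rule fundamental_theorem_of_calculus)
  show "((%z. l/3*rho l z) has_vector_derivative (mu z)^2) (at z within {-H..0})" for z
  proof -
   have "((%z. l/3*rho l z) has_real_derivative l/3*rho1 l z) (at z within {-H..0})" by (rule DERIV_cmult[OF has_field_derivative_at_within[OF rho_deriv(1)[OF l(1)]]])
   then show ?thesis using l by (simp add: has_real_derivative_iff_has_vector_derivative rho1_def mu_def)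
  qed
 qed (use H l in auto)
 also have "\<dots> = l/3" using rho_deep[OF l(1), of "-H"] H by (simp add: rho_0)
 also have "l/3*DD <= 1*DD" using l av_nonneg[OF cont_surface(10)] unfolding DD_def by (intro mult_right_mono) (auto simp: dd_def)
 finally show ?thesis by simp
qed

end

context lattice2
begin

lemma cis_lat: "k \<in> Lam ==> \<gamma> \<in> lat v1 v2 ==> cis (k \<bullet> (x + \<gamma>)) = cis (k \<bullet> x)"
proof -
 assume k: "k \<in> Lam" and g: "\<gamma> \<in> lat v1 v2"
 obtain m n :: int where km: "k = of_int m *\<^sub>R w1 + of_int n *\<^sub>R w2" using k unfolding dual_lat_eq by auto
 obtain p q :: int where "\<gamma> \<bullet> w1/(2*pi) = of_int p" "\<gamma> \<bullet> w2/(2*pi) = of_int q" using g unfolding lat_iff by (auto elim!: Ints_cases)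
 then have pq: "w1 \<bullet> \<gamma> = 2*pi* of_int p" "w2 \<bullet> \<gamma> = 2*pi* of_int q" by (auto simp: field_simps inner_commute)
 have "k \<bullet> \<gamma> = 2*pi* of_int (m*p + n*q)" unfolding km by (simp add: inner_add_left pq algebra_simps)
 then show ?thesis by (simp add: inner_add_right cis_multiple_2pi flip: cis_mult)
qed

end

context two_waves begin

lemma div_free_diff:
 assumes "- h < ereal z" "z < 0"
 shows "\<exists>L N. (fxd has_derivative L) (at (x,z)) \<and> (fzd has_derivative N) (at (x,z)) \<and>
   L (axis 1 1, 0)$1 + L (axis 2 1, 0)$2 + N (0, 1) = 0"
proof -
 obtain L1 N1 where 1: "(flux_x l \<eta>1 V1 has_derivative L1) (at (x,z))" "(flux_z l \<eta>1 V1 B1 has_derivative N1) (at (x,z))"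
  "L1 (axis 1 1, 0)$1 + L1 (axis 2 1, 0)$2 + N1 (0, 1) = 0" using flat_solD(6)[OF f1 assms, of x] by blast
 obtain L2 N2 where 2: "(flux_x l \<eta>2 V2 has_derivative L2) (at (x,z))" "(flux_z l \<eta>2 V2 B2 has_derivative N2) (at (x,z))"
  "L2 (axis 1 1, 0)$1 + L2 (axis 2 1, 0)$2 + N2 (0, 1) = 0" using flat_solD(6)[OF f2 assms, of x] by blast
 show ?thesis unfolding fxd_def[abs_def] fzd_def[abs_def]
  by (intro exI, rule conjI[OF has_derivative_diff[OF 2(1) 1(1)] conjI[OF has_derivative_diff[OF 2(2) 1(2)]]]) (use 1(3) 2(3) in simp)
qed

lemma pot_diff_derivative:
 assumes z: "- h < ereal z" "z < 0"
 shows "(pd3 has_derivative (%v. (Vd (x,z) + Px (x,z)) \<bullet> fst v + (Bd (x,z) + Pz (x,z)) * snd v)) (at (x,z))" unfolding pd3_def[abs_def]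
 by (rule has_derivative_eq_rhs, rule has_derivative_diff[OF flat_solD(5)[OF f2 z] flat_solD(5)[OF f1 z]])
  (auto simp: fun_eq_iff Vd_def Bd_def Px_def Pz_def inner_add_left inner_diff_left algebra_simps)

lemma diff_periodic:
 assumes g: "\<gamma> \<in> lat v1 v2" and z: "- h < ereal z" "z < 0"
 shows "pd3 (x + \<gamma>, z) = pd3 (x, z)" "fxd (x + \<gamma>, z) = fxd (x, z)"
 using flat_solD(4)[OF f1 g z, of x] flat_solD(4)[OF f2 g z, of x] periodic_lat[OF wser_periodic[OF w(1)] g, of x]
  periodic_lat[OF wser_periodic[OF w(3)] g, of x] by (simp_all add: pd3_def fxd_def flux_x_def)

lemma surface_values: "pd3 (x,0) = \<psi>d x" "fzd (x,0) = - (c \<bullet> gd x)"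
 using flat_solD(7,8)[OF f1] flat_solD(7,8)[OF f2] by (simp_all add: pd3_def \<psi>d_def fzd_def gd_def inner_diff_right)

lemma bottom_flux:
 assumes "l <= H" "\<bar>B1 (x,-H)\<bar> <= e" "\<bar>B2 (x,-H)\<bar> <= e"
 shows "\<bar>fzd (x,-H)\<bar> <= 2*e" using rho_deep[OF l(1), of "-H"] assms by (simp add: fzd_def flux_z_def)

text \<open>The flux difference is tested with the potential difference. The surface term follows
  from the kinematic condition; at the bottom the shear is the identity, so the flux there is the
  small vertical velocity and costs at most 2 e \<open>Pm\<close>.\<close>

lemma energy_estimate:
 assumes H: "H > 0" "ereal H <= h" "l <= H" and B: "!!x. \<bar>B1 (x,-H)\<bar> <= e" "!!x. \<bar>B2 (x,-H)\<bar> <= e"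
 shows "av3 H ud <= 2*\<bar>av (%x. (c \<bullet> gd x)*\<psi>d x)\<bar> + 80*Kl^2*M^2*DD + 4*e*Pm"
proof -
 note cd = cont_diffs[OF H(2)]
 have e0: "e \<ge> 0" using B(1)[of 0] by linarith
 have zz: "- h < ereal z" if "-H < z" for z by (rule slab_less[OF H(2) that])
 have id: "av (%x. pd3 (x,0)*fzd (x,0)) - av (%x. pd3 (x,-H)*fzd (x,-H)) = av3 H (%p. (Vd p + Px p) \<bullet> fxd p + (Bd p + Pz p)*fzd p)"
  by (rule product_divergence[OF H(1)])
   (use zz pot_diff_derivative div_free_diff diff_periodic in \<open>auto intro!: continuous_intros cd\<close>)
 have "av3 H (%p. (1/2)*ud p - (40*Kl^2*M^2)*((mu (snd p))^2*dd (fst p))) <= av3 H (%p. (Vd p + Px p) \<bullet> fxd p + (Bd p + Pz p)*fzd p)"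
 proof (rule av3_mono)
  fix x z assume z: "-H <= z" "z <= 0"
  show "(1/2)*ud (x,z) - 40*Kl^2*M^2*((mu (snd (x,z)))^2*dd (fst (x,z))) <= (Vd (x,z) + Px (x,z)) \<bullet> fxd (x,z) + (Bd (x,z) + Pz (x,z))*fzd (x,z)"
   using energy_pointwise[OF slab_le[OF H(2) z(1)] z(2), of x] by simp
 qed (intro continuous_intros cd)+
 moreover have "av3 H (%p. (1/2)*ud p - (40*Kl^2*M^2)*((mu (snd p))^2*dd (fst p)))
   = (1/2)*av3 H ud - (40*Kl^2*M^2)*av3 H (%p. (mu (snd p))^2*dd (fst p))"
  by (subst av3_diff, intro continuous_intros cd, intro continuous_intros cd, simp only: av3_cmul)
 moreover have "(40*Kl^2*M^2)*av3 H (%p. (mu (snd p))^2*dd (fst p)) <= (40*Kl^2*M^2)*DD"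
  by (intro mult_left_mono av3_mu H) auto
 moreover have "\<bar>av (%x. pd3 (x,-H)*fzd (x,-H))\<bar> <= Pm*(2*e)"
 proof -
  have "norm (av (%x. pd3 (x,-H)*fzd (x,-H))) <= Pm*(2*e)"
  proof (rule av_norm_le)
   show "continuous_on UNIV (%x. pd3 (x,-H)*fzd (x,-H))" by (intro continuous_intros continuous_on_compose2[OF cd(4)] continuous_on_compose2[OF cd(10)]) (use H in auto)
   fix x
   have "\<bar>pd3 (x,-H)\<bar> <= Pm" unfolding pd3_def using Pm[of "-H" x] slab_le[OF H(2), of "-H"] H by simp
   then show "norm (pd3 (x,-H)*fzd (x,-H)) <= Pm*(2*e)" using bottom_flux[OF H(3) B] e0 by (simp add: abs_mult mult_mono)
  qed
  then show ?thesis by simp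
 qed
 moreover have "av (%x. pd3 (x,0)*fzd (x,0)) = - av (%x. (c \<bullet> gd x)*\<psi>d x)" unfolding surface_values by (simp add: mult.commute av_minus)
 moreover have "X <= 2*\<bar>T\<bar> + 80*K*m*D + 4*e*P"
  if a: "L <= R" "L = 1/2*X - 40*K*m*Mu" "40*K*m*Mu <= 40*K*m*D" "\<bar>Bq\<bar> <= P*(2*e)" "Tt = - T" "Tt - Bq = R"
  for L R X Mu D T Tt Bq P K m :: real
 proof -
  define u v q where "u = K*m*Mu" and "v = K*m*D" and "q = P*e"
  have "L = 1/2*X - 40*u" "40*u <= 40 * v" "\<bar>Bq\<bar> <= 2*q" using a(2-4) unfolding u_def v_def q_def by (simp_all only: mult.assoc mult.left_commute)
  then have "X <= 2*\<bar>T\<bar> + 80 * v + 4*q" using a(1,5,6) by linarith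
  then show ?thesis unfolding u_def v_def q_def by (simp only: mult.assoc mult.left_commute mult.commute[of P])
 qed
 ultimately show ?thesis using id by blast
qed

lemma av3_linear_combination:
 assumes "continuous_on (UNIV \<times> {-H..0}) f" "continuous_on (UNIV \<times> {-H..0}) g" "continuous_on (UNIV \<times> {-H..0}) k"
 shows "av3 H (%p. t*f p + s*(a*g p + b*k p)) = t*av3 H f + s*(a*av3 H g + b*av3 H k)"
proof -
 have 1: "av3 H (%p. t*f p + s*(a*g p + b*k p)) = av3 H (%p. t*f p) + av3 H (%p. s*(a*g p + b*k p))"
  by (rule av3_add) (intro continuous_intros assms)+
 have 2: "av3 H (%p. a*g p + b*k p) = av3 H (%p. a*g p) + av3 H (%p. b*k p)" by (rule av3_add) (intro continuous_intros assms)+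
 show ?thesis by (simp only: 1 2 av3_cmul)
qed

section \<open>Harmonic extension of trigonometric polynomials, and the tested kinematic
  equation\<close>

definition "us \<beta> k x = Re (\<beta> k * cis (k \<bullet> x))" for \<beta> :: "real^2 => complex"
definition "us1 \<beta> k x = Re (\<i>*\<beta> k * cis (k \<bullet> x))" for \<beta> :: "real^2 => complex"
text \<open>Vertical profile of a harmonic mode with value 1 at the surface and zero normal
  derivative at depth H; \<open>SS\<close> is its derivative divided by |k|.\<close>

definition "CC H k z = cosh (norm k*(z + H))/cosh (norm k*H)" for H z :: real and k :: "real^2"
definition "SS H k z = sinh (norm k*(z + H))/cosh (norm k*H)" for H z :: real and k :: "real^2"

lemma us_derivative:
 "(us \<beta> k has_derivative (%v. (k \<bullet> v)*us1 \<beta> k x)) (at x)"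
 "(us1 \<beta> k has_derivative (%v. - (k \<bullet> v)*us \<beta> k x)) (at x)"
proof -
 have d: "((%x. g * cis (k \<bullet> x)) has_derivative (%v. g*(\<i> * of_real (k \<bullet> v) * cis (k \<bullet> x)))) (at x)" for g
 proof -
  have "((%x. \<i> * complex_of_real (k \<bullet> x)) has_derivative (%v. \<i> * of_real (k \<bullet> v))) (at x)"
   by (intro has_derivative_mult_right has_derivative_of_real has_derivative_inner_right has_derivative_ident)
  from has_derivative_compose[OF this DERIV_exp[unfolded has_field_derivative_def]]
  have "((%x. exp (\<i> * of_real (k \<bullet> x))) has_derivative (%v. exp (\<i> * of_real (k \<bullet> x))*(\<i> * of_real (k \<bullet> v)))) (at x)" .
  from has_derivative_mult_right[OF this, of g] show ?thesis unfolding cis_conv_exp by (simp add: mult_ac)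
 qed
 show "(us \<beta> k has_derivative (%v. (k \<bullet> v)*us1 \<beta> k x)) (at x)" unfolding us_def[abs_def] us1_def
  by (rule has_derivative_eq_rhs, rule bounded_linear.has_derivative[OF bounded_linear_Re d[of "\<beta> k"]])
   (auto simp: fun_eq_iff algebra_simps)
 show "(us1 \<beta> k has_derivative (%v. - (k \<bullet> v)*us \<beta> k x)) (at x)" unfolding us1_def[abs_def] us_def
  by (rule has_derivative_eq_rhs, rule bounded_linear.has_derivative[OF bounded_linear_Re d[of "\<i>*\<beta> k"]])
   (auto simp: fun_eq_iff algebra_simps)
qed

lemma us_cont: "continuous_on A (us \<beta> k)" "continuous_on A (us1 \<beta> k)"
 unfolding us_def[abs_def] us1_def[abs_def] by (intro continuous_intros)+

lemma CS_derivative: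
 "(CC H k has_real_derivative norm k*SS H k z) (at z)" "(SS H k has_real_derivative norm k*CC H k z) (at z)" unfolding CC_def[abs_def] SS_def[abs_def]
 by (auto intro!: derivative_eq_intros simp: cosh_real_nonzero)

lemma CS_cont: "continuous_on A (CC H k)" "continuous_on A (SS H k)"
 unfolding CC_def[abs_def] SS_def[abs_def] by (intro continuous_intros; simp)+

lemma CS_values: "CC H k 0 = 1" "SS H k 0 = tanh (norm k*H)" "SS H k (-H) = 0" "\<bar>CC H k (-H)\<bar> <= 1"
 unfolding CC_def SS_def tanh_def by (auto simp: cosh_real_ge_1)

definition "chi H S \<beta> p = (\<Sum>k\<in>S. us \<beta> k (fst p)*CC H k (snd p))"
definition "chix H S \<beta> p = (\<Sum>k\<in>S. (us1 \<beta> k (fst p)*CC H k (snd p)) *\<^sub>R k)"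
definition "chiz H S \<beta> p = (\<Sum>k\<in>S. us \<beta> k (fst p)*(norm k*SS H k (snd p)))"

lemma chi_cont: "continuous_on A (chi H S \<beta>)" "continuous_on A (chix H S \<beta>)" "continuous_on A (chiz H S \<beta>)"
 unfolding chi_def[abs_def] chix_def[abs_def] chiz_def[abs_def] by (intro continuous_intros cont_fst us_cont cont_snd CS_cont)+

lemma chi_derivatives:
 "(chi H S \<beta> has_derivative (%v. chix H S \<beta> (x,z) \<bullet> fst v + chiz H S \<beta> (x,z) * snd v)) (at (x,z))"
 "\<exists>L N. (chix H S \<beta> has_derivative L) (at (x,z)) \<and> (chiz H S \<beta> has_derivative N) (at (x,z)) \<and>
  L (axis 1 1, 0)$1 + L (axis 2 1, 0)$2 + N (0, 1) = 0"
proof -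
 have u: "((%p. us \<beta> k (fst p)) has_derivative (%v. (k \<bullet> fst v)*us1 \<beta> k x)) (at (x,z))"
  "((%p. us1 \<beta> k (fst p)) has_derivative (%v. - (k \<bullet> fst v)*us \<beta> k x)) (at (x,z))" for k
  by (rule has_derivative_compose[OF has_derivative_fst[OF has_derivative_ident]], use us_derivative in simp)+
 have C: "((%p. CC H k (snd p)) has_derivative (%v. snd v * (norm k*SS H k z))) (at (x,z))"
  "((%p. SS H k (snd p)) has_derivative (%v. snd v * (norm k*CC H k z))) (at (x,z))" for k
  using has_derivative_compose[OF has_derivative_snd[OF has_derivative_ident], of "CC H k" "%v. v * (norm k*SS H k z)" "(x,z)" UNIV]
   has_derivative_compose[OF has_derivative_snd[OF has_derivative_ident], of "SS H k" "%v. v * (norm k*CC H k z)" "(x,z)" UNIV]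
   CS_derivative[of H k z] by (simp_all add: has_field_derivative_def mult_commute_abs)
 have "(chi H S \<beta> has_derivative (%v. \<Sum>k\<in>S. us \<beta> k x*(snd v * (norm k*SS H k z)) + (k \<bullet> fst v)*us1 \<beta> k x*CC H k z)) (at (x,z))"
  unfolding chi_def[abs_def] using has_derivative_mult[OF u(1) C(1)] by (auto intro!: has_derivative_sum)
 then show "(chi H S \<beta> has_derivative (%v. chix H S \<beta> (x,z) \<bullet> fst v + chiz H S \<beta> (x,z) * snd v)) (at (x,z))"
  by (rule has_derivative_eq_rhs) (auto simp: fun_eq_iff chix_def chiz_def inner_sum_left sum_distrib_right sum_distrib_left simp flip: sum.distrib intro!: sum.cong)
 define L where "L v = (\<Sum>k\<in>S. (us1 \<beta> k x*(snd v * (norm k*SS H k z)) + (- (k \<bullet> fst v)*us \<beta> k x)*CC H k z) *\<^sub>R k)" for v :: "(real^2)\<times>real"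
 define N where "N v = (\<Sum>k\<in>S. us \<beta> k x*(norm k*(snd v * (norm k*CC H k z))) + ((k \<bullet> fst v)*us1 \<beta> k x)*(norm k*SS H k z))" for v :: "(real^2)\<times>real"
 have 1: "(chix H S \<beta> has_derivative L) (at (x,z))"
  unfolding chix_def[abs_def] L_def[abs_def] using has_derivative_mult[OF u(2) C(1)] by (auto intro!: has_derivative_sum has_derivative_scaleR_left)
 have 2: "(chiz H S \<beta> has_derivative N) (at (x,z))" unfolding chiz_def[abs_def] N_def[abs_def]
  using has_derivative_mult[OF u(1) has_derivative_mult_right[OF C(2)]] by (auto intro!: has_derivative_sum)
 have n: "(norm (k::real^2))^2 = k$1*k$1 + k$2*k$2" for k by (simp add: norm_eq_sqrt_inner inner_2)
 have "L (axis 1 1, 0)$1 + L (axis 2 1, 0)$2 + N (0, 1) = (\<Sum>k\<in>S. us \<beta> k x*CC H k z*((norm k)^2 - (k$1*k$1 + k$2*k$2)))"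
  unfolding L_def N_def by (simp add: inner_axis power2_eq_square algebra_simps flip: sum.distrib)
 then have 3: "L (axis 1 1, 0)$1 + L (axis 2 1, 0)$2 + N (0, 1) = 0" unfolding n by simp
 show "\<exists>L N. (chix H S \<beta> has_derivative L) (at (x,z)) \<and> (chiz H S \<beta> has_derivative N) (at (x,z)) \<and>
  L (axis 1 1, 0)$1 + L (axis 2 1, 0)$2 + N (0, 1) = 0" using 1 2 3 by blast
qed

lemma chi_periodic:
 assumes "S \<subseteq> Lam" "\<gamma> \<in> lat v1 v2"
 shows "chi H S \<beta> (x + \<gamma>, z) = chi H S \<beta> (x, z)" "chix H S \<beta> (x + \<gamma>, z) = chix H S \<beta> (x, z)"
 unfolding chi_def chix_def us_def us1_def using assms by (auto intro!: sum.cong simp: cis_lat subset_iff)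

text \<open>After averaging in x the density of mode k is |k|^2 (\<open>CC\<close>^2 +
  \<open>SS\<close>^2), which is |k| times the derivative of \<open>CC\<close> \<open>SS\<close>.
  Its integral is |k| tanh(|k| H), at most |k|.\<close>

lemma chi_energy:
 assumes S: "finite S" "S \<subseteq> Lam" and H: "H > 0"
 shows "av3 H (%p. (norm (chix H S \<beta> p))^2 + (chiz H S \<beta> p)^2) <= (\<Sum>k\<in>S. (cmod (\<beta> k))^2*norm k)"
proof -
 have n: "(norm (v::real^2))^2 = (v$1)^2 + (v$2)^2" for v by (simp add: norm_eq_sqrt_inner inner_2 power2_eq_square)
 define g where "g z = (\<Sum>k\<in>S. (cmod (\<beta> k))^2*((norm k)^2*((CC H k z)^2 + (SS H k z)^2)))" for z
 have sl: "av (%x. (norm (chix H S \<beta> (x,z)))^2 + (chiz H S \<beta> (x,z))^2) <= g z" for z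
 proof -
  have X: "chix H S \<beta> (x,z)$i = Re (trig S (%k. \<i>*\<beta> k * of_real (CC H k z*k$i)) x)" for x i
   unfolding chix_def trig_def us1_def by (simp add: sum_component Re_sum algebra_simps)
  have Z: "chiz H S \<beta> (x,z) = Re (trig S (%k. \<beta> k * of_real (norm k*SS H k z)) x)" for x
   unfolding chiz_def trig_def us_def by (simp add: Re_sum algebra_simps)
  have cont: "continuous_on UNIV (%x. (Re (trig S b x))^2)" for b by (intro continuous_intros trig_cont)
  have "av (%x. (norm (chix H S \<beta> (x,z)))^2 + (chiz H S \<beta> (x,z))^2)
   = av (%x. (Re (trig S (%k. \<i>*\<beta> k * of_real (CC H k z*k$1)) x))^2)
   + av (%x. (Re (trig S (%k. \<i>*\<beta> k * of_real (CC H k z*k$2)) x))^2)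
   + av (%x. (Re (trig S (%k. \<beta> k * of_real (norm k*SS H k z)) x))^2)"
   unfolding n X Z by (subst av_add, intro continuous_intros trig_cont, intro continuous_intros trig_cont, subst av_add) (auto intro!: cont)
  also have "\<dots> <= (\<Sum>k\<in>S. (cmod (\<i>*\<beta> k * of_real (CC H k z*k$1)))^2) + (\<Sum>k\<in>S. (cmod (\<i>*\<beta> k * of_real (CC H k z*k$2)))^2)
   + (\<Sum>k\<in>S. (cmod (\<beta> k * of_real (norm k*SS H k z)))^2)" by (intro add_mono av_trig_square S)
  also have "\<dots> = g z" unfolding g_def n sum.distrib[symmetric] by (rule sum.cong) (auto simp: norm_mult power_mult_distrib n algebra_simps)
  finally show ?thesis .
 qed
 have gc: "continuous_on A g" for A unfolding g_def by (intro continuous_intros CS_cont)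
 have cc: "continuous_on (UNIV \<times> {-H..0}) (%p. (norm (chix H S \<beta> p))^2 + (chiz H S \<beta> p)^2)" by (intro continuous_intros chi_cont)
 have "av3 H (%p. (norm (chix H S \<beta> p))^2 + (chiz H S \<beta> p)^2) = integral {-H..0} (%z. av (%x. (norm (chix H S \<beta> (x,z)))^2 + (chiz H S \<beta> (x,z))^2))"
  by (rule av3_slices[OF cc]) (use H in simp)
 also have "\<dots> <= integral {-H..0} g" by (intro integral_le integrable_continuous_real cont_height_av[OF cc, simplified] gc sl)
 also have "\<dots> = (\<Sum>k\<in>S. (cmod (\<beta> k))^2*(norm k*(CC H k 0*SS H k 0))) - (\<Sum>k\<in>S. (cmod (\<beta> k))^2*(norm k*(CC H k (-H)*SS H k (-H))))"
 proof (rule integral_unique, rule fundamental_theorem_of_calculus)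
  fix z
  have "((%z. CC H k z*SS H k z) has_real_derivative norm k*((CC H k z)^2 + (SS H k z)^2)) (at z within {-H..0})" for k
   by (rule DERIV_cong[OF DERIV_mult[OF has_field_derivative_at_within[OF CS_derivative(1)] has_field_derivative_at_within[OF CS_derivative(2)]]])
    (simp add: power2_eq_square algebra_simps)
  then have "((%z. \<Sum>k\<in>S. (cmod (\<beta> k))^2*(norm k*(CC H k z*SS H k z))) has_real_derivative (\<Sum>k\<in>S. (cmod (\<beta> k))^2*(norm k*(norm k*((CC H k z)^2 + (SS H k z)^2))))) (at z within {-H..0})"
   by (intro DERIV_sum DERIV_cmult)
  then show "((%z. \<Sum>k\<in>S. (cmod (\<beta> k))^2*(norm k*(CC H k z*SS H k z))) has_vector_derivative g z) (at z within {-H..0})"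
   unfolding g_def by (simp add: has_real_derivative_iff_has_vector_derivative power2_eq_square mult.assoc)
 qed (use H in simp)
 also have "\<dots> <= (\<Sum>k\<in>S. (cmod (\<beta> k))^2*norm k)"
 proof -
  have "norm k*tanh (norm k*H) <= norm k" for k :: "real^2" using mult_left_mono[OF less_imp_le[OF tanh_real_lt_1], of "norm k" "norm k*H"] by simp
  then show ?thesis unfolding CS_values by (simp add: sum_mono mult_left_mono)
 qed
 finally show ?thesis .
qed

text \<open>Two Green identities, with the test function against the flux difference and with the
  potential difference against the gradient of the test function, share the leading term
  (\<open>Vd\<close>,\<open>Bd\<close>) . grad \<open>chi\<close>. Subtraction leaves the linearised
  kinematic equation on the surface against Q - P in the bulk. The parameter t is the weight in
  Young's inequality.\<close>

lemma kinematic_test: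
 assumes S: "finite S" "S \<subseteq> Lam" and t: "t > 0"
  and H: "H > 0" "ereal H <= h" "l <= H" and B: "!!x. \<bar>B1 (x,-H)\<bar> <= e" "!!x. \<bar>B2 (x,-H)\<bar> <= e"
 shows "\<bar>av (%x. (c \<bullet> gd x) * chi H S \<beta> (x,0)) + av (%x. \<psi>d x * chiz H S \<beta> (x,0))\<bar>
  <= t*(\<Sum>k\<in>S. (cmod (\<beta> k))^2*norm k) + 2/t*(4*Kl^2*\<epsilon>^2*av3 H ud + 4*Kl^2*M^2*DD) + 2*e*(\<Sum>k\<in>S. cmod (\<beta> k))"
proof -
 let ?X = "chix H S \<beta>" and ?Z = "chiz H S \<beta>" and ?c = "chi H S \<beta>"
 note cd = cont_diffs[OF H(2)] and cx = chi_cont[of "UNIV \<times> {-H..0}" H S \<beta>]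
 have e0: "e \<ge> 0" using B(1)[of 0] by linarith
 have zz: "- h < ereal z" if "-H < z" for z by (rule slab_less[OF H(2) that])
 have a: "av (%x. ?c (x,0)*fzd (x,0)) - av (%x. ?c (x,-H)*fzd (x,-H)) = av3 H (%p. ?X p \<bullet> fxd p + ?Z p*fzd p)"
  by (rule product_divergence[OF H(1) cx(1) cx(2) cx(3) cd(9) cd(10)])
   (use zz chi_derivatives(1) div_free_diff diff_periodic(2) chi_periodic(1)[OF S(2)] in auto)
 have b: "av (%x. pd3 (x,0)*?Z (x,0)) - av (%x. pd3 (x,-H)*?Z (x,-H)) = av3 H (%p. (Vd p + Px p) \<bullet> ?X p + (Bd p + Pz p)*?Z p)"
  by (rule product_divergence[OF H(1) cd(4) _ _ cx(2) cx(3)])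
   (use zz pot_diff_derivative chi_derivatives(2) diff_periodic(1) chi_periodic(2)[OF S(2)] in \<open>auto intro!: continuous_intros cd\<close>)
 have "?Z (x,-H) = 0" for x unfolding chiz_def by (simp add: CS_values)
 then have b': "av (%x. \<psi>d x*?Z (x,0)) = av3 H (%p. (Vd p + Px p) \<bullet> ?X p + (Bd p + Pz p)*?Z p)"
  using b unfolding surface_values by (simp add: av_const)
 have c1: "continuous_on (UNIV \<times> {-H..0}) (%p. ?X p \<bullet> fxd p + ?Z p*fzd p)"
  "continuous_on (UNIV \<times> {-H..0}) (%p. (Vd p + Px p) \<bullet> ?X p + (Bd p + Pz p)*?Z p)" by (intro continuous_intros cd cx)+
 have "- (av (%x. (c \<bullet> gd x)*?c (x,0)) + av (%x. \<psi>d x*?Z (x,0))) - av (%x. ?c (x,-H)*fzd (x,-H))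
  = av3 H (%p. (?X p \<bullet> fxd p + ?Z p*fzd p) - ((Vd p + Px p) \<bullet> ?X p + (Bd p + Pz p)*?Z p))"
  unfolding av3_diff[OF c1] using a b' unfolding surface_values by (simp add: mult.commute av_minus)
 also have "(%p. (?X p \<bullet> fxd p + ?Z p*fzd p) - ((Vd p + Px p) \<bullet> ?X p + (Bd p + Pz p)*?Z p)) = (%p. ?X p \<bullet> (Qx p - Px p) + ?Z p*(Qz p - Pz p))"
  unfolding flux_split by (auto simp: fun_eq_iff inner_add_left inner_add_right inner_diff_right inner_commute algebra_simps)
 finally have id: "- (av (%x. (c \<bullet> gd x)*?c (x,0)) + av (%x. \<psi>d x*?Z (x,0))) = av (%x. ?c (x,-H)*fzd (x,-H)) + av3 H (%p. ?X p \<bullet> (Qx p - Px p) + ?Z p*(Qz p - Pz p))"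
  by simp
 have bt: "\<bar>av (%x. ?c (x,-H)*fzd (x,-H))\<bar> <= (\<Sum>k\<in>S. cmod (\<beta> k))*(2*e)"
 proof -
  have "norm (av (%x. ?c (x,-H)*fzd (x,-H))) <= (\<Sum>k\<in>S. cmod (\<beta> k))*(2*e)"
  proof (rule av_norm_le)
   show "continuous_on UNIV (%x. ?c (x,-H)*fzd (x,-H))" by (intro continuous_intros continuous_on_compose2[OF cx(1)] continuous_on_compose2[OF cd(10)]) (use H in auto)
   fix x
   have "\<bar>us \<beta> k x\<bar> <= cmod (\<beta> k)" for k unfolding us_def using abs_Re_le_cmod[of "\<beta> k * cis (k \<bullet> x)"] by (simp add: norm_mult)
   then have "\<bar>us \<beta> k x*CC H k (-H)\<bar> <= cmod (\<beta> k)*1" for k unfolding abs_mult by (intro mult_mono CS_values) auto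
   then have "\<bar>?c (x,-H)\<bar> <= (\<Sum>k\<in>S. cmod (\<beta> k))" unfolding chi_def by (intro order_trans[OF sum_abs] sum_mono) simp
   then show "norm (?c (x,-H)*fzd (x,-H)) <= (\<Sum>k\<in>S. cmod (\<beta> k))*(2*e)" using bottom_flux[OF H(3) B] e0 by (simp add: abs_mult mult_mono sum_nonneg)
  qed
  then show ?thesis by simp
 qed
 have "\<bar>av3 H (%p. ?X p \<bullet> (Qx p - Px p) + ?Z p*(Qz p - Pz p))\<bar> <= av3 H (%p. t*((norm (?X p))^2 + (?Z p)^2) + 2/t*(4*Kl^2*\<epsilon>^2*ud p + 4*Kl^2*M^2*((mu (snd p))^2*dd (fst p))))"
 proof (rule av3_abs_le)
  fix x z assume z: "-H <= z" "z <= 0"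
  let ?p = "(x,z)" and ?r = "rr (x,z)"
  note pb = pert_bounds[OF slab_le[OF H(2) z(1)] z(2), of x]
  have "norm (Qx ?p - Px ?p) <= 2*?r" using norm_triangle_ineq4[of "Qx ?p" "Px ?p"] pb by linarith
  then have 1: "\<bar>?X ?p \<bullet> (Qx ?p - Px ?p)\<bar> <= norm (?X ?p)*(2*?r)" by (intro order_trans[OF Cauchy_Schwarz_ineq2] mult_left_mono) auto
  have "\<bar>Qz ?p - Pz ?p\<bar> <= 2*?r" using pb by linarith
  then have 2: "\<bar>?Z ?p*(Qz ?p - Pz ?p)\<bar> <= \<bar>?Z ?p\<bar>*(2*?r)" unfolding abs_mult by (intro mult_left_mono) auto
  have "\<bar>?X ?p \<bullet> (Qx ?p - Px ?p) + ?Z ?p*(Qz ?p - Pz ?p)\<bar> <= (norm (?X ?p) + \<bar>?Z ?p\<bar>)*(2*?r)" using 1 2 unfolding distrib_right by linarith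
  also have "\<dots> <= t/2*(norm (?X ?p) + \<bar>?Z ?p\<bar>)^2 + 2/t*?r^2" by (rule amgm2[OF t])
  also have "\<dots> <= t/2*(2*((norm (?X ?p))^2 + \<bar>?Z ?p\<bar>^2)) + 2/t*(4*Kl^2*\<epsilon>^2*ud ?p + 4*Kl^2*M^2*((mu (snd ?p))^2*dd (fst ?p)))"
   using t by (intro add_mono mult_left_mono sum_sq_le rr_square) auto
  finally show "\<bar>?X ?p \<bullet> (Qx ?p - Px ?p) + ?Z ?p*(Qz ?p - Pz ?p)\<bar> <= t*((norm (?X ?p))^2 + (?Z ?p)^2) + 2/t*(4*Kl^2*\<epsilon>^2*ud ?p + 4*Kl^2*M^2*((mu (snd ?p))^2*dd (fst ?p)))"
   by (simp add: algebra_simps add_divide_distrib)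
 qed (intro continuous_intros cd cx)+
 also have "\<dots> = t*av3 H (%p. (norm (?X p))^2 + (?Z p)^2) + 2/t*(4*Kl^2*\<epsilon>^2*av3 H ud + 4*Kl^2*M^2*av3 H (%p. (mu (snd p))^2*dd (fst p)))"
  by (rule av3_linear_combination[where f="%p. (norm (?X p))^2 + (?Z p)^2" and g=ud and k="%p. (mu (snd p))^2*dd (fst p)" and t=t and s="2/t" and a="4*Kl^2*\<epsilon>^2" and b="4*Kl^2*M^2", OF _ cd(3) cd(12)]) (intro continuous_intros cx)
 also have "\<dots> <= t*(\<Sum>k\<in>S. (cmod (\<beta> k))^2*norm k) + 2/t*(4*Kl^2*\<epsilon>^2*av3 H ud + 4*Kl^2*M^2*DD)"
  using t by (intro add_mono mult_left_mono chi_energy[OF S H(1)] av3_mu H order_refl) auto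
 finally have fin: "\<bar>av3 H (%p. ?X p \<bullet> (Qx p - Px p) + ?Z p*(Qz p - Pz p))\<bar> <= t*(\<Sum>k\<in>S. (cmod (\<beta> k))^2*norm k) + 2/t*(4*Kl^2*\<epsilon>^2*av3 H ud + 4*Kl^2*M^2*DD)" .
 have gen: "\<bar>A\<bar> <= Y + 2*e*W" if "- A = U + V" "\<bar>U\<bar> <= W*(2*e)" "\<bar>V\<bar> <= Y" for A U V W Y :: real
  using that by (simp add: abs_le_iff mult_ac)
 show ?thesis by (rule gen[OF id bt fin])
qed

end

text \<open>The factor tanh(h|k|) of the flat Dirichlet-Neumann operator, with limit value 1 in
  infinite depth.\<close>

definition tfac :: "ereal => real^2 => real" where
 "tfac h k = (if h = \<infinity> then 1 else tanh (real_of_ereal h*norm k))"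

context lattice2
begin

lemma grad2_inner: "c \<bullet> grad2 f x = c$1*pd 1 f x + c$2*pd 2 f x"
 by (simp add: inner_2 grad2_def)

lemma av_grad_trig:
 assumes w: "wser f a" and S: "finite S" "S \<subseteq> Lam"
 shows "av (%x. (c \<bullet> grad2 f x)*Re (trig S \<beta> x)) = Re (\<Sum>k\<in>S. \<beta> k * cnj (\<i> * of_real (c \<bullet> k)*a k))"
proof -
 have ct: "continuous_on UNIV (%x. Re (trig S \<beta> x))" by (intro continuous_intros trig_cont)
 note wd = wser_has_derivative(2)[OF w]
 have "av (%x. (c \<bullet> grad2 f x)*Re (trig S \<beta> x)) = av (%x. c$1*(pd 1 f x*Re (trig S \<beta> x)) + c$2*(pd 2 f x*Re (trig S \<beta> x)))"
  by (simp add: grad2_inner algebra_simps)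
 also have "\<dots> = c$1*av (%x. pd 1 f x*Re (trig S \<beta> x)) + c$2*av (%x. pd 2 f x*Re (trig S \<beta> x))"
  by (subst av_add) (intro continuous_intros ct wser_cont[OF wd] | simp add: av_cmul)+
 also have "\<dots> = Re (\<Sum>k\<in>S. \<beta> k * cnj (\<i> * of_real (c \<bullet> k)*a k))"
  unfolding av_trig[OF wd S] by (simp add: inner_2 sum_distrib_left sum.distrib[symmetric] algebra_simps)
 finally show ?thesis .
qed

end

section \<open>The kinematic residual in Fourier space\<close>

context two_waves
begin

lemma wd: "wser \<eta>d ad" "wser \<psi>d bd"
 unfolding \<eta>d_def[abs_def] \<psi>d_def[abs_def] ad_def[abs_def] bd_def[abs_def] by (intro wser_diff w)+

lemma gd_eq: "gd x = grad2 \<eta>d x"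
 unfolding gd_def \<eta>d_def[abs_def] by (simp add: wser_grad_diff[OF w(3,1)])

lemma ad_0: "ad 0 = 0" "bd 0 = 0" unfolding ad_def bd_def using mean by simp_all

text \<open>Energy per mode: H^1 for the elevation and H^(1/2) for the potential, the norms in which
  the two linear equations are solved.\<close>

definition "ew k = (norm k)^2*(cmod (ad k))^2 + norm k*(cmod (bd k))^2"
definition "EE = infsum ew Lam"
text \<open>Mode k of c . grad \<eta>d + G(0) \<psi>d, the residual of the kinematic equation
  linearised at rest.\<close>

definition "Xr k = \<i> * of_real (c \<bullet> k)*ad k + of_real (norm k*tfac h k)*bd k"

lemma ew_nonneg: "0 <= ew k" unfolding ew_def by simp

lemma ew_summable: "ew summable_on Lam"
 unfolding ew_def[abs_def]
proof (rule summable_on_add)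
 show "(%k. (norm k)^2*(cmod (ad k))^2) summable_on Lam" using wser_grad_square[OF wd(1)] by (rule has_sum_imp_summable)
 have s: "(%k. (cmod (bd k))^2 + (norm k)^2*(cmod (bd k))^2) summable_on Lam"
  by (rule summable_on_add[OF has_sum_imp_summable[OF wser_square[OF wd(2)]] has_sum_imp_summable[OF wser_grad_square[OF wd(2)]]])
 have "norm k <= 1 + (norm k)^2" for k :: "real^2" using sum_squares_bound[of "norm k" 1] norm_ge_zero[of k] unfolding power_one mult_1_right by linarith
 then have "norm k*(cmod (bd k))^2 <= (1 + (norm k)^2)*(cmod (bd k))^2" for k by (intro mult_right_mono) auto
 then show "(%k. norm k*(cmod (bd k))^2) summable_on Lam" by (intro summable_on_comparison_test[OF s]) (auto simp: distrib_right)
qed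

lemma EE_has_sum: "(ew has_sum EE) Lam" unfolding EE_def using ew_summable by (rule has_sum_infsum)

lemma EE_nonneg: "0 <= EE" unfolding EE_def by (intro infsum_nonneg ew_nonneg)

lemma EE_controls:
 "av (%x. (norm (gd x))^2) <= EE" "kap*av (%x. (\<psi>d x)^2) <= EE" "kap^2*av (%x. (\<eta>d x)^2) <= EE"
proof -
 show "av (%x. (norm (gd x))^2) <= EE" unfolding gd_eq by (rule has_sum_mono[OF wser_grad_square[OF wd(1)] EE_has_sum]) (simp add: ew_def)
 show "kap*av (%x. (\<psi>d x)^2) <= EE"
 proof (rule has_sum_mono[OF has_sum_cmult_right[OF wser_square[OF wd(2)]] EE_has_sum])
  fix k assume k: "k \<in> Lam"
  have "kap*(cmod (bd k))^2 <= norm k*(cmod (bd k))^2" using Lam_norm_ge[OF k] ad_0 by (cases "k = 0") (auto intro: mult_right_mono)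
  also have "\<dots> <= ew k" by (simp add: ew_def)
  finally show "kap*(cmod (bd k))^2 <= ew k" .
 qed
 show "kap^2*av (%x. (\<eta>d x)^2) <= EE"
 proof (rule has_sum_mono[OF has_sum_cmult_right[OF wser_square[OF wd(1)]] EE_has_sum])
  fix k assume k: "k \<in> Lam"
  have "kap^2*(cmod (ad k))^2 <= (norm k)^2*(cmod (ad k))^2"
   using Lam_norm_ge[OF k] ad_0 kap_pos by (cases "k = 0") (auto intro!: mult_right_mono power_mono)
  also have "\<dots> <= ew k" by (simp add: ew_def)
  finally show "kap^2*(cmod (ad k))^2 <= ew k" .
 qed
qed

lemma cont_d: "continuous_on A gd" "continuous_on A \<psi>d" "continuous_on A \<eta>d"
 using wser_grad2_cont[OF wd(1)] wser_cont[OF wd(1)] wser_cont[OF wd(2)] unfolding gd_eq[abs_def] by (auto intro: continuous_on_subset)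

lemma DD_le: "DD <= (1 + 1/kap^2)*EE"
proof -
 have "DD = av (%x. (\<eta>d x)^2) + av (%x. (norm (gd x))^2)" unfolding DD_def dd_def[abs_def] by (rule av_add) (intro continuous_intros cont_d)+
 moreover have "av (%x. (\<eta>d x)^2) <= EE/kap^2" using EE_controls(3) kap_pos by (simp add: field_simps)
 ultimately show ?thesis using EE_controls(1) by (simp add: algebra_simps)
qed

lemma flux_le: "\<bar>av (%x. (c \<bullet> gd x)*\<psi>d x)\<bar> <= norm c*(1 + 1/kap)*EE"
proof -
 have "norm (av (%x. (c \<bullet> gd x)*\<psi>d x)) <= av (%x. norm c*((norm (gd x))^2 + (\<psi>d x)^2))"
 proof -
  have b: "\<bar>(c \<bullet> gd x)*\<psi>d x\<bar> <= norm c*((norm (gd x))^2 + (\<psi>d x)^2)" for x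
  proof -
   have "\<bar>(c \<bullet> gd x)*\<psi>d x\<bar> <= (norm c*norm (gd x))*\<bar>\<psi>d x\<bar>" unfolding abs_mult by (intro mult_right_mono Cauchy_Schwarz_ineq2) auto
   also have "\<dots> = norm c*(norm (gd x)*\<bar>\<psi>d x\<bar>)" by simp
   also have "\<dots> <= norm c*((norm (gd x))^2 + (\<psi>d x)^2)"
   proof (rule mult_left_mono)
    have "2*(p*q) <= p^2 + q^2 ==> 0 <= p*q ==> p*q <= p^2 + q^2" for p q :: real by linarith
    from this[of "norm (gd x)" "\<bar>\<psi>d x\<bar>"] show "norm (gd x)*\<bar>\<psi>d x\<bar> <= (norm (gd x))^2 + (\<psi>d x)^2"
     using sum_squares_bound[of "norm (gd x)" "\<bar>\<psi>d x\<bar>"] by (simp add: mult.assoc)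
   qed simp
   finally show ?thesis .
  qed
  have c: "continuous_on UNIV (%x. (c \<bullet> gd x)*\<psi>d x)" "continuous_on UNIV (%x. norm c*((norm (gd x))^2 + (\<psi>d x)^2))"
   by (intro continuous_intros cont_d)+
  have "av (%x. (c \<bullet> gd x)*\<psi>d x) <= av (%x. norm c*((norm (gd x))^2 + (\<psi>d x)^2))"
   "av (%x. - ((c \<bullet> gd x)*\<psi>d x)) <= av (%x. norm c*((norm (gd x))^2 + (\<psi>d x)^2))"
   using b by (intro av_mono c continuous_on_minus; simp add: abs_le_iff)+
  then show ?thesis by (simp add: av_minus)
 qed
 also have "\<dots> = norm c*(av (%x. (norm (gd x))^2) + av (%x. (\<psi>d x)^2))"
  unfolding av_cmul by (subst av_add) (intro continuous_intros cont_d | simp)+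
 also have "\<dots> <= norm c*(EE + EE/kap)" using EE_controls kap_pos by (intro mult_left_mono add_mono) (auto simp: field_simps)
 finally show ?thesis by (simp add: algebra_simps)
qed

text \<open>The bracket in \<open>kinematic_test\<close> after inserting
  \<open>energy_estimate\<close>, without its bottom error.\<close>

definition "QQ = 4*Kl^2*\<epsilon>^2*(2*\<bar>av (%x. (c \<bullet> gd x)*\<psi>d x)\<bar> + 80*Kl^2*M^2*DD) + 4*Kl^2*M^2*DD"

lemma chi_surface: "chi H S \<beta> (x,0) = Re (trig S \<beta> x)"
 "chiz H S \<beta> (x,0) = Re (trig S (%k. \<beta> k * of_real (norm k*tanh (norm k*H))) x)"
 unfolding chi_def chiz_def us_def trig_def fst_conv snd_conv CS_values by (simp_all add: algebra_simps)

text \<open>Test functions are harmonic in a slab of finite depth H. In infinite depth their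
  tanh(|k| H) has to be compared with 1, uniformly over the finitely many frequencies of S.\<close>

lemma tanh_close:
 assumes "finite S" "e > 0" "0 \<notin> S"
 obtains H0 where "!!H k. k \<in> S ==> (h ~= \<infinity> ==> ereal H = h) ==> (h = \<infinity> ==> H0 <= H) ==> \<bar>tanh (norm k*H) - tfac h k\<bar> <= e"
proof (cases "h = \<infinity>")
 case False
 have "\<bar>tanh (norm k*H) - tfac h k\<bar> <= e" if "ereal H = h" for H k using that assms(2) False unfolding tfac_def by (auto simp: mult.commute)
 then show ?thesis using that[of 0] False by blast
next
 case True
 have "\<forall>\<^sub>F H in at_top. \<forall>k\<in>S. \<bar>tanh (norm k*H) - 1\<bar> <= e"
 proof (rule eventually_ball_finite[OF assms(1)], rule ballI)
  fix k assume "k \<in> S"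
  then have "norm k > 0" using assms(3) by auto
  then have "filterlim (%H. norm k*H) at_top at_top" by (intro filterlim_tendsto_pos_mult_at_top[OF tendsto_const] filterlim_ident)
  from filterlim_compose[OF tanh_real_at_top this] show "\<forall>\<^sub>F H in at_top. \<bar>tanh (norm k*H) - 1\<bar> <= e"
   using assms(2) tendstoD[of "%H. tanh (norm k*H)" 1 at_top e] by (auto simp: dist_real_def elim!: eventually_mono)
 qed
 then obtain H0 where "!!H. H0 <= H ==> \<forall>k\<in>S. \<bar>tanh (norm k*H) - 1\<bar> <= e" unfolding eventually_at_top_linorder by blast
 then show ?thesis using that[of H0] True by (auto simp: tfac_def)
qed

text \<open>Test coefficients \<open>Xr k\<close>/|k| make the tested expression equal to the left
  side A, and their energy equals A too. With t = 1/2 half of A is absorbed and the factor 2/t = 4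
  becomes 8.\<close>

lemma kinematic_residual:
 assumes S: "finite S" "S \<subseteq> Lam" "0 \<notin> S"
 shows "(\<Sum>k\<in>S. (cmod (Xr k))^2/norm k) <= 8*QQ"
proof -
 define \<beta> where "\<beta> k = Xr k/of_real (norm k)" for k
 define A where "A = (\<Sum>k\<in>S. (cmod (Xr k))^2/norm k)"
 define B where "B = (\<Sum>k\<in>S. cmod (\<beta> k))"
 define D where "D = (\<Sum>k\<in>S. cmod (\<beta> k)*(norm k * cmod (bd k)))"
 \<comment> \<open>Everything multiplied by the bottom error e is collected here. W does not depend
   on H, so e may tend to 0 although H varies with e.\<close>
 define W where "W = D + 64*Kl^2*\<epsilon>^2*Pm + 2*B"
 have nz: "norm k > 0" if "k \<in> S" for k using that S(3) by auto
 have b1: "(cmod (\<beta> k))^2*norm k = (cmod (Xr k))^2/norm k" if "k \<in> S" for k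
  using nz[OF that] by (simp add: \<beta>_def norm_divide power_divide power2_eq_square)
 have b2: "Re (\<beta> k * cnj (Xr k)) = (cmod (Xr k))^2/norm k" if "k \<in> S" for k
 proof -
  have "\<beta> k * cnj (Xr k) = of_real ((cmod (Xr k))^2/norm k)" unfolding \<beta>_def times_divide_eq_left mult_cnj_cmod by simp
  then show ?thesis by (simp only: Re_complex_of_real)
 qed
 have key: "A <= 1/2*A + 4*QQ + e*W" if e: "e > 0" for e
 proof -
  obtain H0 where H0: "!!H k. k \<in> S ==> (h ~= \<infinity> ==> ereal H = h) ==> (h = \<infinity> ==> H0 <= H) ==> \<bar>tanh (norm k*H) - tfac h k\<bar> <= e"
   using tanh_close[OF S(1) e S(3)] by blast
  obtain H where H: "H > 0" "ereal H <= h" "l <= H" and Hh: "h ~= \<infinity> ==> ereal H = h" "h = \<infinity> ==> H0 <= H"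
   and HB: "!!x. \<bar>B1 (x,-H)\<bar> <= e" "!!x. \<bar>B2 (x,-H)\<bar> <= e" using bot[OF e, of H0] by blast
  define T where "T = av (%x. (c \<bullet> gd x) * chi H S \<beta> (x,0)) + av (%x. \<psi>d x * chiz H S \<beta> (x,0))"
  have T: "T = Re (\<Sum>k\<in>S. \<beta> k * cnj (\<i> * of_real (c \<bullet> k)*ad k)) + Re (\<Sum>k\<in>S. (\<beta> k * of_real (norm k*tanh (norm k*H))) * cnj (bd k))"
   unfolding T_def chi_surface gd_eq av_grad_trig[OF wd(1) S(1,2)] av_trig[OF wd(2) S(1,2)] ..
  have "A = (\<Sum>k\<in>S. Re (\<beta> k * cnj (Xr k)))" unfolding A_def using b2 by simp
  also have "\<dots> = T + (\<Sum>k\<in>S. (tfac h k - tanh (norm k*H))*Re (\<beta> k * of_real (norm k) * cnj (bd k)))"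
   unfolding T Re_sum sum.distrib[symmetric] Xr_def by (intro sum.cong refl) (simp add: algebra_simps)
  also have "(\<Sum>k\<in>S. (tfac h k - tanh (norm k*H))*Re (\<beta> k * of_real (norm k) * cnj (bd k))) <= (\<Sum>k\<in>S. e*(cmod (\<beta> k)*(norm k * cmod (bd k))))"
  proof (rule sum_mono)
   fix k assume k: "k \<in> S"
   have "\<bar>tfac h k - tanh (norm k*H)\<bar> <= e" using H0[OF k Hh] by (simp add: abs_minus_commute)
   moreover have "\<bar>Re (\<beta> k * of_real (norm k) * cnj (bd k))\<bar> <= cmod (\<beta> k)*(norm k * cmod (bd k))"
    using abs_Re_le_cmod[of "\<beta> k * of_real (norm k) * cnj (bd k)"] by (simp add: norm_mult mult.assoc)
   ultimately have "\<bar>(tfac h k - tanh (norm k*H))*Re (\<beta> k * of_real (norm k) * cnj (bd k))\<bar> <= e*(cmod (\<beta> k)*(norm k * cmod (bd k)))"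
    unfolding abs_mult using e by (intro mult_mono) auto
   then show "(tfac h k - tanh (norm k*H))*Re (\<beta> k * of_real (norm k) * cnj (bd k)) <= e*(cmod (\<beta> k)*(norm k * cmod (bd k)))" by linarith
  qed
  also have "\<dots> = e*D" unfolding D_def sum_distrib_left ..
  finally have 1: "A <= T + e*D" by simp
  have 2: "\<bar>T\<bar> <= 1/2*A + 2/(1/2)*(4*Kl^2*\<epsilon>^2*av3 H ud + 4*Kl^2*M^2*DD) + 2*e*B"
  proof -
   have "(\<Sum>k\<in>S. (cmod (\<beta> k))^2*norm k) = A" unfolding A_def using b1 by simp
   then show ?thesis using kinematic_test[OF S(1,2) _ H HB, where t="1/2" and \<beta>=\<beta>] unfolding T_def B_def by simp
  qed
  have "4*Kl^2*\<epsilon>^2*av3 H ud <= 4*Kl^2*\<epsilon>^2*(2*\<bar>av (%x. (c \<bullet> gd x)*\<psi>d x)\<bar> + 80*Kl^2*M^2*DD + 4*e*Pm)"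
   by (intro mult_left_mono energy_estimate[OF H HB]) auto
  then have 3: "4*Kl^2*\<epsilon>^2*av3 H ud + 4*Kl^2*M^2*DD <= QQ + e*(16*Kl^2*\<epsilon>^2*Pm)"
   unfolding QQ_def by (simp add: algebra_simps)
  have "W = D + 64*Kl^2*\<epsilon>^2*Pm + 2*B" by (simp add: W_def)
  then have 4: "e*W = e*D + 4*(e*(16*Kl^2*\<epsilon>^2*Pm)) + 2*e*B" by (simp add: algebra_simps)
  have gen: "A <= 1/2*A + 4*Q + w" if "A <= T + p" "\<bar>T\<bar> <= 1/2*A + 2/(1/2)*z + q" "z <= Q + y" "w = p + 4*y + q" for p q z y w Q :: real
   using that by simp
  show ?thesis by (rule gen[OF 1 2 3 4])
 qed
 have "A/2 - 4*QQ <= 0"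
 proof (rule field_le_epsilon)
  fix e :: real assume e: "e > 0"
  have "e/(1 + \<bar>W\<bar>) > 0" using e by (simp add: add_pos_nonneg)
  then have "A <= 1/2*A + 4*QQ + e/(1 + \<bar>W\<bar>)*W" by (rule key)
  moreover have "e/(1 + \<bar>W\<bar>)*W <= e/(1 + \<bar>W\<bar>)*(1 + \<bar>W\<bar>)" using e by (intro mult_left_mono) auto
  moreover have "1 + \<bar>W\<bar> ~= 0" by linarith
  then have "e/(1 + \<bar>W\<bar>)*(1 + \<bar>W\<bar>) = e" by simp
  ultimately show "A/2 - 4*QQ <= 0 + e" by linarith
 qed
 then show ?thesis unfolding A_def by linarith
qed

text \<open>Both parts are quadratic in \<epsilon>: the first has the explicit \<epsilon>^2, the
  second gets it from M <= m0 \<epsilon>. Inside the first bracket M^2 is only bounded by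
  m0^2.\<close>

lemma QQ_le:
 assumes C: "norm c <= C" and M: "M <= m0*\<epsilon>" "0 <= m0" and e1: "\<epsilon> <= 1"
 shows "QQ <= (4*Kl^2*(2*(C*(1 + 1/kap)) + 80*Kl^2*m0^2*(1 + 1/kap^2)) + 4*Kl^2*m0^2*(1 + 1/kap^2))*(\<epsilon>^2*EE)"
proof -
 have E: "EE \<ge> 0" by (rule EE_nonneg)
 let ?K = "1 + 1/kap^2"
 have D: "DD <= ?K*EE" by (rule DD_le)
 have D0: "0 <= ?K*EE" using E by simp
 have M2: "M^2 <= m0^2*\<epsilon>^2" using power_mono[OF M(1) M0, of 2] by (simp add: power_mult_distrib)
 have M3: "M^2 <= m0^2" using M2 mult_left_mono[OF power_mono[OF e1 eps(1), of 2], of "m0^2"] by simp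
 have MD: "M^2*DD <= (m0^2*\<epsilon>^2)*(?K*EE)" "M^2*DD <= m0^2*(?K*EE)"
  using mult_left_mono[OF D, of "M^2"] mult_right_mono[OF M2 D0] mult_right_mono[OF M3 D0] by auto
 have F: "\<bar>av (%x. (c \<bullet> gd x)*\<psi>d x)\<bar> <= C*(1 + 1/kap)*EE"
  using flux_le mult_right_mono[OF C, of "(1 + 1/kap)*EE"] kap_pos E by (simp add: mult.assoc)
 have "QQ = 4*Kl^2*\<epsilon>^2*(2*\<bar>av (%x. (c \<bullet> gd x)*\<psi>d x)\<bar> + 80*Kl^2*(M^2*DD)) + 4*Kl^2*(M^2*DD)"
  unfolding QQ_def by (simp add: mult.assoc)
 also have "\<dots> <= 4*Kl^2*\<epsilon>^2*(2*(C*(1 + 1/kap)*EE) + 80*Kl^2*(m0^2*(?K*EE))) + 4*Kl^2*((m0^2*\<epsilon>^2)*(?K*EE))"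
  by (intro add_mono mult_left_mono MD F) auto
 also have "\<dots> = (4*Kl^2*(2*(C*(1 + 1/kap)) + 80*Kl^2*m0^2*?K) + 4*Kl^2*m0^2*?K)*(\<epsilon>^2*EE)"
  by (simp add: algebra_simps)
 finally show ?thesis .
qed

end

section \<open>Difference of two waves: Bernoulli equation\<close>

context lattice2
begin

text \<open>Quotients and square roots of the slope are not given as series in \<open>wser\<close>;
  this class has explicit constants under products and compositions and suffices for integration by
  parts.\<close>

definition C1b :: "(real^2 => real) => real => bool" where
 "C1b f K \<longleftrightarrow> lat_periodic v1 v2 f \<and> (\<forall>x. (f has_derivative (%h. grad2 f x \<bullet> h)) (at x)) \<and>
  continuous_on UNIV (grad2 f) \<and> (\<forall>x. \<bar>f x\<bar> <= K \<and> norm (grad2 f x) <= K)"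

lemma grad2_eqI:
 assumes "!!x. (f has_derivative (%h. g x \<bullet> h)) (at x)"
 shows "grad2 f = g"
proof -
 have "pd i f x = g x$i" for i x
 proof -
  have "((%t. f (x + t *\<^sub>R axis i 1)) has_derivative (%t. g x \<bullet> (t *\<^sub>R axis i 1))) (at 0)"
   by (rule has_derivative_compose[of "%t. x + t *\<^sub>R axis i 1" "%t. t *\<^sub>R axis i 1" 0 UNIV f, simplified])
    (auto intro!: derivative_eq_intros assms)
  then have "((%t. f (x + t *\<^sub>R axis i 1)) has_real_derivative g x$i) (at 0)"
   unfolding has_field_derivative_def by (rule has_derivative_eq_rhs) (auto simp: inner_axis fun_eq_iff)
  then show ?thesis unfolding pd_def by (rule DERIV_imp_deriv)
 qed
 then show ?thesis by (simp add: grad2_def fun_eq_iff vec_eq_iff)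
qed

lemma C1b_I:
 assumes "lat_periodic v1 v2 f" "!!x. (f has_derivative (%h. g x \<bullet> h)) (at x)" "continuous_on UNIV g"
  "!!x. \<bar>f x\<bar> <= K" "!!x. norm (g x) <= K"
 shows "C1b f K" unfolding C1b_def grad2_eqI[OF assms(2)] using assms by blast

lemma C1bD:
 assumes "C1b f K"
 shows "lat_periodic v1 v2 f" "(f has_derivative (%h. grad2 f x \<bullet> h)) (at x)" "continuous_on UNIV (grad2 f)"
  "\<bar>f x\<bar> <= K" "norm (grad2 f x) <= K" "continuous_on A f" "continuous_on UNIV (pd i f)" "\<bar>pd i f x\<bar> <= K"
proof -
 show "lat_periodic v1 v2 f" "\<bar>f x\<bar> <= K" "norm (grad2 f x) <= K" using assms unfolding C1b_def by blast+
 show d: "(f has_derivative (%h. grad2 f x \<bullet> h)) (at x)" for x using assms unfolding C1b_def by (rule conjunct1[OF conjunct2, THEN spec])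
 show c: "continuous_on UNIV (grad2 f)" using assms unfolding C1b_def by (rule conjunct1[OF conjunct2[OF conjunct2]])
 show "continuous_on A f" by (rule continuous_at_imp_continuous_on, rule ballI, rule has_derivative_continuous, rule d)
 have e: "pd i f = (%x. grad2 f x$i)" by (simp add: grad2_def fun_eq_iff)
 show "continuous_on UNIV (pd i f)" unfolding e by (rule continuous_on_component[OF c])
 have "\<bar>grad2 f x$i\<bar> <= norm (grad2 f x)" by (rule component_le_norm_cart)
 then show "\<bar>pd i f x\<bar> <= K" using \<open>norm (grad2 f x) <= K\<close> by (simp add: grad2_def)
qed

lemma C1b_mono: "C1b f K ==> K <= L ==> C1b f L"
 unfolding C1b_def by (meson order_trans)

lemma C1b_nonneg: "C1b f K ==> 0 <= K" using C1bD(4)[of f K 0] by linarith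

lemma C1b_const: "\<bar>k\<bar> <= K ==> C1b (%x. k) K"
 by (rule C1b_I[where g="%x. 0"]) (auto simp: lat_periodic_def)

lemma C1b_add: assumes "C1b f K" "C1b g L" shows "C1b (%x. f x + g x) (K + L)"
proof (rule C1b_I[where g="%x. grad2 f x + grad2 g x"])
 show "lat_periodic v1 v2 (%x. f x + g x)" using C1bD(1)[OF assms(1)] C1bD(1)[OF assms(2)] by (simp add: lat_periodic_def)
 show "((%x. f x + g x) has_derivative (%h. (grad2 f x + grad2 g x) \<bullet> h)) (at x)" for x
  using has_derivative_add[OF C1bD(2)[OF assms(1), of x] C1bD(2)[OF assms(2), of x]] by (simp add: inner_add_left)
 show "\<bar>f x + g x\<bar> <= K + L" for x using C1bD(4)[OF assms(1), of x] C1bD(4)[OF assms(2), of x] by linarith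
 show "norm (grad2 f x + grad2 g x) <= K + L" for x by (intro norm_triangle_le add_mono C1bD(5) assms)
qed (intro continuous_intros C1bD(3)[OF assms(1)] C1bD(3)[OF assms(2)])

lemma grad2_mult:
 assumes "C1b f K" "C1b g L"
 shows "((%x. f x*g x) has_derivative (%h. (f x *\<^sub>R grad2 g x + g x *\<^sub>R grad2 f x) \<bullet> h)) (at x)"
 using has_derivative_mult[OF C1bD(2)[OF assms(1), of x] C1bD(2)[OF assms(2), of x]] by (simp add: inner_add_left mult.commute)

lemma C1b_mult: assumes "C1b f K" "C1b g L" shows "C1b (%x. f x*g x) (2*K*L)"
proof (rule C1b_I[where g="%x. f x *\<^sub>R grad2 g x + g x *\<^sub>R grad2 f x"])
 note K0 = C1b_nonneg[OF assms(1)] and L0 = C1b_nonneg[OF assms(2)]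
 show "lat_periodic v1 v2 (%x. f x*g x)" using C1bD(1)[OF assms(1)] C1bD(1)[OF assms(2)] by (simp add: lat_periodic_def)
 have fg: "\<bar>f x*g x\<bar> <= K*L" for x unfolding abs_mult by (intro mult_mono C1bD(4) assms K0) auto
 show "\<bar>f x*g x\<bar> <= 2*K*L" for x using fg[of x] mult_nonneg_nonneg[OF K0 L0] by simp
 have "norm (f x *\<^sub>R grad2 g x + g x *\<^sub>R grad2 f x) <= K*L + L*K" for x
  using add_mono[OF mult_mono[OF C1bD(4)[OF assms(1)] C1bD(5)[OF assms(2)] K0 norm_ge_zero] mult_mono[OF C1bD(4)[OF assms(2)] C1bD(5)[OF assms(1)] L0 norm_ge_zero], of x x x x]
  by (intro norm_triangle_le) (simp only: norm_scaleR)
 from this[of x for x] show "norm (f x *\<^sub>R grad2 g x + g x *\<^sub>R grad2 f x) <= 2*K*L" for x by (simp add: mult_ac)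
qed (rule grad2_mult[OF assms], intro continuous_intros C1bD(3)[OF assms(1)] C1bD(3)[OF assms(2)] C1bD(6)[OF assms(1)] C1bD(6)[OF assms(2)])

lemma C1b_compose:
 assumes u: "C1b u K" and d: "!!x. (F has_real_derivative F' (u x)) (at (u x))"
  and c: "continuous_on UNIV (%x. F' (u x))" and b: "!!x. \<bar>F (u x)\<bar> <= L" "!!x. \<bar>F' (u x)\<bar> <= 1" "K <= L"
 shows "C1b (%x. F (u x)) L"
proof (rule C1b_I[where g="%x. F' (u x) *\<^sub>R grad2 u x"])
 show "lat_periodic v1 v2 (%x. F (u x))" using C1bD(1)[OF u] by (simp add: lat_periodic_def)
 show "((%x. F (u x)) has_derivative (%h. (F' (u x) *\<^sub>R grad2 u x) \<bullet> h)) (at x)" for x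
  using has_derivative_compose[OF C1bD(2)[OF u, of x] d[of x, unfolded has_field_derivative_def]] by simp
 show "norm (F' (u x) *\<^sub>R grad2 u x) <= L" for x using mult_mono[OF b(2)[of x] C1bD(5)[OF u, of x]] b(3) by simp
qed (intro continuous_intros c C1bD(3)[OF u], rule b)

lemma C1b_inverse:
 assumes "C1b u K" "!!x. u x \<ge> 0"
 shows "C1b (%x. 1/(1 + u x)) (1 + K)" "C1b (%x. 1/sqrt (1 + u x)) (1 + K)"
proof -
 have p: "1 + u x > 0" "1 <= (1 + u x)" for x using assms(2)[of x] by linarith+
 have nz: "1 + u x ~= 0" for x using p(1)[of x] by linarith
 note K0 = C1b_nonneg[OF assms(1)]
 show "C1b (%x. 1/(1 + u x)) (1 + K)"
 proof (rule C1b_compose[OF assms(1), where F="%y. 1/(1 + y)" and F'="%y. - (1/(1 + y)^2)"])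
  show "((%y. 1/(1 + y)) has_real_derivative - (1/(1 + u x)^2)) (at (u x))" for x using nz[of x] by (auto intro!: derivative_eq_intros simp: power2_eq_square)
  show "continuous_on UNIV (%x. - (1/(1 + u x)^2))" by (intro continuous_intros C1bD(6)[OF assms(1)]) (simp add: nz)
  have a: "1/(1 + u x) <= 1" for x using p[of x] by (simp add: divide_le_eq)
  show "\<bar>1/(1 + u x)\<bar> <= 1 + K" for x
  proof -
   have "0 <= 1/(1 + u x)" using p(1)[of x] by simp
   then show ?thesis using a[of x] K0 by linarith
  qed
  show "\<bar>- (1/(1 + u x)^2)\<bar> <= 1" for x using power_le_one[OF _ a[of x], of 2] p(1)[of x] by (simp add: power_divide)
 qed (use K0 in simp)
 show "C1b (%x. 1/sqrt (1 + u x)) (1 + K)"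
 proof (rule C1b_compose[OF assms(1), where F="%y. 1/sqrt (1 + y)" and F'="%y. - (1/2*(1/sqrt (1 + y))*(1/(1 + y)))"])
  show "((%y. 1/sqrt (1 + y)) has_real_derivative - (1/2*(1/sqrt (1 + u x))*(1/(1 + u x)))) (at (u x))" for x
   using p(1)[of x] by (auto intro!: derivative_eq_intros simp: field_simps)
  show "continuous_on UNIV (%x. - (1/2*(1/sqrt (1 + u x))*(1/(1 + u x))))" by (intro continuous_intros C1bD(6)[OF assms(1)]) (auto simp: nz)
  have a: "1/(1 + u x) <= 1" "1/sqrt (1 + u x) <= 1" for x using p[of x] by (simp_all add: divide_le_eq)
  have a0: "0 <= 1/(1 + u x)" "0 <= 1/sqrt (1 + u x)" for x using p[of x] by simp_all
  show "\<bar>1/sqrt (1 + u x)\<bar> <= 1 + K" for x using a[of x] a0[of x] K0 by linarith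
  have "(1/sqrt (1 + u x))*(1/(1 + u x)) <= 1" for x by (rule mult_le_one[OF a(2) a0(1) a(1)])
  moreover have "0 <= (1/sqrt (1 + u x))*(1/(1 + u x))" for x by (rule mult_nonneg_nonneg[OF a0(2) a0(1)])
  moreover have gen: "0 <= a*b ==> a*b <= 1 ==> \<bar>- (1/2*a*b)\<bar> <= 1" for a b :: real
  proof -
   assume "0 <= a*b" "a*b <= 1"
   moreover have "- (1/2*a*b) = - ((a*b)/2)" by simp
   ultimately show ?thesis by linarith
  qed
  ultimately show "\<bar>- (1/2*(1/sqrt (1 + u x))*(1/(1 + u x)))\<bar> <= 1" for x by (intro gen)
 qed (use K0 in simp)
qed

text \<open>The slab divergence theorem for a horizontal field that does not depend on the height,
  in depth 1.\<close>

lemma av_pd: assumes "C1b f K" shows "av (pd i f) = 0"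
proof -
 have "av (%x. 0) - av (%x. 0) = av3 1 (%p. pd i f (fst p))"
 proof (rule torus_divergence[where Fx="%p. f (fst p) *\<^sub>R axis i 1" and Fz="%p. 0"])
  show "continuous_on (UNIV \<times> {-1..0}) (%p. f (fst p) *\<^sub>R axis i 1 :: real^2)"
   by (intro continuous_intros continuous_on_compose2[OF C1bD(6)[OF assms, of UNIV]]) simp_all
  show "continuous_on (UNIV \<times> {-1..0}) (%p. pd i f (fst p))" by (intro continuous_intros continuous_on_compose2[OF C1bD(7)[OF assms]]) simp_all
  show "\<exists>L M. ((%p. f (fst p) *\<^sub>R axis i 1 :: real^2) has_derivative L) (at (x, z)) \<and> ((%p. 0) has_derivative M) (at (x, z)) \<and>
   L (axis 1 1, 0)$1 + L (axis 2 1, 0)$2 + M (0, 1) = pd i f (fst (x, z))" for x :: "real^2" and z :: real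
  proof (intro exI conjI)
   have "((%p. f (fst p)) has_derivative (%v. grad2 f x \<bullet> fst v)) (at (x,z))"
    by (rule has_derivative_compose[of fst fst "(x,z)" UNIV f]) (auto intro!: derivative_eq_intros C1bD(2)[OF assms])
   then show "((%p. f (fst p) *\<^sub>R axis i 1 :: real^2) has_derivative (%v. (grad2 f x \<bullet> fst v) *\<^sub>R axis i 1)) (at (x, z))"
    by (rule has_derivative_scaleR_left)
   have i12: "i = 1 \<or> i = 2" using exhaust_2[of i] by auto
   show "((grad2 f x \<bullet> fst (axis 1 1 :: real^2, 0::real)) *\<^sub>R axis i 1 :: real^2)$1 + ((grad2 f x \<bullet> fst (axis 2 1 :: real^2, 0::real)) *\<^sub>R axis i 1 :: real^2)$2 + 0 = pd i f (fst (x, z))"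
    using i12 by (auto simp: inner_axis axis_def grad2_def inner_2)
  qed (rule has_derivative_const)
 qed (auto simp: periodic_lat[OF C1bD(1)[OF assms]])
 also have "av3 1 (%p. pd i f (fst p)) = av (pd i f)"
 proof -
  have "continuous_on (UNIV \<times> {-1..0}) (%p. pd i f (fst p))" by (intro continuous_intros continuous_on_compose2[OF C1bD(7)[OF assms]]) simp_all
  from av3_slices[OF this] show ?thesis by simp
 qed
 finally show ?thesis by simp
qed

lemma pd_mult: "C1b f K ==> C1b g L ==> pd i (%x. f x*g x) x = f x*pd i g x + pd i f x*g x"
proof -
 assume a: "C1b f K" "C1b g L"
 have "grad2 (%x. f x*g x) = (%x. f x *\<^sub>R grad2 g x + g x *\<^sub>R grad2 f x)" by (rule grad2_eqI[OF grad2_mult[OF a]])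
 then have "grad2 (%x. f x*g x) x$i = (f x *\<^sub>R grad2 g x + g x *\<^sub>R grad2 f x)$i" by simp
 then show ?thesis by (simp add: grad2_def mult.commute)
qed

lemma av_by_parts:
 assumes "C1b f K" "C1b g L"
 shows "av (%x. pd i f x*g x) = - av (%x. f x*pd i g x)"
proof -
 have e: "pd i (%x. f x*g x) = (%x. f x*pd i g x + pd i f x*g x)" by (rule ext, rule pd_mult[OF assms])
 have "0 = av (%x. f x*pd i g x + pd i f x*g x)" using av_pd[OF C1b_mult[OF assms], of i] unfolding e by simp
 also have "\<dots> = av (%x. f x*pd i g x) + av (%x. pd i f x*g x)"
  by (rule av_add) (intro continuous_intros C1bD(6)[OF assms(1)] C1bD(7)[OF assms(1)] C1bD(6)[OF assms(2)] C1bD(7)[OF assms(2)])+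
 finally show ?thesis by linarith
qed

lemma C1b_wser:
 assumes "wser f a" "!!x. \<bar>f x\<bar> <= K" "!!x. norm (grad2 f x) <= K"
 shows "C1b f K" by (rule C1b_I[OF wser_periodic[OF assms(1)] wser_has_derivative(1)[OF assms(1)] wser_grad2_cont[OF assms(1)] assms(2,3)])

lemma trig_C1b:
 assumes S: "finite S" "S \<subseteq> Lam"
 obtains K where "C1b (%x. Re (trig S \<beta> x)) K" "!!i. pd i (%x. Re (trig S \<beta> x)) = (%x. Re (trig S (%k. \<i> * of_real (k$i)*\<beta> k) x))"
proof -
 define G where "G x = (\<chi> i. Re (trig S (%k. \<i> * of_real (k$i)*\<beta> k) x))" for x
 have d: "((%x. Re (trig S \<beta> x)) has_derivative (%h. G x \<bullet> h)) (at x)" for x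
 proof -
  have "((%x. \<beta> k * cis (k \<bullet> x)) has_derivative (%h. \<beta> k*((k \<bullet> h) *\<^sub>R (\<i> * cis (k \<bullet> x))))) (at x)" for k
   by (rule has_derivative_mult_right[OF has_derivative_cis[OF has_derivative_inner_right[OF has_derivative_ident]]])
  then have "((%x. Re (trig S \<beta> x)) has_derivative (%h. Re (\<Sum>k\<in>S. \<beta> k*((k \<bullet> h) *\<^sub>R (\<i> * cis (k \<bullet> x)))))) (at x)"
   unfolding trig_def by (intro bounded_linear.has_derivative[OF bounded_linear_Re] has_derivative_sum)
  then show ?thesis
  proof (rule has_derivative_eq_rhs, intro ext)
   fix h :: "real^2"
   have e: "Re (\<beta> k*((k \<bullet> h) *\<^sub>R (\<i>*z))) = Re (\<i> * of_real (k$1)*\<beta> k*z)*h$1 + Re (\<i> * of_real (k$2)*\<beta> k*z)*h$2" for k z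
    by (simp add: inner_2 algebra_simps)
   show "Re (\<Sum>k\<in>S. \<beta> k*((k \<bullet> h) *\<^sub>R (\<i> * cis (k \<bullet> x)))) = G x \<bullet> h"
    unfolding Re_sum e by (simp only: G_def trig_def inner_2 vec_lambda_beta Re_sum sum.distrib sum_distrib_right)
  qed
 qed
 have per: "lat_periodic v1 v2 (%x. Re (trig S \<beta> x))" unfolding lat_periodic_def trig_def using S(2) by (auto intro!: sum.cong simp: cis_lat subset_iff)
 have c: "continuous_on UNIV G" unfolding G_def by (intro continuous_intros trig_cont)
 have Gp: "lat_periodic v1 v2 G" unfolding lat_periodic_def G_def trig_def using S(2) by (auto intro!: sum.cong simp: cis_lat subset_iff vec_eq_iff)
 obtain K1 where K1: "!!x. norm (Re (trig S \<beta> x)) <= K1" using periodic_bounded[OF continuous_on_Re[OF trig_cont] per] by blast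
 obtain K2 where K2: "!!x. norm (G x) <= K2" using periodic_bounded[OF c Gp] by blast
 have "C1b (%x. Re (trig S \<beta> x)) (max K1 K2)" by (rule C1b_I[OF per d c]) (use K1 K2 in \<open>auto simp: le_max_iff_disj\<close>)
 moreover have "pd i (%x. Re (trig S \<beta> x)) = (%x. Re (trig S (%k. \<i> * of_real (k$i)*\<beta> k) x))" for i
  using grad2_eqI[OF d] by (simp add: G_def grad2_def fun_eq_iff vec_eq_iff)
 ultimately show ?thesis by (rule that)
qed

end

text \<open>In the Bernoulli equations G has been replaced by -c . grad \<eta>, so their difference
  involves surface data only.\<close>

locale two_stokes = two_waves +
 fixes g \<kappa> C :: real
 assumes kappa: "\<kappa> \<ge> 0" and C: "norm c <= C" and eps_le: "\<epsilon> <= 1/16"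
  and C1: "!!i. C1b (pd i \<eta>1) \<epsilon>" "!!i. C1b (pd i \<psi>1) \<epsilon>" "!!i. C1b (pd i \<eta>2) \<epsilon>" "!!i. C1b (pd i \<psi>2) \<epsilon>"
  and bern1: "!!x. c \<bullet> grad2 \<psi>1 x + (- g*\<eta>1 x - 1/2*(norm (grad2 \<psi>1 x))^2
      + (grad2 \<eta>1 x \<bullet> grad2 \<psi>1 x - c \<bullet> grad2 \<eta>1 x)^2/(2*(1 + (norm (grad2 \<eta>1 x))^2))
      + \<kappa>*div2 (%y. (1/sqrt (1 + (norm (grad2 \<eta>1 y))^2)) *\<^sub>R grad2 \<eta>1 y) x) = 0"
  and bern2: "!!x. c \<bullet> grad2 \<psi>2 x + (- g*\<eta>2 x - 1/2*(norm (grad2 \<psi>2 x))^2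
      + (grad2 \<eta>2 x \<bullet> grad2 \<psi>2 x - c \<bullet> grad2 \<eta>2 x)^2/(2*(1 + (norm (grad2 \<eta>2 x))^2))
      + \<kappa>*div2 (%y. (1/sqrt (1 + (norm (grad2 \<eta>2 y))^2)) *\<^sub>R grad2 \<eta>2 y) x) = 0"

section \<open>Lipschitz bounds for the nonlinear terms\<close>

lemma isqrt_bounds:
 fixes u v :: real
 assumes "0 <= u" "0 <= v"
 shows "\<bar>1/sqrt (1 + u) - 1/sqrt (1 + v)\<bar> <= \<bar>u - v\<bar>" "\<bar>1/(1 + u) - 1/(1 + v)\<bar> <= \<bar>u - v\<bar>"
proof -
 have nz: "1 + u > 0" "1 + v > 0" and a: "1/(1 + u) <= 1" "1/(1 + v) <= 1" and a0: "0 <= 1/(1 + u)" "0 <= 1/(1 + v)" using assms by (auto simp: divide_le_eq)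
 have e: "1/(1 + u) - 1/(1 + v) = (v - u)*(1/(1 + u)*(1/(1 + v)))" using nz by (simp add: field_simps)
 have p: "0 <= 1/(1 + u)*(1/(1 + v))" "1/(1 + u)*(1/(1 + v)) <= 1" using a a0 by (simp_all only: mult_le_one mult_nonneg_nonneg)
 have "\<bar>(v - u)*(1/(1 + u)*(1/(1 + v)))\<bar> <= \<bar>v - u\<bar>*1" unfolding abs_mult[of "v - u"] abs_of_nonneg[OF p(1)] by (rule mult_left_mono[OF p(2)]) simp
 then show 2: "\<bar>1/(1 + u) - 1/(1 + v)\<bar> <= \<bar>u - v\<bar>" unfolding e by (simp only: abs_minus_commute[of v u] mult_1_right)
 have s: "1 <= sqrt (1 + u)" "1 <= sqrt (1 + v)" using assms by simp_all
 have "(sqrt (1 + v) - sqrt (1 + u))*(sqrt (1 + v) + sqrt (1 + u)) = v - u" using assms by (simp add: algebra_simps)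
 then have "\<bar>sqrt (1 + v) - sqrt (1 + u)\<bar>*(sqrt (1 + v) + sqrt (1 + u)) = \<bar>v - u\<bar>"
  using s by (metis abs_mult abs_of_nonneg add_nonneg_nonneg zero_le_one order_trans)
 moreover have "\<bar>sqrt (1 + v) - sqrt (1 + u)\<bar>*1 <= \<bar>sqrt (1 + v) - sqrt (1 + u)\<bar>*(sqrt (1 + v) + sqrt (1 + u))"
  using s by (intro mult_left_mono) linarith+
 ultimately have d: "\<bar>sqrt (1 + v) - sqrt (1 + u)\<bar> <= \<bar>v - u\<bar>" by (simp only: mult_1_right)
 have e2: "1/sqrt (1 + u) - 1/sqrt (1 + v) = (sqrt (1 + v) - sqrt (1 + u))*(1/sqrt (1 + u)*(1/sqrt (1 + v)))" using nz by (simp add: field_simps)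
 have b: "1/sqrt (1 + u) <= 1" "1/sqrt (1 + v) <= 1" and b0: "0 <= 1/sqrt (1 + u)" "0 <= 1/sqrt (1 + v)" using s by (simp_all add: divide_le_eq)
 have q: "0 <= 1/sqrt (1 + u)*(1/sqrt (1 + v))" "1/sqrt (1 + u)*(1/sqrt (1 + v)) <= 1" using b b0 by (simp_all only: mult_le_one mult_nonneg_nonneg)
 have "\<bar>(sqrt (1 + v) - sqrt (1 + u))*(1/sqrt (1 + u)*(1/sqrt (1 + v)))\<bar> <= \<bar>sqrt (1 + v) - sqrt (1 + u)\<bar>*1"
  unfolding abs_mult[of "sqrt (1 + v) - sqrt (1 + u)"] abs_of_nonneg[OF q(1)] by (rule mult_left_mono[OF q(2)]) simp
 from order_trans[OF this[unfolded mult_1_right] d]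
 show "\<bar>1/sqrt (1 + u) - 1/sqrt (1 + v)\<bar> <= \<bar>u - v\<bar>" unfolding e2 abs_minus_commute[of u v] .
qed

lemma norm_sq_diff_le:
 fixes p q :: "'a::real_inner"
 assumes "norm p <= d" "norm q <= d"
 shows "\<bar>(norm p)^2 - (norm q)^2\<bar> <= 2*d*norm (p - q)"
proof -
 have "(norm p)^2 - (norm q)^2 = (p - q) \<bullet> (p + q)" by (simp add: power2_norm_eq_inner inner_add_right inner_diff_left inner_diff_right inner_commute)
 also have "\<bar>\<dots>\<bar> <= norm (p - q)*norm (p + q)" by (rule Cauchy_Schwarz_ineq2)
 also have "\<dots> <= norm (p - q)*(2*d)" using norm_triangle_ineq[of p q] assms by (intro mult_left_mono) auto
 finally show ?thesis by (simp add: mult_ac)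
qed

text \<open>The linearisation of the curvature flux at slope 0 is the identity; the deviation is
  Lipschitz with a constant proportional to the slopes.\<close>

lemma curvature_flux_diff:
 fixes p q :: "'a::real_inner"
 assumes d: "norm p <= d" "norm q <= d" "d <= 1"
 shows "norm ((1/sqrt (1 + (norm p)^2)) *\<^sub>R p - (1/sqrt (1 + (norm q)^2)) *\<^sub>R q - (p - q)) <= 3*d*norm (p - q)"
proof -
 let ?s = "%p::'a. 1/sqrt (1 + (norm p)^2)"
 have d0: "0 <= d" using order_trans[OF norm_ge_zero d(1)] .
 have e: "?s p *\<^sub>R p - ?s q *\<^sub>R q - (p - q) = (?s p - 1) *\<^sub>R (p - q) + (?s p - ?s q) *\<^sub>R q" by (simp add: algebra_simps)
 have "\<bar>?s p - 1\<bar> <= (norm p)^2" using isqrt_bounds(1)[of "(norm p)^2" 0] by simp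
 also have "\<dots> <= norm p*1" unfolding power2_eq_square using d by (intro mult_left_mono) auto
 finally have 1: "\<bar>?s p - 1\<bar> <= d" using d by linarith
 have "\<bar>?s p - ?s q\<bar> <= 2*d*norm (p - q)" using isqrt_bounds(1)[of "(norm p)^2" "(norm q)^2"] norm_sq_diff_le[OF d(1,2)] by simp
 then have 2: "\<bar>?s p - ?s q\<bar>*norm q <= (2*d*norm (p - q))*1" using d d0 by (intro mult_mono) auto
 have "norm ((?s p - 1) *\<^sub>R (p - q) + (?s p - ?s q) *\<^sub>R q) <= d*norm (p - q) + (2*d*norm (p - q))*1"
  by (intro norm_triangle_le add_mono) (use 1 2 in \<open>auto intro: mult_right_mono\<close>)
 then show ?thesis unfolding e by simp
qed

text \<open>The term is quadratic in the slope, so changing the slope at fixed r costs one small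
  factor d.\<close>

lemma vertical_speed_diff:
 fixes p q r :: "'a::real_inner"
 assumes d: "norm p <= d" "norm q <= d" "d <= 1" and r: "norm r <= R"
 shows "\<bar>(p \<bullet> r)^2/(2*(1 + (norm p)^2)) - (q \<bullet> r)^2/(2*(1 + (norm q)^2))\<bar> <= 2*d*R^2*norm (p - q)"
proof -
 let ?n = "%p::'a. 1/(1 + (norm p)^2)"
 have d0: "0 <= d" and R0: "0 <= R" using order_trans[OF norm_ge_zero d(1)] order_trans[OF norm_ge_zero r] .
 have alg: "A^2/(2*P) - B^2/(2*Q) = 1/2*(((A - B)*(A + B))*(1/P) + B^2*(1/P - 1/Q))" for A B P Q :: real
 proof -
  have 1: "(A - B)*(A + B) = A^2 - B^2" by (simp add: power2_eq_square algebra_simps)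
  have 2: "A^2/(2*P) = 1/2*(A^2*(1/P))" "B^2/(2*Q) = 1/2*(B^2*(1/Q))" by simp_all
  have 3: "1/2*(a*x) - 1/2*(b*y) = 1/2*((a - b)*x + b*(x - y))" for a b x y :: real by (simp add: algebra_simps)
  show ?thesis unfolding 1 2 by (rule 3)
 qed
 have e: "(p \<bullet> r)^2/(2*(1 + (norm p)^2)) - (q \<bullet> r)^2/(2*(1 + (norm q)^2)) =
  1/2*((((p - q) \<bullet> r)*((p + q) \<bullet> r))*?n p + (q \<bullet> r)^2*(?n p - ?n q))" unfolding inner_diff_left inner_add_left by (rule alg)
 have "1 + (norm p)^2 > 0" by (simp add: add_pos_nonneg)
 then have n: "\<bar>?n p\<bar> <= 1" by (simp add: divide_le_eq)
 have 1: "\<bar>(p - q) \<bullet> r\<bar> <= norm (p - q)*R" using order_trans[OF Cauchy_Schwarz_ineq2 mult_left_mono[OF r]] by simp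
 have "\<bar>(p + q) \<bullet> r\<bar> <= norm (p + q)*norm r" by (rule Cauchy_Schwarz_ineq2)
 also have "\<dots> <= (2*d)*R" using norm_triangle_ineq[of p q] d r d0 by (intro mult_mono) auto
 finally have 2: "\<bar>(p + q) \<bullet> r\<bar> <= (2*d)*R" .
 have 3: "\<bar>(((p - q) \<bullet> r)*((p + q) \<bullet> r))*?n p\<bar> <= ((norm (p - q)*R)*((2*d)*R))*1"
  unfolding abs_mult by (intro mult_mono 1 2 n[simplified abs_mult]) (use R0 d0 n in auto)
 have "\<bar>q \<bullet> r\<bar> <= norm q*norm r" by (rule Cauchy_Schwarz_ineq2)
 also have "\<dots> <= 1*R" using d r by (intro mult_mono) auto
 finally have 4: "(q \<bullet> r)^2 <= R^2" using power_mono[of "\<bar>q \<bullet> r\<bar>" R 2] by simp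
 have 5: "\<bar>?n p - ?n q\<bar> <= 2*d*norm (p - q)" using isqrt_bounds(2)[of "(norm p)^2" "(norm q)^2"] norm_sq_diff_le[OF d(1,2)] by simp
 have 6: "\<bar>(q \<bullet> r)^2*(?n p - ?n q)\<bar> <= R^2*(2*d*norm (p - q))"
  unfolding abs_mult[of "(q \<bullet> r)^2"] using 4 5 by (intro mult_mono) auto
 have gen: "\<bar>1/2*(A + B)\<bar> <= Z" if "\<bar>A\<bar> <= Z" "\<bar>B\<bar> <= Z" for A B Z :: real using that by simp
 show ?thesis unfolding e using 3 6 by (intro gen) (simp_all add: power2_eq_square mult_ac)
qed

context lattice2
begin

lemma norm_grad2_sq: "(norm (grad2 f x))^2 = pd 1 f x*pd 1 f x + pd 2 f x*pd 2 f x"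
 by (simp add: power2_norm_eq_inner inner_2 grad2_def)

lemma slope_sq_C1b:
 assumes "!!i. C1b (pd i f) e" "e <= 1/16"
 shows "C1b (%x. (norm (grad2 f x))^2) 1"
proof -
 have e0: "0 <= e" by (rule C1b_nonneg[OF assms(1)])
 have "e*e <= 1/16*(1/16)" using e0 assms(2) by (intro mult_mono) auto
 then show ?thesis unfolding norm_grad2_sq by (intro C1b_mono[OF C1b_add[OF C1b_mult[OF assms(1,1)] C1b_mult[OF assms(1,1)]]]) simp
qed

lemma curvature_flux_C1b:
 assumes "!!i. C1b (pd i f) e" "e <= 1/16"
 shows "C1b (%x. ((1/sqrt (1 + (norm (grad2 f x))^2)) *\<^sub>R grad2 f x)$i) (2*(1 + 1)*e)"
 using C1b_mult[OF C1b_inverse(2)[OF slope_sq_C1b[OF assms]] assms(1)[of i]] by (simp add: grad2_def)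

lemma C1b_norm_grad: assumes "!!i. C1b (pd i f) e" shows "norm (grad2 f x) <= 2*e"
proof -
 have "norm (grad2 f x) <= \<bar>pd 1 f x\<bar> + \<bar>pd 2 f x\<bar>" using norm_le_l1_cart[of "grad2 f x"] by (simp add: sum_2 grad2_def)
 then show ?thesis using C1bD(4)[OF assms[of 1], of x] C1bD(4)[OF assms[of 2], of x] by linarith
qed

end

context two_stokes
begin

text \<open>Coefficient of \<open>pd i \<psi>d\<close> in the difference of the quadratic terms. The
  energy controls \<psi>d but not its gradient, so this derivative is moved to the test function;
  therefore \<open>ff\<close> must be bounded in C^1.\<close>

definition "ff i x = - (1/2)*(pd i \<psi>1 x + pd i \<psi>2 x) + pd i \<eta>1 x *
 ((pd 1 \<eta>1 x*(pd 1 \<psi>1 x + pd 1 \<psi>2 x + (- 2 * c$1)) + pd 2 \<eta>1 x*(pd 2 \<psi>1 x + pd 2 \<psi>2 x + (- 2 * c$2)))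
 * (1/2*(1/(1 + (norm (grad2 \<eta>1 x))^2))))"

lemma ff_C1b: "C1b (ff i) (50*(1 + C)*\<epsilon>)"
proof -
 have C0: "0 <= C" using order_trans[OF norm_ge_zero C] .
 have e: "0 <= \<epsilon>" by (rule eps)
 have c: "\<bar>c $ j\<bar> <= C" for j using order_trans[OF component_le_norm_cart C] .
 have q: "C1b (%x. pd j \<eta>1 x*(pd j \<psi>1 x + pd j \<psi>2 x + (- 2 * c$j))) (2*\<epsilon>*(1 + 2*C))" for j
  using c[of j] eps_le by (intro C1b_mult C1 C1b_mono[OF C1b_add[OF C1b_add[OF C1(2)[of j] C1(4)[of j]] C1b_const[of "-2 * c$j" "2*C"]]]) auto
 have n: "C1b (%x. 1/2*(1/(1 + (norm (grad2 \<eta>1 x))^2))) 2"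
  using C1b_mult[OF C1b_const[of "1/2" "1/2"] C1b_inverse(1)[OF slope_sq_C1b[OF C1(1) eps_le]]] by simp
 have "C1b (ff i) (2*(1/2)*(\<epsilon> + \<epsilon>) + 2*\<epsilon>*(2*(2*\<epsilon>*(1 + 2*C) + 2*\<epsilon>*(1 + 2*C))*2))"
  unfolding ff_def[abs_def] by (intro C1b_add C1b_mult C1 q n C1b_const) simp
 moreover have "2*(1/2)*(\<epsilon> + \<epsilon>) + 2*\<epsilon>*(2*(2*\<epsilon>*(1 + 2*C) + 2*\<epsilon>*(1 + 2*C))*2) <= 50*(1 + C)*\<epsilon>"
 proof -
  have "\<epsilon>*(\<epsilon>*(1 + 2*C)) <= \<epsilon>*(1*(1 + 2*C))" using e eps_le C0 by (intro mult_left_mono mult_right_mono) auto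
  moreover have "2*(1/2)*(\<epsilon> + \<epsilon>) + 2*\<epsilon>*(2*(2*\<epsilon>*(1 + 2*C) + 2*\<epsilon>*(1 + 2*C))*2) = 2*\<epsilon> + 32*(\<epsilon>*(\<epsilon>*(1 + 2*C)))"
   by (simp add: algebra_simps)
  moreover have "2*\<epsilon> + 32*(\<epsilon>*(1*(1 + 2*C))) = 34*\<epsilon> + 64*(C*\<epsilon>)" by (simp add: algebra_simps)
  moreover have "\<epsilon>*(\<epsilon>*(1 + 2*C)) <= 1/16*(\<epsilon>*(1 + 2*C))" using e eps_le C0 by (intro mult_right_mono) auto
  moreover have "2*\<epsilon> + 32*(1/16*(\<epsilon>*(1 + 2*C))) = 4*\<epsilon> + 4*(C*\<epsilon>)" by (simp add: algebra_simps)
  moreover have "50*(1 + C)*\<epsilon> = 50*\<epsilon> + 50*(C*\<epsilon>)" by (simp add: algebra_simps)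
  moreover have "0 <= C*\<epsilon>" using C0 e by simp
  ultimately show ?thesis using e by linarith
 qed
 ultimately show ?thesis by (rule C1b_mono)
qed

definition "Ns p q = (p \<bullet> (q - c))^2/(2*(1 + (norm p)^2))" for p q :: "real^2"
definition "N1 x = Ns (grad2 \<eta>2 x) (grad2 \<psi>2 x) - Ns (grad2 \<eta>1 x) (grad2 \<psi>2 x)"
definition "cv1 x = (1/sqrt (1 + (norm (grad2 \<eta>1 x))^2)) *\<^sub>R grad2 \<eta>1 x"
definition "cv2 x = (1/sqrt (1 + (norm (grad2 \<eta>2 x))^2)) *\<^sub>R grad2 \<eta>2 x"

lemma grad_psid: "grad2 \<psi>d x = grad2 \<psi>2 x - grad2 \<psi>1 x"
 unfolding \<psi>d_def[abs_def] by (rule wser_grad_diff[OF w(4,2)])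

lemma pd_d: "pd i \<psi>d x = pd i \<psi>2 x - pd i \<psi>1 x" "pd i \<eta>d x = pd i \<eta>2 x - pd i \<eta>1 x"
 unfolding \<psi>d_def[abs_def] \<eta>d_def[abs_def] wser_pd_diff[OF w(4,2)] wser_pd_diff[OF w(3,1)] by simp_all

text \<open>The change is split in two: the slope varies with \<psi>2 frozen (\<open>N1\<close>),
  and the potential varies with \<eta>1 frozen, which is exactly linear in grad \<psi>d because a
  difference of squares factors.\<close>

lemma nonlinearity_diff:
 "(- 1/2*(norm (grad2 \<psi>2 x))^2 + Ns (grad2 \<eta>2 x) (grad2 \<psi>2 x)) - (- 1/2*(norm (grad2 \<psi>1 x))^2 + Ns (grad2 \<eta>1 x) (grad2 \<psi>1 x))
 = N1 x + (ff 1 x*pd 1 \<psi>d x + ff 2 x*pd 2 \<psi>d x)"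
proof -
 have nz: "1 + (norm (grad2 \<eta>1 x))^2 ~= 0" using zero_le_power2[of "norm (grad2 \<eta>1 x)"] by linarith
 have alg: "A^2/(2*P) - B^2/(2*P) = ((A - B)*(A + B))*(1/2*(1/P))" for A B P :: real
 proof -
  have 1: "(A - B)*(A + B) = A^2 - B^2" by (simp add: power2_eq_square algebra_simps)
  show ?thesis unfolding 1 by (simp add: diff_divide_distrib)
 qed
 have "Ns (grad2 \<eta>1 x) (grad2 \<psi>2 x) - Ns (grad2 \<eta>1 x) (grad2 \<psi>1 x) =
  (grad2 \<eta>1 x \<bullet> (grad2 \<psi>2 x - c) - grad2 \<eta>1 x \<bullet> (grad2 \<psi>1 x - c))*(grad2 \<eta>1 x \<bullet> (grad2 \<psi>2 x - c) + grad2 \<eta>1 x \<bullet> (grad2 \<psi>1 x - c))*(1/2*(1/(1 + (norm (grad2 \<eta>1 x))^2)))"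
  unfolding Ns_def by (rule alg)
 also have "\<dots> = (pd 1 \<eta>1 x*pd 1 \<psi>d x + pd 2 \<eta>1 x*pd 2 \<psi>d x) *
  (pd 1 \<eta>1 x*(pd 1 \<psi>1 x + pd 1 \<psi>2 x + (- 2 * c$1)) + pd 2 \<eta>1 x*(pd 2 \<psi>1 x + pd 2 \<psi>2 x + (- 2 * c$2)))*(1/2*(1/(1 + (norm (grad2 \<eta>1 x))^2)))"
  by (rule arg_cong2[where f="(*)"]) (simp_all add: inner_2 grad2_def pd_d algebra_simps)
 finally have 2: "Ns (grad2 \<eta>1 x) (grad2 \<psi>2 x) - Ns (grad2 \<eta>1 x) (grad2 \<psi>1 x) = \<dots>" .
 have 3: "- 1/2*(norm (grad2 \<psi>2 x))^2 - (- 1/2*(norm (grad2 \<psi>1 x))^2) = - (1/2)*(pd 1 \<psi>1 x + pd 1 \<psi>2 x)*pd 1 \<psi>d x + - (1/2)*(pd 2 \<psi>1 x + pd 2 \<psi>2 x)*pd 2 \<psi>d x"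
  unfolding norm_grad2_sq pd_d by (simp add: algebra_simps)
 have gen: "(a2 + n22) - (a1 + n11) = (n22 - n12) + ((u1 + e1*(S*k))*d1 + (u2 + e2*(S*k))*d2)"
  if "n12 - n11 = (e1*d1 + e2*d2)*S*k" "a2 - a1 = u1*d1 + u2*d2" for a2 n22 a1 n11 n12 u1 u2 e1 e2 S k d1 d2 :: real using that by (simp add: algebra_simps)
 show ?thesis unfolding N1_def ff_def by (rule gen[OF 2 3])
qed

lemma N1_le: "\<bar>N1 x\<bar> <= 4*(C + 1)^2*\<epsilon>*norm (gd x)"
proof -
 have e2: "2*\<epsilon> <= 1" using eps_le by simp
 have "norm (grad2 \<psi>2 x - c) <= C + 1" using norm_triangle_ineq4[of "grad2 \<psi>2 x" c] C C1b_norm_grad[OF C1(4), of x] e2 by linarith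
 from vertical_speed_diff[OF C1b_norm_grad[OF C1(3)] C1b_norm_grad[OF C1(1)] e2 this, of x x]
 show ?thesis unfolding N1_def Ns_def gd_def by (simp add: mult_ac)
qed

lemma cv_le: "\<bar>cv2 x$i - cv1 x$i - pd i \<eta>d x\<bar> <= 6*\<epsilon>*norm (gd x)"
proof -
 have e2: "2*\<epsilon> <= 1" using eps_le by simp
 have "\<bar>(cv2 x - cv1 x - (grad2 \<eta>2 x - grad2 \<eta>1 x))$i\<bar> <= 3*(2*\<epsilon>)*norm (grad2 \<eta>2 x - grad2 \<eta>1 x)" unfolding cv1_def cv2_def
  by (rule order_trans[OF component_le_norm_cart curvature_flux_diff[OF C1b_norm_grad[OF C1(3)] C1b_norm_grad[OF C1(1)] e2]])
 then show ?thesis unfolding gd_def by (simp add: pd_d grad2_def)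
qed

lemma cv_C1b: "C1b (%x. cv1 x$i) (4*\<epsilon>)" "C1b (%x. cv2 x$i) (4*\<epsilon>)"
 using curvature_flux_C1b[OF C1(1) eps_le, of i] curvature_flux_C1b[OF C1(3) eps_le, of i] unfolding cv1_def cv2_def by simp_all

lemma bernoulli_diff:
 "c \<bullet> grad2 \<psi>d x - g*\<eta>d x + (N1 x + (ff 1 x*pd 1 \<psi>d x + ff 2 x*pd 2 \<psi>d x))
  + \<kappa>*((pd 1 (%x. cv2 x$1) x + pd 2 (%x. cv2 x$2) x) - (pd 1 (%x. cv1 x$1) x + pd 2 (%x. cv1 x$2) x)) = 0"
proof -
 have b1: "c \<bullet> grad2 \<psi>1 x + (- g*\<eta>1 x - 1/2*(norm (grad2 \<psi>1 x))^2 + Ns (grad2 \<eta>1 x) (grad2 \<psi>1 x) + \<kappa>*(pd 1 (%x. cv1 x$1) x + pd 2 (%x. cv1 x$2) x)) = 0"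
  using bern1[of x] unfolding Ns_def cv1_def div2_def by (simp add: inner_diff_right inner_commute sum_2)
 have b2: "c \<bullet> grad2 \<psi>2 x + (- g*\<eta>2 x - 1/2*(norm (grad2 \<psi>2 x))^2 + Ns (grad2 \<eta>2 x) (grad2 \<psi>2 x) + \<kappa>*(pd 1 (%x. cv2 x$1) x + pd 2 (%x. cv2 x$2) x)) = 0"
  using bern2[of x] unfolding Ns_def cv2_def div2_def by (simp add: inner_diff_right inner_commute sum_2)
 show ?thesis unfolding nonlinearity_diff[of x, symmetric] grad_psid \<eta>d_def inner_diff_right using b1 b2 by (simp add: algebra_simps)
qed

end

context lattice2
begin

lemma av_abs_le:
 fixes f g :: "real^2 => real"
 assumes "continuous_on UNIV f" "continuous_on UNIV g" "!!x. \<bar>f x\<bar> <= g x"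
 shows "\<bar>av f\<bar> <= av g"
proof -
 have "f x <= g x" "- f x <= g x" for x using assms(3)[of x] by linarith+
 then have "av f <= av g" "av (%x. - f x) <= av g" using av_mono[OF assms(1,2)] av_mono[OF continuous_on_minus[OF assms(1)] assms(2)] by simp_all
 then show ?thesis by (simp add: av_minus)
qed

text \<open>Bundles continuity with the mean value, so that means of long expressions are computed
  by introduction rules.\<close>

definition has_av :: "(real^2 => real) => real => bool" where
 "has_av f a \<longleftrightarrow> continuous_on UNIV f \<and> av f = a"

lemma has_av_intros:
 "has_av f a ==> has_av g b ==> has_av (%x. f x + g x) (a + b)"
 "has_av f a ==> has_av g b ==> has_av (%x. f x - g x) (a - b)"
 "has_av f a ==> has_av (%x. - f x) (- a)"
 "has_av f a ==> has_av (%x. c*f x) (c*a)"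
 "continuous_on UNIV f ==> has_av f (av f)" unfolding has_av_def by (auto simp: av_add av_diff av_minus av_cmul intro!: continuous_intros)

lemma has_avD: "has_av f a ==> av f = a" unfolding has_av_def by simp

lemma wser_C1b: assumes "wser f a" obtains K where "C1b f K"
proof -
 obtain B where B: "!!x. norm (f x) <= B" using periodic_bounded[OF wser_cont[OF assms] wser_periodic[OF assms]] by blast
 note pd = wser_has_derivative(2)[OF assms]
 obtain B1 where B1: "!!x. norm (pd 1 f x) <= B1" using periodic_bounded[OF wser_cont[OF pd] wser_periodic[OF pd]] by blast
 obtain B2 where B2: "!!x. norm (pd 2 f x) <= B2" using periodic_bounded[OF wser_cont[OF pd] wser_periodic[OF pd]] by blast
 have "norm (grad2 f x) <= B1 + B2" for x using norm_le_l1_cart[of "grad2 f x"] B1[of x] B2[of x] by (simp add: sum_2 grad2_def)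
 then have "C1b f (max B (B1 + B2))" by (intro C1b_wser[OF assms]) (use B in \<open>auto simp: le_max_iff_disj\<close>)
 then show ?thesis by (rule that)
qed

lemma young: "K*(x*y) <= \<theta>*y^2 + K^2/(4*\<theta>)*x^2" if "\<theta> > 0" for K x y \<theta> :: real
proof -
 have "0 <= (2*\<theta>*y - K*x)^2/(4*\<theta>)" using that by simp
 also have "\<dots> = \<theta>*y^2 + K^2/(4*\<theta>)*x^2 - K*(x*y)" using that by (simp add: power2_eq_square field_simps)
 finally show ?thesis by simp
qed

end

section \<open>The tested Bernoulli equation and its residual\<close>

context two_stokes
begin

text \<open>Mode k of the residual of the Bernoulli equation linearised at rest.\<close>

definition "Yr k = \<i> * of_real (c \<bullet> k)*bd k - of_real (g + \<kappa>*(norm k)^2)*ad k"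

lemma N1_cont: "continuous_on A N1"
proof -
 have "continuous_on A (%x. Ns (grad2 f x) (grad2 h x))" if "wser f a" "wser h b" for f h a b
 proof -
  have "1 + (norm (grad2 f x))^2 > 0" for x by (simp add: add_pos_nonneg)
  then have "2*(1 + (norm (grad2 f x))^2) ~= 0" for x using less_irrefl by (metis mult_eq_0_iff zero_neq_numeral)
  then show ?thesis unfolding Ns_def using continuous_on_subset[OF wser_grad2_cont[OF that(1)]] continuous_on_subset[OF wser_grad2_cont[OF that(2)]]
   by (intro continuous_intros) auto
 qed
 then show ?thesis unfolding N1_def[abs_def] using w by (intro continuous_on_diff) blast+
qed

text \<open>The summands come from \<open>N1_le\<close>, from two terms with \<open>ff_C1b\<close>,
  and from two components of \<open>cv_le\<close>.\<close>

definition "KD = 4*(C + 1)^2 + 100*(1 + C) + 12*\<kappa>"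

text \<open>After integration by parts the remainder contains \<psi>d and grad \<eta>d without
  further derivatives, against \<tau> and grad \<tau>. Hence the H^1 weight on the test
  coefficients, while \<open>EE\<close> controls the rest.\<close>

lemma dynamic_test:
 assumes S: "finite S" "S \<subseteq> Lam" and \<theta>: "\<theta> > 0"
 shows "Re (\<Sum>k\<in>S. \<beta> k * cnj (Yr k)) <= 3*\<theta>*(\<Sum>k\<in>S. (1 + (norm k)^2)*(cmod (\<beta> k))^2) + (KD*\<epsilon>)^2/(2*\<theta>)*((1 + 1/kap)*EE)"
proof -
 define \<tau> where "\<tau> x = Re (trig S \<beta> x)" for x
 obtain K where \<tau>C: "C1b \<tau> K" and pd\<tau>: "!!i. pd i \<tau> = (%x. Re (trig S (%k. \<i> * of_real (k$i)*\<beta> k) x))"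
  using trig_C1b[OF S, of \<beta>] unfolding \<tau>_def[abs_def] by blast
 obtain Ke where eC: "C1b \<eta>d Ke" using wser_C1b[OF wd(1)] .
 obtain Kp where pC: "C1b \<psi>d Kp" using wser_C1b[OF wd(2)] .
 note ct = C1bD(6)[OF \<tau>C] C1bD(7)[OF \<tau>C] C1bD(6)[OF eC] C1bD(7)[OF eC] C1bD(6)[OF pC] C1bD(7)[OF pC] N1_cont cont_d
  C1bD(6)[OF ff_C1b] C1bD(7)[OF ff_C1b] C1bD(6)[OF cv_C1b(1)] C1bD(7)[OF cv_C1b(1)] C1bD(6)[OF cv_C1b(2)] C1bD(7)[OF cv_C1b(2)]
  wser_grad2_cont[OF wd(2)]
 define R where "R x = - (N1 x*\<tau> x) + (\<psi>d x*pd 1 (%x. ff 1 x*\<tau> x) x + \<psi>d x*pd 2 (%x. ff 2 x*\<tau> x) x)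
  + \<kappa>*((cv2 x$1 - cv1 x$1 - pd 1 \<eta>d x)*pd 1 \<tau> x + (cv2 x$2 - cv1 x$2 - pd 2 \<eta>d x)*pd 2 \<tau> x)" for x
 have fC: "C1b (%x. ff i x*\<tau> x) (2*(50*(1 + C)*\<epsilon>)*K)" for i by (rule C1b_mult[OF ff_C1b \<tau>C])
 note ct2 = ct C1bD(6)[OF fC] C1bD(7)[OF fC]
 have split: "av (%x. (c \<bullet> grad2 \<psi>d x)*\<tau> x) - g*av (%x. \<eta>d x*\<tau> x) + av (%x. N1 x*\<tau> x)
  + (av (%x. pd 1 \<psi>d x*(ff 1 x*\<tau> x)) + av (%x. pd 2 \<psi>d x*(ff 2 x*\<tau> x)))
  + \<kappa>*((av (%x. pd 1 (%x. cv2 x$1) x*\<tau> x) + av (%x. pd 2 (%x. cv2 x$2) x*\<tau> x))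
   - (av (%x. pd 1 (%x. cv1 x$1) x*\<tau> x) + av (%x. pd 2 (%x. cv1 x$2) x*\<tau> x))) = 0"
 proof -
  have "0 = av (%x. (c \<bullet> grad2 \<psi>d x)*\<tau> x - g*(\<eta>d x*\<tau> x) + N1 x*\<tau> x
  + (pd 1 \<psi>d x*(ff 1 x*\<tau> x) + pd 2 \<psi>d x*(ff 2 x*\<tau> x))
  + \<kappa>*((pd 1 (%x. cv2 x$1) x*\<tau> x + pd 2 (%x. cv2 x$2) x*\<tau> x)
   - (pd 1 (%x. cv1 x$1) x*\<tau> x + pd 2 (%x. cv1 x$2) x*\<tau> x)))" (is "_ = av ?f")
  proof -
   have "?f x = (c \<bullet> grad2 \<psi>d x - g*\<eta>d x + (N1 x + (ff 1 x*pd 1 \<psi>d x + ff 2 x*pd 2 \<psi>d x))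
  + \<kappa>*((pd 1 (%x. cv2 x$1) x + pd 2 (%x. cv2 x$2) x) - (pd 1 (%x. cv1 x$1) x + pd 2 (%x. cv1 x$2) x)))*\<tau> x" for x
    by (simp add: algebra_simps)
   then have "?f = (%x. 0)" unfolding bernoulli_diff by simp
   then show ?thesis by (simp add: av_const)
  qed
  also have "av ?f = av (%x. (c \<bullet> grad2 \<psi>d x)*\<tau> x) - g*av (%x. \<eta>d x*\<tau> x) + av (%x. N1 x*\<tau> x)
  + (av (%x. pd 1 \<psi>d x*(ff 1 x*\<tau> x)) + av (%x. pd 2 \<psi>d x*(ff 2 x*\<tau> x)))
  + \<kappa>*((av (%x. pd 1 (%x. cv2 x$1) x*\<tau> x) + av (%x. pd 2 (%x. cv2 x$2) x*\<tau> x))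
   - (av (%x. pd 1 (%x. cv1 x$1) x*\<tau> x) + av (%x. pd 2 (%x. cv1 x$2) x*\<tau> x)))"
   by (rule has_avD) (intro has_av_intros continuous_intros ct)
  finally show ?thesis by simp
 qed
 have parts: "av (%x. pd i \<psi>d x*(ff i x*\<tau> x)) = - av (%x. \<psi>d x*pd i (%x. ff i x*\<tau> x) x)"
  "av (%x. pd i (%x. cv2 x$i) x*\<tau> x) = - av (%x. cv2 x$i*pd i \<tau> x)"
  "av (%x. pd i (%x. cv1 x$i) x*\<tau> x) = - av (%x. cv1 x$i*pd i \<tau> x)" for i
  by (rule av_by_parts[OF pC fC], rule av_by_parts[OF cv_C1b(2) \<tau>C], rule av_by_parts[OF cv_C1b(1) \<tau>C])
 have lap: "av (%x. pd i \<eta>d x*pd i \<tau> x) = Re (\<Sum>k\<in>S. \<beta> k * cnj (of_real ((k$i)^2)*ad k))" for i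
  unfolding pd\<tau> av_trig[OF wser_has_derivative(2)[OF wd(1)] S] by (simp add: power2_eq_square algebra_simps)
 have Rsplit: "av R = - av (%x. N1 x*\<tau> x) + (av (%x. \<psi>d x*pd 1 (%x. ff 1 x*\<tau> x) x) + av (%x. \<psi>d x*pd 2 (%x. ff 2 x*\<tau> x) x))
  + \<kappa>*((av (%x. cv2 x$1*pd 1 \<tau> x) - av (%x. cv1 x$1*pd 1 \<tau> x) - av (%x. pd 1 \<eta>d x*pd 1 \<tau> x))
   + (av (%x. cv2 x$2*pd 2 \<tau> x) - av (%x. cv1 x$2*pd 2 \<tau> x) - av (%x. pd 2 \<eta>d x*pd 2 \<tau> x)))"
  unfolding R_def[abs_def] left_diff_distrib by (rule has_avD) (intro has_av_intros continuous_intros ct2)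
 have lin: "Re (\<Sum>k\<in>S. \<beta> k * cnj (Yr k)) = av (%x. (c \<bullet> grad2 \<psi>d x)*\<tau> x) - g*av (%x. \<eta>d x*\<tau> x) - \<kappa>*(av (%x. pd 1 \<eta>d x*pd 1 \<tau> x) + av (%x. pd 2 \<eta>d x*pd 2 \<tau> x))"
 proof -
  have e: "Re (\<beta> k * cnj (Yr k)) = Re (\<beta> k * cnj (\<i> * of_real (c \<bullet> k)*bd k)) - g*Re (\<beta> k * cnj (ad k)) - \<kappa>*(Re (\<beta> k * cnj (of_real ((k$1)^2)*ad k)) + Re (\<beta> k * cnj (of_real ((k$2)^2)*ad k)))" for k
   unfolding Yr_def power2_norm_eq_inner inner_2[of k k] by (simp add: power2_eq_square algebra_simps)
  show ?thesis unfolding lap unfolding \<tau>_def av_grad_trig[OF wd(2) S] av_trig[OF wd(1) S] Re_sum e by (simp only: sum_subtractf sum.distrib sum_distrib_left distrib_left)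
 qed
 have main: "Re (\<Sum>k\<in>S. \<beta> k * cnj (Yr k)) = av R" using split unfolding lin Rsplit parts by (simp add: algebra_simps)
 define X where "X x = norm (gd x) + \<bar>\<psi>d x\<bar>" for x
 define Y where "Y x = \<bar>\<tau> x\<bar> + \<bar>pd 1 \<tau> x\<bar> + \<bar>pd 2 \<tau> x\<bar>" for x
 have C0: "0 <= C" using order_trans[OF norm_ge_zero C] .
 have e0: "0 <= \<epsilon>" by (rule eps)
 have Rle: "\<bar>R x\<bar> <= (KD*\<epsilon>)*(X x*Y x)" for x
 proof -
  have 1: "\<bar>N1 x*\<tau> x\<bar> <= (4*(C + 1)^2*\<epsilon>)*(X x*Y x)"
  proof -
   have "\<bar>N1 x*\<tau> x\<bar> <= (4*(C + 1)^2*\<epsilon>*X x)*Y x" unfolding abs_mult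
    by (rule mult_mono[OF order_trans[OF N1_le mult_left_mono]]) (use e0 in \<open>auto simp: X_def Y_def\<close>)
   then show ?thesis by (simp add: mult.assoc)
  qed
  have 2: "\<bar>\<psi>d x*pd i (%x. ff i x*\<tau> x) x\<bar> <= (50*(1 + C)*\<epsilon>)*(X x*Y x)" if i: "i = 1 \<or> i = 2" for i
  proof -
   note b = C1bD(4)[OF ff_C1b, of i x] C1bD(8)[OF ff_C1b, of i i x]
   have "\<bar>ff i x*pd i \<tau> x + pd i (ff i) x*\<tau> x\<bar> <= (50*(1 + C)*\<epsilon>)*\<bar>pd i \<tau> x\<bar> + (50*(1 + C)*\<epsilon>)*\<bar>\<tau> x\<bar>"
    by (rule order_trans[OF abs_triangle_ineq]) (unfold abs_mult, intro add_mono mult_right_mono b; simp)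
   also have "\<dots> = (50*(1 + C)*\<epsilon>)*(\<bar>pd i \<tau> x\<bar> + \<bar>\<tau> x\<bar>)" by (simp only: distrib_left)
   also have "\<dots> <= (50*(1 + C)*\<epsilon>)*Y x" using i C0 e0 by (intro mult_left_mono) (auto simp: Y_def)
   finally have "\<bar>\<psi>d x*pd i (%x. ff i x*\<tau> x) x\<bar> <= X x*((50*(1 + C)*\<epsilon>)*Y x)"
    unfolding pd_mult[OF ff_C1b \<tau>C] abs_mult[of "\<psi>d x"] by (intro mult_mono) (auto simp: X_def)
   then show ?thesis by (simp only: mult.left_commute)
  qed
  have 3: "\<bar>(cv2 x$i - cv1 x$i - pd i \<eta>d x)*pd i \<tau> x\<bar> <= (6*\<epsilon>)*(X x*Y x)" if i: "i = 1 \<or> i = 2" for i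
  proof -
   have "\<bar>(cv2 x$i - cv1 x$i - pd i \<eta>d x)*pd i \<tau> x\<bar> <= (6*\<epsilon>*X x)*Y x" unfolding abs_mult
    by (rule mult_mono[OF order_trans[OF cv_le mult_left_mono]]) (use e0 i in \<open>auto simp: X_def Y_def\<close>)
   then show ?thesis by (simp add: mult.assoc)
  qed
  have 4: "\<bar>\<kappa>*((cv2 x$1 - cv1 x$1 - pd 1 \<eta>d x)*pd 1 \<tau> x + (cv2 x$2 - cv1 x$2 - pd 2 \<eta>d x)*pd 2 \<tau> x)\<bar> <= \<kappa>*(12*\<epsilon>*(X x*Y x))"
   unfolding abs_mult[of \<kappa>] abs_of_nonneg[OF kappa]
  proof (rule mult_left_mono[OF _ kappa])
   have "12*\<epsilon>*(X x*Y x) = (6*\<epsilon>)*(X x*Y x) + (6*\<epsilon>)*(X x*Y x)" by simp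
   then show "\<bar>(cv2 x$1 - cv1 x$1 - pd 1 \<eta>d x)*pd 1 \<tau> x + (cv2 x$2 - cv1 x$2 - pd 2 \<eta>d x)*pd 2 \<tau> x\<bar> <= 12*\<epsilon>*(X x*Y x)"
    using 3[OF disjI1[OF refl]] 3[OF disjI2[OF refl]] by linarith
  qed
  have gen: "\<bar>- a + (b1 + b2) + d\<bar> <= p + (q + q) + r" if "\<bar>a\<bar> <= p" "\<bar>b1\<bar> <= q" "\<bar>b2\<bar> <= q" "\<bar>d\<bar> <= r" for a b1 b2 d p q r :: real
   using that by linarith
  have "\<bar>R x\<bar> <= (4*(C + 1)^2*\<epsilon>)*(X x*Y x) + ((50*(1 + C)*\<epsilon>)*(X x*Y x) + (50*(1 + C)*\<epsilon>)*(X x*Y x)) + \<kappa>*(12*\<epsilon>*(X x*Y x))"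
   unfolding R_def by (rule gen[OF 1 2[of 1] 2[of 2] 4]) simp_all
  also have "\<dots> = (KD*\<epsilon>)*(X x*Y x)" unfolding KD_def
   by (simp only: distrib_right distrib_left mult.assoc mult.left_commute[of \<kappa>] mult.left_commute[of C])
  finally show ?thesis .
 qed
 have cR: "continuous_on UNIV R" unfolding R_def by (intro continuous_intros ct2)
 have cZ: "continuous_on UNIV (%x. \<theta>*(3*((\<tau> x)^2 + ((pd 1 \<tau> x)^2 + (pd 2 \<tau> x)^2))) + (KD*\<epsilon>)^2/(4*\<theta>)*(2*((norm (gd x))^2 + (\<psi>d x)^2)))"
  by (intro continuous_intros ct2)
 have "\<bar>av R\<bar> <= av (%x. \<theta>*(3*((\<tau> x)^2 + ((pd 1 \<tau> x)^2 + (pd 2 \<tau> x)^2))) + (KD*\<epsilon>)^2/(4*\<theta>)*(2*((norm (gd x))^2 + (\<psi>d x)^2)))"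
 proof (rule av_abs_le[OF cR cZ])
  fix x
  have "\<bar>R x\<bar> <= \<theta>*(Y x)^2 + (KD*\<epsilon>)^2/(4*\<theta>)*(X x)^2" by (rule order_trans[OF Rle young[OF \<theta>]])
  also have "\<dots> <= \<theta>*(3*((\<tau> x)^2 + ((pd 1 \<tau> x)^2 + (pd 2 \<tau> x)^2))) + (KD*\<epsilon>)^2/(4*\<theta>)*(2*((norm (gd x))^2 + \<bar>\<psi>d x\<bar>^2))"
  proof (intro add_mono mult_left_mono)
   have "(p + q + r)^2 <= 3*(p^2 + (q^2 + r^2))" for p q r :: real
    using sum_squares_bound[of p q] sum_squares_bound[of p r] sum_squares_bound[of q r] by (simp add: power2_eq_square algebra_simps)
   from this[of "\<bar>\<tau> x\<bar>" "\<bar>pd 1 \<tau> x\<bar>" "\<bar>pd 2 \<tau> x\<bar>"] show "(Y x)^2 <= 3*((\<tau> x)^2 + ((pd 1 \<tau> x)^2 + (pd 2 \<tau> x)^2))" unfolding Y_def by simp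
   show "(X x)^2 <= 2*((norm (gd x))^2 + \<bar>\<psi>d x\<bar>^2)" unfolding X_def by (rule sum_sq_le)
  qed (use \<theta> in simp_all)
  finally show "\<bar>R x\<bar> <= \<theta>*(3*((\<tau> x)^2 + ((pd 1 \<tau> x)^2 + (pd 2 \<tau> x)^2))) + (KD*\<epsilon>)^2/(4*\<theta>)*(2*((norm (gd x))^2 + (\<psi>d x)^2))" by simp
 qed
 also have "\<dots> = \<theta>*(3*(av (%x. (\<tau> x)^2) + (av (%x. (pd 1 \<tau> x)^2) + av (%x. (pd 2 \<tau> x)^2)))) + (KD*\<epsilon>)^2/(4*\<theta>)*(2*(av (%x. (norm (gd x))^2) + av (%x. (\<psi>d x)^2)))"
  by (rule has_avD) (intro has_av_intros continuous_intros ct2)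
 also have "\<dots> <= \<theta>*(3*(\<Sum>k\<in>S. (1 + (norm k)^2)*(cmod (\<beta> k))^2)) + (KD*\<epsilon>)^2/(4*\<theta>)*(2*(EE + EE/kap))"
 proof (intro add_mono mult_left_mono)
  show "av (%x. (\<psi>d x)^2) <= EE/kap" using EE_controls(2) kap_pos by (simp add: field_simps)
  have "av (%x. (\<tau> x)^2) + (av (%x. (pd 1 \<tau> x)^2) + av (%x. (pd 2 \<tau> x)^2)) <=
   (\<Sum>k\<in>S. (cmod (\<beta> k))^2) + ((\<Sum>k\<in>S. (cmod (\<i> * of_real (k$1)*\<beta> k))^2) + (\<Sum>k\<in>S. (cmod (\<i> * of_real (k$2)*\<beta> k))^2))"
   unfolding pd\<tau> \<tau>_def by (intro add_mono av_trig_square S)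
  also have "\<dots> = (\<Sum>k\<in>S. (1 + (norm k)^2)*(cmod (\<beta> k))^2)"
  proof -
   have "(norm k)^2 = (k$1)^2 + (k$2)^2" for k :: "real^2" unfolding power2_norm_eq_inner inner_2 by (simp add: power2_eq_square)
   then show ?thesis unfolding sum.distrib[symmetric] by (intro sum.cong refl) (simp add: norm_mult power_mult_distrib algebra_simps)
  qed
  finally show "av (%x. (\<tau> x)^2) + (av (%x. (pd 1 \<tau> x)^2) + av (%x. (pd 2 \<tau> x)^2)) <= (\<Sum>k\<in>S. (1 + (norm k)^2)*(cmod (\<beta> k))^2)" .
 qed (use \<theta> EE_controls in simp_all)
 also have "\<dots> = 3*\<theta>*(\<Sum>k\<in>S. (1 + (norm k)^2)*(cmod (\<beta> k))^2) + (KD*\<epsilon>)^2/(2*\<theta>)*((1 + 1/kap)*EE)"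
 proof -
  have "EE + EE/kap = (1 + 1/kap)*EE" by (simp add: distrib_right)
  moreover have "P/(4*\<theta>)*(2*Q) = P/(2*\<theta>)*Q" for P Q :: real using \<theta> by (simp add: field_simps)
  ultimately show ?thesis by simp
 qed
 finally show ?thesis unfolding main by linarith
qed

text \<open>The test coefficients are \<open>Yr k\<close>/|k|^2. The factor L = 1 + 1/kap^2 bounds
  (1 + |k|^2)/|k|^2 on nonzero modes, and \<theta> = 1/(6 L) makes the test term exactly half of the
  left side.\<close>

lemma dynamic_residual:
 assumes S: "finite S" "S \<subseteq> Lam" "0 \<notin> S"
 shows "(\<Sum>k\<in>S. (cmod (Yr k))^2/(norm k)^2) <= 6*(1 + 1/kap^2)*KD^2*(1 + 1/kap)*(\<epsilon>^2*EE)"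
proof -
 define A where "A = (\<Sum>k\<in>S. (cmod (Yr k))^2/(norm k)^2)"
 define L where "L = 1 + 1/kap^2"
 have L: "L > 0" unfolding L_def by (simp add: add_pos_nonneg)
 define \<beta> where "\<beta> k = Yr k/of_real ((norm k)^2)" for k
 have "Re (\<beta> k * cnj (Yr k)) = (cmod (Yr k))^2/(norm k)^2" for k
 proof -
  have "\<beta> k * cnj (Yr k) = of_real ((cmod (Yr k))^2/(norm k)^2)" unfolding \<beta>_def times_divide_eq_left mult_cnj_cmod by simp
  then show ?thesis by (simp only: Re_complex_of_real)
 qed
 then have 1: "Re (\<Sum>k\<in>S. \<beta> k * cnj (Yr k)) = A" unfolding A_def Re_sum by simp
 have 2: "(\<Sum>k\<in>S. (1 + (norm k)^2)*(cmod (\<beta> k))^2) <= L*A" unfolding A_def sum_distrib_left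
 proof (rule sum_mono)
  fix k assume k: "k \<in> S"
  then have k0: "norm k > 0" "norm k \<ge> kap" using S Lam_norm_ge[of k] by auto
  have "(1 + (norm k)^2)*(cmod (\<beta> k))^2 = (1 + 1/(norm k)^2)*((cmod (Yr k))^2/(norm k)^2)"
   using k0 by (simp add: \<beta>_def norm_divide norm_power field_simps)
  also have "\<dots> <= L*((cmod (Yr k))^2/(norm k)^2)"
   unfolding L_def using k0 kap_pos by (intro mult_right_mono add_left_mono divide_left_mono power_mono) auto
  finally show "(1 + (norm k)^2)*(cmod (\<beta> k))^2 <= L*((cmod (Yr k))^2/(norm k)^2)" .
 qed
 have "A <= 3*(1/(6*L))*(\<Sum>k\<in>S. (1 + (norm k)^2)*(cmod (\<beta> k))^2) + (KD*\<epsilon>)^2/(2*(1/(6*L)))*((1 + 1/kap)*EE)"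
  using dynamic_test[OF S(1,2), of "1/(6*L)" \<beta>] L unfolding 1 by simp
 also have "\<dots> <= 3*(1/(6*L))*(L*A) + (KD*\<epsilon>)^2/(2*(1/(6*L)))*((1 + 1/kap)*EE)"
  using L by (intro add_right_mono mult_left_mono 2) simp
 also have "\<dots> = A/2 + 3*L*KD^2*(1 + 1/kap)*(\<epsilon>^2*EE)" using L by (simp add: power_mult_distrib)
 finally have "A <= 2*(3*L*KD^2*(1 + 1/kap)*(\<epsilon>^2*EE))" by linarith
 moreover have "6*L*KD^2*(1 + 1/kap)*(\<epsilon>^2*EE) = 2*(3*L*KD^2*(1 + 1/kap)*(\<epsilon>^2*EE))" by simp
 ultimately show ?thesis unfolding A_def[symmetric] L_def[symmetric] by linarith
qed

end

section \<open>The linearised equations mode by mode\<close>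

context lattice2
begin

lemma finite_Lam_ball: "finite {k \<in> Lam. norm k <= R}"
proof (rule finite_subset)
 let ?N = "%v::real^2. {m::int. \<bar>of_int m\<bar> <= R*norm v}"
 have f: "finite (?N v)" for v
 proof (rule finite_subset)
  show "?N v \<subseteq> {- \<lceil>R*norm v\<rceil> .. \<lceil>R*norm v\<rceil>}"
  proof
   fix m assume "m \<in> ?N v"
   then have "\<bar>m\<bar> <= \<lceil>R*norm v\<rceil>" by (simp add: le_ceiling_iff)
   then show "m \<in> {- \<lceil>R*norm v\<rceil> .. \<lceil>R*norm v\<rceil>}" by auto
  qed
 qed simp
 show "finite ((%(m,n). of_int m *\<^sub>R w1 + of_int n *\<^sub>R w2) ` (?N v1 \<times> ?N v2))" using f by simp
 show "{k \<in> Lam. norm k <= R} \<subseteq> (%(m,n). of_int m *\<^sub>R w1 + of_int n *\<^sub>R w2) ` (?N v1 \<times> ?N v2)"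
 proof
  fix k assume "k \<in> {k \<in> Lam. norm k <= R}"
  then have k: "k \<in> Lam" "norm k <= R" by auto
  obtain m n :: int where mn: "k \<bullet> v1 = of_int m" "k \<bullet> v2 = of_int n" using k(1) unfolding dual_lat_iff by (auto elim!: Ints_cases)
  have "\<bar>k \<bullet> v\<bar> <= R*norm v" for v using order_trans[OF Cauchy_Schwarz_ineq2 mult_right_mono[OF k(2)]] by simp
  from this[of v1] this[of v2] have "(m, n) \<in> ?N v1 \<times> ?N v2" unfolding mn by simp
  moreover have "k = (%(m,n). of_int m *\<^sub>R w1 + of_int n *\<^sub>R w2) (m, n)" using w_expand[of k] unfolding mn by simp
  ultimately show "k \<in> (%(m,n). of_int m *\<^sub>R w1 + of_int n *\<^sub>R w2) ` (?N v1 \<times> ?N v2)" by blast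
 qed
qed

lemma tfac_bounds:
 assumes "h > 0"
 obtains t0 where "t0 > 0" "!!k. k \<in> Lam ==> k ~= 0 ==> t0 <= tfac h k"
proof (cases "h = \<infinity>")
 case True
 then show ?thesis using that[of 1] by (simp add: tfac_def)
next
 case False
 then have h: "real_of_ereal h > 0" using assms by (simp add: zero_less_real_of_ereal)
 show ?thesis
 proof (rule that[of "tanh (real_of_ereal h*kap)"])
  show "0 < tanh (real_of_ereal h*kap)" using h kap_pos by simp
  fix k assume "k \<in> Lam" "k ~= 0"
  then have "real_of_ereal h*kap <= real_of_ereal h*norm k" using h Lam_norm_ge by (intro mult_left_mono) auto
  then show "tanh (real_of_ereal h*kap) <= tfac h k" using False by (simp add: tfac_def)
 qed
qed

text \<open>\<open>Xs\<close> and \<open>Ys\<close> are the residuals \<open>Xr\<close> and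
  \<open>Yr\<close> as linear forms in arbitrary amplitudes and speed. Their 2x2 determinant
  vanishes exactly when the squared dispersion relation holds.\<close>

definition Xs :: "ereal => real^2 => real^2 => complex => complex => complex" where
 "Xs h c k a b = \<i> * of_real (c \<bullet> k)*a + of_real (norm k*tfac h k)*b"
definition Ys :: "real => real => real^2 => real^2 => complex => complex => complex" where
 "Ys g \<kappa> c k a b = \<i> * of_real (c \<bullet> k)*b - of_real (g + \<kappa>*(norm k)^2)*a"

lemma sq_add_le: "z <= x + y ==> 0 <= z ==> z^2 <= 2*(x^2 + y^2)" for x y z :: real
 using power_mono[of z "x + y" 2] sum_sq_le[of x y] by linarith

lemma potential_le:
 assumes t: "t0 > 0" "t0 <= tfac h k" and k: "k \<in> Lam" "k ~= 0"
 shows "norm k*t0 * cmod b <= cmod (Xs h c k a b) + norm c*norm k * cmod a"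
  "norm k*(cmod b)^2 <= 2/t0^2*(1 + (norm c)^2/kap)*((cmod (Xs h c k a b))^2/norm k + (norm k)^2*(cmod a)^2)"
proof -
 let ?r = "norm k" and ?X = "cmod (Xs h c k a b)"
 have r: "?r > 0" "kap <= ?r" using k Lam_norm_ge by auto
 have ck: "\<bar>c \<bullet> k\<bar> <= norm c*?r" by (rule Cauchy_Schwarz_ineq2)
 have "of_real (?r*tfac h k)*b = Xs h c k a b - \<i> * of_real (c \<bullet> k)*a" by (simp add: Xs_def)
 then have "cmod (of_real (?r*tfac h k)*b) <= ?X + cmod (\<i> * of_real (c \<bullet> k)*a)" by (metis norm_triangle_ineq4)
 then have "?r*tfac h k * cmod b <= ?X + \<bar>c \<bullet> k\<bar> * cmod a" using t r by (simp add: norm_mult abs_mult)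
 moreover have "\<bar>c \<bullet> k\<bar> * cmod a <= norm c*?r * cmod a" by (intro mult_right_mono ck) simp
 moreover have "?r*t0 * cmod b <= ?r*tfac h k * cmod b" using t r by (intro mult_right_mono mult_left_mono) auto
 ultimately show 1: "?r*t0 * cmod b <= ?X + norm c*?r * cmod a" by linarith
 have "(?r*t0 * cmod b)^2 <= 2*(?X^2 + (norm c*?r * cmod a)^2)" using t by (intro sq_add_le[OF 1]) simp
 then have "?r*(cmod b)^2 <= 2/t0^2*(?X^2/?r + (norm c)^2*?r*(cmod a)^2)"
  using t r by (simp add: power_mult_distrib field_simps power2_eq_square)
 also have "\<dots> <= 2/t0^2*((1 + (norm c)^2/kap)*(?X^2/?r + ?r^2*(cmod a)^2))"
 proof (rule mult_left_mono)
  have "?r*kap <= ?r*?r" using r by (intro mult_left_mono) auto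
  then have "?r <= ?r^2/kap" using kap_pos by (simp add: field_simps power2_eq_square)
  then have "((norm c)^2*(cmod a)^2)*?r <= ((norm c)^2*(cmod a)^2)*(?r^2/kap)" by (intro mult_left_mono) auto
  then have "?X^2/?r + (norm c)^2*?r*(cmod a)^2 <= ?X^2/?r + (norm c)^2/kap*(?r^2*(cmod a)^2)" by (simp add: mult_ac)
  also have "\<dots> <= (1 + (norm c)^2/kap)*(?X^2/?r + ?r^2*(cmod a)^2)"
  proof -
   have *: "p + m*q <= (1 + m)*(p + q)" if "0 <= p" "0 <= q" "0 <= m" for p q m :: real using that mult_nonneg_nonneg[of m p] by (simp add: algebra_simps)
   show ?thesis by (rule *) (use r kap_pos in simp_all)
  qed
  finally show "?X^2/?r + (norm c)^2*?r*(cmod a)^2 <= (1 + (norm c)^2/kap)*(?X^2/?r + ?r^2*(cmod a)^2)" .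
 qed simp
 finally show "?r*(cmod b)^2 <= 2/t0^2*(1 + (norm c)^2/kap)*(?X^2/?r + ?r^2*(cmod a)^2)" by (simp only: mult.assoc)
qed

text \<open>Surface tension wins: once b is eliminated through \<open>Xs\<close>, the coupling costs
  (|c|^2/t0) |k|, and beyond the threshold this is at most half of \<kappa> |k|^2.\<close>

lemma high_frequency:
 assumes t: "t0 > 0" "t0 <= tfac h k" and k: "k \<in> Lam" "k ~= 0" and g: "g > 0" "\<kappa> > 0"
  and large: "2*(norm c)^2/(t0*\<kappa>) <= norm k"
 shows "(norm k)^2*(cmod a)^2 <= 8/\<kappa>^2*(1 + (norm c)^2/(t0^2*kap))*((cmod (Xs h c k a b))^2/norm k + (cmod (Ys g \<kappa> c k a b))^2/(norm k)^2)"
proof -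
 let ?r = "norm k" and ?X = "cmod (Xs h c k a b)" and ?Y = "cmod (Ys g \<kappa> c k a b)"
 have r: "?r > 0" "kap <= ?r" using k Lam_norm_ge by auto
 have ck: "\<bar>c \<bullet> k\<bar> <= norm c*?r" by (rule Cauchy_Schwarz_ineq2)
 have "of_real (g + \<kappa>*?r^2)*a = \<i> * of_real (c \<bullet> k)*b - Ys g \<kappa> c k a b" by (simp add: Ys_def)
 then have "cmod (of_real (g + \<kappa>*?r^2)*a) <= cmod (\<i> * of_real (c \<bullet> k)*b) + ?Y" by (metis norm_triangle_ineq4)
 moreover have "\<bar>g + \<kappa>*?r^2\<bar> = g + \<kappa>*?r^2" using g by (intro abs_of_nonneg add_nonneg_nonneg) auto
 ultimately have "(g + \<kappa>*?r^2) * cmod a <= \<bar>c \<bullet> k\<bar> * cmod b + ?Y" by (simp only: norm_mult norm_of_real norm_ii mult_1)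
 moreover have "\<bar>c \<bullet> k\<bar> * cmod b <= norm c*?r * cmod b" by (intro mult_right_mono ck) simp
 moreover have "\<kappa>*?r^2 * cmod a <= (g + \<kappa>*?r^2) * cmod a" using g by (intro mult_right_mono) auto
 ultimately have 1: "\<kappa>*?r^2 * cmod a <= ?Y + norm c*?r * cmod b" by linarith
 have "norm c/t0*(?r*t0 * cmod b) <= norm c/t0*(?X + norm c*?r * cmod a)" using t by (intro mult_left_mono potential_le(1)[OF t k]) simp
 then have 2: "norm c*?r * cmod b <= norm c/t0*?X + (norm c)^2/t0*(?r * cmod a)" using t by (simp add: power2_eq_square algebra_simps)
 have "(norm c)^2/t0 <= \<kappa>*?r/2" using large t g by (simp add: field_simps)
 then have "(norm c)^2/t0*(?r * cmod a) <= \<kappa>*?r/2*(?r * cmod a)" by (intro mult_right_mono) auto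
 then have 3: "(norm c)^2/t0*(?r * cmod a) <= \<kappa>*?r^2 * cmod a/2" by (simp add: power2_eq_square mult_ac)
 have 4: "\<kappa>*?r^2 * cmod a/2 <= ?Y + norm c/t0*?X" using 1 2 3 by linarith
 have "(\<kappa>*?r^2 * cmod a/2)^2 <= 2*(?Y^2 + (norm c/t0*?X)^2)" using g by (intro sq_add_le[OF 4]) simp
 then have "?r^2*(cmod a)^2 <= 8/\<kappa>^2*(?Y^2/?r^2 + (norm c)^2/t0^2*(?X^2/?r^2))"
  using t g r by (simp add: power_mult_distrib power_divide field_simps power2_eq_square)
 also have "\<dots> <= 8/\<kappa>^2*((1 + (norm c)^2/(t0^2*kap))*(?X^2/?r + ?Y^2/?r^2))"
 proof (rule mult_left_mono)
  have "?r*kap <= ?r^2" using r unfolding power2_eq_square by (intro mult_left_mono) auto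
  then have "?X^2/?r^2 <= ?X^2/(?r*kap)" using r kap_pos by (intro divide_left_mono) auto
  then have "(norm c)^2/t0^2*(?X^2/?r^2) <= (norm c)^2/t0^2*(?X^2/(?r*kap))" by (intro mult_left_mono) auto
  then have "?Y^2/?r^2 + (norm c)^2/t0^2*(?X^2/?r^2) <= ?Y^2/?r^2 + (norm c)^2/(t0^2*kap)*(?X^2/?r)" by (simp add: mult_ac)
  also have "\<dots> <= (1 + (norm c)^2/(t0^2*kap))*(?X^2/?r + ?Y^2/?r^2)"
  proof -
   have *: "q + m*p <= (1 + m)*(p + q)" if "0 <= p" "0 <= q" "0 <= m" for p q m :: real using that mult_nonneg_nonneg[of m q] by (simp add: algebra_simps)
   show ?thesis by (rule *) (use r kap_pos in simp_all)
  qed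
  finally show "?Y^2/?r^2 + (norm c)^2/t0^2*(?X^2/?r^2) <= (1 + (norm c)^2/(t0^2*kap))*(?X^2/?r + ?Y^2/?r^2)" .
 qed simp
 finally show ?thesis by (simp only: mult.assoc)
qed

text \<open>The dispersion relation is squared, so that with k also -k belongs to the set, as the
  spectrum of real functions requires.\<close>

definition res_set :: "real => real => ereal => real^2 => (real^2) set" where
 "res_set g \<kappa> h c = {k \<in> Lam. k ~= 0 \<and> (g + \<kappa>*(norm k)^2)*norm k*tfac h k = (c \<bullet> k)^2}"

text \<open>Inverts the 2x2 system, whose determinant is nonzero off resonance. The constant depends
  on k, which is harmless since only finitely many k are treated this way.\<close>

lemma nonresonant_mode:
 assumes k: "k \<in> Lam" "k ~= 0" "k \<notin> res_set g \<kappa> h c"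
 shows "\<exists>m\<ge>0. \<forall>a b. (norm k)^2*(cmod a)^2 + norm k*(cmod b)^2 <= m*((cmod (Xs h c k a b))^2/norm k + (cmod (Ys g \<kappa> c k a b))^2/(norm k)^2)"
proof -
 let ?r = "norm k" let ?A = "g + \<kappa>*?r^2" let ?B = "?r*tfac h k" let ?D = "?A*?B - (c \<bullet> k)^2"
 have r: "?r > 0" using k by simp
 have D: "?D ~= 0" using k unfolding res_set_def by (simp add: mult.assoc)
 define m where "m = (\<bar>?A\<bar> + \<bar>?B\<bar> + \<bar>c \<bullet> k\<bar>)/\<bar>?D\<bar>"
 have key: "x^2 <= 2*m^2*(X^2 + Y^2)" if "\<bar>?D\<bar>*x <= p*X + q*Y" "p <= \<bar>?A\<bar> + \<bar>?B\<bar> + \<bar>c \<bullet> k\<bar>" "q <= \<bar>?A\<bar> + \<bar>?B\<bar> + \<bar>c \<bullet> k\<bar>" "0 <= X" "0 <= Y" "0 <= x" for x X Y p q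
 proof -
  have "\<bar>?D\<bar>*x <= (\<bar>?A\<bar> + \<bar>?B\<bar> + \<bar>c \<bullet> k\<bar>)*X + (\<bar>?A\<bar> + \<bar>?B\<bar> + \<bar>c \<bullet> k\<bar>)*Y"
   using that by (intro order_trans[OF that(1)] add_mono mult_right_mono) auto
  moreover have "x <= N/d*X + N/d*Y" if "d*x <= N*X + N*Y" "d > 0" for d N :: real using that by (simp add: field_simps)
  moreover have "\<bar>?D\<bar> > 0" using D by simp
  ultimately have "x <= m*X + m*Y" unfolding m_def by blast
  then have "x^2 <= 2*((m*X)^2 + (m*Y)^2)" by (rule sq_add_le) (rule that)
  then show ?thesis by (simp add: power_mult_distrib algebra_simps)
 qed
 show ?thesis
 proof (intro exI[of _ "2*m^2*(?r^2 + ?r)^2"] conjI allI)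
  fix a b
  let ?X = "Xs h c k a b" and ?Y = "Ys g \<kappa> c k a b"
  have "of_real ?D*b = of_real ?A*?X + \<i> * of_real (c \<bullet> k)*?Y" "of_real ?D*a = \<i> * of_real (c \<bullet> k)*?X - of_real ?B*?Y"
   unfolding Xs_def Ys_def by (simp_all add: algebra_simps power2_eq_square)
  then have "cmod (of_real ?D*b) <= \<bar>?A\<bar> * cmod ?X + \<bar>c \<bullet> k\<bar> * cmod ?Y" "cmod (of_real ?D*a) <= \<bar>c \<bullet> k\<bar> * cmod ?X + \<bar>?B\<bar> * cmod ?Y"
   using norm_triangle_ineq[of "of_real ?A*?X" "\<i> * of_real (c \<bullet> k)*?Y"] norm_triangle_ineq4[of "\<i> * of_real (c \<bullet> k)*?X" "of_real ?B*?Y"]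
   by (simp_all only: norm_mult norm_of_real norm_ii mult_1)
  note nab = this[unfolded norm_mult norm_of_real]
  have b: "(cmod b)^2 <= 2*m^2*((cmod ?X)^2 + (cmod ?Y)^2)" by (rule key[OF nab(1)]) simp_all
  have a: "(cmod a)^2 <= 2*m^2*((cmod ?X)^2 + (cmod ?Y)^2)" by (rule key[OF nab(2)]) simp_all
  have s: "(cmod ?X)^2 + (cmod ?Y)^2 <= (?r^2 + ?r)*((cmod ?X)^2/?r + (cmod ?Y)^2/?r^2)"
  proof -
   have "(?r^2 + ?r)*((cmod ?X)^2/?r + (cmod ?Y)^2/?r^2) = (cmod ?X)^2 + (cmod ?Y)^2 + (?r*(cmod ?X)^2 + (cmod ?Y)^2/?r)"
    using r by (simp add: field_simps power2_eq_square)
   moreover have "0 <= ?r*(cmod ?X)^2 + (cmod ?Y)^2/?r" using r by simp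
   ultimately show ?thesis by linarith
  qed
  have "?r^2*(cmod a)^2 + ?r*(cmod b)^2 <= ?r^2*(2*m^2*((cmod ?X)^2 + (cmod ?Y)^2)) + ?r*(2*m^2*((cmod ?X)^2 + (cmod ?Y)^2))"
   using r by (intro add_mono mult_left_mono a b) auto
  also have "\<dots> = (2*m^2*(?r^2 + ?r))*((cmod ?X)^2 + (cmod ?Y)^2)" by (simp add: algebra_simps)
  also have "\<dots> <= (2*m^2*(?r^2 + ?r))*((?r^2 + ?r)*((cmod ?X)^2/?r + (cmod ?Y)^2/?r^2))"
   using r by (intro mult_left_mono s) auto
  finally show "?r^2*(cmod a)^2 + ?r*(cmod b)^2 <= 2*m^2*(?r^2 + ?r)^2*((cmod ?X)^2/?r + (cmod ?Y)^2/?r^2)"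
   by (simp only: power2_eq_square[of "?r^2 + ?r"] mult.assoc)
 qed simp
qed

text \<open>Uniformity in k: beyond a radius the high-frequency bound applies, and only finitely
  many nonresonant modes lie inside it. The second estimate recovers the potential from the
  elevation and is the one available on resonant modes.\<close>

lemma linear_estimates:
 assumes h: "h > 0" and g: "g > 0" "\<kappa> > 0"
 shows "finite (res_set g \<kappa> h c)"
  and "\<exists>L>0. \<forall>k\<in>Lam. k ~= 0 --> (\<forall>a b.
   (k \<notin> res_set g \<kappa> h c --> (norm k)^2*(cmod a)^2 + norm k*(cmod b)^2 <= L*((cmod (Xs h c k a b))^2/norm k + (cmod (Ys g \<kappa> c k a b))^2/(norm k)^2)) \<and>
   norm k*(cmod b)^2 <= L*((cmod (Xs h c k a b))^2/norm k + (norm k)^2*(cmod a)^2))"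
proof -
 obtain t0 where t: "t0 > 0" "!!k. k \<in> Lam ==> k ~= 0 ==> t0 <= tfac h k" using tfac_bounds[OF h] by blast
 define R where "R = 2*(norm c)^2/(t0*\<kappa>)"
 define L2 where "L2 = 2/t0^2*(1 + (norm c)^2/kap)"
 define L3 where "L3 = 8/\<kappa>^2*(1 + (norm c)^2/(t0^2*kap))"
 have L0: "0 < L2" "0 < L3" unfolding L2_def L3_def using t g kap_pos by (intro mult_pos_pos divide_pos_pos add_pos_nonneg; simp)+
 let ?F = "{k \<in> Lam. norm k <= R}"
 have hf: "(norm k)^2*(cmod a)^2 <= L3*((cmod (Xs h c k a b))^2/norm k + (cmod (Ys g \<kappa> c k a b))^2/(norm k)^2)"
  if "k \<in> Lam" "k ~= 0" "R <= norm k" for k a b unfolding L3_def by (rule high_frequency[OF t(1) t(2) _ _ g]) (use that R_def in auto)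
 show "finite (res_set g \<kappa> h c)"
 proof (rule finite_subset[OF _ finite_Lam_ball[of R]], rule subsetI, rule ccontr)
  fix k assume k: "k \<in> res_set g \<kappa> h c" "k \<notin> ?F"
  then have k': "k \<in> Lam" "k ~= 0" "R <= norm k" and e: "(g + \<kappa>*(norm k)^2)*norm k*tfac h k = (c \<bullet> k)^2" unfolding res_set_def by auto
  \<comment> \<open>A kernel vector of the linear system at a resonant k; beyond the radius it would
    contradict the high-frequency bound.\<close>
  let ?a = "of_real (norm k*tfac h k) :: complex" and ?b = "- \<i> * of_real (c \<bullet> k)"
  have X: "Xs h c k ?a ?b = 0" unfolding Xs_def by simp
  have "Ys g \<kappa> c k ?a ?b = of_real ((c \<bullet> k)^2 - (g + \<kappa>*(norm k)^2)*norm k*tfac h k)" unfolding Ys_def by (simp add: power2_eq_square algebra_simps)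
  then have Y: "Ys g \<kappa> c k ?a ?b = 0" unfolding e by simp
  have "(norm k)^2*(cmod ?a)^2 <= 0" using hf[OF k', of ?a ?b] unfolding X Y by simp
  moreover have "cmod ?a > 0" using k'(2) t(1) t(2)[OF k'(1,2)] by simp
  ultimately show False using k'(2) by (simp add: mult_le_0_iff)
 qed
 have "\<forall>k. \<exists>m. k \<in> ?F - res_set g \<kappa> h c - {0} --> m \<ge> 0 \<and> (\<forall>a b. (norm k)^2*(cmod a)^2 + norm k*(cmod b)^2 <= m*((cmod (Xs h c k a b))^2/norm k + (cmod (Ys g \<kappa> c k a b))^2/(norm k)^2))"
  using nonresonant_mode[of _ g \<kappa> h c] by blast
 from choice[OF this] obtain m where mm: "\<forall>k. k \<in> ?F - res_set g \<kappa> h c - {0} --> m k \<ge> 0 \<and> (\<forall>a b. (norm k)^2*(cmod a)^2 + norm k*(cmod b)^2 <= m k*((cmod (Xs h c k a b))^2/norm k + (cmod (Ys g \<kappa> c k a b))^2/(norm k)^2))" ..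
 have m: "!!k. k \<in> ?F - res_set g \<kappa> h c - {0} ==> m k \<ge> 0" "!!k a b. k \<in> ?F - res_set g \<kappa> h c - {0} ==> (norm k)^2*(cmod a)^2 + norm k*(cmod b)^2 <= m k*((cmod (Xs h c k a b))^2/norm k + (cmod (Ys g \<kappa> c k a b))^2/(norm k)^2)"
  using mm by blast+
 let ?G = "?F - res_set g \<kappa> h c - {0}"
 have fG: "finite ?G" using finite_Lam_ball by simp
 define L where "L = L2 + (L3 + L2*(1 + L3)) + sum m ?G"
 have sm: "0 <= sum m ?G" by (rule sum_nonneg) (rule m(1))
 have sk: "m k <= sum m ?G" if "k \<in> ?G" for k using that m(1) fG by (intro member_le_sum) auto
 have LL: "0 < L" "L2 <= L" "L3 + L2*(1 + L3) <= L" unfolding L_def using L0 sm mult_pos_pos[OF L0(1), of "1 + L3"] by linarith+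
 have LG: "m k <= L" if "k \<in> ?G" for k unfolding L_def using sk[OF that] L0 mult_pos_pos[OF L0(1), of "1 + L3"] by linarith
 show "\<exists>L>0. \<forall>k\<in>Lam. k ~= 0 --> (\<forall>a b.
   (k \<notin> res_set g \<kappa> h c --> (norm k)^2*(cmod a)^2 + norm k*(cmod b)^2 <= L*((cmod (Xs h c k a b))^2/norm k + (cmod (Ys g \<kappa> c k a b))^2/(norm k)^2)) \<and>
   norm k*(cmod b)^2 <= L*((cmod (Xs h c k a b))^2/norm k + (norm k)^2*(cmod a)^2))"
 proof (intro exI[of _ L] conjI ballI allI impI)
  fix k a b assume k: "k \<in> Lam" "k ~= 0"
  let ?U = "(cmod (Xs h c k a b))^2/norm k" and ?W = "(cmod (Ys g \<kappa> c k a b))^2/(norm k)^2" and ?a = "(norm k)^2*(cmod a)^2"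
  have U: "0 <= ?U" "0 <= ?W" by simp_all
  have p: "norm k*(cmod b)^2 <= L2*(?U + ?a)" unfolding L2_def by (rule potential_le(2)[OF t(1) t(2)[OF k] k])
  also have "\<dots> <= L*(?U + ?a)" using U by (intro mult_right_mono LL) simp
  finally show "norm k*(cmod b)^2 <= L*(?U + ?a)" .
  assume nr: "k \<notin> res_set g \<kappa> h c"
  show "?a + norm k*(cmod b)^2 <= L*(?U + ?W)"
  proof (cases "norm k <= R")
   case True
   then have kG: "k \<in> ?G" using k nr by auto
   from m(2)[OF kG] show ?thesis by (rule order_trans) (use U LG[OF kG] in \<open>intro mult_right_mono; simp\<close>)
  next
   case False
   have a: "?a <= L3*(?U + ?W)" using hf[OF k] False by simp
   have "?a + norm k*(cmod b)^2 <= L3*(?U + ?W) + L2*((?U + ?W) + L3*(?U + ?W))"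
   proof (intro add_mono a order_trans[OF p] mult_left_mono)
    show "?U <= ?U + ?W" using U by simp
   qed (use L0 in simp)
   also have "\<dots> = (L3 + L2*(1 + L3))*(?U + ?W)" by (simp only: distrib_left distrib_right mult.assoc mult_1_left mult_1_right)
   also have "\<dots> <= L*(?U + ?W)" using U by (intro mult_right_mono LL) simp
   finally show ?thesis .
  qed
 qed (rule LL)
qed

end

section \<open>Control of the difference by its resonant modes\<close>

lemma cmod_sq_add_le: "(cmod (x + y))^2 <= 2*((cmod x)^2 + (cmod y)^2)"
 by (rule order_trans[OF power_mono[OF norm_triangle_ineq] sum_sq_le]) simp

context two_stokes
begin

definition kin_const :: "real => real" where
 "kin_const m0 = 4*Kl^2*(2*(C*(1 + 1/kap)) + 80*Kl^2*m0^2*(1 + 1/kap^2)) + 4*Kl^2*m0^2*(1 + 1/kap^2)"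
text \<open>Twice the kinematic constant 8 and twice the dynamic constant 6, from |x+y|^2 <=
  2(|x|^2+|y|^2); 4/kap pays for replacing c by \<open>cs\<close> in both equations.\<close>

definition res_const :: "real => real" where
 "res_const m0 = 16*kin_const m0 + 12*(1 + 1/kap^2)*KD^2*(1 + 1/kap) + 4/kap"

lemma ew_sum_le: "finite S ==> S \<subseteq> Lam ==> sum ew S <= EE"
 unfolding EE_def by (intro finite_sum_le_infsum ew_summable) (auto intro: ew_nonneg)

text \<open>Changing the speed perturbs each residual by at most \<epsilon> |k| times the amplitude;
  after division by the weights this is \<epsilon>^2 times the energy of the mode, since |k| is at
  least \<open>kap\<close>.\<close>

lemma residual_sum:
 assumes S: "finite S" "S \<subseteq> Lam" "0 \<notin> S" and cs: "norm (c - cs) <= \<epsilon>" and M: "M <= m0*\<epsilon>" "0 <= m0"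
 shows "(\<Sum>k\<in>S. (cmod (Xs h cs k (ad k) (bd k)))^2/norm k + (cmod (Ys g \<kappa> cs k (ad k) (bd k)))^2/(norm k)^2) <= res_const m0*(\<epsilon>^2*EE)"
proof -
 have kin: "(\<Sum>k\<in>S. (cmod (Xr k))^2/norm k) <= 8*(kin_const m0*(\<epsilon>^2*EE))"
  using kinematic_residual[OF S] QQ_le[OF C M] eps_le unfolding kin_const_def by linarith
 have dyn: "(\<Sum>k\<in>S. (cmod (Yr k))^2/(norm k)^2) <= 6*(1 + 1/kap^2)*KD^2*(1 + 1/kap)*(\<epsilon>^2*EE)"
  by (rule dynamic_residual[OF S])
 have "(\<Sum>k\<in>S. (cmod (Xs h cs k (ad k) (bd k)))^2/norm k + (cmod (Ys g \<kappa> cs k (ad k) (bd k)))^2/(norm k)^2)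
  <= (\<Sum>k\<in>S. 2*((cmod (Xr k))^2/norm k) + 2*((cmod (Yr k))^2/(norm k)^2) + 4/kap*\<epsilon>^2*ew k)"
 proof (rule sum_mono)
  fix k assume "k \<in> S"
  then have r: "norm k > 0" "kap <= norm k" using S Lam_norm_ge by auto
  let ?r = "norm k" and ?\<delta> = "(cs - c) \<bullet> k"
  have "\<bar>?\<delta>\<bar> <= norm (cs - c)*?r" by (rule Cauchy_Schwarz_ineq2)
  also have "\<dots> <= \<epsilon>*?r" using cs by (intro mult_right_mono) (auto simp: norm_minus_commute)
  finally have d2: "?\<delta>^2 <= \<epsilon>^2*?r^2" using power_mono[of "\<bar>?\<delta>\<bar>" "\<epsilon>*?r" 2] by (simp add: power_mult_distrib)
  have "Xs h cs k (ad k) (bd k) = Xr k + \<i> * of_real ?\<delta>*ad k" unfolding Xs_def Xr_def by (simp add: inner_diff_left algebra_simps)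
  then have "(cmod (Xs h cs k (ad k) (bd k)))^2 <= 2*((cmod (Xr k))^2 + ?\<delta>^2*(cmod (ad k))^2)"
   using cmod_sq_add_le[of "Xr k" "\<i> * of_real ?\<delta>*ad k"] by (simp add: norm_mult power_mult_distrib)
  also have "\<dots> <= 2*((cmod (Xr k))^2 + (\<epsilon>^2*?r^2)*(cmod (ad k))^2)" by (intro mult_left_mono add_left_mono mult_right_mono d2) auto
  finally have "(cmod (Xs h cs k (ad k) (bd k)))^2/?r <= 2*((cmod (Xr k))^2 + (\<epsilon>^2*?r^2)*(cmod (ad k))^2)/?r" using r by (intro divide_right_mono) auto
  also have "\<dots> = 2*((cmod (Xr k))^2/?r) + 2*\<epsilon>^2*(?r^2*(cmod (ad k))^2/?r)" using r by (simp add: add_divide_distrib algebra_simps)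
  also have "\<dots> <= 2*((cmod (Xr k))^2/?r) + 2*\<epsilon>^2*(ew k/kap)"
   using r kap_pos by (intro add_left_mono mult_left_mono frac_le) (auto simp: ew_def)
  finally have X: "(cmod (Xs h cs k (ad k) (bd k)))^2/?r <= 2*((cmod (Xr k))^2/?r) + 2*\<epsilon>^2*(ew k/kap)" .
  have "Ys g \<kappa> cs k (ad k) (bd k) = Yr k + \<i> * of_real ?\<delta>*bd k" unfolding Ys_def Yr_def by (simp add: inner_diff_left algebra_simps)
  then have "(cmod (Ys g \<kappa> cs k (ad k) (bd k)))^2 <= 2*((cmod (Yr k))^2 + ?\<delta>^2*(cmod (bd k))^2)"
   using cmod_sq_add_le[of "Yr k" "\<i> * of_real ?\<delta>*bd k"] by (simp add: norm_mult power_mult_distrib)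
  also have "\<dots> <= 2*((cmod (Yr k))^2 + (\<epsilon>^2*?r^2)*(cmod (bd k))^2)" by (intro mult_left_mono add_left_mono mult_right_mono d2) auto
  finally have "(cmod (Ys g \<kappa> cs k (ad k) (bd k)))^2/?r^2 <= 2*((cmod (Yr k))^2 + (\<epsilon>^2*?r^2)*(cmod (bd k))^2)/?r^2" using r by (intro divide_right_mono) auto
  also have "\<dots> = 2*((cmod (Yr k))^2/?r^2) + 2*\<epsilon>^2*(?r*(cmod (bd k))^2/?r)" using r by (simp add: add_divide_distrib algebra_simps)
  also have "\<dots> <= 2*((cmod (Yr k))^2/?r^2) + 2*\<epsilon>^2*(ew k/kap)"
   using r kap_pos by (intro add_left_mono mult_left_mono frac_le) (auto simp: ew_def)
  finally have Y: "(cmod (Ys g \<kappa> cs k (ad k) (bd k)))^2/?r^2 <= 2*((cmod (Yr k))^2/?r^2) + 2*\<epsilon>^2*(ew k/kap)" .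
  have "4/kap*\<epsilon>^2*ew k = 2*\<epsilon>^2*(ew k/kap) + 2*\<epsilon>^2*(ew k/kap)" by simp
  then show "(cmod (Xs h cs k (ad k) (bd k)))^2/?r + (cmod (Ys g \<kappa> cs k (ad k) (bd k)))^2/?r^2 <= 2*((cmod (Xr k))^2/?r) + 2*((cmod (Yr k))^2/?r^2) + 4/kap*\<epsilon>^2*ew k"
   using X Y by linarith
 qed
 also have "\<dots> = 2*(\<Sum>k\<in>S. (cmod (Xr k))^2/norm k) + 2*(\<Sum>k\<in>S. (cmod (Yr k))^2/(norm k)^2) + 4/kap*\<epsilon>^2 * sum ew S"
  by (simp only: sum.distrib sum_distrib_left)
 also have "\<dots> <= 2*(8*(kin_const m0*(\<epsilon>^2*EE))) + 2*(6*(1 + 1/kap^2)*KD^2*(1 + 1/kap)*(\<epsilon>^2*EE)) + 4/kap*\<epsilon>^2*EE"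
  using kap_pos by (intro add_mono mult_left_mono kin dyn ew_sum_le S) auto
 also have "\<dots> = res_const m0*(\<epsilon>^2*EE)"
 proof -
  have "2*(8*(p*q)) + 2*(6*a*b*d*q) + e * s*E = (16*p + 12*a*b*d + e)*q" if "q = s*E" for p q a b d e s E :: real
   unfolding that by (simp add: algebra_simps)
  from this[OF refl] show ?thesis unfolding res_const_def .
 qed
 finally show ?thesis .
qed

text \<open>With E the residual bound, nonresonant modes contribute at most L E to the energy and
  resonant ones at most (1+L) Z + L E. E itself is a multiple of \<epsilon>^2 \<open>EE\<close>, so
  smallness closes the loop and only Z remains on the right.\<close>

lemma pair_estimate:
 assumes cs: "norm (c - cs) <= \<epsilon>" and M: "M <= m0*\<epsilon>" "0 <= m0" and g0: "g > 0" "\<kappa> > 0" and L0: "L > 0"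
  and L: "!!k a b. k \<in> Lam ==> k ~= 0 ==> k \<notin> res_set g \<kappa> h cs ==>
   (norm k)^2*(cmod a)^2 + norm k*(cmod b)^2 <= L*((cmod (Xs h cs k a b))^2/norm k + (cmod (Ys g \<kappa> cs k a b))^2/(norm k)^2)"
   "!!k a b. k \<in> Lam ==> k ~= 0 ==> norm k*(cmod b)^2 <= L*((cmod (Xs h cs k a b))^2/norm k + (norm k)^2*(cmod a)^2)"
  and tiny: "4*L*res_const m0*\<epsilon>^2 <= 1"
 defines "R \<equiv> res_set g \<kappa> h cs"
 defines "Z \<equiv> \<Sum>k\<in>R. (norm k)^2*(cmod (ad k))^2"
 shows "finite S ==> S \<subseteq> Lam ==> 0 \<notin> S ==> S \<inter> R = {} ==> sum ew S <= 2*(1 + L)^2*res_const m0*(\<epsilon>^2*Z)"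
  and "(\<Sum>k\<in>R. (cmod (Xs h cs k (ad k) (bd k)))^2/norm k) <= 2*(1 + L)^2*res_const m0*(\<epsilon>^2*Z)"
proof -
 let ?X = "%k. (cmod (Xs h cs k (ad k) (bd k)))^2/norm k" and ?Y = "%k. (cmod (Ys g \<kappa> cs k (ad k) (bd k)))^2/(norm k)^2"
 define E where "E = res_const m0*(\<epsilon>^2*EE)"
 have fR: "finite R" unfolding R_def by (rule linear_estimates(1)[OF h g0])
 have R: "R \<subseteq> Lam" "0 \<notin> R" unfolding R_def res_set_def by auto
 have C0: "0 <= C" using order_trans[OF norm_ge_zero C] .
 have rc: "0 <= res_const m0" unfolding res_const_def kin_const_def using C0 kap_pos M(2) by (intro add_nonneg_nonneg mult_nonneg_nonneg) auto
 have E0: "0 <= E" unfolding E_def using rc EE_nonneg by simp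
 have rs: "(\<Sum>k\<in>S. ?X k + ?Y k) <= E" if "finite S" "S \<subseteq> Lam" "0 \<notin> S" for S unfolding E_def by (rule residual_sum[OF that cs M])
 have XR: "sum ?X R <= E" by (rule order_trans[OF sum_mono rs[OF fR R]]) simp
 have nr: "sum ew S <= L*E" if S: "finite S" "S \<subseteq> Lam" "0 \<notin> S" "S \<inter> R = {}" for S
 proof -
  have "sum ew S <= (\<Sum>k\<in>S. L*(?X k + ?Y k))"
  proof (rule sum_mono)
   fix k assume k: "k \<in> S"
   have "k \<in> Lam" "k ~= 0" "k \<notin> res_set g \<kappa> h cs" using S k unfolding R_def by auto
   from L(1)[OF this, of "ad k" "bd k"] show "ew k <= L*(?X k + ?Y k)" unfolding ew_def .
  qed
  also have "\<dots> = L*(\<Sum>k\<in>S. ?X k + ?Y k)" by (simp only: sum_distrib_left)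
  also have "\<dots> <= L*E" using L0 by (intro mult_left_mono rs S) simp
  finally show ?thesis .
 qed
 have Z0: "0 <= Z" unfolding Z_def by (intro sum_nonneg) simp
 have rr: "sum ew T <= (1 + L)*Z + L*E" if T: "T \<subseteq> R" for T
 proof -
  have "sum ew T <= sum ew R" by (rule sum_mono2[OF fR T]) (rule ew_nonneg)
  also have "\<dots> <= (\<Sum>k\<in>R. (1 + L)*((norm k)^2*(cmod (ad k))^2) + L*?X k)"
  proof (rule sum_mono)
   fix k assume k: "k \<in> R"
   have "k \<in> Lam" "k ~= 0" using R k by auto
   from L(2)[OF this, of "bd k" "ad k"] show "ew k <= (1 + L)*((norm k)^2*(cmod (ad k))^2) + L*?X k" unfolding ew_def distrib_left distrib_right by linarith
  qed
  also have "\<dots> = (1 + L)*Z + L * sum ?X R" unfolding Z_def by (simp only: sum.distrib sum_distrib_left)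
  also have "\<dots> <= (1 + L)*Z + L*E" using L0 by (intro add_left_mono mult_left_mono XR) simp
  finally show ?thesis .
 qed
 have "EE <= (1 + L)*Z + 2*L*E" unfolding EE_def
 proof (rule infsum_le_finite_sums[OF ew_summable])
  fix S assume S: "finite S" "S \<subseteq> Lam"
  have e0: "ew 0 = 0" by (simp add: ew_def)
  have "sum ew S = sum ew (S \<inter> R) + sum ew (S - R)" using S(1) by (metis sum.Int_Diff)
  also have "sum ew (S - R) = sum ew (S - R - {0})" by (rule sum.mono_neutral_right) (use S e0 in auto)
  also have "sum ew (S \<inter> R) + \<dots> <= ((1 + L)*Z + L*E) + L*E" by (intro add_mono rr nr) (use S in auto)
  finally show "sum ew S <= (1 + L)*Z + 2*L*E" by (simp add: mult_ac)
 qed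
 \<comment> \<open>By \<open>tiny\<close> the term 2 L E is at most half of \<open>EE\<close> and is
   absorbed into the left side.\<close>
 moreover have "4*L*E <= EE" using mult_right_mono[OF tiny EE_nonneg] unfolding E_def by (simp add: mult_ac)
 ultimately have "EE <= 2*((1 + L)*Z)" by linarith
 then have "E <= res_const m0*(\<epsilon>^2*(2*((1 + L)*Z)))" unfolding E_def using rc by (intro mult_left_mono) auto
 then have EZ: "(1 + L)*E <= (1 + L)*(res_const m0*(\<epsilon>^2*(2*((1 + L)*Z))))" using L0 by (intro mult_left_mono) auto
 have fin: "(1 + L)*(res_const m0*(\<epsilon>^2*(2*((1 + L)*Z)))) = 2*(1 + L)^2*res_const m0*(\<epsilon>^2*Z)"
  by (simp only: power2_eq_square mult_ac)
 have LE: "L*E <= (1 + L)*E" "E <= (1 + L)*E" using E0 L0 mult_nonneg_nonneg[of L E] by (auto simp: distrib_right)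
 show "sum ew S <= 2*(1 + L)^2*res_const m0*(\<epsilon>^2*Z)" if "finite S" "S \<subseteq> Lam" "0 \<notin> S" "S \<inter> R = {}"
  using nr[OF that] LE(1) EZ unfolding fin by linarith
 show "sum ?X R <= 2*(1 + L)^2*res_const m0*(\<epsilon>^2*Z)" using XR LE(2) EZ unfolding fin by linarith
qed

end

lemma cmod_cis_minus_1: "(cmod (cis x - 1))^2 = (2 * sin (x/2))^2"
proof -
 have "(cmod (cis x - 1))^2 = (cos x - 1)^2 + (sin x)^2" by (simp add: cmod_power2)
 also have "\<dots> = 2 - 2 * cos x" using sin_cos_squared_add[of x] by (simp add: power2_eq_square algebra_simps)
 also have "\<dots> = (2 * sin (x/2))^2" using cos_double_sin[of "x/2"] by (simp add: power_mult_distrib)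
 finally show ?thesis .
qed

text \<open>Take d = t n and divide by t^2: |cis(t m) - 1|^2/t^2 tends to m^2, and the sums are
  finite, so the limit is taken term by term.\<close>

lemma differentiate_translations:
 fixes u v :: "real^2 => real"
 assumes "!!d. (\<Sum>k\<in>S. (cmod (cis (k \<bullet> d) - 1))^2*u k) <= (\<Sum>k\<in>T. (cmod (cis (k \<bullet> d) - 1))^2 * v k)"
 shows "(\<Sum>k\<in>S. (n \<bullet> k)^2*u k) <= (\<Sum>k\<in>T. (n \<bullet> k)^2 * v k)"
proof -
 have lim: "((%t. (2 * sin (t*m/2)/t)^2) \<longlongrightarrow> m^2) (at 0)" for m :: real
 proof -
  have "((%t. 2 * sin (t*m/2)) has_real_derivative m) (at 0)" by (auto intro!: derivative_eq_intros)
  then have "((%t. 2 * sin (t*m/2)/t) \<longlongrightarrow> m) (at 0)" by (simp add: DERIV_def)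
  then show ?thesis by (rule tendsto_power)
 qed
 have e: "(2 * sin (t*m/2)/t)^2*x = (2 * sin (t*m/2))^2*x/t^2" for t m x :: real by (simp add: power_divide)
 show ?thesis
 proof (rule tendsto_le)
  show "((%t. \<Sum>k\<in>S. (2 * sin (t*(n \<bullet> k)/2)/t)^2*u k) \<longlongrightarrow> (\<Sum>k\<in>S. (n \<bullet> k)^2*u k)) (at 0)"
   "((%t. \<Sum>k\<in>T. (2 * sin (t*(n \<bullet> k)/2)/t)^2 * v k) \<longlongrightarrow> (\<Sum>k\<in>T. (n \<bullet> k)^2 * v k)) (at 0)"
   by (intro tendsto_sum tendsto_mult lim tendsto_const)+
  have "(\<Sum>k\<in>S. (2 * sin (t*(n \<bullet> k)/2)/t)^2*u k) <= (\<Sum>k\<in>T. (2 * sin (t*(n \<bullet> k)/2)/t)^2 * v k)" for t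
   using divide_right_mono[OF assms[of "t *\<^sub>R n"], of "t^2"] unfolding e sum_divide_distrib[symmetric] by (simp add: cmod_cis_minus_1 inner_commute)
  then show "\<forall>\<^sub>F t in at 0. (\<Sum>k\<in>S. (2 * sin (t*(n \<bullet> k)/2)/t)^2*u k) <= (\<Sum>k\<in>T. (2 * sin (t*(n \<bullet> k)/2)/t)^2 * v k)"
   by (intro always_eventually) simp
 qed simp
qed

section \<open>Comparison with translates\<close>

context lattice2
begin

lemma pd_shift: "pd i (%x. f (x + d)) = (%x. pd i f (x + d))"
 by (simp add: pd_def fun_eq_iff add_ac)

lemma grad2_shift: "grad2 (%x. f (x + d)) x = grad2 f (x + d)"
 by (simp add: grad2_def pd_shift)

lemma C1b_shift: assumes "C1b f K" shows "C1b (%x. f (x + d)) K"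
proof (rule C1b_I)
 show "lat_periodic v1 v2 (%x. f (x + d))" using C1bD(1)[OF assms] unfolding lat_periodic_def by (metis add.assoc add.commute)
 show "((%x. f (x + d)) has_derivative (%h. grad2 f (x + d) \<bullet> h)) (at x)" for x
 proof -
  have "((%x. x + d) has_derivative (%v. v)) (at x)" by (auto intro!: derivative_eq_intros)
  from has_derivative_compose[OF this C1bD(2)[OF assms]] show ?thesis .
 qed
 show "continuous_on UNIV (%x. grad2 f (x + d))" by (rule continuous_on_compose2[OF C1bD(3)[OF assms]]) (auto intro: continuous_intros)
qed (rule C1bD(4)[OF assms], rule C1bD(5)[OF assms])

lemma flat_sol_shift:
 assumes f: "flat_sol l h c \<eta> \<psi> \<phi> V B M"
 shows "flat_sol l h c (%x. \<eta> (x + d)) (%x. \<psi> (x + d)) (%p. \<phi> (p + (d,0))) (%p. V (p + (d,0))) (%p. B (p + (d,0))) M"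
proof -
 let ?D = "{(x,z). - h <= ereal z \<and> z <= 0} :: ((real^2) \<times> real) set"
 have co: "continuous_on ?D (%p. u (p + (d,0)))" if "continuous_on ?D u" for u :: "(real^2) \<times> real => 'b::topological_space"
  by (rule continuous_on_compose2[OF that]) (auto intro!: continuous_intros)
 have de: "((%p. u (p + (d,0))) has_derivative A) (at (x,z))" if "(u has_derivative A) (at (x + d, z))"
  for u :: "(real^2) \<times> real => 'b::real_normed_vector" and A x z
 proof -
  have "((%p. p + (d,0)) has_derivative (%v. v)) (at (x,z))" by (auto intro!: derivative_eq_intros)
  from has_derivative_compose[OF this, of u A] that show ?thesis by simp
 qed
 have fx: "flux_x l (%x. \<eta> (x + d)) (%p. V (p + (d,0))) = (%p. flux_x l \<eta> V (p + (d,0)))" by (simp add: fun_eq_iff flux_x_def)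
 have fz: "flux_z l (%x. \<eta> (x + d)) (%p. V (p + (d,0))) (%p. B (p + (d,0))) = (%p. flux_z l \<eta> V B (p + (d,0)))"
  by (simp add: fun_eq_iff flux_z_def grad2_shift)
 have per: "\<phi> ((x + \<gamma>, z) + (d,0)) = \<phi> ((x, z) + (d,0)) \<and> V ((x + \<gamma>, z) + (d,0)) = V ((x, z) + (d,0))"
  if "\<gamma> \<in> lat v1 v2" "- h < ereal z" "z < 0" for x \<gamma> z using flat_solD(4)[OF f that, of "x + d"] by (simp add: add_ac)
 have d1: "((%p. \<phi> (p + (d,0))) has_derivative (%v. (V ((x,z) + (d,0)) + (rho l z*B ((x,z) + (d,0))) *\<^sub>R grad2 (%x. \<eta> (x + d)) x) \<bullet> fst v + (1 + \<eta> (x + d)*rho1 l z)*B ((x,z) + (d,0)) * snd v)) (at (x,z))"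
  if "- h < ereal z" "z < 0" for x z using de[OF flat_solD(5)[OF f that]] by (simp add: grad2_shift)
 have d2: "\<exists>L N. (flux_x l (%x. \<eta> (x + d)) (%p. V (p + (d,0))) has_derivative L) (at (x,z)) \<and>
   (flux_z l (%x. \<eta> (x + d)) (%p. V (p + (d,0))) (%p. B (p + (d,0))) has_derivative N) (at (x,z)) \<and>
    L (axis 1 1, 0)$1 + L (axis 2 1, 0)$2 + N (0, 1) = 0" if z: "- h < ereal z" "z < 0" for x z
 proof -
  obtain L N where LN: "(flux_x l \<eta> V has_derivative L) (at (x + d,z))" "(flux_z l \<eta> V B has_derivative N) (at (x + d,z))"
   "L (axis 1 1, 0)$1 + L (axis 2 1, 0)$2 + N (0, 1) = 0" using flat_solD(6)[OF f z, of "x + d"] by (elim exE conjE)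
  show ?thesis unfolding fx fz by (rule exI[of _ L], rule exI[of _ N], rule conjI[OF de[OF LN(1)] conjI[OF de[OF LN(2)] LN(3)]])
 qed
 have s: "\<phi> ((x,0) + (d,0)) = \<psi> (x + d) \<and> flux_z l (%x. \<eta> (x + d)) (%p. V (p + (d,0))) (%p. B (p + (d,0))) (x,0) = - (c \<bullet> grad2 (%x. \<eta> (x + d)) x)" for x
  unfolding fz using flat_solD(7)[OF f, of "x + d"] flat_solD(8)[OF f, of "x + d"] by (simp add: grad2_shift)
 have bd: "norm (V ((x,z) + (d,0))) <= M \<and> \<bar>B ((x,z) + (d,0))\<bar> <= M" if "- h <= ereal z" "z <= 0" for x z
  using flat_solD(9)[OF f that, of "x + d"] flat_solD(10)[OF f that, of "x + d"] by simp
 have bt: "\<exists>H>0. ereal H <= h \<and> l <= H \<and> (h ~= \<infinity> --> ereal H = h) \<and> (h = \<infinity> --> H0 <= H) \<and> (\<forall>x. \<bar>B ((x,-H) + (d,0))\<bar> <= e)" if "e > 0" for e H0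
  using flat_solD(11)[OF f that, of H0] by auto
 show ?thesis unfolding flat_sol_def by (intro conjI allI impI ballI co flat_solD(1)[OF f] flat_solD(2)[OF f] flat_solD(3)[OF f])
   (use per d1 d2 s bd bt in \<open>(blast | simp only:)+\<close>)
qed

text \<open>The value of \<open>res_const\<close> for a wave and any of its translates, written
  without reference to the pair. It does not involve d, the wave or \<epsilon>, so it can be fixed
  in advance.\<close>

definition est_const :: "real => real => real => real => real" where
 "est_const l \<kappa> C m0 = 16*(4*(1 + 3/l)^2*(2*(C*(1 + 1/kap)) + 80*(1 + 3/l)^2*m0^2*(1 + 1/kap^2)) + 4*(1 + 3/l)^2*m0^2*(1 + 1/kap^2))
  + 12*(1 + 1/kap^2)*(4*(C + 1)^2 + 100*(1 + C) + 12*\<kappa>)^2*(1 + 1/kap) + 4/kap"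

end

locale one_wave = lattice2 +
 fixes l \<epsilon> M :: real and h :: ereal and c :: "real^2" and \<eta> \<psi> :: "real^2 => real"
  and a b :: "real^2 => complex" and \<phi> B :: "(real^2) \<times> real => real" and V :: "(real^2) \<times> real => real^2"
  and g \<kappa> C :: real
 assumes h: "h > 0" and l: "0 < l" "l <= 1" "ereal l <= h"
  and w: "wser \<eta> a" "wser \<psi> b" and fs: "flat_sol l h c \<eta> \<psi> \<phi> V B M"
  and eps: "0 <= \<epsilon>" "(1 + 3/l)*\<epsilon> <= 1/16"
  and small: "!!x. \<bar>\<eta> x\<bar> <= \<epsilon>" "!!x. norm (grad2 \<eta> x) <= \<epsilon>"
  and g: "g > 0" "\<kappa> > 0" and C: "norm c <= C"
  and C1: "!!i. C1b (pd i \<eta>) \<epsilon>" "!!i. C1b (pd i \<psi>) \<epsilon>"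
  and bern: "!!x. c \<bullet> grad2 \<psi> x + (- g*\<eta> x - 1/2*(norm (grad2 \<psi> x))^2
      + (grad2 \<eta> x \<bullet> grad2 \<psi> x - c \<bullet> grad2 \<eta> x)^2/(2*(1 + (norm (grad2 \<eta> x))^2))
      + \<kappa>*div2 (%y. (1/sqrt (1 + (norm (grad2 \<eta> y))^2)) *\<^sub>R grad2 \<eta> y) x) = 0"
begin

text \<open>Supplies the bound \<open>Pm\<close> for a translate. The horizontal gradient of \<phi>
  is bounded, and this controls increments even at unlimited depth.\<close>

lemma horizontal_increment:
 assumes "- h < ereal z" "z < 0"
 shows "\<bar>\<phi> (x + d, z) - \<phi> (x, z)\<bar> <= (M + M*\<epsilon>)*norm d"
proof -
 let ?G = "%x. V (x,z) + (rho l z*B (x,z)) *\<^sub>R grad2 \<eta> x"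
 have z': "- h <= ereal z" "z <= 0" using assms by auto
 have "norm (\<phi> (x + d, z) - \<phi> (x, z)) <= (M + M*\<epsilon>)*norm ((x + d) - x)"
 proof (rule differentiable_bound[where f="%x. \<phi> (x,z)" and f'="%x v. ?G x \<bullet> v" and S=UNIV])
  fix x :: "real^2"
  have "((%x. (x,z)) has_derivative (%v. (v,0))) (at x)" by (auto intro!: derivative_eq_intros)
  from has_derivative_compose[of "%x. (x,z)" "%v. (v,0)" x UNIV \<phi>, OF this flat_solD(5)[OF fs assms, of x]]
  show "((%x. \<phi> (x,z)) has_derivative (%v. ?G x \<bullet> v)) (at x within UNIV)" by simp
  have "norm (?G x) <= norm (V (x,z)) + \<bar>rho l z\<bar>*\<bar>B (x,z)\<bar>*norm (grad2 \<eta> x)" by (rule order_trans[OF norm_triangle_ineq]) (simp add: abs_mult)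
  also have "\<dots> <= M + 1*M*\<epsilon>" using rho_bounds[OF l(1) z'(2)] flat_solD(9)[OF fs z', of x] flat_solD(10)[OF fs z', of x] small(2)[of x] eps(1)
   by (intro add_mono mult_mono) auto
  finally have "norm (?G x) <= M + M*\<epsilon>" by simp
  then have "\<bar>?G x \<bullet> v\<bar> <= (M + M*\<epsilon>)*norm v" for v by (rule order_trans[OF Cauchy_Schwarz_ineq2 mult_right_mono]) simp
  then show "onorm (%v. ?G x \<bullet> v) <= M + M*\<epsilon>" by (intro onorm_le) simp
 qed simp_all
 then show ?thesis by simp
qed

lemma increment_bounded:
 assumes z: "- h <= ereal z" "z <= 0"
 shows "\<bar>\<phi> (x + d, z) - \<phi> (x, z)\<bar> <= (M + M*\<epsilon>)*norm d"
proof -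
 obtain H where H: "H > 0" "ereal H <= h" "-H <= z"
 proof (cases "h = \<infinity>")
  case True then show ?thesis using that[of "1 - z"] z by simp
 next
  case False
  then obtain r where r: "h = ereal r" using h by (cases h) auto
  then show ?thesis using that[of r] h z by simp
 qed
 have cl: "closure {-H<..<0} = {-H..0}" using H(1) by simp
 have sl: "- h < ereal y" if "-H < y" for y using H(2) that by (cases h) auto
 have sl': "- h <= ereal y" if "-H <= y" for y using H(2) that by (cases h) auto
 have c: "continuous_on {-H..0} (%y. \<phi> (x' , y))" for x' by (rule continuous_on_compose2[OF flat_solD(1)[OF fs]]) (auto intro!: continuous_intros sl')
 have "continuous_on (closure {-H<..<0}) (%y. \<phi> (x + d, y) - \<phi> (x, y))" unfolding cl by (intro continuous_intros c)
 moreover have "norm (\<phi> (x + d, y) - \<phi> (x, y)) <= (M + M*\<epsilon>)*norm d" if "y \<in> {-H<..<0}" for y using horizontal_increment[OF sl, of y x d] that by simp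
 ultimately have "norm (\<phi> (x + d, z) - \<phi> (x, z)) <= (M + M*\<epsilon>)*norm d"
  by (intro continuous_on_closure_norm_le[of "{-H<..<0}" "%y. \<phi> (x + d, y) - \<phi> (x, y)"]) (use H z in \<open>auto simp: cl\<close>)
 then show ?thesis by simp
qed

lemma eps_le: "\<epsilon> <= 1/16"
proof -
 have "1*\<epsilon> <= (1 + 3/l)*\<epsilon>" using eps(1) l by (intro mult_right_mono) auto
 then show ?thesis using eps(2) by linarith
qed

text \<open>The equations are invariant under translation, and the zero mode is multiplied by cis 0
  = 1, so speed and means agree.\<close>

lemma shifted: "two_stokes v1 v2 l \<epsilon> M ((M + M*\<epsilon>)*norm d) h c \<eta> \<psi> (%x. \<eta> (x + d)) (%x. \<psi> (x + d)) a b
 (%k. a k * cis (k \<bullet> d)) (%k. b k * cis (k \<bullet> d)) \<phi> (%p. \<phi> (p + (d,0))) B (%p. B (p + (d,0))) V (%p. V (p + (d,0))) g \<kappa> C"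
proof unfold_locales
 fix e H0 :: real assume "e > 0"
 from flat_solD(11)[OF fs this, of H0] show "\<exists>H>0. ereal H <= h \<and> l <= H \<and> (h ~= \<infinity> --> ereal H = h) \<and> (h = \<infinity> --> H0 <= H) \<and>
   (\<forall>x. \<bar>B (x,-H)\<bar> <= e \<and> \<bar>B ((x,-H) + (d,0))\<bar> <= e)" by auto
next
 fix x z assume "- h <= ereal z" "z <= 0"
 from increment_bounded[OF this, of x d] show "\<bar>\<phi> ((x,z) + (d,0)) - \<phi> (x,z)\<bar> <= (M + M*\<epsilon>)*norm d" by simp
next
 fix x
 have dv: "div2 (%y. F (y + d)) x = div2 F (x + d)" for F :: "real^2 => real^2" and x
  unfolding div2_def using pd_shift[of _ "%y. F y $ _" d] by (intro sum.cong refl) (simp add: fun_eq_iff)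
 show "c \<bullet> grad2 (%x. \<psi> (x + d)) x + (- g*\<eta> (x + d) - 1/2*(norm (grad2 (%x. \<psi> (x + d)) x))^2
      + (grad2 (%x. \<eta> (x + d)) x \<bullet> grad2 (%x. \<psi> (x + d)) x - c \<bullet> grad2 (%x. \<eta> (x + d)) x)^2/(2*(1 + (norm (grad2 (%x. \<eta> (x + d)) x))^2))
      + \<kappa>*div2 (%y. (1/sqrt (1 + (norm (grad2 (%x. \<eta> (x + d)) y))^2)) *\<^sub>R grad2 (%x. \<eta> (x + d)) y) x) = 0"
  using bern[of "x + d"] unfolding grad2_shift dv[of "%y. (1/sqrt (1 + (norm (grad2 \<eta> y))^2)) *\<^sub>R grad2 \<eta> y"] .
qed (simp_all only: h l w fs eps small g C C1 bern eps_le wser_shift flat_sol_shift grad2_shift pd_shift C1b_shift less_imp_le inner_zero_left cis_zero mult_1_right)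

text \<open>In \<open>pair_estimate\<close> for a wave and its translate each mode carries the
  factor |cis(k.d) - 1|^2, because \<open>Xs\<close> is linear in the amplitudes. The constant is
  independent of d, so the inequality may be differentiated in d.\<close>

lemma single_estimate:
 assumes cs: "norm (c - cs) <= \<epsilon>" and M: "M <= m0*\<epsilon>" "0 <= m0" and L0: "L > 0"
  and L: "!!k a b. k \<in> Lam ==> k ~= 0 ==> k \<notin> res_set g \<kappa> h cs ==>
   (norm k)^2*(cmod a)^2 + norm k*(cmod b)^2 <= L*((cmod (Xs h cs k a b))^2/norm k + (cmod (Ys g \<kappa> cs k a b))^2/(norm k)^2)"
   "!!k a b. k \<in> Lam ==> k ~= 0 ==> norm k*(cmod b)^2 <= L*((cmod (Xs h cs k a b))^2/norm k + (norm k)^2*(cmod a)^2)"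
  and tiny: "4*L*est_const l \<kappa> C m0*\<epsilon>^2 <= 1"
 defines "R \<equiv> res_set g \<kappa> h cs" and "K \<equiv> 2*(1 + L)^2*est_const l \<kappa> C m0"
 shows "finite S ==> S \<subseteq> Lam ==> 0 \<notin> S ==> S \<inter> R = {} ==>
   (\<Sum>k\<in>S. (n \<bullet> k)^2*((norm k)^2*(cmod (a k))^2 + norm k*(cmod (b k))^2)) <= K*\<epsilon>^2*(\<Sum>k\<in>R. (n \<bullet> k)^2*((norm k)^2*(cmod (a k))^2))"
  and "(\<Sum>k\<in>R. (n \<bullet> k)^2*((cmod (Xs h cs k (a k) (b k)))^2/norm k)) <= K*\<epsilon>^2*(\<Sum>k\<in>R. (n \<bullet> k)^2*((norm k)^2*(cmod (a k))^2))"
proof -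
 let ?z = "%d k. cis (k \<bullet> d) - 1"
 have Xz: "Xs h cs k (z*p) (z*q) = z*Xs h cs k p q" for k z p q unfolding Xs_def by (simp add: algebra_simps)
 have pull: "K*\<epsilon>^2*(\<Sum>k\<in>R. f k*u k) = (\<Sum>k\<in>R. f k*(K*\<epsilon>^2*u k))" for f u :: "real^2 => real"
  by (simp add: sum_distrib_left mult_ac)
 have sq: "(cmod (z*x))^2 = (cmod z)^2*(cmod x)^2" for z x by (simp add: norm_mult power_mult_distrib)
 have est: "(finite S --> S \<subseteq> Lam --> 0 \<notin> S --> S \<inter> R = {} -->
   (\<Sum>k\<in>S. (cmod (?z d k))^2*((norm k)^2*(cmod (a k))^2 + norm k*(cmod (b k))^2)) <= (\<Sum>k\<in>R. (cmod (?z d k))^2*(K*\<epsilon>^2*((norm k)^2*(cmod (a k))^2)))) \<and>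
   (\<Sum>k\<in>R. (cmod (?z d k))^2*((cmod (Xs h cs k (a k) (b k)))^2/norm k)) <= (\<Sum>k\<in>R. (cmod (?z d k))^2*(K*\<epsilon>^2*((norm k)^2*(cmod (a k))^2)))" for S d
 proof -
  interpret D: two_stokes v1 v2 l \<epsilon> M "(M + M*\<epsilon>)*norm d" h c \<eta> \<psi> "%x. \<eta> (x + d)" "%x. \<psi> (x + d)" a b
  "%k. a k * cis (k \<bullet> d)" "%k. b k * cis (k \<bullet> d)" \<phi> "%p. \<phi> (p + (d,0))" B "%p. B (p + (d,0))" V "%p. V (p + (d,0))" g \<kappa> C
   by (rule shifted)
  have rc: "D.res_const m0 = est_const l \<kappa> C m0" unfolding D.res_const_def D.kin_const_def D.KD_def D.Kl_def est_const_def ..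
  have ad: "D.ad k = ?z d k*a k" "D.bd k = ?z d k*b k" for k unfolding D.ad_def D.bd_def by (simp_all add: algebra_simps)
  have ew: "D.ew k = (cmod (?z d k))^2*((norm k)^2*(cmod (a k))^2 + norm k*(cmod (b k))^2)" for k
   unfolding D.ew_def ad sq by (simp add: algebra_simps)
  have Z: "2*(1 + L)^2*D.res_const m0*(\<epsilon>^2*(\<Sum>k\<in>R. (norm k)^2*(cmod (D.ad k))^2)) = (\<Sum>k\<in>R. (cmod (?z d k))^2*(K*\<epsilon>^2*((norm k)^2*(cmod (a k))^2)))"
   unfolding ad sq rc K_def by (simp add: sum_distrib_left mult_ac)
  have X: "(cmod (Xs h cs k (D.ad k) (D.bd k)))^2/norm k = (cmod (?z d k))^2*((cmod (Xs h cs k (a k) (b k)))^2/norm k)" for k unfolding ad Xz sq by simp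
  note P = D.pair_estimate[OF cs M g L0 _ _ tiny[folded rc], folded R_def, unfolded Z ew X]
  show ?thesis
  proof (intro conjI impI)
   show "(\<Sum>k\<in>R. (cmod (?z d k))^2*((cmod (Xs h cs k (a k) (b k)))^2/norm k)) <= (\<Sum>k\<in>R. (cmod (?z d k))^2*(K*\<epsilon>^2*((norm k)^2*(cmod (a k))^2)))"
    by (rule P(2)) (fact L[folded R_def])+
   assume "finite S" "S \<subseteq> Lam" "0 \<notin> S" "S \<inter> R = {}"
   from P(1)[OF _ _ this] L[folded R_def] show "(\<Sum>k\<in>S. (cmod (?z d k))^2*((norm k)^2*(cmod (a k))^2 + norm k*(cmod (b k))^2)) <= (\<Sum>k\<in>R. (cmod (?z d k))^2*(K*\<epsilon>^2*((norm k)^2*(cmod (a k))^2)))" by blast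
  qed
 qed
 show "(\<Sum>k\<in>S. (n \<bullet> k)^2*((norm k)^2*(cmod (a k))^2 + norm k*(cmod (b k))^2)) <= K*\<epsilon>^2*(\<Sum>k\<in>R. (n \<bullet> k)^2*((norm k)^2*(cmod (a k))^2))"
  if "finite S" "S \<subseteq> Lam" "0 \<notin> S" "S \<inter> R = {}" unfolding pull by (rule differentiate_translations) (use est[of S] that in blast)
 show "(\<Sum>k\<in>R. (n \<bullet> k)^2*((cmod (Xs h cs k (a k) (b k)))^2/norm k)) <= K*\<epsilon>^2*(\<Sum>k\<in>R. (n \<bullet> k)^2*((norm k)^2*(cmod (a k))^2))"
  unfolding pull by (rule differentiate_translations) (use est in blast)
qed

end

section \<open>Sign of the momentum\<close>

lemma Ints_abs_le_square: "x \<in> \<int> ==> \<bar>x\<bar> <= x^2" for x :: real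
proof (cases "x = 0")
 case False
 assume "x \<in> \<int>"
 then have "1*\<bar>x\<bar> <= \<bar>x\<bar>*\<bar>x\<bar>" using False by (intro mult_right_mono Ints_nonzero_abs_ge1) auto
 then show ?thesis by (simp add: power2_eq_square)
qed simp

context lattice2
begin

lemma momentum_component:
 assumes "wser \<eta> a" "continuous_on UNIV \<psi>"
 shows "n \<bullet> momentum v1 v2 \<eta> \<psi> = n$1*av (%x. pd 1 \<eta> x*\<psi> x) + n$2*av (%x. pd 2 \<eta> x*\<psi> x)"
proof -
 let ?I = "%f. set_lebesgue_integral lborel (fund_dom v1 v2) f"
 let ?f = "%i x. pd i \<eta> x*\<psi> x"
 have c: "continuous_on UNIV (?f i)" for i by (intro continuous_intros assms wser_cont[OF wser_has_derivative(2)[OF assms(1)]])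
 have int: "integrable lborel (%x. indicator (fund_dom v1 v2) x*?f i x)" for i using fund_dom_integral(1)[OF c[of i]] unfolding set_integrable_def by simp
 have e: "indicator (fund_dom v1 v2) x *\<^sub>R (\<psi> x *\<^sub>R grad2 \<eta> x) = (indicator (fund_dom v1 v2) x*?f 1 x) *\<^sub>R axis 1 1 + (indicator (fund_dom v1 v2) x*?f 2 x) *\<^sub>R axis 2 1" for x
  by (simp add: vec2_eq_iff grad2_def axis_def)
 have "?I (%x. \<psi> x *\<^sub>R grad2 \<eta> x) = ?I (?f 1) *\<^sub>R axis 1 1 + ?I (?f 2) *\<^sub>R axis 2 1"
  unfolding set_lebesgue_integral_def e using int[of 1] int[of 2] by (simp add: mult.assoc)
 then have "momentum v1 v2 \<eta> \<psi> = av (?f 1) *\<^sub>R axis 1 1 + av (?f 2) *\<^sub>R axis 2 1"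
  unfolding momentum_def fund_dom_integral(2)[OF c] lat_area_eq using dt_nz by (simp add: scaleR_add_right)
 then show ?thesis by (simp add: inner_2 axis_def)
qed

lemma momentum_has_sum:
 assumes "wser \<eta> a" "wser \<psi> b"
 shows "((%k. (n \<bullet> k)*Re (\<i>*a k * cnj (b k))) has_sum n \<bullet> momentum v1 v2 \<eta> \<psi>) Lam"
proof -
 have "((%k. n$i*Re (\<i> * of_real (k$i)*a k * cnj (b k))) has_sum n$i*av (%x. pd i \<eta> x*\<psi> x)) Lam" for i
  by (rule has_sum_cmult_right[OF wser_parseval[OF wser_has_derivative(2)[OF assms(1)] assms(2)]])
 from has_sum_add[OF this[of 1] this[of 2]] show ?thesis unfolding momentum_component[OF assms(1) wser_cont[OF assms(2)]] by (simp add: inner_2 algebra_simps)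
qed

end

text \<open>From here on only the coefficients and the two weighted estimates matter; the fluid has
  disappeared from the argument.\<close>

locale mode_estimates = lattice2 +
 fixes \<eta> \<psi> :: "real^2 => real" and a b :: "real^2 => complex" and h :: ereal and cs :: "real^2"
  and R :: "(real^2) set" and K \<epsilon> t0 :: real
 assumes w: "wser \<eta> a" "wser \<psi> b" and R: "finite R" "R \<subseteq> Lam" "0 \<notin> R"
  and t0: "t0 > 0" "!!k. k \<in> Lam ==> k ~= 0 ==> t0 <= tfac h k" and eps: "0 < \<epsilon>" "\<epsilon> <= 1" and K: "K \<ge> 0"
  and E1: "!!n S. finite S ==> S \<subseteq> Lam ==> 0 \<notin> S ==> S \<inter> R = {} ==>
   (\<Sum>k\<in>S. (n \<bullet> k)^2*((norm k)^2*(cmod (a k))^2 + norm k*(cmod (b k))^2)) <= K*\<epsilon>^2*(\<Sum>k\<in>R. (n \<bullet> k)^2*((norm k)^2*(cmod (a k))^2))"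
  and E2: "!!n. (\<Sum>k\<in>R. (n \<bullet> k)^2*((cmod (Xs h cs k (a k) (b k)))^2/norm k)) <= K*\<epsilon>^2*(\<Sum>k\<in>R. (n \<bullet> k)^2*((norm k)^2*(cmod (a k))^2))"
begin

definition "ZZ n = (\<Sum>k\<in>R. (n \<bullet> k)^2*((norm k)^2*(cmod (a k))^2))"
text \<open>Minus the momentum of mode k along n if \<open>Xs\<close> vanished there: then b = -i
  (cs.k) a/(|k| \<open>tfac\<close>), and Re(i a conj b) is -(cs.k)|a|^2/(|k|
  \<open>tfac\<close>).\<close>

definition "qq n k = (n \<bullet> k)*(cs \<bullet> k)/(norm k*tfac h k)*(cmod (a k))^2"
definition "K3 = 1/2*(1/kap^2 + 1/kap)*K + 1/(2*t0)*(1/kap ^ 3 + K)"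

lemma ZZ_nonneg: "0 <= ZZ n" unfolding ZZ_def by (intro sum_nonneg) simp

text \<open>Both estimates have right side 0. A nonresonant mode off the line orthogonal to n dies
  by \<open>E1\<close>; for a resonant one a vanishes by hypothesis, \<open>Xs\<close> by
  \<open>E2\<close>, and then b because \<open>tfac\<close> is positive.\<close>

lemma vanish:
 assumes Z: "ZZ n = 0" and k: "k \<in> Lam" "n \<bullet> k ~= 0"
 shows "a k = 0 \<and> b k = 0"
proof (cases "k \<in> R")
 case False
 have k0: "k ~= 0" using k by auto
 have "(n \<bullet> k)^2*((norm k)^2*(cmod (a k))^2 + norm k*(cmod (b k))^2) <= 0" using E1[of "{k}" n] False k k0 Z unfolding ZZ_def by simp
 then have "(norm k)^2*(cmod (a k))^2 + norm k*(cmod (b k))^2 <= 0" using k(2) by (simp add: mult_le_0_iff)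
 moreover have "0 <= (norm k)^2*(cmod (a k))^2" "0 <= norm k*(cmod (b k))^2" by simp_all
 ultimately have "(norm k)^2*(cmod (a k))^2 = 0" "norm k*(cmod (b k))^2 = 0" by linarith+
 then show ?thesis using k0 by simp
next
 case True
 have k0: "norm k > 0" using k by auto
 have "(n \<bullet> k)^2*((norm k)^2*(cmod (a k))^2) = 0" using Z True R(1) unfolding ZZ_def by (subst (asm) sum_nonneg_eq_0_iff) auto
 then have ak: "a k = 0" using k k0 by simp
 have "(n \<bullet> k)^2*((cmod (Xs h cs k (a k) (b k)))^2/norm k) <= (\<Sum>k\<in>R. (n \<bullet> k)^2*((cmod (Xs h cs k (a k) (b k)))^2/norm k))"
  by (rule member_le_sum[OF True]) (use R in auto)
 also have "\<dots> <= 0" using E2[of n] Z unfolding ZZ_def by simp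
 finally have "Xs h cs k (a k) (b k) = 0" using k(2) k0 by (simp add: mult_le_0_iff divide_le_0_iff)
 then show ?thesis using ak k0 t0(1) t0(2)[OF k(1)] unfolding Xs_def by auto
qed

lemma high_modes_momentum:
 assumes n: "!!k. k \<in> Lam ==> n \<bullet> k \<in> \<int>" and S: "finite S" "S \<subseteq> Lam - R"
 shows "\<bar>\<Sum>k\<in>S. (n \<bullet> k)*Re (\<i>*a k * cnj (b k))\<bar> <= 1/2*(1/kap^2 + 1/kap)*K*\<epsilon>^2*ZZ n"
proof -
 let ?p = "%k. (n \<bullet> k)*Re (\<i>*a k * cnj (b k))"
 let ?w = "%k. (norm k)^2*(cmod (a k))^2 + norm k*(cmod (b k))^2"
 let ?D = "1/2*(1/kap^2 + 1/kap)"
 have D0: "0 <= ?D" using kap_pos by simp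
 have "\<bar>sum ?p S\<bar> = \<bar>sum ?p (S - {0})\<bar>" by (rule arg_cong[where f=abs], rule sum.mono_neutral_right) (use S in auto)
 also have "\<dots> <= (\<Sum>k\<in>S - {0}. ?D*((n \<bullet> k)^2*?w k))"
 proof (rule order_trans[OF sum_abs sum_mono])
  fix k assume k: "k \<in> S - {0}"
  then have kL: "k \<in> Lam" "k ~= 0" using S by auto
  have r: "kap <= norm k" by (rule Lam_norm_ge[OF kL])
  have "\<bar>n \<bullet> k\<bar> <= (n \<bullet> k)^2" by (rule Ints_abs_le_square[OF n[OF kL(1)]])
  moreover have "\<bar>Re (\<i>*a k * cnj (b k))\<bar> <= ?D*?w k"
  proof -
   have "\<bar>Re (\<i>*a k * cnj (b k))\<bar> <= cmod (a k) * cmod (b k)" using abs_Re_le_cmod[of "\<i>*a k * cnj (b k)"] by (simp add: norm_mult)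
   also have "\<dots> <= 1/2*((cmod (a k))^2 + (cmod (b k))^2)" using sum_squares_bound[of "cmod (a k)" "cmod (b k)"] by simp
   also have "\<dots> <= 1/2*(?w k/kap^2 + ?w k/kap)"
   proof (intro mult_left_mono add_mono)
    have "kap^2*(cmod (a k))^2 <= (norm k)^2*(cmod (a k))^2" using r kap_pos by (intro mult_right_mono power_mono) auto
    also have "\<dots> <= ?w k" by simp
    finally show "(cmod (a k))^2 <= ?w k/kap^2" using kap_pos by (simp add: field_simps)
    have "kap*(cmod (b k))^2 <= norm k*(cmod (b k))^2" using r by (intro mult_right_mono) auto
    also have "\<dots> <= ?w k" by simp
    finally show "(cmod (b k))^2 <= ?w k/kap" using kap_pos by (simp add: field_simps)
   qed simp
   also have "\<dots> = ?D*?w k" by (simp add: distrib_right)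
   finally show ?thesis .
  qed
  ultimately have "\<bar>?p k\<bar> <= (n \<bullet> k)^2*(?D*?w k)" unfolding abs_mult by (intro mult_mono) auto
  then show "\<bar>?p k\<bar> <= ?D*((n \<bullet> k)^2*?w k)" by (simp only: mult.left_commute)
 qed
 also have "\<dots> = ?D*(\<Sum>k\<in>S - {0}. (n \<bullet> k)^2*?w k)" by (simp only: sum_distrib_left)
 also have "\<dots> <= ?D*(K*\<epsilon>^2*ZZ n)" unfolding ZZ_def by (intro mult_left_mono E1 D0) (use S in auto)
 finally show ?thesis by (simp only: mult.assoc)
qed

text \<open>The deviation from \<open>qq\<close> is Re(i a conj \<open>Xs\<close>)/(|k|
  \<open>tfac\<close>). As \<open>E2\<close> makes |\<open>Xs\<close>|^2 of order \<epsilon>^2,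
  Young's inequality with weights \<epsilon> and 1/\<epsilon> gives an error of order
  \<epsilon>.\<close>

lemma resonant_momentum:
 assumes n: "!!k. k \<in> Lam ==> n \<bullet> k \<in> \<int>"
 shows "\<bar>(\<Sum>k\<in>R. (n \<bullet> k)*Re (\<i>*a k * cnj (b k))) + sum (qq n) R\<bar> <= 1/(2*t0)*(1/kap ^ 3 + K)*\<epsilon>*ZZ n"
proof -
 let ?X = "%k. Xs h cs k (a k) (b k)"
 let ?z = "%k. (n \<bullet> k)^2*((norm k)^2*(cmod (a k))^2)" and ?x = "%k. (n \<bullet> k)^2*((cmod (?X k))^2/norm k)"
 have "\<bar>\<Sum>k\<in>R. (n \<bullet> k)*Re (\<i>*a k * cnj (b k)) + qq n k\<bar> <= (\<Sum>k\<in>R. 1/(2*t0)*(\<epsilon>/kap ^ 3*?z k + 1/\<epsilon>*?x k))"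
 proof (rule order_trans[OF sum_abs sum_mono])
  fix k assume k: "k \<in> R"
  then have kL: "k \<in> Lam" "k ~= 0" using R by auto
  have r: "kap <= norm k" "norm k > 0" using Lam_norm_ge[OF kL] kL by auto
  have t: "t0 <= tfac h k" "tfac h k > 0" using t0(1) t0(2)[OF kL] by auto
  let ?r = "norm k" and ?t = "tfac h k"
  have nk: "\<bar>n \<bullet> k\<bar> <= (n \<bullet> k)^2" by (rule Ints_abs_le_square[OF n[OF kL(1)]])
  have "Re (\<i>*a k * cnj (?X k)) = (?r*?t)*Re (\<i>*a k * cnj (b k)) + (cs \<bullet> k)*(cmod (a k))^2"
   unfolding Xs_def cmod_power2 by (simp add: power2_eq_square algebra_simps)
  then have rb: "Re (\<i>*a k * cnj (b k)) = (Re (\<i>*a k * cnj (?X k)) - (cs \<bullet> k)*(cmod (a k))^2)/(?r*?t)" using r t by (simp add: field_simps)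
  have "(n \<bullet> k)*Re (\<i>*a k * cnj (b k)) + qq n k = (n \<bullet> k)*(Re (\<i>*a k * cnj (?X k))/(?r*?t))"
  proof -
   have "m*q + m*u/d*A = m*(p/d)" if "q = (p - u*A)/d" for m q u d A p :: real unfolding that by (simp add: diff_divide_distrib right_diff_distrib)
   from this[OF rb] show ?thesis unfolding qq_def .
  qed
  then have "\<bar>(n \<bullet> k)*Re (\<i>*a k * cnj (b k)) + qq n k\<bar> = \<bar>n \<bullet> k\<bar>*(\<bar>Re (\<i>*a k * cnj (?X k))\<bar>/(?r*?t))"
   using r t by (simp add: abs_mult)
  also have "\<dots> <= (n \<bullet> k)^2*(1/(2*t0)*(\<epsilon>/kap ^ 3*(?r^2*(cmod (a k))^2) + 1/\<epsilon>*((cmod (?X k))^2/?r)))"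
  proof (rule mult_mono[OF nk])
   have "\<bar>Re (\<i>*a k * cnj (?X k))\<bar> <= cmod (a k) * cmod (?X k)" using abs_Re_le_cmod[of "\<i>*a k * cnj (?X k)"] by (simp add: norm_mult)
   also have "\<dots> <= 1/2*(\<epsilon>*(cmod (a k))^2 + 1/\<epsilon>*(cmod (?X k))^2)"
   proof -
    have "0 <= (\<epsilon> * cmod (a k) - cmod (?X k))^2/\<epsilon>" using eps by simp
    also have "\<dots> = \<epsilon>*(cmod (a k))^2 + 1/\<epsilon>*(cmod (?X k))^2 - 2*(cmod (a k) * cmod (?X k))"
     using eps by (simp add: power2_eq_square field_simps)
    finally have "0 <= \<dots>" .
    moreover have "Q <= 1/2*P" if "0 <= P - 2*Q" for P Q :: real using that by linarith
    ultimately show ?thesis by blast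
   qed
   finally have "\<bar>Re (\<i>*a k * cnj (?X k))\<bar>/(?r*?t) <= 1/2*(\<epsilon>*(cmod (a k))^2 + 1/\<epsilon>*(cmod (?X k))^2)/(?r*t0)"
    using r t t0(1) eps by (intro frac_le mult_left_mono) auto
   also have "\<dots> = 1/(2*t0)*(\<epsilon>*((cmod (a k))^2/?r) + 1/\<epsilon>*((cmod (?X k))^2/?r))"
    using r t0(1) by (simp add: add_divide_distrib algebra_simps)
   also have "\<dots> <= 1/(2*t0)*(\<epsilon>/kap ^ 3*(?r^2*(cmod (a k))^2) + 1/\<epsilon>*((cmod (?X k))^2/?r))"
   proof (intro mult_left_mono add_right_mono)
    have "kap ^ 3 <= ?r ^ 3" using r kap_pos by (intro power_mono) auto
    then have "kap ^ 3*(cmod (a k))^2 <= (?r*(?r^2))*(cmod (a k))^2" by (intro mult_right_mono) (auto simp: power2_eq_square power3_eq_cube)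
    then have "(cmod (a k))^2/?r <= (?r^2*(cmod (a k))^2)/kap ^ 3" using r kap_pos by (simp add: field_simps)
    then have "\<epsilon>*((cmod (a k))^2/?r) <= \<epsilon>*((?r^2*(cmod (a k))^2)/kap ^ 3)" using eps by (intro mult_left_mono) auto
    then show "\<epsilon>*((cmod (a k))^2/?r) <= \<epsilon>/kap ^ 3*(?r^2*(cmod (a k))^2)" by simp
   qed (use t0 in simp)
   finally show "\<bar>Re (\<i>*a k * cnj (?X k))\<bar>/(?r*?t) <= 1/(2*t0)*(\<epsilon>/kap ^ 3*(?r^2*(cmod (a k))^2) + 1/\<epsilon>*((cmod (?X k))^2/?r))" .
  qed (use r t in auto)
  finally show "\<bar>(n \<bullet> k)*Re (\<i>*a k * cnj (b k)) + qq n k\<bar> <= 1/(2*t0)*(\<epsilon>/kap ^ 3*?z k + 1/\<epsilon>*?x k)"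
   by (simp only: distrib_left mult.left_commute[of "(n \<bullet> k)^2"])
 qed
 also have "\<dots> = 1/(2*t0)*(\<epsilon>/kap ^ 3*ZZ n + 1/\<epsilon> * sum ?x R)" unfolding ZZ_def by (simp only: sum_distrib_left[symmetric] sum.distrib)
 also have "\<dots> <= 1/(2*t0)*(\<epsilon>/kap ^ 3*ZZ n + 1/\<epsilon>*(K*\<epsilon>^2*ZZ n))"
  using t0 eps E2[of n] unfolding ZZ_def by (intro mult_left_mono add_left_mono) auto
 also have "\<dots> = 1/(2*t0)*(1/kap ^ 3 + K)*\<epsilon>*ZZ n" using eps by (simp add: power2_eq_square algebra_simps)
 finally show ?thesis by (simp only: sum.distrib)
qed

lemma momentum_expansion:
 assumes n: "!!k. k \<in> Lam ==> n \<bullet> k \<in> \<int>"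
 shows "\<bar>n \<bullet> momentum v1 v2 \<eta> \<psi> + sum (qq n) R\<bar> <= K3*\<epsilon>*ZZ n"
proof -
 let ?p = "%k. (n \<bullet> k)*Re (\<i>*a k * cnj (b k))"
 let ?B = "1/2*(1/kap^2 + 1/kap)*K*\<epsilon>^2*ZZ n"
 have hs: "(?p has_sum (n \<bullet> momentum v1 v2 \<eta> \<psi> - sum ?p R)) (Lam - R)" by (rule has_sum_Diff[OF momentum_has_sum[OF w] has_sum_finite[OF R(1)] R(2)])
 have "n \<bullet> momentum v1 v2 \<eta> \<psi> - sum ?p R <= ?B" by (rule has_sum_le_finite_sums[OF hs order_trans[OF abs_ge_self high_modes_momentum[OF n]]])
 moreover have "- (n \<bullet> momentum v1 v2 \<eta> \<psi> - sum ?p R) <= ?B"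
 proof (rule has_sum_le_finite_sums)
  show "((%k. - ?p k) has_sum - (n \<bullet> momentum v1 v2 \<eta> \<psi> - sum ?p R)) (Lam - R)" using hs by (simp only: has_sum_uminus minus_minus)
  show "sum (%k. - ?p k) F <= ?B" if "finite F" "F \<subseteq> Lam - R" for F unfolding sum_negf using high_modes_momentum[OF n that] by (simp only: abs_le_iff)
 qed
 moreover have "?B <= 1/2*(1/kap^2 + 1/kap)*K*\<epsilon>*ZZ n"
 proof -
  have "\<epsilon>^2 <= \<epsilon>" using eps mult_left_mono[of \<epsilon> 1 \<epsilon>] by (simp add: power2_eq_square)
  then show ?thesis using kap_pos K ZZ_nonneg[of n] by (intro mult_right_mono mult_left_mono) auto
 qed
 moreover have "K3*\<epsilon>*ZZ n = 1/2*(1/kap^2 + 1/kap)*K*\<epsilon>*ZZ n + 1/(2*t0)*(1/kap ^ 3 + K)*\<epsilon>*ZZ n"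
  unfolding K3_def by (simp only: distrib_right)
 ultimately show ?thesis using resonant_momentum[OF n] by linarith
qed

text \<open>The error is compared with \<open>qq\<close> mode by mode. Both contain the factor
  |n.k|, so \<open>sm\<close> absorbs the error into half of the main term even if n.k = 0. Equality
  forces every \<open>qq\<close> to vanish, hence n.k = 0 or a = 0 on resonant modes.\<close>

lemma momentum_sign:
 assumes n: "!!k. k \<in> Lam ==> n \<bullet> k \<in> \<int>" and pos: "!!k. k \<in> R ==> 0 <= (n \<bullet> k)*(cs \<bullet> k)" and nz: "!!k. k \<in> R ==> cs \<bullet> k ~= 0"
  and sm: "!!k. k \<in> R ==> K3*\<epsilon>*(\<bar>n \<bullet> k\<bar>*(norm k)^2) <= 1/2*(\<bar>cs \<bullet> k\<bar>/(norm k*tfac h k))"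
 shows "n \<bullet> momentum v1 v2 \<eta> \<psi> <= 0" "n \<bullet> momentum v1 v2 \<eta> \<psi> = 0 ==> ZZ n = 0"
proof -
 have tp: "norm k*tfac h k > 0" if "k \<in> R" for k
 proof -
  have k: "k \<in> Lam" "k ~= 0" using that R by auto
  then show ?thesis using less_le_trans[OF t0(1) t0(2)[OF k]] by simp
 qed
 have q0: "0 <= qq n k" if "k \<in> R" for k unfolding qq_def by (rule mult_nonneg_nonneg[OF divide_nonneg_pos[OF pos[OF that] tp[OF that]]]) simp
 have "K3*\<epsilon>*ZZ n <= (\<Sum>k\<in>R. 1/2*qq n k)" unfolding ZZ_def sum_distrib_left
 proof (rule sum_mono)
  fix k assume k: "k \<in> R"
  have sq: "(n \<bullet> k)^2 = \<bar>n \<bullet> k\<bar>*\<bar>n \<bullet> k\<bar>" by (simp add: power2_eq_square)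
  have "K3*\<epsilon>*((n \<bullet> k)^2*((norm k)^2*(cmod (a k))^2)) = (K3*\<epsilon>*(\<bar>n \<bullet> k\<bar>*(norm k)^2))*(\<bar>n \<bullet> k\<bar>*(cmod (a k))^2)"
   unfolding sq by (simp only: mult_ac)
  also have "\<dots> <= (1/2*(\<bar>cs \<bullet> k\<bar>/(norm k*tfac h k)))*(\<bar>n \<bullet> k\<bar>*(cmod (a k))^2)" by (intro mult_right_mono sm k) simp
  also have "\<dots> = 1/2*(\<bar>(n \<bullet> k)*(cs \<bullet> k)\<bar>/(norm k*tfac h k)*(cmod (a k))^2)" by (simp add: abs_mult)
  also have "\<dots> = 1/2*qq n k" unfolding qq_def abs_of_nonneg[OF pos[OF k]] ..
  finally show "K3*\<epsilon>*((n \<bullet> k)^2*((norm k)^2*(cmod (a k))^2)) <= 1/2*qq n k" .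
 qed
 also have "\<dots> = 1/2 * sum (qq n) R" by (simp only: sum_distrib_left)
 finally have m: "n \<bullet> momentum v1 v2 \<eta> \<psi> <= - (1/2) * sum (qq n) R" using momentum_expansion[OF n] by (simp add: abs_le_iff)
 have s0: "0 <= sum (qq n) R" by (intro sum_nonneg q0)
 show "n \<bullet> momentum v1 v2 \<eta> \<psi> <= 0" using m s0 by linarith
 assume "n \<bullet> momentum v1 v2 \<eta> \<psi> = 0"
 then have "sum (qq n) R = 0" using m s0 by linarith
 then have "qq n k = 0" if "k \<in> R" for k using that R(1) q0 by (simp add: sum_nonneg_eq_0_iff)
 then have "n \<bullet> k = 0 \<or> a k = 0" if "k \<in> R" for k using that nz[OF that] tp[OF that] unfolding qq_def by fastforce
 then show "ZZ n = 0" unfolding ZZ_def by (intro sum.neutral) auto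
qed

end

section \<open>Normals of the resonant cone\<close>

definition det2 :: "real^2 => real^2 => real" where "det2 x y = x$1*y$2 - x$2*y$1"

lemma det2_zero_parallel:
 assumes "det2 j x = 0" "j ~= 0"
 shows "x = ((x \<bullet> j)/(j \<bullet> j)) *\<^sub>R j"
proof -
 have j: "j \<bullet> j ~= 0" using assms(2) by simp
 have d: "j$1*x$2 = j$2*x$1" using assms(1) unfolding det2_def by simp
 have "(j \<bullet> j)*x$1 = (x \<bullet> j)*j$1" "(j \<bullet> j)*x$2 = (x \<bullet> j)*j$2" unfolding inner_2 using d by (simp_all add: algebra_simps)
 then have "x$1 = (x \<bullet> j)/(j \<bullet> j)*j$1" "x$2 = (x \<bullet> j)/(j \<bullet> j)*j$2" using j by (simp_all add: field_simps)
 then show ?thesis by (simp add: vec2_eq_iff)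
qed

lemma orthogonal_det2_zero:
 assumes "n \<bullet> j = 0" "n \<bullet> x = 0" "(n::real^2) ~= 0"
 shows "det2 j x = 0"
proof -
 have a: "n$1*j$1 = - n$2*j$2" "n$1*x$1 = - n$2*x$2" using assms(1,2) unfolding inner_2 by auto
 have "n$1*det2 j x = (n$1*j$1)*x$2 - j$2*(n$1*x$1)" unfolding det2_def by (simp add: algebra_simps)
 also have "\<dots> = 0" unfolding a by simp
 finally have 1: "n$1*det2 j x = 0" .
 have b: "n$2*j$2 = - n$1*j$1" "n$2*x$2 = - n$1*x$1" using assms(1,2) unfolding inner_2 by auto
 have "n$2*det2 j x = j$1*(n$2*x$2) - (n$2*j$2)*x$1" unfolding det2_def by (simp add: algebra_simps)
 also have "\<dots> = 0" unfolding b by simp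
 finally have 2: "n$2*det2 j x = 0" .
 show ?thesis using 1 2 assms(3) by (auto simp: vec2_eq_iff)
qed

text \<open>In the half plane c.k > 0 the orientation of j and k is thereby decided by the slopes
  det2 c k/(c.k).\<close>

lemma det2_comparison: "(c \<bullet> c)*det2 j k = (c \<bullet> j)*det2 c k - (c \<bullet> k)*det2 c j"
 unfolding det2_def inner_2 by (simp add: algebra_simps)

lemma det2_combination: "det2 j1 j2 *\<^sub>R a = det2 a j2 *\<^sub>R j1 + det2 j1 a *\<^sub>R j2"
 unfolding vec2_eq_iff det2_def by (simp add: algebra_simps)

lemma neg_cone_1: assumes "finite V" "j \<in> V" "t <= 0" shows "t *\<^sub>R j \<in> neg_cone V"
proof -
 have "(\<Sum>k\<in>V. (if k = j then t else 0) *\<^sub>R k) = (\<Sum>k\<in>V. if k = j then t *\<^sub>R j else 0)" by (intro sum.cong) auto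
 also have "\<dots> = t *\<^sub>R j" using assms by simp
 finally show ?thesis unfolding neg_cone_def using assms(3) by (intro CollectI exI[of _ "%k. if k = j then t else 0"]) auto
qed

lemma neg_cone_add: assumes "x \<in> neg_cone V" "y \<in> neg_cone V" shows "x + y \<in> neg_cone V"
proof -
 obtain s t where "x = (\<Sum>j\<in>V. s j *\<^sub>R j)" "\<forall>j\<in>V. s j <= 0" "y = (\<Sum>j\<in>V. t j *\<^sub>R j)" "\<forall>j\<in>V. t j <= 0"
  using assms unfolding neg_cone_def by auto
 then show ?thesis unfolding neg_cone_def by (intro CollectI exI[of _ "%j. s j + t j"]) (auto simp: scaleR_add_left sum.distrib add_nonpos_nonpos)
qed

context lattice2
begin

text \<open>A multiple of j rotated by a right angle, scaled so that for j in the dual lattice it is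
  an integral combination of \<open>v1\<close>, \<open>v2\<close> and pairs integrally with the dual
  lattice.\<close>

definition perp :: "real^2 => real^2" where "perp j = (j \<bullet> v2) *\<^sub>R v1 - (j \<bullet> v1) *\<^sub>R v2"

lemma perp_inner: "perp j \<bullet> x = - dt*det2 j x"
 unfolding perp_def dt_def det2_def inner_diff_left inner_scaleR_left inner_2 by (simp add: algebra_simps)

lemma perp_nz: assumes "j ~= 0" shows "perp j ~= 0"
proof
 assume "perp j = 0"
 then have "j \<bullet> v2 = 0" "- (j \<bullet> v1) = 0" using indep[rule_format, of "j \<bullet> v2" "- (j \<bullet> v1)"] unfolding perp_def by auto
 then show False using w_expand[of j] assms by simp
qed

lemma perp_int: "j \<in> Lam ==> k \<in> Lam ==> perp j \<bullet> k \<in> \<int>"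
 unfolding perp_def inner_diff_left inner_scaleR_left inner_commute[of v1] inner_commute[of v2] dual_lat_iff by (intro Ints_diff Ints_mult) auto

lemma v_int: "k \<in> Lam ==> v1 \<bullet> k \<in> \<int>" "k \<in> Lam ==> v2 \<bullet> k \<in> \<int>"
 unfolding dual_lat_iff by (simp_all add: inner_commute)

lemma orthogonal_dual_vector:
 assumes n: "!!k. k \<in> Lam ==> n \<bullet> k \<in> \<int>" and nz: "n ~= 0"
 obtains j where "j \<in> Lam" "j ~= 0" "n \<bullet> j = 0"
proof (rule that[of "(n \<bullet> w2) *\<^sub>R w1 - (n \<bullet> w1) *\<^sub>R w2"])
 let ?j = "(n \<bullet> w2) *\<^sub>R w1 - (n \<bullet> w1) *\<^sub>R w2"
 have jv: "?j \<bullet> v1 = n \<bullet> w2" "?j \<bullet> v2 = - (n \<bullet> w1)" by (simp_all add: inner_diff_left w_v)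
 show "?j \<in> Lam" unfolding dual_lat_iff jv using n[OF w_Lam(1)] n[OF w_Lam(2)] by simp
 show "n \<bullet> ?j = 0" by (simp add: inner_diff_right)
 show "?j ~= 0"
 proof
  assume z: "?j = 0"
  have "n \<bullet> w2 = 0" "n \<bullet> w1 = 0" using jv[unfolded z] by (simp_all only: inner_zero_left neg_equal_0_iff_equal)
  then show False using v_expand[of n] nz by simp
 qed
qed

text \<open>All resonant vectors lie in c.k > 0, so the extreme ones are those of least and greatest
  slope, and the normals are their integral perpendiculars oriented towards the cone spanned by V.
  If all of V is collinear the cone is a ray, cut out by a pair of opposite normals and a third one
  along the ray.\<close>

lemma cone_normals:
 assumes V: "finite V" "V ~= {}" "V \<subseteq> Lam" "!!k. k \<in> V ==> c \<bullet> k > 0"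
 obtains N where "finite N" "0 \<notin> N" "N ~= {}" "!!n k. n \<in> N ==> k \<in> Lam ==> n \<bullet> k \<in> \<int>" "!!n k. n \<in> N ==> k \<in> V ==> 0 <= n \<bullet> k"
  "!!x. (!!n. n \<in> N ==> n \<bullet> x = 0) ==> x = 0" "!!a. (!!n. n \<in> N ==> n \<bullet> a <= 0) ==> a \<in> neg_cone V"
proof -
 define m where "m k = det2 c k/(c \<bullet> k)" for k
 have c0: "c \<bullet> c > 0" using V by (metis all_not_in_conv inner_gt_zero_iff inner_zero_left less_irrefl)
 have "Min (m ` V) \<in> m ` V" "Max (m ` V) \<in> m ` V" using V(1,2) by simp_all
 then obtain j1 j2 where j12: "j1 \<in> V" "m j1 = Min (m ` V)" "j2 \<in> V" "m j2 = Max (m ` V)" by (metis imageE)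
 have j1: "j1 \<in> V" "!!k. k \<in> V ==> m j1 <= m k" and j2: "j2 \<in> V" "!!k. k \<in> V ==> m k <= m j2" using j12 V(1) by simp_all
 have det: "det2 j k \<ge> 0" if "j \<in> V" "k \<in> V" "m j <= m k" for j k
 proof -
  have "(c \<bullet> k)*det2 c j <= (c \<bullet> j)*det2 c k" using that(3) V(4)[OF that(1)] V(4)[OF that(2)] unfolding m_def by (simp add: field_simps)
  then have "0 <= (c \<bullet> c)*det2 j k" unfolding det2_comparison by simp
  then show ?thesis using c0 by (simp add: zero_le_mult_iff)
 qed
 \<comment> \<open>Sign correction for the orientation of the basis: s \<open>perp j\<close> pairs
   with x to |dt| det2 j x.\<close>
 define s where "s = - sgn dt"
 have sdt: "s*(- dt*x) = \<bar>dt\<bar>*x" for x unfolding s_def by (simp add: abs_sgn mult_ac)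
 have adt: "\<bar>dt\<bar> > 0" using dt_nz by simp
 have sI: "s \<in> \<int>" "s ~= 0" unfolding s_def using dt_nz by (auto simp: sgn_if)
 have L: "j1 \<in> Lam" "j2 \<in> Lam" using j1 j2 V by auto
 have nz: "j1 ~= 0" "j2 ~= 0" using V(4)[OF j1(1)] V(4)[OF j2(1)] by auto
 define n1 where "n1 = s *\<^sub>R perp j1"
 define n2 where "n2 = - s *\<^sub>R perp j2"
 have n1: "n1 \<bullet> x = \<bar>dt\<bar>*det2 j1 x" for x unfolding n1_def by (simp only: inner_scaleR_left perp_inner sdt)
 have n2: "n2 \<bullet> x = \<bar>dt\<bar>*det2 x j2" for x unfolding n2_def using sdt[of "det2 j2 x"] by (simp add: perp_inner det2_def algebra_simps)
 have nI: "n1 \<bullet> k \<in> \<int>" "n2 \<bullet> k \<in> \<int>" if "k \<in> Lam" for k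
  unfolding n1_def n2_def inner_scaleR_left using perp_int[OF L(1) that] perp_int[OF L(2) that] sI by (auto intro: Ints_mult Ints_minus)
 have n0: "n1 ~= 0" "n2 ~= 0" unfolding n1_def n2_def using perp_nz nz sI by simp_all
 show ?thesis
 proof (cases "det2 j1 j2 = 0")
  case False
  then have d: "det2 j1 j2 > 0" using det[OF j1(1) j2(1) j1(2)[OF j2(1)]] by simp
  have comb: "a = (det2 a j2/det2 j1 j2) *\<^sub>R j1 + (det2 j1 a/det2 j1 j2) *\<^sub>R j2" for a
  proof -
   have "a = (1/det2 j1 j2) *\<^sub>R (det2 j1 j2 *\<^sub>R a)" using d by simp
   then show ?thesis unfolding det2_combination[of j1 j2 a] by (simp add: scaleR_add_right)
  qed
  show ?thesis
  proof (rule that[of "{n1, n2}"])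
   show "0 <= n \<bullet> k" if "n \<in> {n1,n2}" "k \<in> V" for n k
    using that det[OF j1(1) that(2) j1(2)[OF that(2)]] det[OF that(2) j2(1) j2(2)[OF that(2)]] adt by (auto simp: n1 n2)
   fix a
   show "a = 0" if z: "!!n. n \<in> {n1,n2} ==> n \<bullet> a = 0" using z[of n1] z[of n2] adt comb[of a] by (simp add: n1 n2)
   assume le: "!!n. n \<in> {n1,n2} ==> n \<bullet> a <= 0"
   have "det2 j1 a <= 0" "det2 a j2 <= 0" using le[of n1] le[of n2] adt by (auto simp: n1 n2 mult_le_0_iff)
   then have "det2 j1 a/det2 j1 j2 <= 0" "det2 a j2/det2 j1 j2 <= 0" using d by (auto simp: divide_le_0_iff)
   then show "a \<in> neg_cone V" by (subst comb) (intro neg_cone_add neg_cone_1 V(1) j1(1) j2(1))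
  qed (use nI n0 in auto)
 next
  case True
  have par: "det2 j1 k = 0" "k = ((c \<bullet> k)/(c \<bullet> j1)) *\<^sub>R j1" if k: "k \<in> V" for k
  proof -
   have "m j1 = m j2"
   proof -
    have "(c \<bullet> j1)*det2 c j2 = (c \<bullet> j2)*det2 c j1" using True det2_comparison[of c j1 j2] by simp
    then show ?thesis unfolding m_def using V(4)[OF j1(1)] V(4)[OF j2(1)] by (simp add: field_simps)
   qed
   then have "m k = m j1" using j1(2)[OF k] j2(2)[OF k] by simp
   then have "(c \<bullet> j1)*det2 c k = (c \<bullet> k)*det2 c j1" unfolding m_def using V(4)[OF j1(1)] V(4)[OF k] by (simp add: field_simps)
   then have "(c \<bullet> c)*det2 j1 k = 0" unfolding det2_comparison by simp
   then show z: "det2 j1 k = 0" using c0 by simp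
   have e: "k = ((k \<bullet> j1)/(j1 \<bullet> j1)) *\<^sub>R j1" by (rule det2_zero_parallel[OF z nz(1)])
   have "c \<bullet> k = ((k \<bullet> j1)/(j1 \<bullet> j1))*(c \<bullet> j1)" using arg_cong[OF e, of "%x. c \<bullet> x"] by simp
   then show "k = ((c \<bullet> k)/(c \<bullet> j1)) *\<^sub>R j1" using e V(4)[OF j1(1)] by simp
  qed
  \<comment> \<open>One of \<open>v1\<close>, \<open>v2\<close> is not orthogonal to j1; up to sign
    it is the third normal.\<close>
  obtain n' where n': "n' ~= 0" "n' \<bullet> j1 > 0" "!!k. k \<in> Lam ==> n' \<bullet> k \<in> \<int>"
  proof -
   have "v1 \<bullet> j1 ~= 0 \<or> v2 \<bullet> j1 ~= 0" using w_expand[of j1] nz(1) by (auto simp: inner_commute)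
   then obtain v where v: "v \<bullet> j1 ~= 0" "!!k. k \<in> Lam ==> v \<bullet> k \<in> \<int>" using v_int by blast
   show ?thesis
   proof (rule that[of "sgn (v \<bullet> j1) *\<^sub>R v"])
    show "sgn (v \<bullet> j1) *\<^sub>R v ~= 0" using v(1) by (auto simp: sgn_if)
    show "sgn (v \<bullet> j1) *\<^sub>R v \<bullet> j1 > 0" using v(1) by (auto simp: sgn_if)
    show "sgn (v \<bullet> j1) *\<^sub>R v \<bullet> k \<in> \<int>" if "k \<in> Lam" for k using v(2)[OF that] by (auto simp: sgn_if)
   qed
  qed
  have onl: "x = ((x \<bullet> j1)/(j1 \<bullet> j1)) *\<^sub>R j1" if "n1 \<bullet> x = 0" for x using that adt by (intro det2_zero_parallel nz) (auto simp: n1)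
  show ?thesis
  proof (rule that[of "{n1, - n1, n'}"])
   show "0 <= n \<bullet> k" if n: "n \<in> {n1, - n1, n'}" and k: "k \<in> V" for n k
   proof -
    have "n' \<bullet> k = ((c \<bullet> k)/(c \<bullet> j1))*(n' \<bullet> j1)" using arg_cong[OF par(2)[OF k], of "%x. n' \<bullet> x"] by simp
    then have "n' \<bullet> k > 0" using V(4)[OF k] V(4)[OF j1(1)] n'(2) by simp
    moreover have "n1 \<bullet> k = 0" unfolding n1 par(1)[OF k] by simp
    ultimately show ?thesis using n by auto
   qed
   fix a
   show "a = 0" if z: "!!n. n \<in> {n1, - n1, n'} ==> n \<bullet> a = 0"
   proof -
    have e: "a = ((a \<bullet> j1)/(j1 \<bullet> j1)) *\<^sub>R j1" using z[of n1] by (intro onl) simp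
    have "((a \<bullet> j1)/(j1 \<bullet> j1))*(n' \<bullet> j1) = 0" using z[of n'] arg_cong[OF e, of "%x. n' \<bullet> x"] by simp
    then have z0: "(a \<bullet> j1)/(j1 \<bullet> j1) = 0" using n'(2) by (simp only: mult_eq_0_iff) simp
    show ?thesis using e unfolding z0 by simp
   qed
   assume le: "!!n. n \<in> {n1, - n1, n'} ==> n \<bullet> a <= 0"
   have e: "a = ((a \<bullet> j1)/(j1 \<bullet> j1)) *\<^sub>R j1" using le[of n1] le[of "- n1"] by (intro onl) simp
   have "((a \<bullet> j1)/(j1 \<bullet> j1))*(n' \<bullet> j1) <= 0" using le[of n'] arg_cong[OF e, of "%x. n' \<bullet> x"] by simp
   then have "(a \<bullet> j1)/(j1 \<bullet> j1) <= 0" using n'(2) unfolding mult_le_0_iff by linarith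
   then show "a \<in> neg_cone V" by (subst e) (intro neg_cone_1 V(1) j1(1))
  qed (use nI n0 n' in auto)
 qed
qed

text \<open>All surviving k are multiples of one dual vector j, so k.x depends only on the
  projection of x on j.\<close>

lemma modes_on_line_two_d:
 assumes w: "wser \<eta> a" "wser \<psi> b" and n: "n ~= 0" "!!k. k \<in> Lam ==> n \<bullet> k \<in> \<int>"
  and z: "!!k. k \<in> Lam ==> n \<bullet> k ~= 0 ==> a k = 0 \<and> b k = 0"
 shows "two_d_wave v1 v2 \<eta> \<psi>"
proof -
 obtain j where j: "j \<in> Lam" "j ~= 0" "n \<bullet> j = 0" using orthogonal_dual_vector[OF n(2,1)] by blast
 let ?e = "(1/norm j) *\<^sub>R j"
 have key: "f x = f ((x \<bullet> ?e) *\<^sub>R ?e)" if f: "wser f u" and u: "!!k. k \<in> Lam ==> n \<bullet> k ~= 0 ==> u k = 0" for f u x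
 proof -
  have "k \<bullet> ((x \<bullet> ?e) *\<^sub>R ?e) = k \<bullet> x" if "k \<in> Lam" "n \<bullet> k = 0" for k
  proof -
   have k: "k = ((k \<bullet> j)/(j \<bullet> j)) *\<^sub>R j" by (rule det2_zero_parallel[OF orthogonal_det2_zero[OF j(3) that(2) n(1)] j(2)])
   have jj: "norm j*norm j = j \<bullet> j" by (simp add: dot_square_norm power2_eq_square)
   have "(x \<bullet> ?e) *\<^sub>R ?e = ((x \<bullet> j)/(j \<bullet> j)) *\<^sub>R j" by (simp add: jj)
   then have 1: "k \<bullet> ((x \<bullet> ?e) *\<^sub>R ?e) = (x \<bullet> j)/(j \<bullet> j)*(k \<bullet> j)" by (simp only: inner_scaleR_right)
   have "k \<bullet> x = (k \<bullet> j)/(j \<bullet> j)*(j \<bullet> x)" using arg_cong[OF k, of "%y. y \<bullet> x"] by (simp only: inner_scaleR_left)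
   then show ?thesis unfolding 1 by (simp add: inner_commute[of j x])
  qed
  then have t: "u k * cis (k \<bullet> ((x \<bullet> ?e) *\<^sub>R ?e)) = u k * cis (k \<bullet> x)" if "k \<in> Lam" for k
   using u[OF that] that by (cases "n \<bullet> k = 0") auto
  have "((%k. u k * cis (k \<bullet> x)) has_sum complex_of_real (f ((x \<bullet> ?e) *\<^sub>R ?e))) Lam"
   using wser_sum[OF f, of "(x \<bullet> ?e) *\<^sub>R ?e"] t by (simp only: has_sum_cong[OF t])
  from has_sum_unique[OF wser_sum[OF f, of x] this] show ?thesis by simp
 qed
 show ?thesis unfolding two_d_wave_def using j(1,2) key[OF w(1)] key[OF w(2)] z by (intro bexI[of _ j]) (blast, simp)
qed

text \<open>f is invariant under translations orthogonal to j. One of them, along n, has phase k.d =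
  pi and reverses the sign of mode k.\<close>

lemma two_d_modes:
 assumes f: "wser f a" and j: "j ~= 0" and two: "!!x. f x = f ((x \<bullet> ((1/norm j) *\<^sub>R j)) *\<^sub>R ((1/norm j) *\<^sub>R j))"
  and n: "n \<bullet> j = 0" and k: "k \<in> Lam" "n \<bullet> k ~= 0"
 shows "a k = 0"
proof -
 let ?d = "(pi/(k \<bullet> n)) *\<^sub>R n"
 have "f (x + ?d) = f x" for x using two[of "x + ?d"] two[of x] n by (simp add: inner_add_left)
 then have "wser f (%k. a k * cis (k \<bullet> ?d))" using wser_shift[OF f, of ?d] by simp
 from wser_coeff[OF this k(1)] wser_coeff[OF f k(1)] have "a k = a k * cis (k \<bullet> ?d)" by simp
 also have "k \<bullet> ?d = pi" using k(2) by (simp add: inner_commute)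
 finally show ?thesis by simp
qed

end

section \<open>The main theorem\<close>

context mode_estimates
begin

lemma wave_conclusions:
 assumes V: "V ~= {}" "V \<subseteq> Lam" "!!k. k \<in> V ==> cs \<bullet> k > 0" "R = V \<union> uminus ` V"
  and N: "finite N" "0 \<notin> N" "N ~= {}" "!!n k. n \<in> N ==> k \<in> Lam ==> n \<bullet> k \<in> \<int>" "!!n k. n \<in> N ==> k \<in> V ==> 0 <= n \<bullet> k"
   "!!x. (!!n. n \<in> N ==> n \<bullet> x = 0) ==> x = 0" "!!a. (!!n. n \<in> N ==> n \<bullet> a <= 0) ==> a \<in> neg_cone V"
  and sm: "!!n k. n \<in> N ==> k \<in> R ==> K3*\<epsilon>*(\<bar>n \<bullet> k\<bar>*(norm k)^2) <= 1/2*(\<bar>cs \<bullet> k\<bar>/(norm k*tfac h k))"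
 defines "m \<equiv> momentum v1 v2 \<eta> \<psi>"
 shows "m \<in> neg_cone V" "m \<in> frontier (neg_cone V) ==> two_d_wave v1 v2 \<eta> \<psi>"
  "m = 0 ==> k \<in> Lam ==> k ~= 0 ==> a k = 0 \<and> b k = 0"
  "\<not> (\<exists>j\<in>V. \<exists>t::real. m = t *\<^sub>R j) ==> \<not> two_d_wave v1 v2 \<eta> \<psi>"
proof -
 have pos: "0 <= (n \<bullet> k)*(cs \<bullet> k)" "cs \<bullet> k ~= 0" if nk: "n \<in> N" "k \<in> R" for n k
 proof -
  have vp: "0 <= (n \<bullet> j)*(cs \<bullet> j)" "cs \<bullet> j ~= 0" if "j \<in> V" for j
   using mult_nonneg_nonneg[OF N(5)[OF nk(1) that] less_imp_le[OF V(3)[OF that]]] V(3)[OF that] by simp_all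
  consider "k \<in> V" | j where "j \<in> V" "k = - j" using nk(2) unfolding V(4) by auto
  then show "0 <= (n \<bullet> k)*(cs \<bullet> k)" "cs \<bullet> k ~= 0" by (cases; simp add: vp)+
 qed
 obtain n0 where n0: "n0 \<in> N" using N(3) by blast
 have sign: "n \<bullet> m <= 0" and zero: "n \<bullet> m = 0 ==> ZZ n = 0" if n: "n \<in> N" for n
  unfolding m_def using momentum_sign[OF N(4)[OF n] pos(1)[OF n] pos(2)[OF n] sm[OF n]] by simp_all
 show "m \<in> neg_cone V" by (rule N(7)[OF sign])
 have line: "two_d_wave v1 v2 \<eta> \<psi>" if n: "n \<in> N" "n \<bullet> m = 0" for n
 proof (rule modes_on_line_two_d[OF w _ N(4)[OF n(1)]])
  show "n ~= 0" using n N(2) by auto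
  show "a k = 0 \<and> b k = 0" if "k \<in> Lam" "n \<bullet> k ~= 0" for k by (rule vanish[OF zero[OF n] that])
 qed
 \<comment> \<open>If u were not 2d, all inequalities n.m <= 0 would be strict; finitely many open
   half planes then form a neighbourhood of m inside the cone.\<close>
 show "two_d_wave v1 v2 \<eta> \<psi>" if fr: "m \<in> frontier (neg_cone V)"
 proof (rule ccontr)
  assume "\<not> two_d_wave v1 v2 \<eta> \<psi>"
  then have lt: "n \<bullet> m < 0" if "n \<in> N" for n using line[OF that] sign[OF that] by force
  let ?U = "\<Inter>n\<in>N. {x. n \<bullet> x < 0}"
  have "open ?U" by (intro open_INT N(1) ballI open_halfspace_lt)
  moreover have "?U \<subseteq> neg_cone V" by (rule subsetI, rule N(7)) (auto simp: less_imp_le)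
  moreover have "m \<in> ?U" using lt by blast
  ultimately have "m \<in> interior (neg_cone V)" using interior_maximal by blast
  then show False using fr unfolding frontier_def by blast
 qed
 show "a k = 0 \<and> b k = 0" if z: "m = 0" and k: "k \<in> Lam" "k ~= 0"
 proof -
  obtain n where n: "n \<in> N" "n \<bullet> k ~= 0" using N(6)[of k] k(2) by blast
  have "ZZ n = 0" by (rule zero[OF n(1)]) (simp add: z)
  then show ?thesis by (rule vanish[OF _ k(1) n(2)])
 qed
 assume nc: "\<not> (\<exists>j\<in>V. \<exists>t::real. m = t *\<^sub>R j)"
 show "\<not> two_d_wave v1 v2 \<eta> \<psi>"
 proof
  assume "two_d_wave v1 v2 \<eta> \<psi>"
  then obtain j where j: "j \<in> Lam" "j ~= 0"
   and tw: "!!x. \<eta> x = \<eta> ((x \<bullet> ((1/norm j) *\<^sub>R j)) *\<^sub>R ((1/norm j) *\<^sub>R j))" "!!x. \<psi> x = \<psi> ((x \<bullet> ((1/norm j) *\<^sub>R j)) *\<^sub>R ((1/norm j) *\<^sub>R j))"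
   unfolding two_d_wave_def by blast
  let ?n = "perp j"
  have nj: "?n \<bullet> j = 0" unfolding perp_inner det2_def by simp
  have n0: "?n ~= 0" by (rule perp_nz[OF j(2)])
  have az: "a k = 0" if "k \<in> Lam" "?n \<bullet> k ~= 0" for k by (rule two_d_modes[OF w(1) j(2) tw(1) nj that])
  have "((%k. (?n \<bullet> k)*Re (\<i>*a k * cnj (b k))) has_sum ?n \<bullet> m) Lam" unfolding m_def by (rule momentum_has_sum[OF w])
  moreover have "((%k. (?n \<bullet> k)*Re (\<i>*a k * cnj (b k))) has_sum 0) Lam"
   by (rule has_sum_0) (use az in \<open>metis complex_cnj_zero mult_eq_0_iff mult_zero_right zero_complex.simps(1)\<close>)
  ultimately have nm: "?n \<bullet> m = 0" by (rule has_sum_unique)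
  have mj: "m = ((m \<bullet> j)/(j \<bullet> j)) *\<^sub>R j" by (rule det2_zero_parallel[OF orthogonal_det2_zero[OF nj nm n0] j(2)])
  \<comment> \<open>m is parallel to j. If a resonant vector is parallel to j, m is a multiple of
    it. Otherwise all resonant amplitudes vanish, so every \<open>ZZ n\<close> is 0 and m = 0, which
    is the multiple 0 of any resonant vector.\<close>
  show False
  proof (cases "\<exists>k\<in>V. ?n \<bullet> k = 0")
   case True
   then obtain k where k: "k \<in> V" "?n \<bullet> k = 0" by blast
   have k0: "k ~= 0" using V(3)[OF k(1)] by auto
   have "m = ((m \<bullet> k)/(k \<bullet> k)) *\<^sub>R k" by (rule det2_zero_parallel[OF orthogonal_det2_zero[OF k(2) nm n0] k0])
   then show False using nc k(1) by blast
  next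
   case False
   have "a k = 0" if "k \<in> R" for k
   proof (rule az)
    show "k \<in> Lam" using that R(2) by auto
    show "?n \<bullet> k ~= 0" using that False unfolding V(4) by auto
   qed
   then have ZZ0: "ZZ n = 0" for n unfolding ZZ_def by simp
   have "m = 0"
   proof (rule N(6))
    fix n assume n: "n \<in> N"
    have "((%k. (n \<bullet> k)*Re (\<i>*a k * cnj (b k))) has_sum n \<bullet> m) Lam" unfolding m_def by (rule momentum_has_sum[OF w])
    moreover have "((%k. (n \<bullet> k)*Re (\<i>*a k * cnj (b k))) has_sum 0) Lam"
    proof (rule has_sum_0)
     fix k assume "k \<in> Lam"
     then show "(n \<bullet> k)*Re (\<i>*a k * cnj (b k)) = 0" using vanish[OF ZZ0, of k n] by (cases "n \<bullet> k = 0") auto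
    qed
    ultimately show "n \<bullet> m = 0" by (rule has_sum_unique)
   qed
   moreover obtain k where "k \<in> V" using V(1) by blast
   moreover have "(0::real^2) = 0 *\<^sub>R k" for k by simp
   ultimately show False using nc by blast
  qed
 qed
qed

end

context lattice2
begin

lemma wser_constant:
 assumes "wser f a" "!!k. k \<in> Lam ==> k ~= 0 ==> a k = 0"
 shows "f x = f y"
proof -
 have eq: "a k * cis (k \<bullet> x) = a k * cis (k \<bullet> y)" if "k \<in> Lam" for k using assms(2)[OF that] by (cases "k = 0") auto
 have "((%k. a k * cis (k \<bullet> x)) has_sum complex_of_real (f y)) Lam" using wser_sum[OF assms(1), of y] by (simp only: has_sum_cong[OF eq])
 from has_sum_unique[OF wser_sum[OF assms(1), of x] this] show ?thesis by simp
qed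

lemma resonant_res_set:
 fixes cs :: "real^2"
 assumes h: "h > 0" and g: "g > 0" "\<kappa> > 0"
 defines "V \<equiv> resonant g \<kappa> h v1 v2 cs"
 shows "k \<in> V ==> cs \<bullet> k > 0" "V \<subseteq> Lam" "res_set g \<kappa> h cs = V \<union> uminus ` V"
proof -
 let ?A = "%k. (g + \<kappa>*(norm k)^2)*norm k*tfac h k"
 obtain t0 where t0: "t0 > 0" "!!k. k \<in> Lam ==> k ~= 0 ==> t0 <= tfac h k" using tfac_bounds[OF h] by blast
 have A: "?A k > 0" if "k \<in> Lam" "k ~= 0" for k using that t0(1) t0(2)[OF that] g by (intro mult_pos_pos add_pos_nonneg) auto
 have om: "omega g \<kappa> h k = sqrt (?A k)" for k unfolding omega_def tfac_def ..
 show pos: "cs \<bullet> k > 0" if "k \<in> V" for k using that A[of k] real_sqrt_gt_zero[OF A, of k] unfolding V_def resonant_def om by auto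
 show sub: "V \<subseteq> Lam" unfolding V_def resonant_def by auto
 have VR: "k \<in> V \<longleftrightarrow> k \<in> Lam \<and> k ~= 0 \<and> ?A k = (cs \<bullet> k)^2 \<and> 0 <= cs \<bullet> k" for k
 proof
  assume k: "k \<in> V"
  then have kl: "k \<in> Lam" "k ~= 0" and e: "sqrt (?A k) = cs \<bullet> k" unfolding V_def resonant_def om by auto
  show "k \<in> Lam \<and> k ~= 0 \<and> ?A k = (cs \<bullet> k)^2 \<and> 0 <= cs \<bullet> k"
   using kl pos[OF k] real_sqrt_pow2[of "?A k"] A[OF kl] unfolding e by simp
 next
  assume "k \<in> Lam \<and> k ~= 0 \<and> ?A k = (cs \<bullet> k)^2 \<and> 0 <= cs \<bullet> k"
  then show "k \<in> V" unfolding V_def resonant_def om by simp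
 qed
 have Am: "?A (- k) = ?A k" for k by (simp add: tfac_def)
 show "res_set g \<kappa> h cs = V \<union> uminus ` V"
 proof (intro set_eqI iffI)
  fix k assume "k \<in> res_set g \<kappa> h cs"
  then have k: "k \<in> Lam" "k ~= 0" "?A k = (cs \<bullet> k)^2" unfolding res_set_def by auto
  show "k \<in> V \<union> uminus ` V"
  proof (cases "0 <= cs \<bullet> k")
   case True then show ?thesis using k VR by blast
  next
   case False
   then have "- k \<in> V" using k Am[of k] VR[of "- k"] by simp
   then have "- (- k) \<in> uminus ` V" by (rule imageI)
   then show ?thesis by simp
  qed
 next
  fix k assume "k \<in> V \<union> uminus ` V"
  then have "k \<in> V \<or> - k \<in> V" by auto
  then show "k \<in> res_set g \<kappa> h cs" using VR[of k] VR[of "- k"] Am[of k] unfolding res_set_def by auto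
 qed
qed

text \<open>The factor 2 bounds the gradient by the sum of its two components.\<close>

lemma wser_small:
 assumes w: "wser f a" and e: "wnorm 0 a <= \<epsilon>" "2*wnorm 1 a <= \<epsilon>" "2*wnorm 2 a <= \<epsilon>"
 shows "\<bar>f x\<bar> <= \<epsilon>" "norm (grad2 f x) <= \<epsilon>" "C1b (pd i f) \<epsilon>"
proof -
 note pd = wser_has_derivative(2)
 show "\<bar>f x\<bar> <= \<epsilon>" using wser_bound[OF w, of x] e by linarith
 have gr: "norm (grad2 u x) <= 2*wnorm (Suc 0) c" if "wser u c" for u c x
 proof -
  have "\<bar>pd i u x\<bar> <= wnorm (Suc 0) c" for i using order_trans[OF wser_bound[OF pd[OF that]] wnorm_pd[OF that]] .
  from this[of 1] this[of 2] show ?thesis using norm_le_l1_cart[of "grad2 u x"] by (simp add: sum_2 grad2_def)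
 qed
 show "norm (grad2 f x) <= \<epsilon>" using gr[OF w, of x] e by simp
 show "C1b (pd i f) \<epsilon>"
 proof (rule C1b_wser[OF pd[OF w]])
  fix x
  show "\<bar>pd i f x\<bar> <= \<epsilon>" using order_trans[OF wser_bound[OF pd[OF w]] wnorm_pd[OF w], of i x] e wnorm_nonneg[of 1 a] by simp
  have "wnorm (Suc 0) (%k. \<i> * of_real (k$i)*a k) <= wnorm 2 a" using wnorm_pd[OF w, of "Suc 0" i] by (simp add: numeral_2_eq_2)
  then show "norm (grad2 (pd i f) x) <= \<epsilon>" using gr[OF pd[OF w], of i x] e by linarith
 qed
qed

end

theorem theorem1p3:
  fixes g \<kappa> \<sigma> s :: real and h :: ereal and v1 v2 cs :: "real^2"
  assumes "g > 0" and "\<kappa> > 0" and "h > 0"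
    and "\<forall>a b :: real. a *\<^sub>R v1 + b *\<^sub>R v2 = 0 \<longrightarrow> a = 0 \<and> b = 0"
    and "\<sigma> > 0" and "s \<ge> 7/2" and "s + 1/2 \<in> \<nat>"
    and "resonant g \<kappa> h v1 v2 cs \<noteq> {}"
  shows "\<exists>\<delta>>0. \<forall>\<eta> \<psi> (c :: real^2).
     (\<eta>, \<psi>) \<in> Xsp \<sigma> s v1 v2 \<and> stokes_wave g \<kappa> h v1 v2 c \<eta> \<psi> \<and>
     norm (c - cs) < \<delta> \<and> Xnorm \<sigma> s v1 v2 \<eta> \<psi> < \<delta> \<longrightarrow>
     (let a = momentum v1 v2 \<eta> \<psi>; C = neg_cone (resonant g \<kappa> h v1 v2 cs) in
        a \<in> C \<and>
        (a \<in> frontier C \<longrightarrow> two_d_wave v1 v2 \<eta> \<psi>) \<and>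
        (a = 0 \<longrightarrow> (\<forall>x. \<eta> x = 0 \<and> \<psi> x = 0)) \<and>
        (a \<in> interior C \<and> \<not> (\<exists>j \<in> resonant g \<kappa> h v1 v2 cs. \<exists>t::real. a = t *\<^sub>R j)
           \<longrightarrow> \<not> two_d_wave v1 v2 \<eta> \<psi>))"
proof -
 interpret lattice2 v1 v2 by unfold_locales (rule assms(4))
 note g = assms(1,2) and h = assms(3)
 let ?V = "resonant g \<kappa> h v1 v2 cs" and ?R = "res_set g \<kappa> h cs"
 note VR = resonant_res_set[OF h g, where cs=cs]
 have finR: "finite ?R" by (rule linear_estimates(1)[OF h g])
 have finV: "finite ?V" using finR unfolding VR(3) by simp
 have R: "?R \<subseteq> Lam" "0 \<notin> ?R" unfolding res_set_def by auto
 obtain N where N: "finite N" "0 \<notin> N" "N ~= {}" "!!n k. n \<in> N ==> k \<in> Lam ==> n \<bullet> k \<in> \<int>" "!!n k. n \<in> N ==> k \<in> ?V ==> 0 <= n \<bullet> k"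
  "!!x. (!!n. n \<in> N ==> n \<bullet> x = 0) ==> x = 0" "!!a. (!!n. n \<in> N ==> n \<bullet> a <= 0) ==> a \<in> neg_cone ?V"
  using cone_normals[OF finV assms(8) VR(2) VR(1)] by blast
 obtain t0 where t0: "t0 > 0" "!!k. k \<in> Lam ==> k ~= 0 ==> t0 <= tfac h k" using tfac_bounds[OF h] by blast
 obtain L where L0: "L > 0" and L:
   "!!k a b. k \<in> Lam ==> k ~= 0 ==> k \<notin> ?R ==>
   (norm k)^2*(cmod a)^2 + norm k*(cmod b)^2 <= L*((cmod (Xs h cs k a b))^2/norm k + (cmod (Ys g \<kappa> cs k a b))^2/(norm k)^2)"
   "!!k a b. k \<in> Lam ==> k ~= 0 ==> norm k*(cmod b)^2 <= L*((cmod (Xs h cs k a b))^2/norm k + (norm k)^2*(cmod a)^2)"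
  using linear_estimates(2)[OF h g, of cs] by blast
 obtain l where l: "0 < l" "l <= 1" "ereal l <= h"
 proof (cases "h = \<infinity>")
  case True then show ?thesis using that[of 1] by simp
 next
  case False
  then obtain r where "h = ereal r" using h by (cases h) auto
  then show ?thesis using that[of "min 1 r"] h by auto
 qed
 \<comment> \<open>Bounds every admissible speed, since |c - cs| will be less than 1.\<close>
 define C where "C = norm cs + 1"
 define K where "K = 2*(1 + L)^2*est_const l \<kappa> C (2*C + 3)"
 define K3 where "K3 = 1/2*(1/kap^2 + 1/kap)*K + 1/(2*t0)*(1/kap ^ 3 + K)"
 have C0: "0 <= C" unfolding C_def by (simp add: add_nonneg_nonneg)
 have K0: "K \<ge> 0" unfolding K_def est_const_def using C0 kap_pos L0 by (intro mult_nonneg_nonneg add_nonneg_nonneg) auto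
 \<comment> \<open>All smallness conditions are stated linearly in \<epsilon>, finitely many of
   them, so one \<epsilon> meets them together; the quadratic one in \<open>tiny\<close> follows
   because \<epsilon> < 1.\<close>
 have ev: "\<forall>\<^sub>F \<epsilon> in at_right (0::real). A*\<epsilon> < B" if "B > 0" for A B :: real
 proof -
  have "((%\<epsilon>. A*\<epsilon>) \<longlongrightarrow> A*0) (at_right 0)" by (intro tendsto_intros)
  then show ?thesis using that by (intro order_tendstoD(2)[of _ 0]) auto
 qed
 have rhs: "1/2*(\<bar>cs \<bullet> k\<bar>/(norm k*tfac h k)) > 0" if "k \<in> ?R" for k
 proof -
  have k: "k \<in> Lam" "k ~= 0" using that R by auto
  have "cs \<bullet> k ~= 0" using that VR(1) unfolding VR(3) by force
  moreover have "0 < norm k*tfac h k" using k less_le_trans[OF t0(1) t0(2)[OF k]] by simp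
  ultimately show ?thesis by simp
 qed
 have "\<forall>\<^sub>F \<epsilon> in at_right (0::real). \<forall>n\<in>N. \<forall>k\<in>?R. (K3*(\<bar>n \<bullet> k\<bar>*(norm k)^2))*\<epsilon> < 1/2*(\<bar>cs \<bullet> k\<bar>/(norm k*tfac h k))"
  by (intro eventually_ball_finite N(1) finR ballI ev rhs)
 then have "\<forall>\<^sub>F \<epsilon> in at_right (0::real). 0 < \<epsilon> \<and> 1*\<epsilon> < 1 \<and> (1 + 3/l)*\<epsilon> < 1/16 \<and> 3*\<epsilon> < l \<and> (4*L*est_const l \<kappa> C (2*C + 3))*\<epsilon> < 1 \<and>
  (\<forall>n\<in>N. \<forall>k\<in>?R. (K3*(\<bar>n \<bullet> k\<bar>*(norm k)^2))*\<epsilon> < 1/2*(\<bar>cs \<bullet> k\<bar>/(norm k*tfac h k)))"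
  using l by (intro eventually_conj ev eventually_at_right_less) auto
 from eventually_happens'[OF trivial_limit_at_right_real this]
 obtain \<epsilon> where ee: "0 < \<epsilon> \<and> 1*\<epsilon> < 1 \<and> (1 + 3/l)*\<epsilon> < 1/16 \<and> 3*\<epsilon> < l \<and> (4*L*est_const l \<kappa> C (2*C + 3))*\<epsilon> < 1 \<and>
  (\<forall>n\<in>N. \<forall>k\<in>?R. (K3*(\<bar>n \<bullet> k\<bar>*(norm k)^2))*\<epsilon> < 1/2*(\<bar>cs \<bullet> k\<bar>/(norm k*tfac h k)))" ..
 then have e: "0 < \<epsilon>" "\<epsilon> < 1" "(1 + 3/l)*\<epsilon> < 1/16" "3*\<epsilon> < l" and e4: "(4*L*est_const l \<kappa> C (2*C + 3))*\<epsilon> < 1"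
  and eN: "!!n k. n \<in> N ==> k \<in> ?R ==> (K3*(\<bar>n \<bullet> k\<bar>*(norm k)^2))*\<epsilon> < 1/2*(\<bar>cs \<bullet> k\<bar>/(norm k*tfac h k))"
  unfolding mult_1_left by blast+
 have E0: "0 <= 4*L*est_const l \<kappa> C (2*C + 3)" unfolding est_const_def using C0 kap_pos L0 g by (intro mult_nonneg_nonneg add_nonneg_nonneg) auto
 have "(4*L*est_const l \<kappa> C (2*C + 3))*\<epsilon>^2 <= (4*L*est_const l \<kappa> C (2*C + 3))*\<epsilon>"
  using e E0 mult_left_mono[of \<epsilon> 1 \<epsilon>] by (intro mult_left_mono) (auto simp: power2_eq_square)
 then have tiny: "4*L*est_const l \<kappa> C (2*C + 3)*\<epsilon>^2 <= 1" using e4 by linarith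
 have sm: "K3*\<epsilon>*(\<bar>n \<bullet> k\<bar>*(norm k)^2) <= 1/2*(\<bar>cs \<bullet> k\<bar>/(norm k*tfac h k))" if "n \<in> N" "k \<in> ?R" for n k
  using eN[OF that] by (simp add: mult_ac)
 \<comment> \<open>Converts the norm of X into the hypotheses of \<open>wser_small\<close>, which
   need derivatives up to order 2 with a factor 2; the summand 1 ensures \<delta> <= \<epsilon> for
   the speed.\<close>
 define D where "D = 1 + 2*(Kc \<sigma> 0 + Kc \<sigma> 1 + Kc \<sigma> 2)"
 have D: "1 <= D" "Kc \<sigma> 0 <= D" "2*Kc \<sigma> 1 <= D" "2*Kc \<sigma> 2 <= D"
  unfolding D_def using Kc_nonneg[of \<sigma> 0] Kc_nonneg[of \<sigma> 1] Kc_nonneg[of \<sigma> 2] by simp_all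
 define \<delta> where "\<delta> = \<epsilon>/D"
 have \<delta>: "0 < \<delta>" "\<delta> <= \<epsilon>" "\<delta>*D = \<epsilon>"
 proof -
  have "\<epsilon>*1 <= \<epsilon>*D" using e D by (intro mult_left_mono) auto
  then show "0 < \<delta>" "\<delta> <= \<epsilon>" "\<delta>*D = \<epsilon>" unfolding \<delta>_def using e D(1) by (simp_all add: divide_le_eq)
 qed
 show ?thesis
 proof (rule exI[of _ \<delta>], intro conjI \<delta>(1) allI impI, elim conjE)
  fix \<eta> \<psi> :: "real^2 => real" and c :: "real^2"
  assume X: "(\<eta>, \<psi>) \<in> Xsp \<sigma> s v1 v2" and st: "stokes_wave g \<kappa> h v1 v2 c \<eta> \<psi>" and cc: "norm (c - cs) < \<delta>" and Xn: "Xnorm \<sigma> s v1 v2 \<eta> \<psi> < \<delta>"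
  have sp: "\<eta> \<in> Hsp \<sigma> s v1 v2" "\<psi> \<in> Hsp \<sigma> s v1 v2" "fcoeff v1 v2 \<psi> 0 = 0" using X unfolding Xsp_def Hsp0_def by auto
  have s0: "s \<ge> 0" using assms(6) by simp
  note wE = Hsp_wser[OF sp(1) s0 assms(5)] and wP = Hsp_wser[OF sp(2) s0 assms(5)]
  have hn: "0 <= hnorm_sq \<sigma> s v1 v2 f" for f unfolding hnorm_sq_def hweight_def by (intro infsum_nonneg) simp
  have sq: "sqrt (hnorm_sq \<sigma> s v1 v2 \<eta>) <= \<delta>" "sqrt (hnorm_sq \<sigma> s v1 v2 \<psi>) <= \<delta>"
   using order_trans[OF real_sqrt_le_mono less_imp_le[OF Xn[unfolded Xnorm_def]]] hn[of \<eta>] hn[of \<psi>] by simp_all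
  have wn: "q*wnorm m u <= \<epsilon>" if "wnorm m u <= r*Kc \<sigma> m" "r <= \<delta>" "q*Kc \<sigma> m <= D" "0 <= q" for q m u r
  proof -
   have "q*wnorm m u <= q*(r*Kc \<sigma> m)" by (intro mult_left_mono that)
   also have "\<dots> <= q*(\<delta>*Kc \<sigma> m)" by (intro mult_left_mono mult_right_mono that Kc_nonneg)
   also have "\<dots> = \<delta>*(q*Kc \<sigma> m)" by simp
   also have "\<dots> <= \<delta>*D" using \<delta> that by (intro mult_left_mono) auto
   finally show ?thesis unfolding \<delta>(3) .
  qed
  have D1: "1*Kc \<sigma> 0 <= D" using D by simp
  note sE = wser_small[OF wE(1) wn[OF wE(2) sq(1) D1 zero_le_one, simplified] wn[OF wE(2) sq(1) D(3)] wn[OF wE(2) sq(1) D(4)], simplified]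
  note sP = wser_small[OF wP(1) wn[OF wP(2) sq(2) D1 zero_le_one, simplified] wn[OF wP(2) sq(2) D(3)] wn[OF wP(2) sq(2) D(4)], simplified]
  have cle: "norm (c - cs) <= \<epsilon>" using cc \<delta> by simp
  have cC: "norm c <= C" using norm_triangle_sub[of c cs] cle e unfolding C_def by simp
  obtain G where dn: "is_DN h v1 v2 \<eta> \<psi> G" and kin: "!!x. c \<bullet> grad2 \<eta> x + G x = 0"
   and dyn: "!!x. c \<bullet> grad2 \<psi> x + (- g*\<eta> x - 1/2*(norm (grad2 \<psi> x))^2
      + (grad2 \<eta> x \<bullet> grad2 \<psi> x + G x)^2/(2*(1 + (norm (grad2 \<eta> x))^2))
      + \<kappa>*div2 (%y. (1/sqrt (1 + (norm (grad2 \<eta> y))^2)) *\<^sub>R grad2 \<eta> y) x) = 0" using st unfolding stokes_wave_def by blast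
  have Gx: "G x = - (c \<bullet> grad2 \<eta> x)" for x using kin[of x] by linarith
  have bern: "c \<bullet> grad2 \<psi> x + (- g*\<eta> x - 1/2*(norm (grad2 \<psi> x))^2
      + (grad2 \<eta> x \<bullet> grad2 \<psi> x - c \<bullet> grad2 \<eta> x)^2/(2*(1 + (norm (grad2 \<eta> x))^2))
      + \<kappa>*div2 (%y. (1/sqrt (1 + (norm (grad2 \<eta> y))^2)) *\<^sub>R grad2 \<eta> y) x) = 0" for x using dyn[of x] unfolding Gx by simp
  obtain \<phi> V B where fs: "flat_sol l h c \<eta> \<psi> \<phi> V B ((2*C + 3)*\<epsilon>)"
   using flat_sol_exists[OF h l(1,3) wE(1) wP(1) dn kin _ _ e(4) sE(1,2) sP(2) cC] e by auto
  interpret W: one_wave v1 v2 l \<epsilon> "(2*C + 3)*\<epsilon>" h c \<eta> \<psi> "fcoeff v1 v2 \<eta>" "fcoeff v1 v2 \<psi>" \<phi> B V g \<kappa> C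
   by unfold_locales (use h l wE(1) wP(1) fs e sE sP g cC bern in auto)
  have m0: "0 <= 2*C + 3" using C0 by simp
  note est = W.single_estimate[OF cle order_refl m0 L0 L tiny, folded K_def]
  interpret ME: mode_estimates v1 v2 \<eta> \<psi> "fcoeff v1 v2 \<eta>" "fcoeff v1 v2 \<psi>" h cs ?R K \<epsilon> t0
   by unfold_locales (use wE(1) wP(1) finR R t0 e K0 est in auto)
  have K3: "ME.K3 = K3" unfolding ME.K3_def K3_def ..
  note con = ME.wave_conclusions[OF assms(8) VR(2) VR(1) VR(3) N sm[folded K3]]
  let ?m = "momentum v1 v2 \<eta> \<psi>"
  \<comment> \<open>The estimates only remove the nonzero modes. The constant \<psi> vanishes by its
    zero average, the constant \<eta> by the Bernoulli equation, which reduces to -g \<eta> =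
    0.\<close>
  have triv: "\<eta> x = 0 \<and> \<psi> x = 0" if z: "?m = 0" for x
  proof -
   have az: "fcoeff v1 v2 \<eta> k = 0 \<and> fcoeff v1 v2 \<psi> k = 0" if "k \<in> Lam" "k ~= 0" for k using con(3) z that by blast
   have z1: "\<eta> y = \<eta> 0" "\<psi> y = \<psi> 0" for y by (rule wser_constant[OF wE(1)], simp add: az) (rule wser_constant[OF wP(1)], simp add: az)
   have "\<eta> = (%y. \<eta> 0)" "\<psi> = (%y. \<psi> 0)" using z1 by auto
   then obtain e0 p0 where c0: "\<eta> = (%y. e0)" "\<psi> = (%y. p0)" by blast
   have "complex_of_real p0 = 0" using wser_coeff[OF wP(1) Lam_0] sp(3) unfolding c0 by (simp add: av_const)
   moreover have "e0 = 0" using bern[of 0] g unfolding c0 by (simp add: grad2_def pd_def div2_def zero_vec_def[symmetric])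
   ultimately show ?thesis unfolding c0 by simp
  qed
  show "let a = momentum v1 v2 \<eta> \<psi>; C = neg_cone (resonant g \<kappa> h v1 v2 cs) in
    a \<in> C \<and>
    (a \<in> frontier C --> two_d_wave v1 v2 \<eta> \<psi>) \<and>
    (a = 0 --> (\<forall>x. \<eta> x = 0 \<and> \<psi> x = 0)) \<and>
    (a \<in> interior C \<and> \<not> (\<exists>j \<in> resonant g \<kappa> h v1 v2 cs. \<exists>t::real. a = t *\<^sub>R j)
     --> \<not> two_d_wave v1 v2 \<eta> \<psi>)" unfolding Let_def using con(1,2,4) triv by blast
 qed
qed

end
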